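(* Let $n\ge 3$, $t\in(0,2)$, $q_1,q_2>1$, and let $l\in[1,n/2)$ be an integer. The system $$(-\Delta)^l u=|x|^{-t}v^{q_2},\qquad (-\Delta)^l v=|x|^{-t}u^{q_1},\qquad u,v>0 \text{ in }\mathbb{R}^n,$$ has finite energy solutions if and only if $$\frac{1}{q_1+1}+\frac{1}{q_2+1}=\frac{n-2l}{n-t}.$$
   Context: Classical (positive) solutions $u,v$ of the system are called finite energy solutions if $\big\||x|^{-t/(q_1+1)}u\big\|_{L^{q_1+1}(\mathbb{R}^n)}<\infty$ and $\big\||x|^{-t/(q_2+1)}v\big\|_{L^{q_2+1}(\mathbb{R}^n)}<\infty$. *)

theory Defs
  imports "HOL-Analysis.Analysis"
begin

definition partial :: "'n \<Rightarrow> (real ^ 'n \<Rightarrow> real) \<Rightarrow> real ^ 'n \<Rightarrow> real" where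
  "partial i f x = deriv (\<lambda>s. f (x + s *\<^sub>R axis i 1)) 0"

text \<open>
  The class \<open>C\<^sup>k\<close> on a set \<open>S\<close>, meant for open \<open>S\<close>. Requiring differentiability in addition
  to \<open>C\<^sup>k\<close> partial derivatives is no restriction, but makes \<open>partial\<close> (a total function with
  an arbitrary value where the derivative does not exist) meaningful.
\<close>

primrec Ck_on :: "nat \<Rightarrow> (real ^ 'n \<Rightarrow> real) \<Rightarrow> (real ^ 'n) set \<Rightarrow> bool" where
  "Ck_on 0 f S \<longleftrightarrow> continuous_on S f"
| "Ck_on (Suc k) f S \<longleftrightarrow> f differentiable_on S \<and> (\<forall>i. Ck_on k (partial i f) S)"

definition laplacian :: "(real ^ 'n \<Rightarrow> real) \<Rightarrow> real ^ 'n \<Rightarrow> real" where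
  "laplacian f x = (\<Sum>i\<in>UNIV. partial i (partial i f) x)"

definition neg_laplacian_power :: "nat \<Rightarrow> (real ^ 'n \<Rightarrow> real) \<Rightarrow> real ^ 'n \<Rightarrow> real" where
  "neg_laplacian_power l = (\<lambda>f x. - laplacian f x) ^^ l"

definition Lp_norm :: "real \<Rightarrow> (real ^ 'n \<Rightarrow> real) \<Rightarrow> ennreal" where
  "Lp_norm p f =
    (let I = (\<integral>\<^sup>+ x. ennreal (\<bar>f x\<bar> powr p) \<partial>lborel)
     in if I = \<infinity> then \<infinity> else ennreal (enn2real I powr (1 / p)))"

text \<open>
  Since \<open>t > 0\<close>, the right-hand sides blow up at the origin, so no positive solution is
  \<open>C\<^sup>2\<^sup>l\<close> there. As usual for Hardy-Henon type equations, a classical solution is continuous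
  and positive on the whole space, is \<open>C\<^sup>2\<^sup>l\<close> away from the origin, and satisfies the equations
  pointwise away from the origin. For \<open>2 l < n\<close> continuity at the origin
  makes the equations hold on the whole space in the sense of distributions.
\<close>

definition classical_positive_solution ::
  "nat \<Rightarrow> real \<Rightarrow> real \<Rightarrow> real \<Rightarrow> (real ^ 'n \<Rightarrow> real) \<Rightarrow> (real ^ 'n \<Rightarrow> real) \<Rightarrow> bool" where
  "classical_positive_solution l t q1 q2 u v \<longleftrightarrow>
     continuous_on UNIV u \<and> continuous_on UNIV v \<and>
     Ck_on (2 * l) u (- {0}) \<and> Ck_on (2 * l) v (- {0}) \<and>
     (\<forall>x. u x > 0 \<and> v x > 0) \<and>
     (\<forall>x. x \<noteq> 0 \<longrightarrow>
        neg_laplacian_power l u x = norm x powr (- t) * v x powr q2 \<and>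
        neg_laplacian_power l v x = norm x powr (- t) * u x powr q1)"

definition finite_energy_solution ::
  "nat \<Rightarrow> real \<Rightarrow> real \<Rightarrow> real \<Rightarrow> (real ^ 'n \<Rightarrow> real) \<Rightarrow> (real ^ 'n \<Rightarrow> real) \<Rightarrow> bool" where
  "finite_energy_solution l t q1 q2 u v \<longleftrightarrow>
     classical_positive_solution l t q1 q2 u v \<and>
     Lp_norm (q1 + 1) (\<lambda>x. norm x powr (- t / (q1 + 1)) * u x) < \<infinity> \<and>
     Lp_norm (q2 + 1) (\<lambda>x. norm x powr (- t / (q2 + 1)) * v x) < \<infinity>"

end

theory Submission
  imports Defs "HOL-Complex_Analysis.Great_Picard"
begin

text \<open>
  Necessity. The equations imply the integral equations
  \<open>u(y) = c \<integral> |x - y|\<^sup>2\<^sup>l\<^sup>-\<^sup>n |x|\<^sup>-\<^sup>t v(x) powr q2 dx\<close> and the same with \<open>u\<close>, \<open>v\<close> exchanged: the equation is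
  tested with \<open>(\<epsilon>\<^sup>2 + |x - y|\<^sup>2)\<close> to the power \<open>- s\<close>, \<open>s = (n - 2 l) / 2\<close>, whose polyharmonic Laplacian is an
  explicit positive approximate identity; the finite energy controls the growth of \<open>u\<close> and \<open>v\<close> well
  enough to remove the cutoffs. By Tonelli both energies equal a common
  value \<open>A\<close>. Differentiating the integral equations along the cut-off field \<open>x\<close>, which is Lipschitz uniformly in the
  cutoff, gives the Pohozaev identity
  \<open>(n - t) (1 / (q1 + 1) + 1 / (q2 + 1)) A = (n - 2 l) A\<close>.

  Existence. For radial functions put \<open>s = ln |x|\<close>, \<open>u = |x|\<^sup>-\<^sup>a w(s)\<close>, \<open>v = |x|\<^sup>-\<^sup>b z(s)\<close> with
  \<open>a = (n - t) / (q1 + 1)\<close> and \<open>b = (n - t) / (q2 + 1)\<close>. For critical exponents the system becomes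
  translation invariant, \<open>w = G (z powr q2)\<close> and \<open>z = G\<^sup>* (w powr q1)\<close>, where \<open>G\<close> is a product of \<open>l\<close> positive
  resolvents of first-order factors and \<open>G\<^sup>*\<close> is its adjoint. A power iteration solves the \<open>N\<close>-periodic
  problem; the solutions are equi-Lipschitz on the logarithmic scale and do not degenerate, so after
  translating the maximum to the origin they converge along \<open>N \<longlonglongrightarrow> \<infinity>\<close> to a solution of finite energy on
  the line. It decays exponentially, with the sharp rates \<open>exp (a s)\<close> and \<open>exp (b s)\<close> at \<open>-\<infinity>\<close>, which makes
  \<open>u\<close> and \<open>v\<close> continuous at the origin.
\<close>

section \<open>Iterated partial derivatives\<close>

text \<open>Multiplying the equations by \<open>x \<bullet> grad u\<close> would need control of
  derivatives up to order \<open>2 * l - 1\<close> near infinity and near the origin, where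
  solutions are only continuous; hence the detour through integral equations. There a single
  differentiated kernel is not dominated by the original one. Adding both equations with exchanged
  variables yields the factor \<open>(\<eta> y *\<^sub>R y - \<eta> x *\<^sub>R x) \<bullet> (y -
  x)\<close>, of order \<open>|x - y|^2\<close>, which restores it.

  For existence the obstacle to compactness is the scaling group. In \<open>s = ln |x|\<close> it
  acts by translations, harmless on a circle of length \<open>N\<close>. The weights
  \<open>a\<close>, \<open>b\<close> turn the energy densities into \<open>w powr (q1 + 1)\<close>
  and \<open>z powr (q2 + 1)\<close> with respect to \<open>ds\<close>. Criticality reads
  \<open>a + b = n - 2 l\<close>, exactly the condition under which the factors of the second
  equation are the adjoint of those of the first, so that the iteration is monotone. What survives
  for large \<open>N\<close> is a Harnack inequality for the resolvents, a starting norm independent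
  of \<open>N\<close>, and a lower bound for the maximum coming from
  \<open>q1 * q2 > 1\<close>.\<close>

lemma partial_has_real_derivative:
  assumes "(f has_derivative D) (at x)"
  shows "((\<lambda>s. f (x + s *\<^sub>R axis i 1)) has_real_derivative D (axis i 1)) (at 0)"
proof -
  have 1: "((\<lambda>s::real. x + s *\<^sub>R axis i 1) has_derivative (\<lambda>s. s *\<^sub>R axis i 1)) (at 0)"
    by (auto intro!: derivative_eq_intros)
  have "((\<lambda>s. f (x + s *\<^sub>R axis i 1)) has_derivative (\<lambda>s. D (s *\<^sub>R axis i 1))) (at 0)"
    using diff_chain_at[OF 1, of f D] assms by (simp add: o_def)
  moreover have "(\<lambda>s. D (s *\<^sub>R axis i 1)) = (\<lambda>s. D (axis i 1) * s)"
    using has_derivative_linear[OF assms] by (auto simp: linear_cmul)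
  ultimately show ?thesis by (simp add: has_field_derivative_def)
qed

lemma partial_eq_derivative:
  assumes "(f has_derivative D) (at x)"
  shows "partial i f x = D (axis i 1)"
  unfolding partial_def using partial_has_real_derivative[OF assms] by (rule DERIV_imp_deriv)

lemma has_derivative_partial_sum:
  assumes "(f has_derivative D) (at x)"
  shows "D h = (\<Sum>i\<in>UNIV. h $ i * partial i f x)"
proof -
  have lin: "linear D" using has_derivative_linear[OF assms] .
  have "h = (\<Sum>i\<in>UNIV. (h $ i) *\<^sub>R axis i 1)"
    using basis_expansion[of h] by (simp add: scalar_mult_eq_scaleR)
  then have "D h = D (\<Sum>i\<in>UNIV. (h $ i) *\<^sub>R axis i 1)" by simp
  also have "\<dots> = (\<Sum>i\<in>UNIV. h $ i * partial i f x)"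
    using lin by (simp add: linear_sum linear_cmul partial_eq_derivative[OF assms])
  finally show ?thesis .
qed

lemma partial_cong_open:
  assumes "open S" "x \<in> S" "\<And>y. y \<in> S \<Longrightarrow> f y = g y"
  shows "partial i f x = partial i g x"
  unfolding partial_def
proof (rule deriv_cong_ev)
  have "isCont (\<lambda>s::real. x + s *\<^sub>R axis i 1) 0" by simp
  then have "((\<lambda>s::real. x + s *\<^sub>R axis i 1) \<longlongrightarrow> x) (nhds 0)"
    using tendsto_at_iff_tendsto_nhds[of "\<lambda>s::real. x + s *\<^sub>R axis i 1" 0] by (simp add: isCont_def)
  then have "eventually (\<lambda>s::real. x + s *\<^sub>R axis i 1 \<in> S) (nhds 0)"
    using assms by (simp add: topological_tendstoD)
  then show "\<forall>\<^sub>F s in nhds 0. f (x + s *\<^sub>R axis i 1) = g (x + s *\<^sub>R axis i 1)"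
    by eventually_elim (rule assms(3))
qed simp

lemma differentiable_onD_open:
  "open S \<Longrightarrow> f differentiable_on S \<Longrightarrow> x \<in> S \<Longrightarrow> f differentiable (at x)"
  using differentiable_on_eq_differentiable_at by blast

lemma partial_add:
  assumes "f differentiable (at x)" "g differentiable (at x)"
  shows "partial i (\<lambda>x. f x + g x) x = partial i f x + partial i g x"
proof -
  obtain F G where F: "(f has_derivative F) (at x)" and G: "(g has_derivative G) (at x)"
    using assms unfolding differentiable_def by blast
  show ?thesis
    using partial_eq_derivative[OF has_derivative_add[OF F G], of i]
    by (simp add: partial_eq_derivative[OF F] partial_eq_derivative[OF G])
qed

lemma partial_mult:
  assumes "f differentiable (at x)" "g differentiable (at x)"
  shows "partial i (\<lambda>x. f x * g x) x = f x * partial i g x + partial i f x * g x"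
proof -
  obtain F G where F: "(f has_derivative F) (at x)" and G: "(g has_derivative G) (at x)"
    using assms unfolding differentiable_def by blast
  show ?thesis
    using partial_eq_derivative[OF has_derivative_mult[OF F G], of i]
    by (simp add: partial_eq_derivative[OF F] partial_eq_derivative[OF G])
qed

lemma partial_compose:
  assumes "f differentiable (at x)" "(h has_real_derivative h') (at (f x))"
  shows "partial i (\<lambda>x. h (f x)) x = h' * partial i f x"
    and "(\<lambda>x. h (f x)) differentiable (at x)"
proof -
  obtain F where F: "(f has_derivative F) (at x)"
    using assms unfolding differentiable_def by blast
  have H: "(h has_derivative (\<lambda>s. h' * s)) (at (f x))"
    using assms(2) by (simp add: has_field_derivative_def)
  have *: "((\<lambda>x. h (f x)) has_derivative (\<lambda>y. h' * F y)) (at x)"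
    using diff_chain_at[OF F H] by (simp add: o_def)
  show "partial i (\<lambda>x. h (f x)) x = h' * partial i f x"
    using partial_eq_derivative[OF *, of i] partial_eq_derivative[OF F] by simp
  show "(\<lambda>x. h (f x)) differentiable (at x)" using * unfolding differentiable_def by blast
qed

lemma partial_const [simp]: "partial i (\<lambda>x. c) x = 0"
  by (rule partial_eq_derivative[OF has_derivative_const])

lemma partial_component: "partial i (\<lambda>x. x $ j - c) x = (if i = j then 1 else 0)"
proof -
  have "((\<lambda>x. x $ j - c) has_derivative (\<lambda>h. h $ j)) (at x)"
    by (auto intro!: derivative_eq_intros bounded_linear.has_derivative[OF bounded_linear_vec_nth])
  from partial_eq_derivative[OF this, of i] show ?thesis by (simp add: axis_def)
qed

lemma Ck_on_cong:
  assumes "open S" "\<And>x. x \<in> S \<Longrightarrow> f x = g x" "Ck_on k f S"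
  shows "Ck_on k g S"
  using assms(2,3)
proof (induction k arbitrary: f g)
  case 0
  then show ?case by (simp add: continuous_on_eq)
next
  case (Suc k)
  have "g differentiable_on S"
    using Suc.prems unfolding differentiable_on_def Ck_on.simps
    by (metis differentiable_transform_within zero_less_one)
  moreover have "Ck_on k (partial i g) S" for i
    using Suc.IH[of "partial i f" "partial i g"] Suc.prems partial_cong_open[OF assms(1)] by (metis Ck_on.simps(2))
  ultimately show ?case by simp
qed

lemma Ck_on_Suc_D: "Ck_on (Suc k) f S \<Longrightarrow> Ck_on k f S"
  by (induction k arbitrary: f) (auto simp: differentiable_imp_continuous_on)

lemma Ck_on_mono: "Ck_on m f S \<Longrightarrow> k \<le> m \<Longrightarrow> Ck_on k f S"
proof (induction m)
  case (Suc m)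
  then show ?case using Ck_on_Suc_D[of m f S] by (cases "k = Suc m") (auto simp del: Ck_on.simps)
qed simp

lemma Ck_on_subset: "Ck_on k f S \<Longrightarrow> T \<subseteq> S \<Longrightarrow> Ck_on k f T"
  by (induction k arbitrary: f) (auto simp: continuous_on_subset differentiable_on_subset)

lemma Ck_on_continuous: "Ck_on k f S \<Longrightarrow> continuous_on S f"
  using Ck_on_mono[of k f S 0] by simp

lemma Ck_on_differentiable: "open S \<Longrightarrow> Ck_on (Suc k) f S \<Longrightarrow> x \<in> S \<Longrightarrow> f differentiable (at x)"
  by (auto intro: differentiable_onD_open)

lemma Ck_on_const: "Ck_on k (\<lambda>x. c) S"
proof (induction k arbitrary: c)
  case (Suc k)
  have "partial i (\<lambda>x. c) = (\<lambda>x. 0)" for i :: 'a by (rule ext) simp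
  then show ?case using Suc by simp
qed simp

lemma Ck_on_component: "Ck_on k (\<lambda>x. x $ j - c) S"
proof (cases k)
  case (Suc m)
  have "partial i (\<lambda>x. x $ j - c) = (\<lambda>x. if i = j then 1 else 0)" for i
    by (rule ext) (rule partial_component)
  moreover have "(\<lambda>x. x $ j - c) differentiable_on S"
    by (intro differentiable_on_diff differentiable_on_const
        linear_imp_differentiable_on bounded_linear.linear[OF bounded_linear_vec_nth])
  ultimately show ?thesis using Suc by (simp add: Ck_on_const)
qed (auto intro!: continuous_intros)

lemma Ck_on_add:
  assumes "open S"
  shows "Ck_on k f S \<Longrightarrow> Ck_on k g S \<Longrightarrow> Ck_on k (\<lambda>x. f x + g x) S"
proof (induction k arbitrary: f g)
  case 0
  then show ?case by (simp add: continuous_on_add)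
next
  case (Suc k)
  have "Ck_on k (partial i (\<lambda>x. f x + g x)) S" for i
    by (rule Ck_on_cong[OF assms _ Suc.IH[of "partial i f" "partial i g"]])
      (use Suc.prems in \<open>auto intro!: partial_add[symmetric] differentiable_onD_open[OF assms]\<close>)
  with Suc show ?case by (simp add: differentiable_on_add)
qed

lemma Ck_on_mult:
  assumes "open S"
  shows "Ck_on k f S \<Longrightarrow> Ck_on k g S \<Longrightarrow> Ck_on k (\<lambda>x. f x * g x) S"
proof (induction k arbitrary: f g)
  case 0
  then show ?case by (simp add: continuous_on_mult)
next
  case (Suc k)
  have "Ck_on k (partial i (\<lambda>x. f x * g x)) S" for i
    by (rule Ck_on_cong[OF assms _ Ck_on_add[OF assms Suc.IH[of f "partial i g"] Suc.IH[of "partial i f" g]]])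
      (use Suc.prems in \<open>auto intro!: partial_mult[symmetric] differentiable_onD_open[OF assms]
        Ck_on_Suc_D[of k] simp del: Ck_on.simps(1)\<close>)
  moreover have "(\<lambda>x. f x * g x) differentiable_on S"
    using Suc.prems by (auto intro!: differentiable_at_imp_differentiable_on differentiable_mult
        differentiable_onD_open[OF assms])
  ultimately show ?case by simp
qed

lemma Ck_on_cmult: "open S \<Longrightarrow> Ck_on k f S \<Longrightarrow> Ck_on k (\<lambda>x. c * f x) S"
  by (intro Ck_on_mult Ck_on_const)

lemma Ck_on_minus: "open S \<Longrightarrow> Ck_on k f S \<Longrightarrow> Ck_on k (\<lambda>x. - f x) S"
  using Ck_on_cmult[of S k f "-1"] by simp

lemma Ck_on_diff: "open S \<Longrightarrow> Ck_on k f S \<Longrightarrow> Ck_on k g S \<Longrightarrow> Ck_on k (\<lambda>x. f x - g x) S"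
  using Ck_on_add[of S k f "\<lambda>x. - g x"] Ck_on_minus[of S k g] by simp

lemma Ck_on_sum:
  assumes "open S" "finite I" "\<And>i. i \<in> I \<Longrightarrow> Ck_on k (f i) S"
  shows "Ck_on k (\<lambda>x. \<Sum>i\<in>I. f i x) S"
  using assms(2,3) by (induction I) (auto intro: Ck_on_const Ck_on_add[OF assms(1)])

lemma Ck_on_sqdist: "Ck_on k (\<lambda>x. (norm (x - d))\<^sup>2) S"
proof -
  have "Ck_on k (\<lambda>x. \<Sum>i\<in>UNIV. (x $ i - d $ i) * (x $ i - d $ i)) UNIV"
    by (intro Ck_on_sum Ck_on_mult Ck_on_component) auto
  moreover have "(\<lambda>x. (norm (x - d))\<^sup>2) = (\<lambda>x. \<Sum>i\<in>UNIV. (x $ i - d $ i) * (x $ i - d $ i))"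
    by (simp add: power2_norm_eq_inner inner_vec_def)
  ultimately show ?thesis using Ck_on_subset[OF _ subset_UNIV] by metis
qed

lemma partial_sqdist: "partial i (\<lambda>x. (norm (x - d))\<^sup>2) x = 2 * (x $ i - d $ i)"
proof -
  have "((\<lambda>x. (norm (x - d))\<^sup>2) has_derivative (\<lambda>h. 2 * ((x - d) \<bullet> h))) (at x)"
    unfolding power2_norm_eq_inner
    by (auto intro!: derivative_eq_intros simp: inner_commute)
  from partial_eq_derivative[OF this, of i] show ?thesis by (simp add: inner_axis)
qed

text \<open>One-variable counterpart of \<open>Ck_on\<close> for the outer functions of
  compositions: powers, ramps, logarithms and radial profiles. As \<open>deriv\<close> is total,
  differentiability is demanded separately.\<close>

primrec Ck1_on :: "nat \<Rightarrow> (real \<Rightarrow> real) \<Rightarrow> real set \<Rightarrow> bool" where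
  "Ck1_on 0 f S \<longleftrightarrow> continuous_on S f"
| "Ck1_on (Suc k) f S \<longleftrightarrow> (\<forall>s\<in>S. f field_differentiable (at s)) \<and> Ck1_on k (deriv f) S"

lemma Ck1_on_cong:
  assumes "open S" "\<And>x. x \<in> S \<Longrightarrow> f x = g x" "Ck1_on k f S"
  shows "Ck1_on k g S"
  using assms(2,3)
proof (induction k arbitrary: f g)
  case 0
  then show ?case by (simp add: continuous_on_eq)
next
  case (Suc k)
  have ev: "eventually (\<lambda>y. f y = g y) (nhds s)" if "s \<in> S" for s
    using eventually_nhds_in_open[OF assms(1) that] by eventually_elim (rule Suc.prems(1))
  have "g field_differentiable (at s)" if "s \<in> S" for s
  proof -
    have "f field_differentiable (at s)" using Suc.prems(2) that by simp
    then obtain u where "(f has_real_derivative u) (at s)"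
      unfolding field_differentiable_def by blast
    then show ?thesis
      using DERIV_cong_ev[OF refl ev[OF that] refl, of u] unfolding field_differentiable_def by auto
  qed
  moreover have "Ck1_on k (deriv g) S"
    using Suc.IH[of "deriv f" "deriv g"] Suc.prems deriv_cong_ev[OF ev refl] by auto
  ultimately show ?case by simp
qed

lemma Ck1_on_SucI:
  assumes "open S" "\<And>s. s \<in> S \<Longrightarrow> (f has_real_derivative f' s) (at s)" "Ck1_on k f' S"
  shows "Ck1_on (Suc k) f S"
proof -
  have "Ck1_on k (deriv f) S"
    by (rule Ck1_on_cong[OF assms(1) _ assms(3)]) (use DERIV_imp_deriv[OF assms(2)] in auto)
  then show ?thesis using assms(2) by (auto simp: field_differentiable_def)
qed

lemma Ck1_on_Suc_D: "Ck1_on (Suc k) f S \<Longrightarrow> Ck1_on k f S"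
proof (induction k arbitrary: f)
  case 0
  then have "\<forall>s\<in>S. isCont f s" by (auto simp: field_differentiable_imp_continuous_at)
  then show ?case by (simp add: continuous_at_imp_continuous_on)
qed simp

lemma Ck_on_compose:
  assumes "open S" "open I"
  shows "f ` S \<subseteq> I \<Longrightarrow> Ck_on k f S \<Longrightarrow> Ck1_on k h I \<Longrightarrow> Ck_on k (\<lambda>x. h (f x)) S"
proof (induction k arbitrary: f h)
  case 0
  then show ?case by (auto intro: continuous_on_compose2)
next
  case (Suc k)
  have d: "(h has_real_derivative deriv h (f x)) (at (f x))" if "x \<in> S" for x
    using Suc.prems that by (auto simp: DERIV_deriv_iff_field_differentiable)
  have fd: "f differentiable (at x)" if "x \<in> S" for x
    using Suc.prems that by (auto intro: differentiable_onD_open[OF assms(1)])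
  have "Ck_on k (partial i (\<lambda>x. h (f x))) S" for i
    by (rule Ck_on_cong[OF assms(1) _ Ck_on_mult[OF assms(1) Suc.IH[of f "deriv h"], of "partial i f"]])
      (use Suc.prems in \<open>auto simp del: Ck_on.simps(1) intro: Ck_on_Suc_D[of k]
         simp: partial_compose(1)[OF fd d]\<close>)
  moreover have "(\<lambda>x. h (f x)) differentiable_on S"
    by (auto intro!: differentiable_at_imp_differentiable_on partial_compose(2)[OF fd d])
  ultimately show ?case by simp
qed

text \<open>Differentiation stays inside the family \<open>c * y powr p\<close>; carrying the factor
  \<open>c\<close> along closes the induction.\<close>

lemma Ck1_on_powr: "Ck1_on k (\<lambda>y. c * y powr p) {0<..}"
proof (induction k arbitrary: c p)
  case (Suc k)
  show ?case
    by (rule Ck1_on_SucI[OF _ _ Suc, of _ "c * p" "p - 1"])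
      (auto intro!: derivative_eq_intros simp: algebra_simps)
qed (auto intro!: continuous_intros)

lemma Ck_on_powr:
  assumes "open S" "\<And>x. x \<in> S \<Longrightarrow> f x > 0" "Ck_on k f S"
  shows "Ck_on k (\<lambda>x. f x powr p) S"
  using Ck_on_compose[OF assms(1) open_greaterThan[of 0] _ assms(3) Ck1_on_powr[of k 1 p]] assms(2)
  by auto

lemma partial_scale:
  assumes "f differentiable (at (c *\<^sub>R x))"
  shows "partial i (\<lambda>x. f (c *\<^sub>R x)) x = c * partial i f (c *\<^sub>R x)"
    and "(\<lambda>x. f (c *\<^sub>R x)) differentiable (at x)"
proof -
  obtain F where F: "(f has_derivative F) (at (c *\<^sub>R x))"
    using assms unfolding differentiable_def by blast
  have "((\<lambda>x. c *\<^sub>R x) has_derivative (\<lambda>h. c *\<^sub>R h)) (at x)"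
    by (auto intro!: derivative_eq_intros)
  from diff_chain_at[OF this F]
  have *: "((\<lambda>x. f (c *\<^sub>R x)) has_derivative (\<lambda>h. F (c *\<^sub>R h))) (at x)" by (simp add: o_def)
  show "partial i (\<lambda>x. f (c *\<^sub>R x)) x = c * partial i f (c *\<^sub>R x)"
    using partial_eq_derivative[OF *, of i] partial_eq_derivative[OF F]
      has_derivative_linear[OF F] by (simp add: linear_cmul)
  show "(\<lambda>x. f (c *\<^sub>R x)) differentiable (at x)" using * unfolding differentiable_def by blast
qed

lemma open_scale: "open S \<Longrightarrow> open {x::real^'n. c *\<^sub>R x \<in> S}"
proof -
  assume "open S"
  moreover have "continuous_on UNIV (\<lambda>x::real^'n. c *\<^sub>R x)" by (intro continuous_intros)
  ultimately show ?thesis using open_vimage[of S "\<lambda>x. c *\<^sub>R x"] by (simp add: vimage_def)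
qed

lemma Ck_on_scale:
  assumes "open S"
  shows "Ck_on k f S \<Longrightarrow> Ck_on k (\<lambda>x. f (c *\<^sub>R x)) {x. c *\<^sub>R x \<in> S}"
proof (induction k arbitrary: f)
  case 0
  then show ?case by (auto intro!: continuous_on_compose2[of S f] continuous_intros)
next
  case (Suc k)
  note o = open_scale[OF assms, of c]
  have fd: "f differentiable (at (c *\<^sub>R x))" if "c *\<^sub>R x \<in> S" for x
    using Suc.prems that by (auto intro: differentiable_onD_open[OF assms(1)])
  have "Ck_on k (partial i (\<lambda>x. f (c *\<^sub>R x))) {x. c *\<^sub>R x \<in> S}" for i
    by (rule Ck_on_cong[OF o _ Ck_on_cmult[OF o Suc.IH[of "partial i f"]]])
      (use Suc.prems in \<open>auto simp: partial_scale(1)[OF fd]\<close>)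
  moreover have "(\<lambda>x. f (c *\<^sub>R x)) differentiable_on {x. c *\<^sub>R x \<in> S}"
    by (auto intro!: differentiable_at_imp_differentiable_on partial_scale(2)[OF fd])
  ultimately show ?case by simp
qed

section \<open>Iterated Laplacians: locality, regularity, homogeneity\<close>

lemma neg_laplacian_power_0: "neg_laplacian_power 0 f = f"
  by (simp add: neg_laplacian_power_def)

lemma neg_laplacian_power_Suc:
  "neg_laplacian_power (Suc l) f = neg_laplacian_power l (\<lambda>x. - laplacian f x)"
  unfolding neg_laplacian_power_def funpow_Suc_right o_def ..

lemma neg_laplacian_power_Suc2:
  "neg_laplacian_power (Suc l) f = (\<lambda>x. - laplacian (neg_laplacian_power l f) x)"
  by (simp add: neg_laplacian_power_def)

lemma laplacian_cong_open:
  assumes "open S" "x \<in> S" "\<And>y. y \<in> S \<Longrightarrow> f y = g y"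
  shows "laplacian f x = laplacian g x"
  unfolding laplacian_def
  by (intro sum.cong refl partial_cong_open[OF assms(1,2)]) (auto intro: partial_cong_open[OF assms(1)] assms(3))

lemma neg_laplacian_power_cong_open:
  assumes "open S" "x \<in> S" "\<And>y. y \<in> S \<Longrightarrow> f y = g y"
  shows "neg_laplacian_power l f x = neg_laplacian_power l g x"
  using assms(2,3)
proof (induction l arbitrary: f g x)
  case (Suc l)
  have "- laplacian f y = - laplacian g y" if "y \<in> S" for y
    using laplacian_cong_open[OF assms(1) that Suc.prems(2)] by simp
  from Suc.IH[OF Suc.prems(1) this] show ?case by (simp add: neg_laplacian_power_Suc)
qed (simp add: neg_laplacian_power_0)

lemma Ck_on_laplacian:
  assumes "open S" "Ck_on (Suc (Suc k)) f S"
  shows "Ck_on k (\<lambda>x. - laplacian f x) S"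
  unfolding laplacian_def using assms(2) by (intro Ck_on_minus Ck_on_sum assms(1)) auto

lemma Ck_on_neg_laplacian_power:
  "open S \<Longrightarrow> Ck_on (2 * l + k) f S \<Longrightarrow> Ck_on k (neg_laplacian_power l f) S"
  by (induction l arbitrary: f) (auto simp: neg_laplacian_power_0 neg_laplacian_power_Suc Ck_on_laplacian
    simp del: Ck_on.simps)

lemma laplacian_scale:
  assumes "open S" "Ck_on 2 f S" "c *\<^sub>R x \<in> S"
  shows "laplacian (\<lambda>x. f (c *\<^sub>R x)) x = c\<^sup>2 * laplacian f (c *\<^sub>R x)"
proof -
  have 2: "f differentiable_on S" "partial i f differentiable_on S" for i
    using assms(2) by (auto simp: numeral_2_eq_2)
  have "partial i (partial i (\<lambda>x. f (c *\<^sub>R x))) x = c\<^sup>2 * partial i (partial i f) (c *\<^sub>R x)" for i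
  proof -
    have "partial i (partial i (\<lambda>x. f (c *\<^sub>R x))) x = partial i (\<lambda>x. c * partial i f (c *\<^sub>R x)) x"
      using assms by (intro partial_cong_open[OF open_scale[OF assms(1)]] partial_scale(1)
        differentiable_onD_open[OF assms(1) 2(1)]) auto
    also have "\<dots> = c * partial i (\<lambda>x. partial i f (c *\<^sub>R x)) x"
      by (subst partial_mult) (auto intro!: partial_scale(2) differentiable_onD_open[OF assms(1) 2(2)] assms(3))
    also have "\<dots> = c * (c * partial i (partial i f) (c *\<^sub>R x))"
      by (subst partial_scale(1)) (auto intro!: differentiable_onD_open[OF assms(1) 2(2)] assms(3))
    finally show ?thesis by (simp add: power2_eq_square)
  qed
  then show ?thesis by (simp add: laplacian_def sum_distrib_left)
qed

lemma laplacian_cmult: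
  assumes "open S" "Ck_on 2 f S" "x \<in> S"
  shows "laplacian (\<lambda>x. c * f x) x = c * laplacian f x"
proof -
  have 2: "f differentiable_on S" "partial i f differentiable_on S" for i
    using assms(2) by (auto simp: numeral_2_eq_2)
  have "partial i (partial i (\<lambda>x. c * f x)) x = c * partial i (partial i f) x" for i
  proof -
    have "partial i (partial i (\<lambda>x. c * f x)) x = partial i (\<lambda>x. c * partial i f x) x"
      by (intro partial_cong_open[OF assms(1,3)])
        (subst partial_mult, auto intro!: differentiable_onD_open[OF assms(1) 2(1)])
    also have "\<dots> = c * partial i (partial i f) x"
      by (subst partial_mult) (auto intro!: differentiable_onD_open[OF assms(1) 2(2)] assms(3))
    finally show ?thesis .
  qed
  then show ?thesis by (simp add: laplacian_def sum_distrib_left)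
qed

lemma neg_laplacian_power_cmult:
  assumes "open S"
  shows "Ck_on (2 * l) f S \<Longrightarrow> x \<in> S \<Longrightarrow>
    neg_laplacian_power l (\<lambda>x. c * f x) x = c * neg_laplacian_power l f x"
proof (induction l arbitrary: f)
  case (Suc l)
  have C: "Ck_on 2 f S" by (rule Ck_on_mono[OF Suc.prems(1)]) simp
  have "neg_laplacian_power (Suc l) (\<lambda>x. c * f x) x = neg_laplacian_power l (\<lambda>x. c * - laplacian f x) x"
    unfolding neg_laplacian_power_Suc
    by (rule neg_laplacian_power_cong_open[OF assms Suc.prems(2)]) (simp add: laplacian_cmult[OF assms C])
  also have "\<dots> = c * neg_laplacian_power (Suc l) f x"
    unfolding neg_laplacian_power_Suc
    by (rule Suc.IH[OF Ck_on_laplacian[OF assms] Suc.prems(2)]) (use Suc.prems(1) in simp)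
  finally show ?case .
qed (simp add: neg_laplacian_power_0)

text \<open>Each Laplacian is homogeneous of degree 2 under dilations. This moves estimates between
  the small and large shells of the cutoffs and one fixed shell.\<close>

lemma neg_laplacian_power_scale:
  assumes "open S"
  shows "Ck_on (2 * l) f S \<Longrightarrow> c *\<^sub>R x \<in> S \<Longrightarrow>
    neg_laplacian_power l (\<lambda>x. f (c *\<^sub>R x)) x = c ^ (2 * l) * neg_laplacian_power l f (c *\<^sub>R x)"
proof (induction l arbitrary: f)
  case (Suc l)
  note o = open_scale[OF assms, of c]
  have C: "Ck_on 2 f S" by (rule Ck_on_mono[OF Suc.prems(1)]) simp
  have C2: "Ck_on (2 * l) (\<lambda>x. - laplacian f x) S"
    by (rule Ck_on_laplacian[OF assms]) (use Suc.prems(1) in simp)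
  have "neg_laplacian_power (Suc l) (\<lambda>x. f (c *\<^sub>R x)) x
      = neg_laplacian_power l (\<lambda>x. c\<^sup>2 * - laplacian f (c *\<^sub>R x)) x"
    unfolding neg_laplacian_power_Suc
    by (rule neg_laplacian_power_cong_open[OF o]) (use Suc.prems in \<open>auto simp: laplacian_scale[OF assms C]\<close>)
  also have "\<dots> = c\<^sup>2 * neg_laplacian_power l (\<lambda>x. - laplacian f (c *\<^sub>R x)) x"
    by (rule neg_laplacian_power_cmult[OF o Ck_on_scale[OF assms C2]]) (use Suc.prems in auto)
  also have "\<dots> = c\<^sup>2 * (c ^ (2 * l) * neg_laplacian_power (Suc l) f (c *\<^sub>R x))"
    using Suc.IH[OF C2] Suc.prems by (simp add: neg_laplacian_power_Suc)
  finally show ?case by (simp add: power2_eq_square)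
qed (simp add: neg_laplacian_power_0)

section \<open>Uniform bounds for iterated derivatives\<close>

text \<open>One constant serves all orders up to \<open>k\<close>, and derivatives are those of the
  ambient space, so \<open>K\<close> may be compact while smoothness is assumed on an open
  \<open>S\<close> around it.\<close>

primrec derivs_le :: "nat \<Rightarrow> real \<Rightarrow> (real ^ 'n \<Rightarrow> real) \<Rightarrow> (real ^ 'n) set \<Rightarrow> bool" where
  "derivs_le 0 M f K \<longleftrightarrow> (\<forall>x\<in>K. \<bar>f x\<bar> \<le> M)"
| "derivs_le (Suc k) M f K \<longleftrightarrow> (\<forall>x\<in>K. \<bar>f x\<bar> \<le> M) \<and> (\<forall>i. derivs_le k M (partial i f) K)"

lemma derivs_le_Suc_D: "derivs_le (Suc k) M f K \<Longrightarrow> derivs_le k M f K"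
  by (induction k arbitrary: f) auto

lemma derivs_le_bound: "derivs_le k M f K \<Longrightarrow> x \<in> K \<Longrightarrow> \<bar>f x\<bar> \<le> M"
  by (cases k) auto

lemma derivs_le_mono: "derivs_le k M f K \<Longrightarrow> M \<le> N \<Longrightarrow> derivs_le k N f K"
  by (induction k arbitrary: f) force+

lemma derivs_le_subset: "derivs_le k M f K \<Longrightarrow> L \<subseteq> K \<Longrightarrow> derivs_le k M f L"
  by (induction k arbitrary: f) (simp, blast)+

lemma derivs_le_cong:
  assumes "open S" "K \<subseteq> S" "\<And>x. x \<in> S \<Longrightarrow> f x = g x" "derivs_le k M f K"
  shows "derivs_le k M g K"
  using assms(3,4)
proof (induction k arbitrary: f g)
  case 0
  have "\<bar>g x\<bar> \<le> M" if "x \<in> K" for x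
    using 0(2) that unfolding 0(1)[OF subsetD[OF assms(2) that], symmetric] by simp
  then show ?case by simp
next
  case (Suc k)
  have b: "\<bar>g x\<bar> \<le> M" if "x \<in> K" for x
    using Suc.prems(2) that unfolding Suc.prems(1)[OF subsetD[OF assms(2) that], symmetric] by simp
  have "derivs_le k M (partial i f) K" for i using Suc.prems(2) by simp
  then have "derivs_le k M (partial i g) K" for i
    by (rule Suc.IH[rotated]) (rule partial_cong_open[OF assms(1) _ Suc.prems(1)])
  with b show ?case by simp
qed

lemma derivs_le_const: "\<bar>c\<bar> \<le> M \<Longrightarrow> derivs_le k M (\<lambda>x. c) K"
proof (induction k arbitrary: c)
  case (Suc k)
  have "partial i (\<lambda>x. c) = (\<lambda>x. 0)" for i :: 'a by (rule ext) simp
  then show ?case using Suc by auto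
qed simp

lemma derivs_le_component:
  assumes "\<And>x. x \<in> K \<Longrightarrow> \<bar>x $ j - c\<bar> \<le> M" "1 \<le> M"
  shows "derivs_le k M (\<lambda>x. x $ j - c) K"
proof (cases k)
  case (Suc m)
  have "partial i (\<lambda>x. x $ j - c) = (\<lambda>x. if i = j then 1 else 0)" for i
    by (rule ext) (rule partial_component)
  then show ?thesis using Suc assms by (auto intro!: derivs_le_const)
qed (use assms in auto)

context
  fixes S K :: "(real ^ 'n) set"
  assumes S: "open S" and K: "K \<subseteq> S"
begin

lemma derivs_le_add:
  "Ck_on k f S \<Longrightarrow> Ck_on k g S \<Longrightarrow> derivs_le k M f K \<Longrightarrow> derivs_le k N g K \<Longrightarrow> derivs_le k (M + N) (\<lambda>x. f x + g x) K"
proof (induction k arbitrary: f g)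
  case 0
  then show ?case by (fastforce intro: order_trans[OF abs_triangle_ineq])
next
  case (Suc k)
  have "derivs_le k (M + N) (partial i (\<lambda>x. f x + g x)) K" for i
    by (rule derivs_le_cong[OF S K _ Suc.IH[of "partial i f" "partial i g"]])
      (use Suc.prems in \<open>auto intro!: partial_add[symmetric] differentiable_onD_open[OF S]\<close>)
  with Suc.prems show ?case by (fastforce intro: order_trans[OF abs_triangle_ineq])
qed

text \<open>Every differentiation splits the product into two terms by Leibniz' rule, hence the
  factor \<open>2 ^ k\<close>.\<close>

lemma derivs_le_mult:
  assumes "0 \<le> M" "0 \<le> N"
  shows "Ck_on k f S \<Longrightarrow> Ck_on k g S \<Longrightarrow> derivs_le k M f K \<Longrightarrow> derivs_le k N g K \<Longrightarrow>
    derivs_le k (2 ^ k * M * N) (\<lambda>x. f x * g x) K"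
proof (induction k arbitrary: f g)
  case 0
  then show ?case using assms by (auto simp: abs_mult intro!: mult_mono)
next
  case (Suc k)
  have e: "2 ^ Suc k * M * N = 2 ^ k * M * N + 2 ^ k * M * N" by simp
  have "derivs_le k (2 ^ k * M * N + 2 ^ k * M * N) (\<lambda>x. f x * partial i g x + partial i f x * g x) K" for i
    using Suc.prems
    by (intro derivs_le_add Suc.IH Ck_on_mult[OF S]) (auto intro: Ck_on_Suc_D[of k] derivs_le_Suc_D[of k] simp del: Ck_on.simps(1))
  then have "derivs_le k (2 ^ Suc k * M * N) (partial i (\<lambda>x. f x * g x)) K" for i
    unfolding e
    by (rule derivs_le_cong[OF S K, rotated])
      (use Suc.prems in \<open>auto intro!: partial_mult[symmetric] differentiable_onD_open[OF S]\<close>)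
  moreover have "\<bar>f x * g x\<bar> \<le> 2 ^ Suc k * M * N" if "x \<in> K" for x
  proof -
    have "\<bar>f x\<bar> * \<bar>g x\<bar> \<le> M * N" using Suc.prems that assms by (auto intro!: mult_mono)
    also have "\<dots> \<le> 2 ^ Suc k * (M * N)" using assms
      by (metis mult_1 mult_nonneg_nonneg mult_right_mono one_le_numeral one_le_power)
    finally show ?thesis by (simp add: abs_mult)
  qed
  ultimately show ?case by simp
qed

lemma derivs_le_sum:
  assumes "finite I" "\<And>i. i \<in> I \<Longrightarrow> Ck_on k (f i) S" "\<And>i. i \<in> I \<Longrightarrow> derivs_le k M (f i) K" 
  shows "derivs_le k (real (card I) * M) (\<lambda>x. \<Sum>i\<in>I. f i x) K"
  using assms
proof (induction I)
  case (insert i I)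
  then have "derivs_le k (M + real (card I) * M) (\<lambda>x. f i x + (\<Sum>i\<in>I. f i x)) K"
    by (intro derivs_le_add Ck_on_sum S) auto
  then show ?case using insert by (simp add: algebra_simps)
qed (auto intro: derivs_le_const)

lemma derivs_le_cmult:
  assumes "0 \<le> M"
  shows "Ck_on k f S \<Longrightarrow> derivs_le k M f K \<Longrightarrow> derivs_le k (\<bar>c\<bar> * M) (\<lambda>x. c * f x) K"
proof (induction k arbitrary: f)
  case 0
  then show ?case by (auto simp: abs_mult mult_left_mono)
next
  case (Suc k)
  have "derivs_le k (\<bar>c\<bar> * M) (partial i (\<lambda>x. c * f x)) K" for i
    by (rule derivs_le_cong[OF S K _ Suc.IH[of "partial i f"]])
      (use Suc.prems in \<open>auto simp: partial_mult differentiable_onD_open[OF S]\<close>)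
  with Suc.prems show ?case by (auto simp: abs_mult mult_left_mono)
qed

lemma derivs_le_laplacian:
  assumes "Ck_on (Suc (Suc k)) f S" "derivs_le (Suc (Suc k)) M f K" "0 \<le> M"
  shows "derivs_le k (real CARD('n) * M) (\<lambda>x. - laplacian f x) K"
proof -
  have "derivs_le k (real CARD('n) * M) (laplacian f) K"
    unfolding laplacian_def using assms(1,2) by (intro derivs_le_sum) auto
  moreover have "Ck_on k (laplacian f) S"
    using Ck_on_minus[OF S Ck_on_laplacian[OF S assms(1)]] by simp
  ultimately show ?thesis
    using derivs_le_cmult[of "real CARD('n) * M" k "laplacian f" "-1"] assms(3) by simp
qed

lemma derivs_le_neg_laplacian_power:
  assumes "0 \<le> M"
  shows "Ck_on (2 * l) f S \<Longrightarrow> derivs_le (2 * l) M f K \<Longrightarrow> x \<in> K \<Longrightarrow>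
    \<bar>neg_laplacian_power l f x\<bar> \<le> real CARD('n) ^ l * M"
  using assms
proof (induction l arbitrary: f M)
  case (Suc l)
  have "\<bar>neg_laplacian_power l (\<lambda>x. - laplacian f x) x\<bar> \<le> real CARD('n) ^ l * (real CARD('n) * M)"
    using Suc.prems
    by (intro Suc.IH derivs_le_laplacian Ck_on_laplacian S) (auto simp del: Ck_on.simps derivs_le.simps)
  then show ?case by (simp add: neg_laplacian_power_Suc algebra_simps)
qed (simp add: neg_laplacian_power_0)

end

lemma derivs_le_scale:
  fixes f :: "real ^ 'n \<Rightarrow> real"
  assumes "open S" "K \<subseteq> S" "\<bar>c\<bar> \<le> 1"
  shows "Ck_on k f S \<Longrightarrow> derivs_le k M f K \<Longrightarrow> derivs_le k M (\<lambda>x. f (c *\<^sub>R x)) {x. c *\<^sub>R x \<in> K}"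
proof (induction k arbitrary: f)
  case (Suc k)
  note o = open_scale[OF assms(1), of c]
  have fd: "f differentiable (at (c *\<^sub>R x))" if "c *\<^sub>R x \<in> S" for x
    using Suc.prems that by (auto intro: differentiable_onD_open[OF assms(1)])
  have "derivs_le k M (partial i (\<lambda>x. f (c *\<^sub>R x))) {x. c *\<^sub>R x \<in> K}" for i
  proof (rule derivs_le_cong[OF o])
    show "{x. c *\<^sub>R x \<in> K} \<subseteq> {x. c *\<^sub>R x \<in> S}" using assms(2) by auto
    show "c * partial i f (c *\<^sub>R x) = partial i (\<lambda>x. f (c *\<^sub>R x)) x" if "x \<in> {x. c *\<^sub>R x \<in> S}" for x
      using that by (simp add: partial_scale(1)[OF fd])
    show "derivs_le k M (\<lambda>x. c * partial i f (c *\<^sub>R x)) {x. c *\<^sub>R x \<in> K}"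
    \<comment> \<open>\<open>0 \<le> M\<close> is only implied by the bound at some point of
      \<open>K\<close>; the empty set is settled directly.\<close>
    proof (cases "K = {}")
      case True
      have "derivs_le k M h {}" for h :: "real^'n \<Rightarrow> real" by (induction k arbitrary: h) auto
      then show ?thesis using True by simp
    next
      case False
      then obtain z where "z \<in> K" by blast
      then have M: "0 \<le> M" using derivs_le_bound[OF Suc.prems(2)] by fastforce
      have "derivs_le k (\<bar>c\<bar> * M) (\<lambda>x. c * partial i f (c *\<^sub>R x)) {x. c *\<^sub>R x \<in> K}"
        using Suc assms(2) by (intro derivs_le_cmult[OF o _ M] Ck_on_scale[OF assms(1)]) auto
      moreover have "\<bar>c\<bar> * M \<le> M" using M assms(3) by (simp add: mult_left_le_one_le)
      ultimately show ?thesis by (rule derivs_le_mono)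
    qed
  qed
  then show ?case using Suc.prems by auto
qed auto

lemma derivs_le_compact_ex:
  assumes "open S" "compact K" "K \<subseteq> S"
  shows "Ck_on k f S \<Longrightarrow> \<exists>M\<ge>0. derivs_le k M f K"
proof (induction k arbitrary: f)
  case 0
  then have "compact (f ` K)"
    using compact_continuous_image[OF continuous_on_subset[OF _ assms(3)] assms(2)] by simp
  then obtain M where "\<forall>y\<in>f ` K. \<bar>y\<bar> \<le> M"
    using compact_imp_bounded bounded_real by metis
  then show ?case by (intro exI[of _ "max M 0"]) (auto simp: le_max_iff_disj)
next
  case (Suc k)
  have "\<exists>M\<ge>0. derivs_le k M (partial i f) K" for i using Suc by simp
  then obtain M where M: "\<And>i. M i \<ge> 0" "\<And>i. derivs_le k (M i) (partial i f) K" by metis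
  have "\<exists>N\<ge>0. derivs_le k N f K" using Suc.prems by (intro Suc.IH Ck_on_Suc_D[of k])
  then obtain N where N: "N \<ge> 0" "derivs_le k N f K" by blast
  have le: "M i \<le> N + sum M UNIV" for i
    using member_le_sum[of i UNIV M] M N by (simp add: add_increasing)
  have "derivs_le (Suc k) (N + sum M UNIV) f K"
    using derivs_le_bound[OF N(2)] derivs_le_mono[OF M(2) le] M(1) by (auto intro!: order_trans[OF derivs_le_bound[OF N(2)]] sum_nonneg)
  then show ?case using M(1) N(1) by (auto intro!: exI[of _ "N + sum M UNIV"] sum_nonneg add_nonneg_nonneg)
qed

section \<open>Green's formula\<close>

lemma Ck_on_Un:
  assumes "open S" "open T"
  shows "Ck_on k f S \<Longrightarrow> Ck_on k f T \<Longrightarrow> Ck_on k f (S \<union> T)"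
proof (induction k arbitrary: f)
  case 0
  then show ?case using assms by (auto intro: continuous_on_open_Un)
next
  case (Suc k)
  then have "f differentiable_on (S \<union> T)"
    by (auto intro!: differentiable_at_imp_differentiable_on intro: differentiable_onD_open assms)
  with Suc show ?case by simp
qed

lemma Ck_on_zero: "open S \<Longrightarrow> (\<And>x. x \<in> S \<Longrightarrow> f x = 0) \<Longrightarrow> Ck_on k f S"
  by (rule Ck_on_cong[of S "\<lambda>x. 0"]) (auto intro: Ck_on_const)

text \<open>The factor \<open>\<phi>\<close> vanishes on a ball around the origin, so the product is
  smooth across the point where \<open>f\<close> may be singular: \<open>- {0}\<close> and that ball
  cover the space.\<close>

lemma Ck_on_mult_supp:
  assumes "0 < a" "Ck_on k f (- {0})" "Ck_on k \<phi> UNIV" "\<And>x. norm x < a \<or> norm x > b \<Longrightarrow> \<phi> x = 0"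
  shows "Ck_on k (\<lambda>x. f x * \<phi> x) UNIV"
proof -
  have "Ck_on k (\<lambda>x. f x * \<phi> x) (- {0} \<union> ball 0 a)"
  proof (intro Ck_on_Un)
    show "Ck_on k (\<lambda>x. f x * \<phi> x) (- {0})"
      using assms by (intro Ck_on_mult) (auto intro: Ck_on_subset)
    show "Ck_on k (\<lambda>x. f x * \<phi> x) (ball 0 a)"
      using assms by (intro Ck_on_zero) (auto simp: dist_norm)
  qed auto
  moreover have "- {0} \<union> ball 0 a = (UNIV :: (real^'a) set)" using assms(1) by auto
  ultimately show ?thesis by simp
qed

lemma integrable_compact_supp:
  fixes f :: "real ^ 'n \<Rightarrow> real"
  assumes "continuous_on UNIV f" "\<And>x. norm x > b \<Longrightarrow> f x = 0"
  shows "integrable lborel f"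
proof -
  have "integrable lborel (\<lambda>x. indicator (cball 0 b) x *\<^sub>R f x)"
    using assms(1) by (intro borel_integrable_compact compact_cball) (auto intro: continuous_on_subset)
  moreover have "(\<lambda>x. indicator (cball 0 b) x *\<^sub>R f x) = f"
    using assms(2) by (auto simp: indicator_def fun_eq_iff)
  ultimately show ?thesis by simp
qed

lemma lborel_integral_translate:
  fixes f :: "real ^ 'n \<Rightarrow> real"
  assumes "f \<in> borel_measurable borel"
  shows "(LINT x|lborel. f (x + c)) = (LINT x|lborel. f x)"
proof -
  have "(LINT x|lborel. f x) = (LINT x|distr lborel borel ((+) c). f x)"
    by (simp add: lborel_distr_plus)
  also have "\<dots> = (LINT x|lborel. f (c + x))"
    using assms by (intro integral_distr) auto
  finally show ?thesis by (simp add: add.commute)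
qed

lemma partial_zero_open:
  "open S \<Longrightarrow> x \<in> S \<Longrightarrow> (\<And>y. y \<in> S \<Longrightarrow> f y = 0) \<Longrightarrow> partial i f x = 0"
  using partial_cong_open[of S x f "\<lambda>x. 0"] by simp

lemma partial_supp:
  assumes "\<And>x. norm x < a \<or> norm x > b \<Longrightarrow> \<phi> x = 0" "norm x < a \<or> norm x > b"
  shows "partial i \<phi> x = 0"
proof (rule partial_zero_open[of "ball 0 a \<union> - cball 0 b"])
  show "open (ball (0::real^'a) a \<union> - cball 0 b)" by (intro open_Un open_ball open_Compl closed_cball)
qed (use assms in \<open>auto simp: dist_norm not_le\<close>)

text \<open>By translation invariance of Lebesgue measure all difference quotients of
  \<open>w\<close> have integral zero. The mean value theorem bounds them by \<open>M\<close> on a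
  slightly larger ball, so dominated convergence passes to the derivative.\<close>

lemma integral_partial_zero:
  fixes w :: "real ^ 'n \<Rightarrow> real"
  assumes w: "Ck_on 1 w UNIV" and supp: "\<And>x. norm x > b \<Longrightarrow> w x = 0"
  shows "(LINT x|lborel. partial i w x) = 0"
proof -
  let ?e = "axis i 1 :: real ^ 'n"
  have dw: "w differentiable (at x)" for x
    using w by (auto intro: Ck_on_differentiable[of UNIV 0])
  have cp: "continuous_on UNIV (partial i w)" and cw: "continuous_on UNIV w"
    using w Ck_on_continuous[OF w] by auto
  have sp: "partial i w x = 0" if "norm x > b" for x
    using partial_supp[of "-1" b w x i] supp that by (meson norm_ge_zero not_le less_trans neg_less_0_iff_less zero_less_one)
  have mw: "w \<in> borel_measurable borel" using cw by (rule borel_measurable_continuous_onI)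
  have "compact (partial i w ` cball 0 b)"
    using cp by (intro compact_continuous_image compact_cball) (auto intro: continuous_on_subset)
  then obtain M0 where M0: "\<forall>y\<in>partial i w ` cball 0 b. \<bar>y\<bar> \<le> M0"
    using compact_imp_bounded bounded_real by metis
  define M where "M = max M0 0"
  have M: "\<bar>partial i w x\<bar> \<le> M" "0 \<le> M" for x
    using M0 sp[of x] unfolding M_def by (cases "norm x \<le> b"; force)+
  have der: "((\<lambda>s. w (x + s *\<^sub>R ?e)) has_real_derivative partial i w (x + s *\<^sub>R ?e)) (at s)" for x s
  proof -
    obtain D where D: "(w has_derivative D) (at (x + s *\<^sub>R ?e))"
      using dw unfolding differentiable_def by blast
    have "((\<lambda>r. w (x + s *\<^sub>R ?e + r *\<^sub>R ?e)) has_real_derivative partial i w (x + s *\<^sub>R ?e)) (at 0)"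
      using partial_has_real_derivative[OF D] partial_eq_derivative[OF D] by metis
    then have "((\<lambda>r. w (x + (s + r) *\<^sub>R ?e)) has_real_derivative partial i w (x + s *\<^sub>R ?e)) (at 0)"
      by (simp add: scaleR_add_left add.assoc)
    then show ?thesis using DERIV_at_within_shift[of "\<lambda>r. w (x + r *\<^sub>R ?e)" _ s 0 UNIV] by simp
  qed
  define h where "h k = inverse (real (Suc k))" for k
  have h: "0 < h k" "h k \<le> 1" for k unfolding h_def by (auto simp: field_simps)
  have h0: "h \<longlonglongrightarrow> 0" unfolding h_def by (rule LIMSEQ_inverse_real_of_nat)
  define D where "D k x = (w (x + h k *\<^sub>R ?e) - w x) / h k" for k x
  have Dz: "(LINT x|lborel. D k x) = 0" for k
  proof -
    have "integrable lborel w" using integrable_compact_supp[OF cw supp] by blast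
    moreover have "integrable lborel (\<lambda>x. w (x + h k *\<^sub>R ?e))"
    proof (rule integrable_compact_supp[where b = "b + 1"])
      show "continuous_on UNIV (\<lambda>x. w (x + h k *\<^sub>R ?e))"
        by (intro continuous_on_compose2[OF cw] continuous_intros) auto
      fix x :: "real ^ 'n" assume "norm x > b + 1"
      moreover have "norm x \<le> norm (x + h k *\<^sub>R ?e) + h k"
        using norm_triangle_ineq4[of "x + h k *\<^sub>R ?e" "h k *\<^sub>R ?e"] h(1)[of k] by simp
      ultimately show "w (x + h k *\<^sub>R ?e) = 0" using h(2)[of k] by (intro supp) linarith
    qed
    ultimately have "(LINT x|lborel. D k x) = ((LINT x|lborel. w (x + h k *\<^sub>R ?e)) - (LINT x|lborel. w x)) / h k"
      unfolding D_def by simp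
    then show ?thesis by (simp add: lborel_integral_translate[OF mw])
  qed
  have "(\<lambda>k. LINT x|lborel. D k x) \<longlonglongrightarrow> (LINT x|lborel. partial i w x)"
  proof (rule integral_dominated_convergence[where w = "\<lambda>x. M * indicator (cball 0 (b + 1)) x"])
    show "partial i w \<in> borel_measurable lborel" using cp by (simp add: borel_measurable_continuous_onI)
    show "D k \<in> borel_measurable lborel" for k
      unfolding D_def using mw by measurable
    show "integrable lborel (\<lambda>x. M * indicator (cball (0::real^'n) (b + 1)) x)"
      by (intro integrable_mult_right integrable_real_indicator) (use emeasure_lborel_cball_finite[of "0::real^'n" "b + 1"] in simp_all)
    show "AE x in lborel. (\<lambda>k. D k x) \<longlonglongrightarrow> partial i w x"
    proof (rule AE_I2)
      fix x
      have "((\<lambda>s. (w (x + s *\<^sub>R ?e) - w x) / s) \<longlongrightarrow> partial i w x) (at 0)"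
        using der[of x 0] by (simp add: DERIV_def)
      then show "(\<lambda>k. D k x) \<longlonglongrightarrow> partial i w x"
        unfolding D_def by (rule tendsto_compose_eventually[OF _ h0]) (use h in \<open>auto simp: less_imp_neq[symmetric] intro!: always_eventually\<close>)
    qed
    show "AE x in lborel. norm (D k x) \<le> M * indicator (cball 0 (b + 1)) x" for k
    proof (rule AE_I2)
      fix x
      obtain z where z: "0 < z" "z < h k" "w (x + h k *\<^sub>R ?e) - w (x + 0 *\<^sub>R ?e) = (h k - 0) * partial i w (x + z *\<^sub>R ?e)"
        using MVT2[OF h(1)[of k], of "\<lambda>s. w (x + s *\<^sub>R ?e)" "\<lambda>s. partial i w (x + s *\<^sub>R ?e)"] der by blast
      then have Dx: "D k x = partial i w (x + z *\<^sub>R ?e)" unfolding D_def using h(1)[of k] by simp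
      show "norm (D k x) \<le> M * indicator (cball 0 (b + 1)) x"
      proof (cases "norm x \<le> b + 1")
        case False
        have "norm x \<le> norm (x + z *\<^sub>R ?e) + z"
          using norm_triangle_ineq4[of "x + z *\<^sub>R ?e" "z *\<^sub>R ?e"] z(1) by simp
        then have "D k x = 0" unfolding Dx using False z(2) h(2)[of k] by (intro sp) linarith
        then show ?thesis using M(2) by simp
      qed (use M Dx in simp)
    qed
  qed
  then have "(\<lambda>k::nat. 0::real) \<longlonglongrightarrow> (LINT x|lborel. partial i w x)" by (simp add: Dz)
  then show ?thesis using LIMSEQ_unique[OF _ tendsto_const] by blast
qed

lemma integral_by_parts_partial:
  fixes f \<phi> :: "real ^ 'n \<Rightarrow> real"
  assumes "0 < a" "Ck_on 1 f (- {0})" "Ck_on 1 \<phi> UNIV" "\<And>x. norm x < a \<or> norm x > b \<Longrightarrow> \<phi> x = 0"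
  shows "(LINT x|lborel. partial i f x * \<phi> x) = - (LINT x|lborel. f x * partial i \<phi> x)"
proof -
  have C: "Ck_on 1 (\<lambda>x. f x * \<phi> x) UNIV" by (rule Ck_on_mult_supp[OF assms])
  have 1: "(LINT x|lborel. partial i (\<lambda>x. f x * \<phi> x) x) = 0"
    using assms(4) by (intro integral_partial_zero[OF C, of b]) auto
  have eq: "partial i (\<lambda>x. f x * \<phi> x) x = f x * partial i \<phi> x + partial i f x * \<phi> x" for x
  \<comment> \<open>At the origin \<open>f\<close> need not be differentiable; both sides are zero
    there because \<open>\<phi>\<close> vanishes nearby.\<close>
  proof (cases "x = 0")
    case True
    have "partial i (\<lambda>x. f x * \<phi> x) x = 0" "partial i \<phi> x = 0" "\<phi> x = 0"
      using assms(1,4) True by (auto intro!: partial_supp[of a b])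
    then show ?thesis by simp
  next
    case False
    then show ?thesis using assms
      by (intro partial_mult) (auto intro: differentiable_onD_open[of "- {0}"] differentiable_onD_open[of UNIV])
  qed
  have c1: "continuous_on UNIV (\<lambda>x. f x * partial i \<phi> x)"
    using Ck_on_mult_supp[OF assms(1), of 0 f "partial i \<phi>" b] assms
    by (auto intro: partial_supp[of a b] differentiable_imp_continuous_on)
  have c2: "continuous_on UNIV (\<lambda>x. partial i f x * \<phi> x)"
    using Ck_on_mult_supp[OF assms(1), of 0 "partial i f" \<phi> b] assms
    by (auto intro: differentiable_imp_continuous_on)
  have "integrable lborel (\<lambda>x. f x * partial i \<phi> x)" "integrable lborel (\<lambda>x. partial i f x * \<phi> x)"
    using assms(4) by (auto intro!: integrable_compact_supp[OF c1, of b] integrable_compact_supp[OF c2, of b]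
      simp: partial_supp[of a b])
  then show ?thesis using 1 unfolding eq by simp
qed

lemma laplacian_supp:
  assumes "\<And>x. norm x < a \<or> norm x > b \<Longrightarrow> \<phi> x = 0" "norm x < a \<or> norm x > b"
  shows "laplacian \<phi> x = 0"
  unfolding laplacian_def using assms by (auto intro!: sum.neutral partial_supp[of a b])

lemma green_laplacian:
  fixes f \<phi> :: "real ^ 'n \<Rightarrow> real"
  assumes "0 < a" "Ck_on 2 f (- {0})" "Ck_on 2 \<phi> UNIV" "\<And>x. norm x < a \<or> norm x > b \<Longrightarrow> \<phi> x = 0"
  shows "(LINT x|lborel. laplacian f x * \<phi> x) = (LINT x|lborel. f x * laplacian \<phi> x)"
proof -
  have C: "Ck_on 1 f (- {0})" "Ck_on 1 (partial i f) (- {0})" "Ck_on 1 \<phi> UNIV" "Ck_on 1 (partial i \<phi>) UNIV" for i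
    using assms Ck_on_mono[of 2 _ _ 1] by (auto simp: numeral_2_eq_2)
  have s: "partial i \<phi> x = 0" "partial i (partial i \<phi>) x = 0" if "norm x < a \<or> norm x > b" for i x
    using assms(4) that by (auto intro!: partial_supp[of a b])
  have c: "continuous_on UNIV (\<lambda>x. partial i (partial i f) x * \<phi> x)"
    "continuous_on UNIV (\<lambda>x. f x * partial i (partial i \<phi>) x)" for i
    using Ck_on_mult_supp[OF assms(1), of 0 "partial i (partial i f)" \<phi> b]
       Ck_on_mult_supp[OF assms(1), of 0 f "partial i (partial i \<phi>)" b] s assms(4) C Ck_on_continuous
    by (auto simp: Ck_on_continuous)
  have i: "integrable lborel (\<lambda>x. partial i (partial i f) x * \<phi> x)"
    "integrable lborel (\<lambda>x. f x * partial i (partial i \<phi>) x)" for i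
    using s assms(4) by (auto intro!: integrable_compact_supp[OF c(1), of b] integrable_compact_supp[OF c(2), of b])
  have "(LINT x|lborel. laplacian f x * \<phi> x) = (\<Sum>i\<in>UNIV. LINT x|lborel. partial i (partial i f) x * \<phi> x)"
    unfolding laplacian_def sum_distrib_right using i by (intro Bochner_Integration.integral_sum) auto
  also have "\<dots> = (\<Sum>i\<in>UNIV. LINT x|lborel. f x * partial i (partial i \<phi>) x)"
    using s assms(4) by (intro sum.cong refl)
      (simp add: integral_by_parts_partial[OF assms(1) C(2) C(3), of b] integral_by_parts_partial[OF assms(1) C(1) C(4), of b])
  also have "\<dots> = (LINT x|lborel. f x * laplacian \<phi> x)"
    unfolding laplacian_def sum_distrib_left using i by (intro Bochner_Integration.integral_sum[symmetric]) auto
  finally show ?thesis .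
qed

lemma neg_laplacian_power_supp:
  assumes "\<And>x. norm x < a \<or> norm x > b \<Longrightarrow> \<phi> x = 0"
  shows "norm x < a \<or> norm x > b \<Longrightarrow> neg_laplacian_power l \<phi> x = 0"
proof (induction l arbitrary: x)
  case (Suc l)
  then show ?case using laplacian_supp[of a b "neg_laplacian_power l \<phi>" x]
    by (auto simp: neg_laplacian_power_Suc2)
qed (use assms in \<open>auto simp: neg_laplacian_power_0\<close>)

text \<open>\<open>neg_laplacian_power\<close> unfolds at either end: the innermost Laplacian of
  \<open>f\<close> is left in place by the induction hypothesis and then moved by
  \<open>green_laplacian\<close> to the outside of the iterate of \<open>\<phi>\<close>.\<close>

lemma green_neg_laplacian_power:
  fixes f \<phi> :: "real ^ 'n \<Rightarrow> real"
  assumes a: "0 < a" and \<phi>: "Ck_on (2 * l) \<phi> UNIV" "\<And>x. norm x < a \<or> norm x > b \<Longrightarrow> \<phi> x = 0"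
    and f: "Ck_on (2 * l) f (- {0})"
  shows "(LINT x|lborel. neg_laplacian_power l f x * \<phi> x) = (LINT x|lborel. f x * neg_laplacian_power l \<phi> x)"
  using f \<phi>(1)
proof (induction l arbitrary: f)
  case (Suc l)
  have 1: "Ck_on (2 * l) (\<lambda>x. - laplacian f x) (- {0})"
    using Suc.prems(1) by (intro Ck_on_laplacian) auto
  have 2: "Ck_on 2 f (- {0})" by (rule Ck_on_mono[OF Suc.prems(1)]) simp
  have 3: "Ck_on 2 (neg_laplacian_power l \<phi>) UNIV"
    by (rule Ck_on_neg_laplacian_power) (use Suc.prems(2) in simp_all)
  have 4: "Ck_on (2 * l) \<phi> UNIV" by (rule Ck_on_mono[OF Suc.prems(2)]) simp
  have "(LINT x|lborel. neg_laplacian_power (Suc l) f x * \<phi> x)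
      = (LINT x|lborel. (- laplacian f x) * neg_laplacian_power l \<phi> x)"
    unfolding neg_laplacian_power_Suc by (rule Suc.IH[OF 1 4])
  also have "\<dots> = - (LINT x|lborel. laplacian f x * neg_laplacian_power l \<phi> x)" by simp
  also have "\<dots> = - (LINT x|lborel. f x * laplacian (neg_laplacian_power l \<phi>) x)"
    using neg_laplacian_power_supp[of a b \<phi>, OF \<phi>(2)] by (simp add: green_laplacian[OF a 2 3, of b])
  finally show ?case by (simp add: neg_laplacian_power_Suc2)
qed (simp add: neg_laplacian_power_0)

section \<open>Cutoffs and the regularized fundamental solution\<close>

text \<open>A truncated power, of class C^(m-1). Tests against an operator of order
  \<open>2 * l\<close> need only finite smoothness, which \<open>m = 2 * l + 1\<close>
  supplies.\<close>

definition ramp :: "nat \<Rightarrow> real \<Rightarrow> real" where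
  "ramp m y = max 0 y ^ m"

lemma ramp_has_derivative:
  assumes "2 \<le> m"
  shows "(ramp m has_real_derivative real m * ramp (m - 1) y) (at y)"
proof -
  consider "y < 0" | "y > 0" | "y = 0" by linarith
  then show ?thesis
  proof cases
    case 1
    have "((\<lambda>y. 0) has_real_derivative 0) (at y)" by simp
    then have "(ramp m has_real_derivative 0) (at y)"
      by (rule has_field_derivative_transform_within_open[of _ _ _ "{..<0}"])
        (use 1 assms in \<open>auto simp: ramp_def max_def\<close>)
    moreover have "real m * ramp (m - 1) y = 0" using 1 assms by (simp add: ramp_def max_def zero_power)
    ultimately show ?thesis by metis
  next
    case 2
    have "((\<lambda>y. y ^ m) has_real_derivative real m * y ^ (m - 1)) (at y)"
      by (auto intro!: derivative_eq_intros)
    then have "(ramp m has_real_derivative real m * y ^ (m - 1)) (at y)"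
      by (rule has_field_derivative_transform_within_open[of _ _ _ "{0<..}"])
        (use 2 in \<open>auto simp: ramp_def max_def\<close>)
    then show ?thesis using 2 by (simp add: ramp_def max_def)
  next
    case 3
    have "((\<lambda>h. ramp m h / h) \<longlongrightarrow> 0) (at 0)"
    proof (rule Lim_null_comparison[where g = "\<lambda>h. \<bar>h\<bar> ^ (m - 1)"])
      show "\<forall>\<^sub>F h in at 0. norm (ramp m h / h) \<le> \<bar>h\<bar> ^ (m - 1)"
      proof (rule always_eventually, rule allI)
        fix h :: real
        show "norm (ramp m h / h) \<le> \<bar>h\<bar> ^ (m - 1)"
          using assms by (cases "h > 0") (auto simp: ramp_def max_def power_eq_if[of h m] zero_power)
      qed
      have "((\<lambda>h::real. \<bar>h\<bar> ^ (m - 1)) \<longlongrightarrow> \<bar>0\<bar> ^ (m - 1)) (at 0)" by (intro tendsto_intros)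
        moreover have "\<bar>0::real\<bar> ^ (m - 1) = 0" using assms by (simp add: zero_power)
      ultimately show "((\<lambda>h::real. \<bar>h\<bar> ^ (m - 1)) \<longlongrightarrow> 0) (at 0)" by metis
    qed
    moreover have "ramp m 0 = 0" "ramp (m - 1) 0 = 0" using assms by (simp_all add: ramp_def zero_power)
    ultimately show ?thesis using 3 by (simp add: DERIV_def)
  qed
qed

lemma Ck1_on_ramp: "k < m \<Longrightarrow> Ck1_on k (\<lambda>y. c * ramp m y) UNIV"
proof (induction k arbitrary: m c)
  case 0
  then show ?case by (auto simp: ramp_def intro!: continuous_intros)
next
  case (Suc k)
  show ?case
    by (rule Ck1_on_SucI[OF _ _ Suc.IH[of "m - 1" "c * real m"]])
      (use Suc.prems in \<open>auto intro!: derivative_eq_intros ramp_has_derivative\<close>)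
qed

text \<open>The inner ramp is zero on the closed unit ball and at least one outside the ball of
  radius 2, so the outer ramp is one, respectively zero, there: a radially decreasing plateau
  function. Using the squared norm keeps it smooth at the origin.\<close>

definition chi :: "nat \<Rightarrow> real ^ 'n \<Rightarrow> real" where
  "chi m x = ramp m (1 - ramp m ((norm x)\<^sup>2 - 1))"

lemma Ck_on_chi:
  assumes "k < m"
  shows "Ck_on k (chi m) UNIV"
proof -
  have r: "Ck_on k (\<lambda>x. ramp m (f x)) UNIV" if "Ck_on k f UNIV" for f
    using Ck_on_compose[OF open_UNIV open_UNIV _ that Ck1_on_ramp[OF assms, of 1]] by simp
  show ?thesis unfolding chi_def
    using Ck_on_sqdist[of k 0 UNIV] by (intro r Ck_on_diff Ck_on_const) auto
qed

lemma ramp_mono: "x \<le> y \<Longrightarrow> ramp m x \<le> ramp m y"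
  unfolding ramp_def by (intro power_mono) auto

lemma chi_antimono: "norm x \<le> norm y \<Longrightarrow> chi m y \<le> chi m x"
  unfolding chi_def by (intro ramp_mono diff_mono order_refl power_mono) auto

lemma chi_eq_1: "0 < m \<Longrightarrow> norm x \<le> 1 \<Longrightarrow> chi m x = 1"
proof -
  assume "0 < m" "norm x \<le> 1"
  then have "max 0 ((norm x)\<^sup>2 - 1) = 0" using power_le_one[of "norm x" 2] by simp
  then show ?thesis using \<open>0 < m\<close> by (simp add: chi_def ramp_def zero_power)
qed

lemma chi_eq_0:
  assumes "0 < m" "norm x \<ge> 2"
  shows "chi m x = 0"
proof -
  have "(norm x)\<^sup>2 \<ge> 2\<^sup>2" using assms by (intro power_mono) auto
  then have "1 \<le> ramp m ((norm x)\<^sup>2 - 1)" unfolding ramp_def by (intro one_le_power) simp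
  then show ?thesis using assms by (simp add: chi_def ramp_def max_def)
qed

lemma chi_bounds: "0 \<le> chi m x" "chi m x \<le> 1"
  unfolding chi_def by (auto simp: ramp_def intro!: power_le_one)

text \<open>\<open>Eker s e d\<close> with \<open>s = (n - 2 l) / 2\<close> is the fundamental solution of \<open>(-\<Delta>)\<^sup>l\<close> with pole \<open>d\<close>, up to a
  constant and regularized at scale \<open>e\<close>.\<close>

definition Eker :: "real \<Rightarrow> real \<Rightarrow> real ^ 'n \<Rightarrow> real ^ 'n \<Rightarrow> real" where
  "Eker s e d x = (e\<^sup>2 + (norm (x - d))\<^sup>2) powr (- s)"

lemma Ck_on_Eker:
  assumes "open S" "\<And>x. x \<in> S \<Longrightarrow> e\<^sup>2 + (norm (x - d))\<^sup>2 > 0"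
  shows "Ck_on k (Eker s e d) S"
  unfolding Eker_def[abs_def]
  by (intro Ck_on_powr assms(1) Ck_on_add Ck_on_const Ck_on_sqdist) (use assms(2) in auto)

lemma Ck_on_Eker_UNIV: "e > 0 \<Longrightarrow> Ck_on k (Eker s e d) UNIV"
  by (rule Ck_on_Eker) (auto intro!: add_pos_nonneg)

lemma partial_Eker:
  assumes "e\<^sup>2 + (norm (x - d))\<^sup>2 > 0"
  shows "partial i (Eker s e d) x = - 2 * s * (x $ i - d $ i) * Eker (s + 1) e d x"
proof -
  have 1: "(\<lambda>x. (norm (x - d))\<^sup>2) differentiable (at x)"
    using Ck_on_sqdist[of 1 d UNIV] by (intro Ck_on_differentiable[of UNIV 0]) auto
  have "((\<lambda>y. (e\<^sup>2 + y) powr (- s)) has_real_derivative (- s) * (e\<^sup>2 + (norm (x - d))\<^sup>2) powr (- s - 1))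
      (at ((norm (x - d))\<^sup>2))"
    using assms by (auto intro!: derivative_eq_intros)
  from partial_compose(1)[OF 1 this, of i]
  moreover have "- (s + 1) = - s - 1" by simp
  ultimately show ?thesis unfolding Eker_def[abs_def] by (simp only: partial_sqdist) simp
qed

text \<open>Writing \<open>|x - d|^2\<close> as \<open>(e^2 + |x - d|^2) - e^2\<close> keeps the
  result inside the family of kernels. The first coefficient vanishes at the harmonic exponent
  \<open>2 * s = n - 2\<close>; the second term carries the regularization.\<close>

lemma neg_laplacian_Eker:
  fixes d x :: "real ^ 'n"
  assumes "e > 0"
  shows "- laplacian (Eker s e d) x
    = 2 * s * (real CARD('n) - 2 * s - 2) * Eker (s + 1) e d x + 4 * s * (s + 1) * e\<^sup>2 * Eker (s + 2) e d x"
proof -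
  have pos: "e\<^sup>2 + (norm (x - d))\<^sup>2 > 0" for x using assms by (intro add_pos_nonneg) auto
  have dE: "Eker (s + 1) e d differentiable (at x)"
    using Ck_on_Eker_UNIV[OF assms, of "Suc 0"] by (rule Ck_on_differentiable[OF open_UNIV]) simp
  have dc: "(\<lambda>x. - 2 * s * (x $ i - d $ i)) differentiable (at x)" for i
    using Ck_on_cmult[OF open_UNIV Ck_on_component[of 1 i "d $ i" UNIV], of "- 2 * s"]
    by (intro Ck_on_differentiable[of UNIV 0]) auto
  have pc: "partial i (\<lambda>x. - 2 * s * (x $ i - d $ i)) x = - 2 * s" for i
    using Ck_on_component[of 1 i "d $ i" UNIV]
    by (subst partial_mult) (auto simp: partial_component intro: Ck_on_differentiable[of UNIV 0])
  have "partial i (partial i (Eker s e d)) x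
      = - 2 * s * Eker (s + 1) e d x + 4 * s * (s + 1) * (x $ i - d $ i)\<^sup>2 * Eker (s + 2) e d x" for i
  proof -
    have "partial i (partial i (Eker s e d)) x = partial i (\<lambda>x. (- 2 * s * (x $ i - d $ i)) * Eker (s + 1) e d x) x"
      by (rule arg_cong[where f = "\<lambda>g. partial i g x"]) (simp add: fun_eq_iff partial_Eker[OF pos])
    also have "\<dots> = - 2 * s * (x $ i - d $ i) * (- 2 * (s + 1) * (x $ i - d $ i) * Eker (s + 1 + 1) e d x)
        + - 2 * s * Eker (s + 1) e d x"
      by (subst partial_mult[OF dc dE]) (simp only: pc partial_Eker[OF pos])
    finally show ?thesis by (simp add: algebra_simps power2_eq_square)
  qed
  then have "laplacian (Eker s e d) x = - 2 * s * real CARD('n) * Eker (s + 1) e d x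
      + 4 * s * (s + 1) * (\<Sum>i\<in>UNIV. (x $ i - d $ i)\<^sup>2) * Eker (s + 2) e d x"
    by (simp add: laplacian_def sum_subtractf sum_distrib_left sum_distrib_right)
  also have "(\<Sum>i\<in>UNIV. (x $ i - d $ i)\<^sup>2) = (norm (x - d))\<^sup>2"
    unfolding power2_norm_eq_inner inner_vec_def by (simp add: power2_eq_square)
  finally have L: "laplacian (Eker s e d) x = - 2 * s * real CARD('n) * Eker (s + 1) e d x
      + 4 * s * (s + 1) * ((norm (x - d))\<^sup>2 * Eker (s + 2) e d x)" by simp
  have "(e\<^sup>2 + (norm (x - d))\<^sup>2) * Eker (s + 2) e d x = Eker (s + 1) e d x"
  proof -
    have "- (s + 1) = 1 + - (s + 2)" by simp
    then show ?thesis unfolding Eker_def using pos[of x] by (simp only: powr_mult_base less_imp_le)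
  qed
  then have "(norm (x - d))\<^sup>2 * Eker (s + 2) e d x = Eker (s + 1) e d x - e\<^sup>2 * Eker (s + 2) e d x"
    by (simp add: algebra_simps)
  then have N: "(norm (x - d))\<^sup>2 * Eker (s + 2) e d x = Eker (s + 1) e d x - e\<^sup>2 * Eker (s + 2) e d x" .
  show ?thesis unfolding L N by algebra
qed

lemma laplacian_sum:
  fixes f :: "'i \<Rightarrow> real ^ 'n \<Rightarrow> real"
  assumes "finite I" "\<And>i. i \<in> I \<Longrightarrow> Ck_on 2 (f i) UNIV"
  shows "laplacian (\<lambda>x. \<Sum>i\<in>I. c i * f i x) x = (\<Sum>i\<in>I. c i * laplacian (f i) x)"
  using assms
proof (induction I)
  case empty
  have "partial j (\<lambda>x. 0) = (\<lambda>x. 0)" for j :: 'n by (rule ext) simp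
  then show ?case by (simp add: laplacian_def)
next
  case (insert i I)
  let ?g = "\<lambda>x. \<Sum>i\<in>I. c i * f i x"
  have C: "Ck_on 2 (\<lambda>x. c i * f i x) UNIV" "Ck_on 2 ?g UNIV"
    using insert by (auto intro!: Ck_on_sum Ck_on_cmult)
  have dd: "g differentiable (at x)" "partial j g differentiable (at x)" if "Ck_on 2 g UNIV" for g and j :: 'n and x
    using that by (auto simp: numeral_2_eq_2 intro: differentiable_onD_open[of UNIV])
  from C have d: "(\<lambda>x. c i * f i x) differentiable (at x)" "?g differentiable (at x)"
     "partial j (\<lambda>x. c i * f i x) differentiable (at x)" "partial j ?g differentiable (at x)" for j x
    by (blast intro: dd)+
  have "partial j (\<lambda>x. c i * f i x + ?g x) = (\<lambda>x. partial j (\<lambda>x. c i * f i x) x + partial j ?g x)" for j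
    using d by (intro ext partial_add)
  then have "laplacian (\<lambda>x. c i * f i x + ?g x) x = laplacian (\<lambda>x. c i * f i x) x + laplacian ?g x"
    using d by (simp add: laplacian_def partial_add sum.distrib)
  then show ?case using insert laplacian_cmult[of UNIV "f i" x "c i"] by simp
qed

text \<open>The coefficients of \<open>(-\<Delta>)\<^sup>j\<close> of the kernel in the powers \<open>e\<^sup>2\<^sup>i (e\<^sup>2 + |x|\<^sup>2)\<close> to the \<open>- s - j - i\<close>. Since
  \<open>pochhammer 0 m = 0\<close> for \<open>m > 0\<close>, only \<open>i = j\<close> survives for \<open>j = l\<close>.\<close>

definition kcoef :: "nat \<Rightarrow> real \<Rightarrow> nat \<Rightarrow> nat \<Rightarrow> real" where
  "kcoef l s j i = 4 ^ j * real (j choose i) * pochhammer (real l - real j) (j - i) * pochhammer s (j + i)"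

text \<open>This and \<open>kcoef_Suc\<close> are the recurrences obtained by applying
  \<open>neg_laplacian_Eker\<close> termwise with \<open>n = 2 * s + 2 * l\<close>. A new
  coefficient collects the first summand at the same power of \<open>e\<close> and the second
  summand from the power below.\<close>

lemma kcoef_0: "kcoef l s (Suc j) 0 = 4 * (s + j) * (real l - 1 - real j) * kcoef l s j 0"
proof -
  have "pochhammer (real l - real (Suc j)) (Suc j) = (real l - 1 - real j) * pochhammer (real l - real j) j"
    using pochhammer_rec[of "real l - real (Suc j)" j] by (simp add: algebra_simps)
  then show ?thesis using pochhammer_Suc[of s j] by (simp add: kcoef_def)
qed

lemma kcoef_Suc:
  assumes "i \<le> j"
  shows "kcoef l s (Suc j) (Suc i) = 4 * (s + j + Suc i) * (real l - 1 - real j - real (Suc i)) * kcoef l s j (Suc i)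
    + 4 * (s + j + i) * (s + j + i + 1) * kcoef l s j i"
proof (cases "i = j")
  case True
  have "j choose Suc j = 0" by (simp add: binomial_eq_0)
  moreover have "pochhammer s (Suc j + Suc j) = pochhammer s (j + j) * (s + 2 * j) * (s + 2 * j + 1)"
    by (simp add: pochhammer_Suc algebra_simps)
  ultimately have "kcoef l s j (Suc j) = 0"
    "kcoef l s (Suc j) (Suc j) = 4 * 4 ^ j * (pochhammer s (j + j) * (s + 2 * j) * (s + 2 * j + 1))"
    "kcoef l s j j = 4 ^ j * pochhammer s (j + j)"
    unfolding kcoef_def by simp_all
  then show ?thesis using True by (simp add: algebra_simps)
next
  case False
  define q where "q = j - Suc i"
  have q: "j - i = Suc q" "j - Suc i = q" "Suc j - Suc i = Suc q" "real j = real q + real i + 1"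
    using False assms by (auto simp: q_def)
  define P where "P = pochhammer (real l - real j) q"
  define S where "S = pochhammer s (j + i)"
  have S: "pochhammer s (j + Suc i) = S * (s + j + i)" "pochhammer s (Suc j + Suc i) = S * (s + j + i) * (s + j + i + 1)"
    using pochhammer_Suc[of s "j + i"] pochhammer_Suc[of s "Suc (j + i)"] by (simp_all add: S_def algebra_simps)
  have P1: "pochhammer (real l - real (Suc j)) (Suc q) = (real l - real j - 1) * P"
    using pochhammer_rec[of "real l - real (Suc j)" q] by (simp add: P_def algebra_simps)
  have P2: "pochhammer (real l - real j) (Suc q) = P * (real l - real i - 1)"
    using pochhammer_Suc[of "real l - real j" q] q(4) by (simp add: P_def algebra_simps)
  define B where "B = real (j choose i)"
  define B' where "B' = real (j choose Suc i)"
  \<comment> \<open>This absorption identity is the only combinatorial input. It turns Pascal's sum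
    \<open>B + B'\<close> times the common Pochhammer factor into the two terms of the
    recurrence.\<close>
  have "Suc i * (j choose Suc i) = (j - i) * (j choose i)"
    by (metis Suc_diff_Suc assms False binomial_absorb_comp binomial_absorption diff_Suc_1 le_neq_implies_less mult.commute)
  then have "real (Suc i) * B' = real (j - i) * B" unfolding B_def B'_def by (metis of_nat_mult)
  then have b: "(real i + 1) * B' = (real j - real i) * B" using assms by (simp add: of_nat_diff add.commute)
  have b2: "(B + B') * (real l - real j - 1) = (real l - 1 - real j - (real i + 1)) * B' + (real l - real i - 1) * B"
    using b by (simp add: algebra_simps)
  define T where "T = 4 * 4 ^ j * (S * (s + j + i) * (s + j + i + 1)) * P"
  have k0: "kcoef l s (Suc j) (Suc i) = T * ((B + B') * (real l - real j - 1))"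
    unfolding kcoef_def q(3) S P1 B_def B'_def T_def by (simp add: algebra_simps)
  have k1: "kcoef l s j (Suc i) = 4 ^ j * B' * P * (S * (s + j + i))"
    unfolding kcoef_def q(2) S P_def B'_def by simp
  have k2: "kcoef l s j i = 4 ^ j * B * (P * (real l - real i - 1)) * S"
    unfolding kcoef_def q(1) P2 B_def S_def by simp
  have "4 * (s + j + Suc i) * (real l - 1 - real j - real (Suc i)) * kcoef l s j (Suc i)
      = T * ((real l - 1 - real j - (real i + 1)) * B')"
    unfolding k1 T_def of_nat_Suc by algebra
  moreover have "4 * (s + j + i) * (s + j + i + 1) * kcoef l s j i = T * ((real l - real i - 1) * B)"
    unfolding k2 T_def by algebra
  ultimately show ?thesis unfolding k0 b2 by (simp only: distrib_left)
qed

lemma neg_laplacian_power_Eker_sum: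
  fixes d :: "real ^ 'n"
  assumes e: "e > 0" and n: "real CARD('n) = 2 * s + 2 * real l"
  shows "neg_laplacian_power j (Eker s e d) = (\<lambda>x. \<Sum>i\<le>j. kcoef l s j i * e ^ (2 * i) * Eker (s + j + i) e d x)"
proof (induction j)
  case 0
  show ?case by (simp add: neg_laplacian_power_0 kcoef_def)
next
  case (Suc j)
  show ?case
  proof (rule ext)
    fix x
    let ?A = "\<lambda>r. Eker r e d x"
    let ?c = "kcoef l s"
    have "neg_laplacian_power (Suc j) (Eker s e d) x
      = - (\<Sum>i\<le>j. ?c j i * e ^ (2 * i) * laplacian (Eker (s + j + i) e d) x)"
      unfolding neg_laplacian_power_Suc2 Suc using Ck_on_Eker_UNIV[OF e] by (subst laplacian_sum) auto
    also have "\<dots> = (\<Sum>i\<le>j. ?c j i * e ^ (2 * i) * (- laplacian (Eker (s + j + i) e d) x))"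
      by (simp add: sum_negf)
    also have "\<dots> = (\<Sum>i\<le>j. (4 * (s + j + i) * (real l - 1 - real j - real i) * ?c j i) * e ^ (2 * i) * ?A (s + j + i + 1)
        + (4 * (s + j + i) * (s + j + i + 1) * ?c j i) * e ^ (2 * Suc i) * ?A (s + j + i + 2))"
      unfolding neg_laplacian_Eker[OF e] n by (intro sum.cong refl) (simp add: algebra_simps power2_eq_square)
    also have "\<dots> = (\<Sum>i\<le>j. (4 * (s + j + i) * (real l - 1 - real j - real i) * ?c j i) * e ^ (2 * i) * ?A (s + Suc j + i))
       + (\<Sum>i\<le>j. (4 * (s + j + i) * (s + j + i + 1) * ?c j i) * e ^ (2 * Suc i) * ?A (s + Suc j + Suc i))"
      by (simp add: sum.distrib add.assoc add.commute add.left_commute)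
    \<comment> \<open>The added term with index \<open>Suc j\<close> is zero since
      \<open>j choose Suc j\<close> is; it aligns this sum with the shifted one.\<close>
    also have "(\<Sum>i\<le>j. (4 * (s + j + i) * (real l - 1 - real j - real i) * ?c j i) * e ^ (2 * i) * ?A (s + Suc j + i))
       = (\<Sum>i\<le>Suc j. (4 * (s + j + i) * (real l - 1 - real j - real i) * ?c j i) * e ^ (2 * i) * ?A (s + Suc j + i))"
      by (simp add: kcoef_def)
    also have "\<dots> = (4 * (s + j) * (real l - 1 - real j) * ?c j 0) * ?A (s + Suc j)
       + (\<Sum>i\<le>j. (4 * (s + j + Suc i) * (real l - 1 - real j - real (Suc i)) * ?c j (Suc i)) * e ^ (2 * Suc i) * ?A (s + Suc j + Suc i))"
      by (subst sum.atMost_Suc_shift) simp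
    also have "\<dots> + (\<Sum>i\<le>j. (4 * (s + j + i) * (s + j + i + 1) * ?c j i) * e ^ (2 * Suc i) * ?A (s + Suc j + Suc i))
       = ?c (Suc j) 0 * ?A (s + Suc j) + (\<Sum>i\<le>j. ?c (Suc j) (Suc i) * e ^ (2 * Suc i) * ?A (s + Suc j + Suc i))"
      unfolding kcoef_0 add.assoc sum.distrib[symmetric]
      by (intro arg_cong2[where f = "(+)"] sum.cong refl) (simp add: kcoef_Suc algebra_simps)
    also have "\<dots> = (\<Sum>i\<le>Suc j. ?c (Suc j) i * e ^ (2 * i) * ?A (s + Suc j + i))"
      by (subst sum.atMost_Suc_shift) simp
    finally show "neg_laplacian_power (Suc j) (Eker s e d) x
      = (\<Sum>i\<le>Suc j. ?c (Suc j) i * e ^ (2 * i) * ?A (s + Suc j + i))" .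
  qed
qed

lemma neg_laplacian_power_Eker:
  fixes d :: "real ^ 'n"
  assumes e: "e > 0" and n: "real CARD('n) = 2 * s + 2 * real l"
  shows "neg_laplacian_power l (Eker s e d) x = 4 ^ l * pochhammer s (2 * l) * e ^ (2 * l) * Eker (s + 2 * l) e d x"
proof -
  have "kcoef l s l i = 0" if "i < l" for i
    using that by (simp add: kcoef_def pochhammer_0_left)
  then have 1: "(\<Sum>i\<in>{..l} - {l}. kcoef l s l i * e ^ (2 * i) * Eker (s + l + i) e d x) = 0"
    by (intro sum.neutral) auto
  have "neg_laplacian_power l (Eker s e d) x = kcoef l s l l * e ^ (2 * l) * Eker (s + l + l) e d x"
    unfolding neg_laplacian_power_Eker_sum[OF e n]
    using sum.remove[of "{..l}" l "\<lambda>i. kcoef l s l i * e ^ (2 * i) * Eker (s + l + i) e d x"] 1 by simp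
  also have "kcoef l s l l = 4 ^ l * pochhammer s (2 * l)" by (simp add: kcoef_def mult_2)
  also have "s + real l + real l = s + real (2 * l)" by simp
  finally show ?thesis by (simp only: mult.assoc)
qed

section \<open>Growth estimates\<close>

lemma nn_integral_lborel_affine:
  fixes f :: "real ^ 'n \<Rightarrow> ennreal"
  assumes "f \<in> borel_measurable borel" "c \<noteq> 0"
  shows "(\<integral>\<^sup>+x. f x \<partial>lborel) = ennreal (\<bar>c\<bar> ^ CARD('n)) * (\<integral>\<^sup>+x. f (t + c *\<^sub>R x) \<partial>lborel)"
proof -
  have "(\<integral>\<^sup>+x. f x \<partial>lborel) = (\<integral>\<^sup>+x. f x \<partial>density (distr lborel borel (\<lambda>x. t + c *\<^sub>R x)) (\<lambda>_. ennreal (\<bar>c\<bar> ^ DIM(real ^ 'n))))"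
    by (subst lborel_affine[OF assms(2), of t]) simp
  also have "\<dots> = ennreal (\<bar>c\<bar> ^ CARD('n)) * (\<integral>\<^sup>+x. f (t + c *\<^sub>R x) \<partial>lborel)"
    using assms(1) by (simp add: nn_integral_density nn_integral_cmult nn_integral_distr)
  finally show ?thesis .
qed

lemma emeasure_cball_0:
  "0 \<le> r \<Longrightarrow> emeasure lborel (cball (0 :: real ^ 'n) r) = ennreal (unit_ball_vol (real CARD('n)) * r ^ CARD('n))"
  by (simp add: emeasure_cball)

lemma dyadic_exists:
  fixes r :: real
  assumes "1 < r"
  obtains k :: nat where "2 ^ k \<le> r" "r \<le> 2 ^ Suc k"
proof -
  define k where "k = nat \<lfloor>log 2 r\<rfloor>"
  have "0 \<le> log 2 r" using assms by simp
  then have "real k \<le> log 2 r" "log 2 r \<le> real (Suc k)" unfolding k_def by linarith+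
  then have "2 powr real k \<le> r" "r \<le> 2 powr real (Suc k)"
    using assms by (simp_all add: le_log_iff log_le_iff)
  then show ?thesis by (intro that[of k]) (simp_all only: powr_realpow zero_less_numeral)
qed

text \<open>Dyadic shells: for \<open>2 ^ k \<le> norm x \<le> 2 ^ Suc k\<close> the weight is at
  most \<open>2 ^ k\<close> to the power \<open>- n - \<sigma>\<close>, while \<open>h\<close> has
  mass at most \<open>C * (2 ^ Suc k) ^ n\<close>. The products form a geometric series of ratio
  \<open>2 powr - \<sigma>\<close>.\<close>

lemma nn_integral_tail_finite:
  fixes h :: "real ^ 'n \<Rightarrow> ennreal"
  assumes [measurable]: "h \<in> borel_measurable borel" and \<sigma>: "0 < \<sigma>" and C: "0 \<le> C"
    and b: "\<And>R. 1 \<le> R \<Longrightarrow> (\<integral>\<^sup>+x. h x * indicator (cball 0 R) x \<partial>lborel) \<le> ennreal (C * R ^ CARD('n))"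
  shows "(\<integral>\<^sup>+x. h x * ennreal (norm x powr (- real CARD('n) - \<sigma>)) * indicator {x. 1 < norm x} x \<partial>lborel) < \<infinity>"
proof -
  let ?n = "CARD('n)"
  let ?e = "- real ?n - \<sigma>"
  let ?f = "\<lambda>k x. ennreal ((2 ^ k) powr ?e) * (h x * indicator (cball 0 (2 ^ Suc k)) x)"
  have hm: "(\<lambda>x. h x * indicator (cball 0 (2 ^ Suc k)) x) \<in> borel_measurable lborel" for k
    by (intro borel_measurable_times_ennreal borel_measurable_indicator) simp_all
  have fm: "?f k \<in> borel_measurable lborel" for k
    by (intro borel_measurable_times_ennreal borel_measurable_const hm)
  have "h x * ennreal (norm x powr ?e) * indicator {x. 1 < norm x} x \<le> (\<Sum>k. ?f k x)" for x
  proof (cases "1 < norm x")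
    case True
    then obtain k where k: "2 ^ k \<le> norm x" "norm x \<le> 2 ^ Suc k" using dyadic_exists by blast
    have "norm x powr ?e \<le> (2 ^ k) powr ?e" using k \<sigma> True by (intro powr_mono2') auto
    then have "h x * ennreal (norm x powr ?e) * indicator {x. 1 < norm x} x \<le> ?f k x"
      using k True by (simp add: mult.commute mult_left_mono ennreal_leI)
    also have "\<dots> \<le> (\<Sum>k. ?f k x)" using sum_le_suminf[of "\<lambda>k. ?f k x" "{k}"] by (simp add: summableI)
    finally show ?thesis .
  qed auto
  then have "(\<integral>\<^sup>+x. h x * ennreal (norm x powr ?e) * indicator {x. 1 < norm x} x \<partial>lborel)
     \<le> (\<integral>\<^sup>+x. (\<Sum>k. ?f k x) \<partial>lborel)" by (rule nn_integral_mono)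
  also have "\<dots> = (\<Sum>k. \<integral>\<^sup>+x. ?f k x \<partial>lborel)"
    by (rule nn_integral_suminf[of ?f lborel, OF fm])
  also have "\<dots> = (\<Sum>k. ennreal ((2 ^ k) powr ?e) * (\<integral>\<^sup>+x. h x * indicator (cball 0 (2 ^ Suc k)) x \<partial>lborel))"
    by (intro suminf_cong nn_integral_cmult hm)
  also have "\<dots> \<le> (\<Sum>k. ennreal (C * 2 ^ ?n * (2 powr - \<sigma>) ^ k))"
  proof (intro suminf_le summableI)
    fix k :: nat
    have "ennreal ((2 ^ k) powr ?e) * (\<integral>\<^sup>+x. h x * indicator (cball 0 (2 ^ Suc k)) x \<partial>lborel)
      \<le> ennreal ((2 ^ k) powr ?e) * ennreal (C * (2 ^ Suc k) ^ ?n)"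
      by (intro mult_left_mono b one_le_power) auto
    also have "\<dots> = ennreal ((2 ^ k) powr ?e * (C * (2 ^ Suc k) ^ ?n))" by (simp add: ennreal_mult' C)
    also have "(2 ^ k) powr ?e * (C * (2 ^ Suc k) ^ ?n) = C * 2 ^ ?n * (2 powr - \<sigma>) ^ k"
    proof -
      have "(2 ^ k) powr ?e = 1 / (2 ^ k) ^ ?n * (2 ^ k) powr (- \<sigma>)"
        using powr_add[of "2 ^ k" "- real ?n" "- \<sigma>"] by (simp add: powr_minus powr_realpow inverse_eq_divide)
      moreover have "((2::real) ^ k) powr (- \<sigma>) = (2 powr - \<sigma>) ^ k"
        by (simp add: powr_realpow[symmetric] powr_powr mult.commute)
      ultimately show ?thesis by (simp add: power_mult_distrib)
    qed
    finally show "ennreal ((2 ^ k) powr ?e) * (\<integral>\<^sup>+x. h x * indicator (cball 0 (2 ^ Suc k)) x \<partial>lborel)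
      \<le> ennreal (C * 2 ^ ?n * (2 powr - \<sigma>) ^ k)" .
  qed
  also have "\<dots> < \<infinity>"
  proof -
    have "(2::real) powr - \<sigma> < 1" using \<sigma> by (simp add: powr_less_one)
    then have "summable (\<lambda>k. C * 2 ^ ?n * (2 powr - \<sigma>) ^ k)"
      by (intro summable_mult summable_geometric) auto
    then show ?thesis by (subst suminf_ennreal2) (auto simp: C)
  qed
  finally show ?thesis .
qed

text \<open>Hoelder's inequality on a ball in disguise: a Young inequality with a free parameter
  \<open>\<mu>\<close> splits \<open>u\<close> into an energy term and a volume term, after
  \<open>norm x powr (t / p)\<close> has been bounded by \<open>R powr (t / p)\<close>.\<close>

lemma growth_from_energy:
  fixes u :: "real ^ 'n \<Rightarrow> real"
  assumes u: "u \<in> borel_measurable borel" "\<And>x. 0 \<le> u x" and p: "1 < p" and t: "0 < t"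
    and fin: "(\<integral>\<^sup>+x. ennreal (norm x powr (- t) * u x powr p) \<partial>lborel) < \<infinity>"
  shows "\<exists>C\<ge>0. \<forall>R\<ge>1. (\<integral>\<^sup>+x. ennreal (u x) * indicator (cball 0 R) x \<partial>lborel)
    \<le> ennreal (C * R powr (real CARD('n) - (real CARD('n) - t) / p))"
proof -
  let ?n = "real CARD('n)"
  let ?V = "unit_ball_vol ?n"
  note [measurable] = u(1)
  obtain A where A: "0 \<le> A" "(\<integral>\<^sup>+x. ennreal (norm x powr (- t) * u x powr p) \<partial>lborel) = ennreal A"
    by (rule that[of "enn2real (\<integral>\<^sup>+x. ennreal (norm x powr (- t) * u x powr p) \<partial>lborel)"])
      (use fin in \<open>simp_all add: ennreal_enn2real\<close>)
  have "(\<integral>\<^sup>+x. ennreal (u x) * indicator (cball 0 R) x \<partial>lborel) \<le> ennreal ((A + ?V) * R powr (?n - (?n - t) / p))"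
    if R: "1 \<le> R" for R
  proof -
    \<comment> \<open>The exponent balances the two terms: the energy term grows like
      \<open>R powr (t / p) * \<mu>\<close>, the volume term like
      \<open>R powr (t / p + n) * \<mu> powr (- 1 / (p - 1))\<close>, and both become the claimed
      power.\<close>
    define \<mu> where "\<mu> = R powr (?n * (p - 1) / p)"
    have \<mu>: "0 < \<mu>" using R by (simp add: \<mu>_def)
    \<comment> \<open>Either \<open>X\<close> lies below the threshold, which is the second term, or
      \<open>X powr (p - 1) \<ge> 1 / \<mu>\<close> and the first term dominates.\<close>
    have young: "X \<le> \<mu> * X powr p + \<mu> powr (- 1 / (p - 1))" if X: "0 \<le> X" for X
    proof (cases "X \<le> \<mu> powr (- 1 / (p - 1))")
      case False
      have "(\<mu> powr (- 1 / (p - 1))) powr (p - 1) \<le> X powr (p - 1)" using False p by (intro powr_mono2) auto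
      moreover have "(\<mu> powr (- 1 / (p - 1))) powr (p - 1) = 1 / \<mu>"
      proof -
        have "- 1 / (p - 1) * (p - 1) = - 1" using p by simp
        then show ?thesis using \<mu> by (simp only: powr_powr) (simp add: powr_minus divide_inverse)
      qed
      ultimately have "1 / \<mu> \<le> X powr (p - 1)" by simp
      then have "X * 1 \<le> X * (\<mu> * X powr (p - 1))" using \<mu> X by (intro mult_left_mono) (auto simp: field_simps)
      also have "\<dots> = \<mu> * X powr p" using X powr_mult_base[of X "p - 1"] by simp
      finally show ?thesis by (simp add: add_increasing2)
    qed (use \<mu> in \<open>auto simp: add_increasing\<close>)
    have pt: "ennreal (u x) * indicator (cball 0 R) x \<le> ennreal (R powr (t / p) * \<mu>) * ennreal (norm x powr (- t) * u x powr p)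
        + ennreal (R powr (t / p) * \<mu> powr (- 1 / (p - 1))) * indicator (cball 0 R) x" if "x \<noteq> 0" for x :: "real^'n"
    proof (cases "norm x \<le> R")
      case True
      define X where "X = norm x powr (- t / p) * u x"
      have X0: "0 \<le> X" unfolding X_def using u by simp
      have Xp: "X powr p = norm x powr (- t) * u x powr p"
        unfolding X_def using u p by (simp add: powr_mult powr_powr)
      have "u x = norm x powr (t / p) * X"
        unfolding X_def using that by (simp add: powr_add[symmetric] mult.assoc[symmetric])
      also have "\<dots> \<le> R powr (t / p) * X" using True X0 t p by (intro mult_right_mono powr_mono2) auto
      also have "\<dots> \<le> R powr (t / p) * (\<mu> * X powr p + \<mu> powr (- 1 / (p - 1)))"
        by (intro mult_left_mono young X0) auto
      finally have "u x \<le> R powr (t / p) * \<mu> * (norm x powr (- t) * u x powr p) + R powr (t / p) * \<mu> powr (- 1 / (p - 1))"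
        by (simp add: Xp algebra_simps)
      then show ?thesis using True \<mu>
        by (simp add: ennreal_mult'[symmetric] ennreal_plus[symmetric] del: ennreal_plus)
    qed simp
    have "(\<integral>\<^sup>+x. ennreal (u x) * indicator (cball 0 R) x \<partial>lborel) \<le>
      (\<integral>\<^sup>+x. (ennreal (R powr (t / p) * \<mu>) * ennreal (norm x powr (- t) * u x powr p)
        + ennreal (R powr (t / p) * \<mu> powr (- 1 / (p - 1))) * indicator (cball 0 R) x) \<partial>lborel)"
      by (rule nn_integral_mono_AE, use AE_lborel_singleton[of 0] in eventually_elim) (rule pt)
    also have "\<dots> = ennreal (R powr (t / p) * \<mu>) * ennreal A
        + ennreal (R powr (t / p) * \<mu> powr (- 1 / (p - 1))) * ennreal (?V * R ^ CARD('n))"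
    proof -
      have m1: "(\<lambda>x. ennreal (norm x powr (- t) * u x powr p)) \<in> borel_measurable lborel" by measurable
      have m2: "(\<lambda>x. indicator (cball 0 R) x :: ennreal) \<in> borel_measurable (lborel :: (real ^ 'n) measure)"
        by (intro borel_measurable_indicator) simp
      have "(\<integral>\<^sup>+x. indicator (cball (0 :: real ^ 'n) R) x \<partial>lborel) = ennreal (?V * R ^ CARD('n))"
        using R by (subst nn_integral_indicator) (simp_all only: emeasure_cball_0, simp_all)
      then show ?thesis
        by (simp only: nn_integral_add[OF borel_measurable_times_ennreal[OF borel_measurable_const m1]
           borel_measurable_times_ennreal[OF borel_measurable_const m2]] nn_integral_cmult[OF m1] nn_integral_cmult[OF m2] A(2))
    qed
    also have "\<dots> = ennreal (R powr (t / p) * \<mu> * A + R powr (t / p) * \<mu> powr (- 1 / (p - 1)) * (?V * R ^ CARD('n)))"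
      using A R \<mu> by (simp add: ennreal_mult' ennreal_plus)
    also have "R powr (t / p) * \<mu> * A = A * R powr (?n - (?n - t) / p)"
      using R p unfolding \<mu>_def by (simp add: powr_add[symmetric] field_simps)
    also have "R powr (t / p) * \<mu> powr (- 1 / (p - 1)) * (?V * R ^ CARD('n)) = ?V * R powr (?n - (?n - t) / p)"
    proof -
      have "\<mu> powr (- 1 / (p - 1)) = R powr (- ?n / p)"
      proof -
        have "?n * (p - 1) / p * (- 1 / (p - 1)) = - ?n / p" using p by (simp add: divide_simps)
        then show ?thesis unfolding \<mu>_def powr_powr by (rule arg_cong)
      qed
      moreover have "R ^ CARD('n) = R powr ?n" using R by (simp add: powr_realpow)
      moreover have "R powr (t / p) * R powr (- ?n / p) * R powr ?n = R powr (?n - (?n - t) / p)"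
        using p by (simp add: powr_add[symmetric] field_simps)
      ultimately show ?thesis by (simp add: algebra_simps)
    qed
    finally show ?thesis by (simp add: algebra_simps)
  qed
  then show ?thesis using A(1) by (intro exI[of _ "A + ?V"]) auto
qed

text \<open>Both infinity and the origin are cut off, as solutions need not be smooth at zero. Each
  factor is a dilate of the one fixed profile \<open>chi m\<close>.\<close>

definition cutoff :: "nat \<Rightarrow> nat \<Rightarrow> real ^ 'n \<Rightarrow> real" where
  "cutoff m k x = chi m ((1 / real k) *\<^sub>R x) * (1 - chi m (real k *\<^sub>R x))"

text \<open>The margins \<open>3 / 4 * real k\<close> and \<open>3 / real k\<close> give open
  neighbourhoods of the outer and inner transition shells on which a single factor is active, so
  derivatives on a shell may be computed from that factor alone.\<close>

lemma cutoff_props: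
  fixes x :: "real ^ 'n"
  assumes m: "0 < m" and k: "2 \<le> k"
  shows "0 \<le> cutoff m k x" "cutoff m k x \<le> 1"
    and "norm x < 1 / real k \<or> norm x > 2 * real k \<Longrightarrow> cutoff m k x = 0"
    and "2 / real k \<le> norm x \<Longrightarrow> norm x \<le> real k \<Longrightarrow> cutoff m k x = 1"
    and "3 / 4 * real k < norm x \<Longrightarrow> cutoff m k x = chi m ((1 / real k) *\<^sub>R x)"
    and "norm x < 3 / real k \<Longrightarrow> cutoff m k x = 1 - chi m (real k *\<^sub>R x)"
    and "k \<le> j \<Longrightarrow> cutoff m k x \<le> cutoff m j x"
proof -
  show "0 \<le> cutoff m k x" "cutoff m k x \<le> 1"
    unfolding cutoff_def using chi_bounds[of m "real k *\<^sub>R x"] chi_bounds[of m "(1 / real k) *\<^sub>R x"]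
    by (auto intro: mult_le_one)
  have k4: "4 \<le> real k * real k" using k mult_mono[of 2 "real k" 2 "real k"] by simp
  show "cutoff m k x = 0" if "norm x < 1 / real k \<or> norm x > 2 * real k"
    using that
  proof
    assume "norm x < 1 / real k"
    then have "chi m (real k *\<^sub>R x) = 1" using k by (intro chi_eq_1 m) (auto simp: field_simps)
    then show ?thesis by (simp add: cutoff_def)
  next
    assume "norm x > 2 * real k"
    then have "chi m ((1 / real k) *\<^sub>R x) = 0" using k by (intro chi_eq_0 m) (auto simp: field_simps)
    then show ?thesis by (simp add: cutoff_def)
  qed
  show "cutoff m k x = 1" if "2 / real k \<le> norm x" "norm x \<le> real k"
  proof -
    have "chi m (real k *\<^sub>R x) = 0" using k that by (intro chi_eq_0 m) (auto simp: field_simps)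
    moreover have "chi m ((1 / real k) *\<^sub>R x) = 1" using k that by (intro chi_eq_1 m) (auto simp: field_simps)
    ultimately show ?thesis by (simp add: cutoff_def)
  qed
  show "cutoff m k x = chi m ((1 / real k) *\<^sub>R x)" if "3 / 4 * real k < norm x"
  proof -
    have "2 \<le> real k * (3 / 4 * real k)" using k4 by simp
    also have "\<dots> \<le> real k * norm x" using that k by (intro mult_left_mono) auto
    finally have "chi m (real k *\<^sub>R x) = 0" using k by (intro chi_eq_0 m) simp
    then show ?thesis by (simp add: cutoff_def)
  qed
  show "cutoff m k x = 1 - chi m (real k *\<^sub>R x)" if "norm x < 3 / real k"
  proof -
    have "norm x * real k < 3" using that k by (simp add: field_simps)
    then have "norm x * real k < real k * real k" using k4 by linarith
    then have "norm x \<le> real k" using k by simp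
    then have "chi m ((1 / real k) *\<^sub>R x) = 1" using k by (intro chi_eq_1 m) (auto simp: field_simps)
    then show ?thesis by (simp add: cutoff_def)
  qed
  show "cutoff m k x \<le> cutoff m j x" if "k \<le> j"
  proof -
    have "norm ((1 / real j) *\<^sub>R x) \<le> norm ((1 / real k) *\<^sub>R x)"
      using that k by (simp add: divide_left_mono)
    moreover have "norm (real k *\<^sub>R x) \<le> norm (real j *\<^sub>R x)" using that by (simp add: mult_right_mono)
    ultimately show ?thesis unfolding cutoff_def using chi_bounds
      by (intro mult_mono diff_mono chi_antimono) (auto simp: chi_bounds)
  qed
qed

lemma Ck_on_scale_UNIV: "Ck_on k f UNIV \<Longrightarrow> Ck_on k (\<lambda>x. f (c *\<^sub>R x)) UNIV"
  using Ck_on_scale[of UNIV k f c] by simp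

lemma Ck_on_cutoff: "j < m \<Longrightarrow> Ck_on j (cutoff m k) UNIV"
  unfolding cutoff_def[abs_def]
  by (intro Ck_on_mult Ck_on_diff Ck_on_const Ck_on_scale_UNIV Ck_on_chi open_UNIV)

lemma Eker_nonneg: "0 \<le> Eker s e d x" by (simp add: Eker_def)

text \<open>A pole of norm at most \<open>1 / 2\<close> keeps distance at least \<open>1 / 2\<close>
  from the shell, so nothing degenerates even for \<open>e = 0\<close>. The induction raises
  \<open>s\<close>, because a derivative of \<open>Eker s\<close> is a linear function times
  \<open>Eker (s + 1)\<close>.\<close>

lemma derivs_le_Eker_uniform:
  assumes "0 \<le> s"
  shows "\<exists>M\<ge>0. \<forall>e d :: real ^ 'n. \<bar>e\<bar> \<le> 1 \<longrightarrow> norm d \<le> 1 / 2 \<longrightarrow> derivs_le k M (Eker s e d) {x. 1 \<le> norm x \<and> norm x \<le> 2}"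
  using assms
proof (induction k arbitrary: s)
  case (0 s)
  have "\<bar>Eker s e d x\<bar> \<le> 4 powr s" if "norm d \<le> 1 / 2" "1 \<le> norm x" for e and d x :: "real^'n"
  proof -
    have "1 / 2 \<le> norm (x - d)" using that norm_triangle_ineq2[of x d] by linarith
    then have "(1 / 2)\<^sup>2 \<le> (norm (x - d))\<^sup>2" by (intro power_mono) auto
    then have "1 / 4 \<le> e\<^sup>2 + (norm (x - d))\<^sup>2" by (simp add: power2_eq_square add_increasing)
    then have "Eker s e d x \<le> (1 / 4) powr (- s)" unfolding Eker_def using 0 by (intro powr_mono2') auto
    also have "(1 / 4) powr (- s) = 4 powr s" by (simp add: powr_minus powr_divide)
    finally show ?thesis using Eker_nonneg[of s e d x] by simp
  qed
  then show ?case by (intro exI[of _ "4 powr s"]) auto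
next
  case (Suc k s)
  let ?K = "{x :: real ^ 'n. 1 \<le> norm x \<and> norm x \<le> 2}"
  let ?S = "{x :: real ^ 'n. 3 / 4 < norm x}"
  have oS: "open ?S" by (intro open_Collect_less continuous_intros)
  have KS: "?K \<subseteq> ?S" by auto
  from Suc.IH[of "s + 1"] Suc.prems obtain M where M: "0 \<le> M"
    "\<And>e d :: real ^ 'n. \<bar>e\<bar> \<le> 1 \<Longrightarrow> norm d \<le> 1 / 2 \<Longrightarrow> derivs_le k M (Eker (s + 1) e d) ?K" by auto
  from Suc.IH[of s] Suc.prems obtain N where N: "0 \<le> N"
    "\<And>e d :: real ^ 'n. \<bar>e\<bar> \<le> 1 \<Longrightarrow> norm d \<le> 1 / 2 \<Longrightarrow> derivs_le k N (Eker s e d) ?K" by auto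
  \<comment> \<open>\<open>2 ^ k\<close> is the product rule, \<open>2 * s\<close> the coefficient
    of the derivative, and \<open>3\<close> bounds the coordinates of \<open>x - d\<close> as well
    as the derivative of a coordinate.\<close>
  define L where "L = 2 ^ k * (2 * s * 3) * M"
  have L: "0 \<le> L" unfolding L_def using M Suc.prems by simp
  have "derivs_le (Suc k) (N + L) (Eker s e d) ?K" if e: "\<bar>e\<bar> \<le> 1" and d: "norm d \<le> 1 / 2" for e and d :: "real ^ 'n"
  proof -
    have pos: "e\<^sup>2 + (norm (x - d))\<^sup>2 > 0" if "x \<in> ?S" for x
    proof -
      have "3 / 4 < norm x" using that by simp
      then have "0 < norm (x - d)" using d norm_triangle_ineq2[of x d] by linarith
      then show ?thesis by (intro add_nonneg_pos) auto
    qed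
    have cE: "Ck_on k (Eker (s + 1) e d) ?S" by (intro Ck_on_Eker oS pos)
    have "derivs_le k L (partial i (Eker s e d)) ?K" for i
    proof (rule derivs_le_cong[OF oS KS])
      show "- 2 * s * (x $ i - d $ i) * Eker (s + 1) e d x = partial i (Eker s e d) x" if "x \<in> ?S" for x
        using partial_Eker[OF pos[OF that]] by simp
      have "derivs_le k 3 (\<lambda>x. x $ i - d $ i) ?K"
      proof (rule derivs_le_component)
        fix x assume "x \<in> ?K"
        then have "\<bar>x $ i\<bar> \<le> 2" "\<bar>d $ i\<bar> \<le> 1 / 2"
          using component_le_norm_cart[of x i] component_le_norm_cart[of d i] d by auto
        then show "\<bar>x $ i - d $ i\<bar> \<le> 3" by linarith
      qed simp
      then have "derivs_le k (\<bar>- 2 * s\<bar> * 3) (\<lambda>x. - 2 * s * (x $ i - d $ i)) ?K"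
        by (intro derivs_le_cmult[OF oS KS] Ck_on_component) auto
      then have "derivs_le k (2 * s * 3) (\<lambda>x. - 2 * s * (x $ i - d $ i)) ?K" using Suc.prems by (simp add: abs_mult)
      then show "derivs_le k L (\<lambda>x. - 2 * s * (x $ i - d $ i) * Eker (s + 1) e d x) ?K"
        unfolding L_def using Suc.prems M(2)[OF e d]
        by (intro derivs_le_mult[OF oS KS _ _ _ cE] Ck_on_cmult oS Ck_on_component M(1)) auto
    qed
    then have "derivs_le k (N + L) (partial i (Eker s e d)) ?K" for i by (rule derivs_le_mono) (use N in simp)
    moreover have "\<bar>Eker s e d x\<bar> \<le> N + L" if "x \<in> ?K" for x
      using derivs_le_bound[OF N(2)[OF e d] that] L by simp
    ultimately show ?thesis by simp
  qed
  then show ?case using N(1) L by (intro exI[of _ "N + L"]) auto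
qed

lemma Eker_scale:
  assumes "c \<noteq> 0"
  shows "Eker s e d (c *\<^sub>R z) = \<bar>c\<bar> powr (- 2 * s) * Eker s (e / c) ((1 / c) *\<^sub>R d) z"
proof -
  have "c *\<^sub>R z - d = c *\<^sub>R (z - (1 / c) *\<^sub>R d)" using assms by (simp add: scaleR_right_diff_distrib)
  then have "e\<^sup>2 + (norm (c *\<^sub>R z - d))\<^sup>2 = \<bar>c\<bar>\<^sup>2 * ((e / c)\<^sup>2 + (norm (z - (1 / c) *\<^sub>R d))\<^sup>2)"
    using assms by (simp add: power_mult_distrib distrib_left power_divide)
  then have "Eker s e d (c *\<^sub>R z) = (\<bar>c\<bar>\<^sup>2) powr (- s) * Eker s (e / c) ((1 / c) *\<^sub>R d) z"
    unfolding Eker_def by (simp add: powr_mult)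
  also have "(\<bar>c\<bar>\<^sup>2) powr (- s) = (\<bar>c\<bar> powr 2) powr (- s)" using assms by (simp add: powr_numeral)
  also have "\<dots> = \<bar>c\<bar> powr (- 2 * s)" by (simp only: powr_powr) simp
  finally show ?thesis .
qed

text \<open>Rescaling by \<open>k\<close>, respectively \<open>1 / k\<close>, maps the two transition regions of the cutoff to
  fixed bounded sets on which the rescaled cutoff no longer depends on \<open>k\<close>.\<close>

lemma test_function_bounds:
  fixes y :: "real ^ 'n" and l :: nat
  assumes e: "0 < e" and s: "0 \<le> s"
  defines "\<phi> \<equiv> \<lambda>k x. Eker s e y x * cutoff (2 * l + 1) k x"
  shows "\<exists>C\<ge>0. \<exists>k0\<ge>2. \<forall>k\<ge>k0. (\<forall>x. norm x \<le> 2 / real k \<longrightarrow> \<bar>neg_laplacian_power l (\<phi> k) x\<bar> \<le> C * real k ^ (2 * l))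
     \<and> (\<forall>x. real k \<le> norm x \<and> norm x \<le> 2 * real k \<longrightarrow>
          \<bar>neg_laplacian_power l (\<phi> k) x\<bar> \<le> C * real k powr (- 2 * s - 2 * real l))"
proof -
  define m where "m = 2 * l + 1"
  let ?n = "real CARD('n)"
  let ?K = "{x :: real ^ 'n. 1 \<le> norm x \<and> norm x \<le> 2}"
  let ?S = "{x :: real ^ 'n. 3 / 4 < norm x}"
  have oS: "open ?S" by (intro open_Collect_less continuous_intros)
  have KS: "?K \<subseteq> ?S" by auto
  have cK: "compact ?K"
  proof -
    have "?K = cball 0 2 - ball 0 1" by auto
    then show ?thesis by (metis compact_cball compact_diff open_ball)
  qed
  have chiC: "Ck_on (2 * l) (chi m) (UNIV :: (real ^ 'n) set)" by (rule Ck_on_chi) (simp add: m_def)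
  have \<phi>C: "Ck_on (2 * l) (\<phi> k) UNIV" for k
    unfolding \<phi>_def using e by (intro Ck_on_mult Ck_on_Eker_UNIV Ck_on_cutoff) auto
  obtain M where M: "0 \<le> M" "\<And>e d :: real ^ 'n. \<bar>e\<bar> \<le> 1 \<Longrightarrow> norm d \<le> 1 / 2 \<Longrightarrow> derivs_le (2 * l) M (Eker s e d) ?K"
    using derivs_le_Eker_uniform[OF s] by blast
  obtain N where N: "0 \<le> N" "derivs_le (2 * l) N (chi m) ?K"
    using derivs_le_compact_ex[OF open_UNIV cK subset_UNIV chiC] by blast
  have cE: "Ck_on (2 * l) (Eker s e y) UNIV" by (intro Ck_on_Eker_UNIV e)
  obtain M' where M': "0 \<le> M'" "derivs_le (2 * l) M' (Eker s e y) (cball 0 2)"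
    using derivs_le_compact_ex[OF open_UNIV compact_cball subset_UNIV cE] by blast
  have c1C: "Ck_on (2 * l) (\<lambda>x. 1 - chi m x) (UNIV :: (real ^ 'n) set)" by (intro Ck_on_diff Ck_on_const chiC open_UNIV)
  obtain N' where N': "0 \<le> N'" "derivs_le (2 * l) N' (\<lambda>x. 1 - chi m x) (cball (0::real^'n) 2)"
    using derivs_le_compact_ex[OF open_UNIV compact_cball subset_UNIV c1C] by blast
  \<comment> \<open>\<open>?n ^ l\<close> counts the summands of \<open>l\<close> Laplacians and
    \<open>2 ^ (2 * l)\<close> comes from the product rule.\<close>
  define C1 where "C1 = ?n ^ l * (2 ^ (2 * l) * M' * N')"
  define C2 where "C2 = ?n ^ l * (2 ^ (2 * l) * M * N)"
  \<comment> \<open>After rescaling by \<open>k \<ge> k0\<close> the regularization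
    \<open>e / k\<close> is at most 1 and the pole \<open>y / k\<close> has norm at most
    \<open>1 / 2\<close>, as \<open>derivs_le_Eker_uniform\<close> demands.\<close>
  obtain k0 :: nat where k0: "k0 \<ge> 2" "real k0 \<ge> e" "real k0 \<ge> 2 * norm y"
  proof -
    obtain j where "real j \<ge> e + 2 * norm y" using real_arch_simple by blast
    then show ?thesis using e norm_ge_zero[of y] by (intro that[of "j + 2"]) (simp, linarith+)
  qed
  have "\<bar>neg_laplacian_power l (\<phi> k) x\<bar> \<le> C1 * real k ^ (2 * l)"
    if k: "k \<ge> k0" and x: "norm x \<le> 2 / real k" for k x
  proof -
    have k2: "k \<ge> 2" using k k0 by simp
    let ?\<psi> = "\<lambda>z. \<phi> k ((1 / real k) *\<^sub>R z)"
    have \<psi>C: "Ck_on (2 * l) ?\<psi> UNIV" by (rule Ck_on_scale_UNIV[OF \<phi>C])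
    have eq: "Eker s e y ((1 / real k) *\<^sub>R z) * (1 - chi m z) = ?\<psi> z" if "z \<in> ball 0 3" for z
    proof -
      have "norm ((1 / real k) *\<^sub>R z) < 3 / real k" using that k2 by (simp add: divide_strict_right_mono)
      then show ?thesis using k2 unfolding \<phi>_def
        by (subst cutoff_props(6)) (auto simp: m_def)
    qed
    have "derivs_le (2 * l) M' (\<lambda>z. Eker s e y ((1 / real k) *\<^sub>R z)) (cball 0 2)"
    proof -
      have "derivs_le (2 * l) M' (\<lambda>z. Eker s e y ((1 / real k) *\<^sub>R z)) {z. (1 / real k) *\<^sub>R z \<in> cball 0 2}"
        using k2 by (intro derivs_le_scale[OF open_UNIV subset_UNIV _ cE M'(2)]) auto
      moreover have "cball 0 2 \<subseteq> {z. (1 / real k) *\<^sub>R z \<in> cball (0::real^'n) 2}"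
      proof
        fix z :: "real ^ 'n" assume "z \<in> cball 0 2"
        then have "norm z / real k \<le> 2 / 1" using k2 by (intro frac_le) auto
        then show "z \<in> {z. (1 / real k) *\<^sub>R z \<in> cball (0::real^'n) 2}" by simp
      qed
      ultimately show ?thesis by (rule derivs_le_subset)
    qed
    then have "derivs_le (2 * l) (2 ^ (2 * l) * M' * N') (\<lambda>z. Eker s e y ((1 / real k) *\<^sub>R z) * (1 - chi m z)) (cball 0 2)"
      by (intro derivs_le_mult[OF open_UNIV subset_UNIV M'(1) N'(1) _ c1C _ N'(2)] Ck_on_scale_UNIV cE)
    then have "derivs_le (2 * l) (2 ^ (2 * l) * M' * N') ?\<psi> (cball 0 2)"
      by (rule derivs_le_cong[OF open_ball[of 0 3], rotated 2]) (use eq in auto)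
    then have b: "\<bar>neg_laplacian_power l ?\<psi> z\<bar> \<le> C1" if "norm z \<le> 2" for z
      unfolding C1_def using that M' N'
      by (intro derivs_le_neg_laplacian_power[OF open_UNIV subset_UNIV _ \<psi>C]) auto
    have "\<phi> k x = ?\<psi> (real k *\<^sub>R x)" for x using k2 by simp
    then have "neg_laplacian_power l (\<phi> k) x = neg_laplacian_power l (\<lambda>x. ?\<psi> (real k *\<^sub>R x)) x" by simp
    also have "\<dots> = real k ^ (2 * l) * neg_laplacian_power l ?\<psi> (real k *\<^sub>R x)"
      by (intro neg_laplacian_power_scale[OF open_UNIV \<psi>C]) simp
    finally have "\<bar>neg_laplacian_power l (\<phi> k) x\<bar> = real k ^ (2 * l) * \<bar>neg_laplacian_power l ?\<psi> (real k *\<^sub>R x)\<bar>"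
      by (simp add: abs_mult)
    also have "\<dots> \<le> real k ^ (2 * l) * C1" using x k2 by (intro mult_left_mono b) (auto simp: field_simps)
    finally show ?thesis by (simp add: mult.commute)
  qed
  note b1 = this
  have b2: "\<bar>neg_laplacian_power l (\<phi> k) x\<bar> \<le> C2 * real k powr (- 2 * s - 2 * real l)"
    if k: "k \<ge> k0" and x: "real k \<le> norm x" "norm x \<le> 2 * real k" for k x
  proof -
    have k2: "k \<ge> 2" using k k0 by simp
    let ?A = "Eker s (e / real k) ((1 / real k) *\<^sub>R y)"
    let ?\<psi> = "\<lambda>z. \<phi> k (real k *\<^sub>R z)"
    let ?\<psi>1 = "\<lambda>z. ?A z * chi m z"
    have \<psi>C: "Ck_on (2 * l) ?\<psi> UNIV" by (rule Ck_on_scale_UNIV[OF \<phi>C])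
    have \<psi>1C: "Ck_on (2 * l) ?\<psi>1 UNIV"
      using e k2 by (intro Ck_on_mult chiC Ck_on_Eker_UNIV) auto
    have eq: "?\<psi> z = real k powr (- 2 * s) * ?\<psi>1 z" if "z \<in> ?S" for z
    proof -
      have "3 / 4 * real k < norm (real k *\<^sub>R z)" using that k2 by simp
      from cutoff_props(5)[OF _ k2 this, of m] show ?thesis
        using k2 unfolding \<phi>_def by (simp add: m_def Eker_scale)
    qed
    have nd: "norm ((1 / real k) *\<^sub>R y) \<le> 1 / 2"
      using k k0 k2 by (simp add: field_simps)
    have "derivs_le (2 * l) M ?A ?K" using k k0 k2 e nd by (intro M(2)) (auto simp: field_simps)
    then have "derivs_le (2 * l) (2 ^ (2 * l) * M * N) ?\<psi>1 ?K"
      using e k2 by (intro derivs_le_mult[OF open_UNIV subset_UNIV M(1) N(1) _ chiC _ N(2)] Ck_on_Eker_UNIV) auto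
    then have b: "\<bar>neg_laplacian_power l ?\<psi>1 z\<bar> \<le> C2" if "z \<in> ?K" for z
      unfolding C2_def using that M N
      by (intro derivs_le_neg_laplacian_power[OF open_UNIV subset_UNIV _ \<psi>1C]) auto
    have zK: "(1 / real k) *\<^sub>R x \<in> ?K" using x k2 by (auto simp: field_simps)
    have "\<phi> k x = ?\<psi> ((1 / real k) *\<^sub>R x)" for x using k2 by simp
    then have "neg_laplacian_power l (\<phi> k) x = neg_laplacian_power l (\<lambda>x. ?\<psi> ((1 / real k) *\<^sub>R x)) x" by simp
    also have "\<dots> = (1 / real k) ^ (2 * l) * neg_laplacian_power l ?\<psi> ((1 / real k) *\<^sub>R x)"
      by (intro neg_laplacian_power_scale[OF open_UNIV \<psi>C]) simp
    also have "neg_laplacian_power l ?\<psi> ((1 / real k) *\<^sub>R x)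
       = neg_laplacian_power l (\<lambda>z. real k powr (- 2 * s) * ?\<psi>1 z) ((1 / real k) *\<^sub>R x)"
      by (rule neg_laplacian_power_cong_open[OF oS]) (rule subsetD[OF KS zK], erule eq)
    also have "\<dots> = real k powr (- 2 * s) * neg_laplacian_power l ?\<psi>1 ((1 / real k) *\<^sub>R x)"
      by (rule neg_laplacian_power_cmult[OF open_UNIV \<psi>1C]) simp
    finally have "\<bar>neg_laplacian_power l (\<phi> k) x\<bar>
       = ((1 / real k) ^ (2 * l) * real k powr (- 2 * s)) * \<bar>neg_laplacian_power l ?\<psi>1 ((1 / real k) *\<^sub>R x)\<bar>"
      by (simp add: abs_mult)
    also have "\<dots> \<le> ((1 / real k) ^ (2 * l) * real k powr (- 2 * s)) * C2"
      using zK by (intro mult_left_mono b) auto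
    also have "(1 / real k) ^ (2 * l) * real k powr (- 2 * s) = real k powr (- 2 * s - 2 * real l)"
    proof -
      have "(1 / real k) ^ (2 * l) = real k powr (- (2 * real l))"
        using k2 powr_realpow[of "real k" "2 * l"] by (simp add: powr_minus power_divide inverse_eq_divide)
      then show ?thesis by (simp add: powr_add[symmetric] algebra_simps)
    qed
    finally show ?thesis by (simp add: mult.commute)
  qed
  have C: "0 \<le> C1" "0 \<le> C2" unfolding C1_def C2_def using M N M' N' by auto
  have le: "C1 * real k ^ (2 * l) \<le> (C1 + C2) * real k ^ (2 * l)"
    "C2 * real k powr (- 2 * s - 2 * real l) \<le> (C1 + C2) * real k powr (- 2 * s - 2 * real l)" for k
    using C by (auto intro!: mult_right_mono)
  show ?thesis
  proof (intro exI[of _ "C1 + C2"] conjI exI[of _ k0] allI impI)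
    fix k and x :: "real ^ 'n" assume k: "k0 \<le> k"
    show "\<bar>neg_laplacian_power l (\<phi> k) x\<bar> \<le> (C1 + C2) * real k ^ (2 * l)" if "norm x \<le> 2 / real k"
      using b1[OF k that] le(1)[of k] by (rule order_trans)
    show "\<bar>neg_laplacian_power l (\<phi> k) x\<bar> \<le> (C1 + C2) * real k powr (- 2 * s - 2 * real l)"
      if "real k \<le> norm x \<and> norm x \<le> 2 * real k"
      using b2[OF k] that le(2)[of k] by (meson order_trans)
  qed (use C k0(1) in auto)
qed

section \<open>The integral representation\<close>

text \<open>Monotone convergence with the limit prescribed only off one null point: the cutoffs
  never reach 1 at the origin, and regularized kernels blow up at their pole. At \<open>a\<close>
  the limit is replaced by the supremum.\<close>

lemma nn_integral_LIMSEQ_except: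
  fixes f :: "nat \<Rightarrow> real ^ 'n \<Rightarrow> ennreal"
  assumes f: "\<And>i j x. i \<le> j \<Longrightarrow> f i x \<le> f j x" "\<And>i. f i \<in> borel_measurable lborel"
    and u: "\<And>x. x \<noteq> a \<Longrightarrow> (\<lambda>i. f i x) \<longlonglongrightarrow> u x"
  shows "(\<lambda>n. integral\<^sup>N lborel (f n)) \<longlonglongrightarrow> integral\<^sup>N lborel u"
proof -
  define v where "v x = (if x = a then SUP i. f i a else u x)" for x
  have inc: "incseq f" using f(1) by (auto simp: incseq_def le_fun_def)
  have "(\<lambda>i. f i x) \<longlonglongrightarrow> v x" for x
    using u LIMSEQ_SUP[of "\<lambda>i. f i a"] f(1) by (auto simp: v_def incseq_def)
  then have "(\<lambda>n. integral\<^sup>N lborel (f n)) \<longlonglongrightarrow> integral\<^sup>N lborel v"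
    by (rule nn_integral_LIMSEQ[OF inc f(2)])
  also have "integral\<^sup>N lborel v = integral\<^sup>N lborel u"
    by (rule nn_integral_cong_AE, use AE_lborel_singleton[of a] in eventually_elim) (simp add: v_def)
  finally show ?thesis .
qed

lemma cutoff_eventually_1:
  fixes x :: "real ^ 'n"
  assumes "0 < m" "x \<noteq> 0"
  shows "eventually (\<lambda>k. cutoff m (k + 2) x = 1) sequentially"
proof -
  obtain k0 :: nat where k0: "real k0 \<ge> norm x + 2 / norm x" using real_arch_simple by blast
  have "cutoff m (k + 2) x = 1" if "k \<ge> k0" for k
  proof (rule cutoff_props(4)[OF assms(1)])
    have k: "real (k + 2) \<ge> norm x + 2 / norm x" using k0 that by simp
    have p: "0 < norm x" "0 \<le> 2 / norm x" using assms by auto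
    show "norm x \<le> real (k + 2)" using k p by linarith
    have "2 / norm x \<le> real (k + 2)" using k p by linarith
    then show "2 / real (k + 2) \<le> norm x" using p by (simp add: field_simps)
  qed simp
  then show ?thesis by (auto simp: eventually_sequentially)
qed

text \<open>The limits may a priori be infinite, so they cannot be subtracted; instead
  \<open>X \<le> Y + \<bar>X - Y\<bar>\<close> is used in both directions.\<close>

lemma ennreal_limits_eq:
  assumes "\<And>k. 0 \<le> X k" "\<And>k. 0 \<le> Y k" "(\<lambda>k. X k - Y k) \<longlonglongrightarrow> 0"
    "(\<lambda>k. ennreal (X k)) \<longlonglongrightarrow> A" "(\<lambda>k. ennreal (Y k)) \<longlonglongrightarrow> B"
  shows "A = B"
proof -
  have *: "A \<le> B" if "\<And>k. 0 \<le> X k" "\<And>k. 0 \<le> Y k" "(\<lambda>k. X k - Y k) \<longlonglongrightarrow> 0"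
    "(\<lambda>k. ennreal (X k)) \<longlonglongrightarrow> A" "(\<lambda>k. ennreal (Y k)) \<longlonglongrightarrow> B" for X Y :: "nat \<Rightarrow> real" and A B
  proof -
    have "(\<lambda>k. ennreal \<bar>X k - Y k\<bar>) \<longlonglongrightarrow> ennreal 0"
      using that(3) by (intro tendsto_ennrealI tendsto_rabs_zero)
    from tendsto_add[OF that(5) this] have "(\<lambda>k. ennreal (Y k) + ennreal \<bar>X k - Y k\<bar>) \<longlonglongrightarrow> B" by simp
    moreover have "ennreal (X k) \<le> ennreal (Y k) + ennreal \<bar>X k - Y k\<bar>" for k
      using that(2)[of k] by (simp add: ennreal_plus[symmetric] ennreal_leI del: ennreal_plus)
    ultimately show "A \<le> B" using that(4) by (intro LIMSEQ_le) auto
  qed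
  show ?thesis
    using *[OF assms] *[OF assms(2,1) _ assms(5,4)] tendsto_minus[OF assms(3)] by auto
qed

text \<open>What a single equation of the system supplies, with \<open>F\<close> standing for its
  right-hand side; the system gives two instances. The last assumption is the conclusion of
  \<open>growth_from_energy\<close>, and the gain \<open>a > 0\<close> over volume growth makes the
  cutoff error at infinity vanish.\<close>

locale polyharmonic_growth =
  fixes l :: nat and s a C :: real and u F :: "real ^ 'n \<Rightarrow> real"
  assumes l: "1 \<le> l" and n: "real CARD('n) = 2 * s + 2 * real l" and s: "0 < s" and a: "0 < a"
    and u: "continuous_on UNIV u" "\<And>x. 0 \<le> u x" "Ck_on (2 * l) u (- {0})"
    and F: "F \<in> borel_measurable borel" "\<And>x. 0 \<le> F x" "\<And>x. x \<noteq> 0 \<Longrightarrow> neg_laplacian_power l u x = F x"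
    and C: "0 \<le> C" "\<And>R. 1 \<le> R \<Longrightarrow> (\<integral>\<^sup>+x. ennreal (u x) * indicator (cball 0 R) x \<partial>lborel)
      \<le> ennreal (C * R powr (real CARD('n) - a))"
begin

lemma u_borel [measurable]: "u \<in> borel_measurable borel"
  using u(1) by (rule borel_measurable_continuous_onI)

lemma F_borel [measurable]: "F \<in> borel_measurable borel" by (rule F(1))

lemma Eker_borel [measurable]: "Eker r e y \<in> borel_measurable borel"
  unfolding Eker_def[abs_def] by measurable

lemma u_integrable_cball:
  "integrable lborel (\<lambda>x. u x * indicator (cball 0 R) x)"
  using borel_integrable_compact[OF compact_cball continuous_on_subset[OF u(1) subset_UNIV], of 0 R]
  by (simp add: mult.commute)

lemma u_integral_cball:
  assumes "1 \<le> R"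
  shows "(LINT x|lborel. u x * indicator (cball 0 R) x) \<le> C * R powr (real CARD('n) - a)"
proof -
  have "ennreal (LINT x|lborel. u x * indicator (cball 0 R) x)
      = (\<integral>\<^sup>+x. ennreal (u x * indicator (cball 0 R) x) \<partial>lborel)"
    using u(2) by (intro nn_integral_eq_integral[symmetric] u_integrable_cball) auto
  also have "\<dots> = (\<integral>\<^sup>+x. ennreal (u x) * indicator (cball 0 R) x \<partial>lborel)"
    by (intro nn_integral_cong) (auto simp: indicator_def)
  also have "\<dots> \<le> ennreal (C * R powr (real CARD('n) - a))" by (rule C(2)[OF assms])
  finally show ?thesis using C(1) by (simp add: ennreal_le_iff)
qed

text \<open>By \<open>neg_laplacian_power_Eker\<close> this is the \<open>l\<close>-th power of the
  negative Laplacian of \<open>Eker s e y\<close>.\<close>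

abbreviation (input) rho :: "real \<Rightarrow> real ^ 'n \<Rightarrow> real ^ 'n \<Rightarrow> real" where
  "rho e y x \<equiv> 4 ^ l * pochhammer s (2 * l) * e ^ (2 * l) * Eker (s + 2 * l) e y x"

lemma rho_nonneg: "0 < e \<Longrightarrow> 0 \<le> rho e y x"
  using s by (intro mult_nonneg_nonneg Eker_nonneg) (auto simp: pochhammer_pos less_imp_le)

text \<open>Green's formula with the cut-off kernel as test function leaves \<open>rho\<close> on
  the plateau of the cutoff and an error on the two transition shells, controlled by
  \<open>test_function_bounds\<close>; then both sides converge monotonically.\<close>

lemma smoothed_representation:
  assumes e: "0 < e"
  shows "(\<integral>\<^sup>+x. ennreal (F x * Eker s e y x) \<partial>lborel) = (\<integral>\<^sup>+x. ennreal (u x * rho e y x) \<partial>lborel)"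
proof -
  define m where "m = 2 * l + 1"
  let ?n = "real CARD('n)"
  define \<phi> where "\<phi> k x = Eker s e y x * cutoff m k x" for k x
  define A where "A k = {x :: real ^ 'n. 2 / real k < norm x \<and> norm x < real k}" for k :: nat
  have m0: "0 < m" by (simp add: m_def)
  have oA: "open (A k)" for k
    unfolding A_def by (intro open_Collect_conj open_Collect_less continuous_intros)
  have \<phi>C: "Ck_on (2 * l) (\<phi> k) UNIV" for k
    unfolding \<phi>_def using e by (intro Ck_on_mult Ck_on_Eker_UNIV Ck_on_cutoff) (auto simp: m_def)
  have \<phi>0: "\<phi> k x = 0" if "2 \<le> k" "norm x < 1 / real k \<or> norm x > 2 * real k" for k x
    unfolding \<phi>_def using cutoff_props(3)[OF m0 that] by simp
  define N where "N k = neg_laplacian_power l (\<phi> k)" for k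
  have N0: "N k x = 0" if "2 \<le> k" "norm x < 1 / real k \<or> norm x > 2 * real k" for k x
    unfolding N_def using that by (intro neg_laplacian_power_supp[of "1 / real k" "2 * real k"] \<phi>0) auto
  have NC: "continuous_on UNIV (N k)" for k
    unfolding N_def using Ck_on_neg_laplacian_power[of UNIV l 0 "\<phi> k"] \<phi>C by simp
  have rhoC: "continuous_on UNIV (rho e y)"
    using Ck_on_Eker_UNIV[OF e, of 0 "s + 2 * l" y] by (auto intro!: continuous_intros)
  have NA: "N k x = rho e y x" if "2 \<le> k" "x \<in> A k" for k x
  proof -
    have "N k x = neg_laplacian_power l (Eker s e y) x"
      unfolding N_def
    proof (rule neg_laplacian_power_cong_open[OF oA that(2)])
      fix z assume "z \<in> A k"
      then show "\<phi> k z = Eker s e y z"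
        unfolding \<phi>_def A_def using cutoff_props(4)[OF m0 that(1), of z] by simp
    qed
    then show ?thesis by (simp add: neg_laplacian_power_Eker[OF e n])
  qed
  define X where "X k = (LINT x|lborel. F x * \<phi> k x)" for k
  define Y where "Y k = (LINT x|lborel. u x * rho e y x * indicator (A k) x)" for k
  have FX: "F x * \<phi> k x = neg_laplacian_power l u x * \<phi> k x" if "2 \<le> k" for k x
    using F(3)[of x] \<phi>0[OF that, of 0] that by (cases "x = 0") auto
  have iF: "integrable lborel (\<lambda>x. F x * \<phi> k x)" if k: "2 \<le> k" for k
  proof -
    have "Ck_on 0 (neg_laplacian_power l u) (- {0})" using u(3) by (intro Ck_on_neg_laplacian_power) auto
    then have "Ck_on 0 (\<lambda>x. neg_laplacian_power l u x * \<phi> k x) UNIV"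
      using k Ck_on_mono[OF \<phi>C, of 0 k]
      by (intro Ck_on_mult_supp[where a = "1 / real k" and b = "2 * real k"] \<phi>0[OF k]) auto
    then have "integrable lborel (\<lambda>x. neg_laplacian_power l u x * \<phi> k x)"
      using \<phi>0[OF k] by (intro integrable_compact_supp[where b = "2 * real k"]) auto
    then show ?thesis by (simp add: FX[OF k])
  qed
  have XG: "X k = (LINT x|lborel. u x * N k x)" if k: "2 \<le> k" for k
    unfolding X_def N_def FX[OF k] using k
    by (intro green_neg_laplacian_power[where a = "1 / real k" and b = "2 * real k"] \<phi>C u(3) \<phi>0[OF k]) auto
  have iN: "integrable lborel (\<lambda>x. u x * N k x)" if k: "2 \<le> k" for k
    using N0[OF k] by (intro integrable_compact_supp[where b = "2 * real k"] continuous_intros u(1) NC) auto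
  have iY: "integrable lborel (\<lambda>x. u x * rho e y x * indicator (A k) x)" for k
  proof (rule Bochner_Integration.integrable_bound)
    show "integrable lborel (\<lambda>x. u x * rho e y x * indicator (cball 0 (real k)) x)"
    proof -
      have "integrable lborel (\<lambda>x. indicator (cball 0 (real k)) x *\<^sub>R (u x * rho e y x))"
        by (intro borel_integrable_compact compact_cball continuous_on_subset[OF continuous_on_mult[OF u(1) rhoC] subset_UNIV])
      then show ?thesis by (simp add: mult.commute)
    qed
    show "(\<lambda>x. u x * rho e y x * indicator (A k) x) \<in> borel_measurable lborel"
      using borel_open[OF oA] by measurable
    show "AE x in lborel. norm (u x * rho e y x * indicator (A k) x) \<le> norm (u x * rho e y x * indicator (cball 0 (real k)) x)"
      by (auto simp: A_def indicator_def)
  qed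
  obtain B k0 where B: "0 \<le> B" "2 \<le> k0"
    "\<And>k x. k0 \<le> k \<Longrightarrow> norm x \<le> 2 / real k \<Longrightarrow> \<bar>N k x\<bar> \<le> B * real k ^ (2 * l)"
    "\<And>k x. k0 \<le> k \<Longrightarrow> real k \<le> norm x \<Longrightarrow> norm x \<le> 2 * real k \<Longrightarrow> \<bar>N k x\<bar> \<le> B * real k powr (- 2 * s - 2 * real l)"
    using test_function_bounds[OF e less_imp_le[OF s], of l y] unfolding N_def \<phi>_def m_def by blast
  have "compact (u ` cball 0 1)"
    by (intro compact_continuous_image compact_cball continuous_on_subset[OF u(1)]) auto
  then obtain U0 where U0: "\<forall>y\<in>u ` cball 0 1. \<bar>y\<bar> \<le> U0" using compact_imp_bounded bounded_real by metis
  define U where "U = max U0 0"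
  have U: "0 \<le> U" "\<And>x. norm x \<le> 1 \<Longrightarrow> u x \<le> U" using U0 u(2) unfolding U_def by force+
  define V where "V = unit_ball_vol ?n"
  have V: "0 \<le> V" unfolding V_def by simp
  \<comment> \<open>First term: the inner shell, with derivatives of size \<open>k ^ (2 * l)\<close>
    on a volume of order \<open>k powr (- n)\<close>. Second term: the outer shell, with derivatives
    of order \<open>k powr (- n)\<close> against the mass of \<open>u\<close>, of order
    \<open>k powr (n - a)\<close>.\<close>
  define err where "err k = B * U * V * 2 ^ CARD('n) * real k powr (- 2 * s) + B * C * 2 powr (?n - a) * real k powr (- a)" for k :: nat
  have bnd: "\<bar>X k - Y k\<bar> \<le> err k" if k: "k0 \<le> k" for k
  proof -
    have k2: "2 \<le> k" using k B(2) by simp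
    have iD: "integrable lborel (\<lambda>x. u x * N k x - u x * rho e y x * indicator (A k) x)"
      using iN[OF k2] iY by (rule Bochner_Integration.integrable_diff)
    let ?b = "\<lambda>x. B * real k ^ (2 * l) * U * indicator (cball 0 (2 / real k)) x
        + B * real k powr (- 2 * s - 2 * real l) * (u x * indicator (cball 0 (2 * real k)) x)"
    have ib1: "integrable lborel (\<lambda>x. indicator (cball (0::real^'n) (2 / real k)) x :: real)"
      using emeasure_lborel_cball_finite[of "0::real^'n" "2 / real k"] by (intro integrable_real_indicator) auto
    have ib: "integrable lborel ?b"
      using ib1 u_integrable_cball by (intro Bochner_Integration.integrable_add integrable_mult_right) auto
    have pt: "\<bar>u x * N k x - u x * rho e y x * indicator (A k) x\<bar> \<le> ?b x" for x
    proof -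
      have nn: "0 \<le> B * real k ^ (2 * l) * U * indicator (cball 0 (2 / real k)) x"
        "0 \<le> B * real k powr (- 2 * s - 2 * real l) * (u x * indicator (cball 0 (2 * real k)) x)"
        using B(1) U(1) u(2) by auto
      consider "x \<in> A k" | "norm x \<le> 2 / real k" | "real k \<le> norm x" "norm x \<le> 2 * real k" | "norm x > 2 * real k"
        unfolding A_def by fastforce
      then show ?thesis
      proof cases
        case 1
        then show ?thesis using NA[OF k2 1] nn by simp
      next
        case 2
        have "2 / real k \<le> 1" using k2 by simp
        then have "norm x \<le> 1" using 2 by linarith
        then have "\<bar>u x * N k x\<bar> \<le> U * (B * real k ^ (2 * l))"
          unfolding abs_mult using U u(2)[of x] B(1) B(3)[OF k 2] by (intro mult_mono) auto
        moreover have "indicator (A k) x = (0::real)" using 2 by (simp add: A_def)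
        ultimately show ?thesis using 2 nn(2) by (simp add: mult_ac)
      next
        case 3
        have "\<bar>u x * N k x\<bar> \<le> u x * (B * real k powr (- 2 * s - 2 * real l))"
          unfolding abs_mult using u(2)[of x] B(4)[OF k 3] by (intro mult_mono) auto
        moreover have "indicator (A k) x = (0::real)" using 3 by (simp add: A_def)
        ultimately show ?thesis using 3 nn(1) by (simp add: mult_ac)
      next
        case 4
        have "N k x = 0" using N0[OF k2] 4 by blast
        moreover have "indicator (A k) x = (0::real)" using 4 k2 by (simp add: A_def)
        ultimately show ?thesis using nn by simp
      qed
    qed
    have "X k - Y k = (LINT x|lborel. u x * N k x - u x * rho e y x * indicator (A k) x)"
      unfolding XG[OF k2] Y_def using iN[OF k2] iY by simp
    then have "\<bar>X k - Y k\<bar> \<le> (LINT x|lborel. ?b x)"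
      using Bochner_Integration.integral_norm_bound_integral[OF iD ib] pt by simp
    also have "\<dots> = B * real k ^ (2 * l) * U * (LINT x|lborel. indicator (cball (0::real^'n) (2 / real k)) x)
        + B * real k powr (- 2 * s - 2 * real l) * (LINT x|lborel. u x * indicator (cball 0 (2 * real k)) x)"
      using ib1 u_integrable_cball[of "2 * real k"] by (subst Bochner_Integration.integral_add) auto
    also have "(LINT x|lborel. indicator (cball (0::real^'n) (2 / real k)) x) = V * (2 / real k) ^ CARD('n)"
      using emeasure_cball_0[of "2 / real k", where 'n = 'n] k2
      by (simp add: measure_def V_def)
    also have "B * real k ^ (2 * l) * U * (V * (2 / real k) ^ CARD('n))
      + B * real k powr (- 2 * s - 2 * real l) * (LINT x|lborel. u x * indicator (cball 0 (2 * real k)) x)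
      \<le> B * real k ^ (2 * l) * U * (V * (2 / real k) ^ CARD('n))
      + B * real k powr (- 2 * s - 2 * real l) * (C * (2 * real k) powr (?n - a))"
      using u_integral_cball[of "2 * real k"] k2 B(1) by (intro add_left_mono mult_left_mono) auto
    also have "\<dots> = err k"
    proof -
      have kp: "real k > 0" using k2 by simp
      have "real k ^ (2 * l) * (2 / real k) ^ CARD('n) = 2 ^ CARD('n) * real k powr (- 2 * s)"
      proof -
        have "real k ^ (2 * l) = real k powr (2 * real l)" "real k ^ CARD('n) = real k powr ?n"
          using kp by (simp_all add: powr_realpow[symmetric])
        moreover have "real k powr (2 * real l) / real k powr ?n = real k powr (- 2 * s)"
          using kp by (simp add: powr_diff[symmetric] n)
        ultimately have "real k ^ (2 * l) / real k ^ CARD('n) = real k powr (- 2 * s)" by simp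
        moreover have "real k ^ (2 * l) * (2 / real k) ^ CARD('n) = 2 ^ CARD('n) * (real k ^ (2 * l) / real k ^ CARD('n))"
          by (simp add: power_divide)
        ultimately show ?thesis by metis
      qed
      moreover have "real k powr (- 2 * s - 2 * real l) * (2 * real k) powr (?n - a) = 2 powr (?n - a) * real k powr (- a)"
      proof -
        have "real k powr (- 2 * s - 2 * real l) * real k powr (?n - a) = real k powr (- a)"
          using kp by (simp add: powr_add[symmetric] n)
        then show ?thesis using kp by (simp add: powr_mult)
      qed
      ultimately show ?thesis unfolding err_def
        by (metis (no_types, opaque_lifting) mult.assoc mult.left_commute)
    qed
    finally show ?thesis .
  qed
  have lim0: "(\<lambda>k. real k powr (- r)) \<longlonglongrightarrow> 0" if "0 < r" for r
    using that by (intro tendsto_neg_powr filterlim_real_sequentially) auto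
  have "err \<longlonglongrightarrow> B * U * V * 2 ^ CARD('n) * 0 + B * C * 2 powr (?n - a) * 0"
    unfolding err_def using lim0[of "2 * s"] lim0[of a] s a by (intro tendsto_intros) auto
  then have err0: "err \<longlonglongrightarrow> 0" by simp
  have "(\<lambda>k. X k - Y k) \<longlonglongrightarrow> 0"
    by (rule Lim_null_comparison[OF _ err0]) (use bnd in \<open>auto simp: eventually_sequentially intro!: exI[of _ k0]\<close>)
  then have L1: "(\<lambda>k. X (k + 2) - Y (k + 2)) \<longlonglongrightarrow> 0" by (rule LIMSEQ_ignore_initial_segment)
  have X0: "0 \<le> F x * \<phi> (k + 2) x" for k x
    unfolding \<phi>_def by (intro mult_nonneg_nonneg F(2) Eker_nonneg cutoff_props(1)[OF m0]) simp
  have Y0: "0 \<le> u x * rho e y x * indicator (A (k + 2)) x" for k x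
    using u(2)[of x] rho_nonneg[OF e, of y x] by simp
  have LX: "(\<lambda>k. ennreal (X (k + 2))) \<longlonglongrightarrow> (\<integral>\<^sup>+x. ennreal (F x * Eker s e y x) \<partial>lborel)"
  proof -
    have "ennreal (X (k + 2)) = (\<integral>\<^sup>+x. ennreal (F x * \<phi> (k + 2) x) \<partial>lborel)" for k
      unfolding X_def using X0 by (intro nn_integral_eq_integral[symmetric] iF) auto
    moreover have "(\<lambda>k. \<integral>\<^sup>+x. ennreal (F x * \<phi> (k + 2) x) \<partial>lborel) \<longlonglongrightarrow> (\<integral>\<^sup>+x. ennreal (F x * Eker s e y x) \<partial>lborel)"
    proof (rule nn_integral_LIMSEQ_except[where a = 0])
      fix i j :: nat and x :: "real ^ 'n" assume "i \<le> j"
      then show "ennreal (F x * \<phi> (i + 2) x) \<le> ennreal (F x * \<phi> (j + 2) x)"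
        unfolding \<phi>_def using F(2) Eker_nonneg
        by (intro ennreal_leI mult_left_mono cutoff_props(7) m0) auto
    next
      fix i :: nat
      have "continuous_on UNIV (\<phi> (i + 2))" using Ck_on_mono[OF \<phi>C, of 0] by simp
      then have [measurable]: "\<phi> (i + 2) \<in> borel_measurable borel" by (rule borel_measurable_continuous_onI)
      show "(\<lambda>x. ennreal (F x * \<phi> (i + 2) x)) \<in> borel_measurable lborel" by measurable
    next
      fix x :: "real ^ 'n" assume "x \<noteq> 0"
      show "(\<lambda>i. ennreal (F x * \<phi> (i + 2) x)) \<longlonglongrightarrow> ennreal (F x * Eker s e y x)"
        by (rule tendsto_eventually, use cutoff_eventually_1[OF m0 \<open>x \<noteq> 0\<close>] in eventually_elim) (simp add: \<phi>_def)
    qed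
    ultimately show ?thesis by simp
  qed
  have LY: "(\<lambda>k. ennreal (Y (k + 2))) \<longlonglongrightarrow> (\<integral>\<^sup>+x. ennreal (u x * rho e y x) \<partial>lborel)"
  proof -
    have "ennreal (Y (k + 2)) = (\<integral>\<^sup>+x. ennreal (u x * rho e y x * indicator (A (k + 2)) x) \<partial>lborel)" for k
      unfolding Y_def using Y0 by (intro nn_integral_eq_integral[symmetric] iY) auto
    moreover have "(\<lambda>k. \<integral>\<^sup>+x. ennreal (u x * rho e y x * indicator (A (k + 2)) x) \<partial>lborel) \<longlonglongrightarrow> (\<integral>\<^sup>+x. ennreal (u x * rho e y x) \<partial>lborel)"
    proof (rule nn_integral_LIMSEQ_except[where a = 0])
      fix i j :: nat and x :: "real ^ 'n" assume ij: "i \<le> j"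
      have "A (i + 2) \<subseteq> A (j + 2)"
      proof
        fix x assume x: "x \<in> A (i + 2)"
        have "2 / real (j + 2) \<le> 2 / real (i + 2)" using ij by (intro divide_left_mono) auto
        then show "x \<in> A (j + 2)" using x ij unfolding A_def by auto
      qed
      then have "indicator (A (i + 2)) x \<le> (indicator (A (j + 2)) x :: real)" by (auto simp: indicator_def)
      then show "ennreal (u x * rho e y x * indicator (A (i + 2)) x) \<le> ennreal (u x * rho e y x * indicator (A (j + 2)) x)"
        using u(2)[of x] rho_nonneg[OF e, of y x] by (intro ennreal_leI mult_left_mono) auto
    next
      fix i :: nat
      show "(\<lambda>x. ennreal (u x * rho e y x * indicator (A (i + 2)) x)) \<in> borel_measurable lborel"
        using borel_open[OF oA] by measurable
    next
      fix x :: "real ^ 'n" assume x: "x \<noteq> 0"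
      obtain k1 :: nat where k1: "real k1 \<ge> norm x + 2 / norm x" using real_arch_simple by blast
      have "x \<in> A (k + 2)" if "k1 \<le> k" for k
      proof -
        have p: "0 < norm x" "0 \<le> 2 / norm x" using x by auto
        have k: "real (k + 2) > norm x + 2 / norm x" using k1 that by simp
        have "norm x < real (k + 2)" using k p by linarith
        moreover have "2 / norm x < real (k + 2)" using k p by linarith
        then have "2 / real (k + 2) < norm x" using p by (simp add: field_simps)
        ultimately show ?thesis by (simp add: A_def)
      qed
      then have "eventually (\<lambda>k. x \<in> A (k + 2)) sequentially" by (auto simp: eventually_sequentially)
      then show "(\<lambda>i. ennreal (u x * rho e y x * indicator (A (i + 2)) x)) \<longlonglongrightarrow> ennreal (u x * rho e y x)"
        by (intro tendsto_eventually) (auto elim: eventually_mono)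
    qed
    ultimately show ?thesis by simp
  qed
  show ?thesis
    by (rule ennreal_limits_eq[OF _ _ L1 LX LY])
      (unfold X_def Y_def, rule Bochner_Integration.integral_nonneg, rule X0,
        rule Bochner_Integration.integral_nonneg, rule Y0)
qed

lemma Eker_le: "x \<noteq> y \<Longrightarrow> 0 \<le> r \<Longrightarrow> Eker r e y x \<le> norm (x - y) powr (- 2 * r)"
proof -
  assume x: "x \<noteq> y" and r: "0 \<le> r"
  have "Eker r e y x \<le> ((norm (x - y))\<^sup>2) powr (- r)" unfolding Eker_def using x r by (intro powr_mono2') auto
  also have "(norm (x - y))\<^sup>2 = norm (x - y) powr 2" using x by (simp add: powr_numeral)
  also have "(norm (x - y) powr 2) powr (- r) = norm (x - y) powr (- 2 * r)" by (simp only: powr_powr) simp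
  finally show ?thesis .
qed

text \<open>The mass of the approximate identity, that is, the constant in front of the delta
  distribution when \<open>(-\<Delta>)\<close> to the power \<open>l\<close> hits
  \<open>norm x powr (- 2 * s)\<close>. It depends on \<open>l\<close>, \<open>s\<close> and the
  dimension only, so both equations share it.\<close>

definition rconst :: real where
  "rconst = (LINT z|lborel. rho 1 (0 :: real ^ 'n) z)"

text \<open>The kernel decays like the power \<open>- n - 2 * l\<close>, which beats volume growth.
  Moving the centre from 0 to \<open>y\<close> enlarges balls of radius \<open>R \<ge> 1\<close> by
  a factor of at most \<open>1 + norm y\<close>.\<close>

lemma tail: "(\<integral>\<^sup>+x. ennreal (u x) * ennreal (norm (x - y) powr (- 2 * (s + 2 * l))) * indicator {x. 1 < norm (x - y)} x \<partial>lborel) < \<infinity>"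
proof -
  define D where "D = C * (1 + norm y) powr (real CARD('n) - a)"
  have na: "real CARD('n) - a \<le> real CARD('n)" using a by simp
  have e: "- 2 * (s + real (2 * l)) = - real CARD('n) - 2 * real l" using n by simp
  define h where "h x = ennreal (u (y + x))" for x
  have hm [measurable]: "h \<in> borel_measurable borel" unfolding h_def by measurable
  have "(\<integral>\<^sup>+x. h x * ennreal (norm x powr (- real CARD('n) - 2 * real l)) * indicator {x. 1 < norm x} x \<partial>lborel) < \<infinity>"
  proof (rule nn_integral_tail_finite[OF hm])
    show "0 < 2 * real l" using l by simp
    show "0 \<le> C * (1 + norm y) ^ CARD('n)" using C(1) by simp
    fix R :: real assume R: "1 \<le> R"
    have i: "indicator (cball 0 R) x \<le> (indicator (cball 0 (R + norm y)) (y + x) :: ennreal)" for x :: "real^'n"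
      using norm_triangle_ineq[of y x] by (auto simp: indicator_def)
    have "(\<integral>\<^sup>+x. h x * indicator (cball 0 R) x \<partial>lborel) \<le> (\<integral>\<^sup>+x. ennreal (u (y + 1 *\<^sub>R x)) * indicator (cball 0 (R + norm y)) (y + 1 *\<^sub>R x) \<partial>lborel)"
      unfolding h_def scaleR_one using i by (intro nn_integral_mono mult_left_mono) (simp_all del: mem_cball)
    also have "\<dots> = (\<integral>\<^sup>+x. ennreal (u x) * indicator (cball 0 (R + norm y)) x \<partial>lborel)"
    proof -
      have "(\<lambda>x. ennreal (u x) * indicator (cball 0 (R + norm y)) x) \<in> borel_measurable borel"
        by (intro borel_measurable_times_ennreal borel_measurable_indicator) auto
      from nn_integral_lborel_affine[OF this, of 1 y] show ?thesis by simp
    qed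
    also have "\<dots> \<le> ennreal (C * (R + norm y) powr (real CARD('n) - a))" using R by (intro C(2)) (simp add: add_increasing2)
    also have "\<dots> \<le> ennreal (C * (1 + norm y) ^ CARD('n) * R ^ CARD('n))"
    proof (rule ennreal_leI)
      have "(R + norm y) powr (real CARD('n) - a) \<le> (R + norm y) powr (real CARD('n))"
        using R a by (intro powr_mono) (auto simp: add_increasing2)
      also have "\<dots> = (R + norm y) ^ CARD('n)" using R by (simp add: powr_realpow add_pos_nonneg)
      also have "\<dots> \<le> ((1 + norm y) * R) ^ CARD('n)"
        using R mult_right_mono[OF R, of "norm y"] by (intro power_mono) (auto simp: algebra_simps)
      finally show "C * (R + norm y) powr (real CARD('n) - a) \<le> C * (1 + norm y) ^ CARD('n) * R ^ CARD('n)"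
        using C(1) by (simp add: power_mult_distrib mult_left_mono mult.assoc)
    qed
    finally show "(\<integral>\<^sup>+x. h x * indicator (cball 0 R) x \<partial>lborel) \<le> ennreal (C * (1 + norm y) ^ CARD('n) * R ^ CARD('n))" .
  qed
  moreover have "(\<integral>\<^sup>+x. ennreal (u x) * ennreal (norm (x - y) powr (- 2 * (s + 2 * l))) * indicator {x. 1 < norm (x - y)} x \<partial>lborel)
     = (\<integral>\<^sup>+x. h x * ennreal (norm x powr (- real CARD('n) - 2 * real l)) * indicator {x. 1 < norm x} x \<partial>lborel)"
  proof -
    have "(\<lambda>x. ennreal (u x) * ennreal (norm (x - y) powr (- 2 * (s + 2 * l))) * indicator {x. 1 < norm (x - y)} x) \<in> borel_measurable borel"
      by measurable
    from nn_integral_lborel_affine[OF this, of 1 y]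
    have "(\<integral>\<^sup>+x. ennreal (u x) * ennreal (norm (x - y) powr (- 2 * (s + 2 * l))) * indicator {x. 1 < norm (x - y)} x \<partial>lborel)
      = (\<integral>\<^sup>+x. ennreal (u (y + x)) * ennreal (norm x powr (- 2 * (s + 2 * l))) * indicator {x. 1 < norm x} x \<partial>lborel)"
      by (simp add: indicator_def)
    then show ?thesis by (simp only: h_def e)
  qed
  ultimately show ?thesis by simp
qed

lemma rho1_integrable: "integrable lborel (rho 1 (0 :: real ^ 'n))"
proof (rule integrableI_nonneg)
  show "rho 1 (0 :: real ^ 'n) \<in> borel_measurable lborel" by measurable
  show "AE x in lborel. 0 \<le> rho 1 (0 :: real ^ 'n) x" using rho_nonneg[of 1 0] by simp
  let ?\<kappa> = "4 ^ l * pochhammer s (2 * l)"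
  have \<kappa>: "0 \<le> ?\<kappa>" using s by (simp add: pochhammer_pos less_imp_le)
  have t: "(\<integral>\<^sup>+x. 1 * ennreal (norm x powr (- real CARD('n) - 2 * real l)) * indicator {x. 1 < norm x} x \<partial>(lborel :: (real ^ 'n) measure)) < \<infinity>"
    by (rule nn_integral_tail_finite[where C = "unit_ball_vol (real CARD('n))"])
      (use l in \<open>auto simp: emeasure_cball_0\<close>)
  have m1: "(\<lambda>x::real^'n. ennreal (norm x powr (- real CARD('n) - 2 * real l)) * indicator {x. 1 < norm x} x) \<in> borel_measurable lborel"
    by measurable
  have m2: "(\<lambda>x::real^'n. indicator (cball 0 1) x :: ennreal) \<in> borel_measurable lborel"
    by (intro borel_measurable_indicator) simp
  have "(\<integral>\<^sup>+x. ennreal (rho 1 (0 :: real ^ 'n) x) \<partial>lborel) \<le> (\<integral>\<^sup>+x. ennreal ?\<kappa> * (indicator (cball 0 1) x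
     + ennreal (norm x powr (- real CARD('n) - 2 * real l)) * indicator {x. 1 < norm x} x) \<partial>(lborel :: (real^'n) measure))"
  proof (rule nn_integral_mono)
    fix x :: "real ^ 'n"
    have E1: "Eker (s + 2 * l) 1 0 x \<le> 1" unfolding Eker_def using s
      powr_mono2'[of "- (s + 2 * l)" 1 "1\<^sup>2 + (norm (x - 0))\<^sup>2"] by simp
    have e: "- 2 * (s + real (2 * l)) = - real CARD('n) - 2 * real l" using n by simp
    have E2: "Eker (s + 2 * l) 1 0 x \<le> norm x powr (- real CARD('n) - 2 * real l)" if "1 < norm x"
    proof -
      have "x \<noteq> 0" using that by auto
      then show ?thesis using Eker_le[of x 0 "s + real (2 * l)" 1] s unfolding e by simp
    qed
    have "ennreal (Eker (s + 2 * l) 1 0 x) \<le> indicator (cball 0 1) x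
       + ennreal (norm x powr (- real CARD('n) - 2 * real l)) * indicator {x. 1 < norm x} x"
      using E1 E2 by (cases "1 < norm x") (auto intro: ennreal_leI simp: ennreal_le_1)
    then have "ennreal ?\<kappa> * ennreal (Eker (s + 2 * l) 1 0 x) \<le> ennreal ?\<kappa> * (indicator (cball 0 1) x
       + ennreal (norm x powr (- real CARD('n) - 2 * real l)) * indicator {x. 1 < norm x} x)"
      by (intro mult_left_mono) auto
    then show "ennreal (rho 1 0 x) \<le> ennreal ?\<kappa> * (indicator (cball 0 1) x
       + ennreal (norm x powr (- real CARD('n) - 2 * real l)) * indicator {x. 1 < norm x} x)"
      using \<kappa> by (simp add: ennreal_mult' Eker_nonneg)
  qed
  also have "\<dots> < \<infinity>"
    using t emeasure_lborel_cball_finite[of "0::real^'n" 1]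
    by (simp only: nn_integral_cmult[OF borel_measurable_add[OF m2 m1]] nn_integral_add[OF m2 m1])
      (simp add: ennreal_mult_less_top)
  finally show "(\<integral>\<^sup>+x. ennreal (rho 1 (0 :: real ^ 'n) x) \<partial>lborel) < \<infinity>" .
qed

lemma rconst_pos: "0 < rconst"
proof -
  have pos: "0 < rho 1 (0 :: real ^ 'n) z" for z
  proof -
    have "0 < 1\<^sup>2 + (norm (z - 0))\<^sup>2" by (intro add_pos_nonneg) auto
    then have "0 < Eker (s + 2 * l) 1 0 z" unfolding Eker_def by simp
    then show ?thesis using s by (simp add: pochhammer_pos)
  qed
  have "0 \<le> rconst" unfolding rconst_def by (intro Bochner_Integration.integral_nonneg less_imp_le pos)
  moreover have "rconst \<noteq> 0"
  proof
    assume "rconst = 0"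
    then have "AE z in lborel. rho 1 (0 :: real ^ 'n) z = 0"
      unfolding rconst_def using integral_nonneg_eq_0_iff_AE[OF rho1_integrable AE_I2[OF less_imp_le[OF pos]]] by simp
    then have "AE z in (lborel :: (real ^ 'n) measure). False"
      by eventually_elim (use pos less_irrefl in metis)
    then have "emeasure lborel (UNIV :: (real ^ 'n) set) = 0" by (simp add: AE_iff_measurable[of UNIV])
    then show False using emeasure_lborel_UNIV[where 'a = "real ^ 'n"] by simp
  qed
  ultimately show ?thesis by simp
qed

text \<open>The powers of \<open>e\<close> cancel because
  \<open>n + 2 * l = 2 * (s + 2 * l)\<close>, so \<open>rho e y\<close> is a mass-preserving
  rescaling of \<open>rho 1 0\<close> and concentrates at \<open>y\<close> for small
  \<open>e\<close>.\<close>

lemma rho_affine: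
  assumes "0 < e"
  shows "\<bar>e\<bar> ^ CARD('n) * rho e y (y + e *\<^sub>R z) = rho 1 0 z"
proof -
  have "Eker (s + 2 * l) e y (y + e *\<^sub>R z) = Eker (s + 2 * l) e 0 (e *\<^sub>R z)" by (simp add: Eker_def)
  also have "\<dots> = e powr (- 2 * (s + 2 * l)) * Eker (s + 2 * l) 1 0 z"
    using Eker_scale[of e "s + 2 * l" e 0 z] assms by simp
  finally have "\<bar>e\<bar> ^ CARD('n) * rho e y (y + e *\<^sub>R z)
     = (e ^ CARD('n) * e ^ (2 * l) * e powr (- 2 * (s + 2 * l))) * rho 1 0 z"
    using assms by simp
  also have "e ^ CARD('n) * e ^ (2 * l) * e powr (- 2 * (s + 2 * l)) = 1"
  proof -
    have "e ^ CARD('n) = e powr (real CARD('n))" "e ^ (2 * l) = e powr (2 * real l)"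
      using assms by (simp_all add: powr_realpow[symmetric])
    then show ?thesis using assms n by (simp add: powr_add[symmetric])
  qed
  finally show ?thesis by simp
qed

text \<open>Let \<open>e\<close> tend to 0 in \<open>smoothed_representation\<close>. The left side
  increases to the singular kernel. The right side is split at distance 1 from \<open>y\<close>: the
  near part is an approximate identity acting on a locally bounded continuous function, the far part
  is \<open>e ^ (2 * l)\<close> times the finite integral from \<open>tail\<close>.\<close>

lemma representation:
  "(\<integral>\<^sup>+x. ennreal (F x * norm (x - y) powr (- 2 * s)) \<partial>lborel) = ennreal (rconst * u y)"
proof -
  define e where "e j = inverse (real (Suc j))" for j
  have e: "0 < e j" "e j \<le> 1" for j unfolding e_def by (auto simp: field_simps)
  have e0: "e \<longlonglongrightarrow> 0" unfolding e_def by (rule LIMSEQ_inverse_real_of_nat)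
  have L1: "(\<lambda>j. \<integral>\<^sup>+x. ennreal (F x * Eker s (e j) y x) \<partial>lborel)
     \<longlonglongrightarrow> (\<integral>\<^sup>+x. ennreal (F x * norm (x - y) powr (- 2 * s)) \<partial>lborel)"
  proof (rule nn_integral_LIMSEQ_except[where a = y])
    fix i j :: nat and x :: "real ^ 'n" assume "i \<le> j"
    then have "e j \<le> e i" unfolding e_def by (intro le_imp_inverse_le) auto
    then have "(e j)\<^sup>2 \<le> (e i)\<^sup>2" using e(1)[of j] by (intro power_mono) auto
    then have "Eker s (e i) y x \<le> Eker s (e j) y x"
      unfolding Eker_def using s e(1)[of j] by (intro powr_mono2') (auto intro: add_pos_nonneg)
    then show "ennreal (F x * Eker s (e i) y x) \<le> ennreal (F x * Eker s (e j) y x)"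
      using F(2) by (intro ennreal_leI mult_left_mono)
  next
    fix x assume x: "x \<noteq> y"
    have "(\<lambda>j. Eker s (e j) y x) \<longlonglongrightarrow> (0\<^sup>2 + (norm (x - y))\<^sup>2) powr (- s)"
      unfolding Eker_def using x by (intro tendsto_intros e0) auto
    also have "(0\<^sup>2 + (norm (x - y))\<^sup>2) powr (- s) = (norm (x - y) powr 2) powr (- s)"
      using x by (simp add: powr_numeral)
    also have "\<dots> = norm (x - y) powr (- 2 * s)" by (simp only: powr_powr) simp
    finally show "(\<lambda>j. ennreal (F x * Eker s (e j) y x)) \<longlonglongrightarrow> ennreal (F x * norm (x - y) powr (- 2 * s))"
      by (intro tendsto_ennrealI tendsto_mult tendsto_const)
  qed measurable
  have "compact (u ` cball y 1)"
    by (intro compact_continuous_image compact_cball continuous_on_subset[OF u(1)]) auto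
  then obtain U0 where U0: "\<forall>y\<in>u ` cball y 1. \<bar>y\<bar> \<le> U0" using compact_imp_bounded bounded_real by metis
  define M where "M = max U0 0"
  have M: "0 \<le> M" unfolding M_def by simp
  have M2: "u x \<le> M" if "norm (x - y) \<le> 1" for x
  proof -
    have "x \<in> cball y 1" using that by (simp add: dist_norm norm_minus_commute)
    then have "\<bar>u x\<bar> \<le> U0" using U0 by blast
    then show ?thesis unfolding M_def by simp
  qed
  define P1 where "P1 j = (\<integral>\<^sup>+x. ennreal (u x * rho (e j) y x) * indicator {x. norm (x - y) \<le> 1} x \<partial>lborel)" for j
  define P2 where "P2 j = (\<integral>\<^sup>+x. ennreal (u x * rho (e j) y x) * indicator {x. 1 < norm (x - y)} x \<partial>lborel)" for j
  have P: "(\<integral>\<^sup>+x. ennreal (u x * rho (e j) y x) \<partial>lborel) = P1 j + P2 j" for j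
    unfolding P1_def P2_def
    by (subst nn_integral_add[symmetric]) (measurable, auto intro!: nn_integral_cong simp: indicator_def)
  let ?\<kappa> = "4 ^ l * pochhammer s (2 * l)"
  have \<kappa>: "0 \<le> ?\<kappa>" using s by (simp add: pochhammer_pos less_imp_le)
  have "P1 \<longlonglongrightarrow> (\<integral>\<^sup>+z. ennreal (u y * rho 1 0 z) \<partial>lborel)"
  proof -
    have P1': "P1 j = (\<integral>\<^sup>+z. ennreal (u (y + e j *\<^sub>R z) * rho 1 0 z) * indicator {z. norm (e j *\<^sub>R z) \<le> 1} z \<partial>lborel)" for j
    proof -
      have "(\<lambda>x. ennreal (u x * rho (e j) y x) * indicator {x. norm (x - y) \<le> 1} x) \<in> borel_measurable borel" by measurable
      from nn_integral_lborel_affine[OF this, of "e j" y] e(1)[of j]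
      have "P1 j = ennreal (\<bar>e j\<bar> ^ CARD('n)) * (\<integral>\<^sup>+z. ennreal (u (y + e j *\<^sub>R z) * rho (e j) y (y + e j *\<^sub>R z))
          * indicator {x. norm (x - y) \<le> 1} (y + e j *\<^sub>R z) \<partial>lborel)"
        unfolding P1_def by simp
      also have "\<dots> = (\<integral>\<^sup>+z. ennreal (\<bar>e j\<bar> ^ CARD('n)) * (ennreal (u (y + e j *\<^sub>R z) * rho (e j) y (y + e j *\<^sub>R z))
          * indicator {x. norm (x - y) \<le> 1} (y + e j *\<^sub>R z)) \<partial>lborel)"
        by (rule nn_integral_cmult[symmetric]) measurable
      also have "\<dots> = (\<integral>\<^sup>+z. ennreal (u (y + e j *\<^sub>R z) * rho 1 0 z) * indicator {z. norm (e j *\<^sub>R z) \<le> 1} z \<partial>lborel)"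
      proof (rule nn_integral_cong)
        fix z :: "real ^ 'n"
        have "ennreal (\<bar>e j\<bar> ^ CARD('n)) * ennreal (u (y + e j *\<^sub>R z) * rho (e j) y (y + e j *\<^sub>R z))
          = ennreal (u (y + e j *\<^sub>R z) * (\<bar>e j\<bar> ^ CARD('n) * rho (e j) y (y + e j *\<^sub>R z)))"
          by (subst ennreal_mult'[symmetric]) (auto simp: mult_ac)
        also have "\<dots> = ennreal (u (y + e j *\<^sub>R z) * rho 1 0 z)" by (simp only: rho_affine[OF e(1)])
        finally show "ennreal (\<bar>e j\<bar> ^ CARD('n)) * (ennreal (u (y + e j *\<^sub>R z) * rho (e j) y (y + e j *\<^sub>R z))
          * indicator {x. norm (x - y) \<le> 1} (y + e j *\<^sub>R z)) = ennreal (u (y + e j *\<^sub>R z) * rho 1 0 z) * indicator {z. norm (e j *\<^sub>R z) \<le> 1} z"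
          by (simp add: mult.assoc[symmetric] indicator_def)
      qed
      finally show ?thesis .
    qed
    show ?thesis unfolding P1'
    proof (rule nn_integral_dominated_convergence[where w = "\<lambda>z. ennreal (M * rho 1 0 z)"])
      show "(\<lambda>z. ennreal (u (y + e j *\<^sub>R z) * rho 1 0 z) * indicator {z. norm (e j *\<^sub>R z) \<le> 1} z) \<in> borel_measurable lborel" for j
        by measurable
      show "(\<lambda>z. ennreal (u y * rho 1 0 z)) \<in> borel_measurable lborel" by measurable
      show "(\<lambda>z. ennreal (M * rho 1 0 z)) \<in> borel_measurable lborel" by measurable
      show "AE z in lborel. ennreal (u (y + e j *\<^sub>R z) * rho 1 0 z) * indicator {z. norm (e j *\<^sub>R z) \<le> 1} z \<le> ennreal (M * rho 1 0 z)" for j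
        using M2[of "y + e j *\<^sub>R z" for z] rho_nonneg[of 1 0]
        by (intro AE_I2) (auto simp: indicator_def intro!: ennreal_leI mult_right_mono)
      have "integrable lborel (\<lambda>z. M * rho 1 (0 :: real ^ 'n) z)" by (intro integrable_mult_right rho1_integrable)
      then show "(\<integral>\<^sup>+z. ennreal (M * rho 1 0 z) \<partial>lborel) < \<infinity>"
        using M rho_nonneg[of 1 0] by (subst nn_integral_eq_integral) auto
      show "AE z in lborel. (\<lambda>j. ennreal (u (y + e j *\<^sub>R z) * rho 1 0 z) * indicator {z. norm (e j *\<^sub>R z) \<le> 1} z) \<longlonglongrightarrow> ennreal (u y * rho 1 0 z)"
      proof (rule AE_I2)
        fix z :: "real ^ 'n"
        have "(\<lambda>j. y + e j *\<^sub>R z) \<longlonglongrightarrow> y + 0 *\<^sub>R z" by (intro tendsto_intros e0)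
        then have "(\<lambda>j. u (y + e j *\<^sub>R z)) \<longlonglongrightarrow> u y"
          using u(1) continuous_on_tendsto_compose[of UNIV u] by (simp add: continuous_on_eq_continuous_at isCont_tendsto_compose)
        then have 1: "(\<lambda>j. ennreal (u (y + e j *\<^sub>R z) * rho 1 0 z)) \<longlonglongrightarrow> ennreal (u y * rho 1 0 z)"
          by (intro tendsto_ennrealI tendsto_mult tendsto_const)
        have "(\<lambda>j. norm (e j *\<^sub>R z)) \<longlonglongrightarrow> norm (0 *\<^sub>R z)" by (intro tendsto_intros e0)
        then have "eventually (\<lambda>j. norm (e j *\<^sub>R z) < 1) sequentially" by (rule order_tendstoD) simp
        then have "eventually (\<lambda>j. ennreal (u (y + e j *\<^sub>R z) * rho 1 0 z) = ennreal (u (y + e j *\<^sub>R z) * rho 1 0 z) * indicator {z. norm (e j *\<^sub>R z) \<le> 1} z) sequentially"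
          by eventually_elim simp
        with 1 show "(\<lambda>j. ennreal (u (y + e j *\<^sub>R z) * rho 1 0 z) * indicator {z. norm (e j *\<^sub>R z) \<le> 1} z) \<longlonglongrightarrow> ennreal (u y * rho 1 0 z)"
          by (rule Lim_transform_eventually)
      qed
    qed
  qed
  also have "(\<integral>\<^sup>+z. ennreal (u y * rho 1 0 z) \<partial>lborel) = ennreal (rconst * u y)"
  proof -
    have "integrable lborel (\<lambda>z. u y * rho 1 (0 :: real ^ 'n) z)" by (intro integrable_mult_right rho1_integrable)
    then have "(\<integral>\<^sup>+z. ennreal (u y * rho 1 0 z) \<partial>lborel) = ennreal (LINT z|lborel. u y * rho 1 (0 :: real ^ 'n) z)"
      using u(2)[of y] rho_nonneg[of 1 0] by (intro nn_integral_eq_integral) auto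
    also have "(LINT z|lborel. u y * rho 1 (0 :: real ^ 'n) z) = u y * (LINT z|lborel. rho 1 (0 :: real ^ 'n) z)"
      by (rule integral_mult_right_zero)
    finally show ?thesis by (simp add: rconst_def mult.commute)
  qed
  finally have LP1: "P1 \<longlonglongrightarrow> ennreal (rconst * u y)" .
  have LP2: "P2 \<longlonglongrightarrow> 0"
  proof -
    define T where "T = (\<integral>\<^sup>+x. ennreal (u x) * ennreal (norm (x - y) powr (- 2 * (s + 2 * l))) * indicator {x. 1 < norm (x - y)} x \<partial>lborel)"
    have T: "T < \<infinity>" unfolding T_def by (rule tail)
    have le: "P2 j \<le> ennreal (?\<kappa> * e j ^ (2 * l)) * T" for j
    proof -
      have "P2 j \<le> (\<integral>\<^sup>+x. ennreal (?\<kappa> * e j ^ (2 * l)) * (ennreal (u x) * ennreal (norm (x - y) powr (- 2 * (s + 2 * l))) * indicator {x. 1 < norm (x - y)} x) \<partial>lborel)"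
        unfolding P2_def
      proof (rule nn_integral_mono)
        fix x
        show "ennreal (u x * rho (e j) y x) * indicator {x. 1 < norm (x - y)} x \<le> ennreal (?\<kappa> * e j ^ (2 * l)) *
          (ennreal (u x) * ennreal (norm (x - y) powr (- 2 * (s + 2 * l))) * indicator {x. 1 < norm (x - y)} x)"
        proof (cases "1 < norm (x - y)")
          case True
          then have "Eker (s + 2 * l) (e j) y x \<le> norm (x - y) powr (- 2 * (s + 2 * l))" using s by (intro Eker_le) auto
          note E = this
          have "u x * rho (e j) y x \<le> ?\<kappa> * e j ^ (2 * l) * (u x * norm (x - y) powr (- 2 * (s + 2 * l)))"
          proof -
            have "0 \<le> ?\<kappa> * e j ^ (2 * l) * u x" using \<kappa> e(1)[of j] u(2)[of x] by simp
            from mult_left_mono[OF E this] show ?thesis by (simp only: mult_ac)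
          qed
          then have "ennreal (u x * rho (e j) y x) \<le> ennreal (?\<kappa> * e j ^ (2 * l) * (u x * norm (x - y) powr (- 2 * (s + 2 * l))))"
            by (rule ennreal_leI)
          also have "\<dots> = ennreal (?\<kappa> * e j ^ (2 * l)) * (ennreal (u x) * ennreal (norm (x - y) powr (- 2 * (s + 2 * l))))"
            using \<kappa> e(1)[of j] u(2)[of x] by (simp add: ennreal_mult)
          finally show ?thesis using True by simp
        qed simp
      qed
      also have "\<dots> = ennreal (?\<kappa> * e j ^ (2 * l)) * T"
        unfolding T_def by (rule nn_integral_cmult) measurable
      finally show ?thesis .
    qed
    have "(\<lambda>j. ?\<kappa> * e j ^ (2 * l)) \<longlonglongrightarrow> ?\<kappa> * 0 ^ (2 * l)" by (intro tendsto_intros e0)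
    then have "(\<lambda>j. ennreal (?\<kappa> * e j ^ (2 * l))) \<longlonglongrightarrow> ennreal 0" using l by (intro tendsto_ennrealI) (simp add: zero_power)
    then have "(\<lambda>j. ennreal (?\<kappa> * e j ^ (2 * l)) * T) \<longlonglongrightarrow> ennreal 0 * T"
      using T by (intro tendsto_mult_ennreal tendsto_const) auto
    then have "(\<lambda>j. ennreal (?\<kappa> * e j ^ (2 * l)) * T) \<longlonglongrightarrow> 0" by simp
    then show ?thesis by (rule tendsto_sandwich[OF _ _ tendsto_const, rotated 2]) (use le in auto)
  qed
  have "(\<lambda>j. \<integral>\<^sup>+x. ennreal (F x * Eker s (e j) y x) \<partial>lborel) \<longlonglongrightarrow> ennreal (rconst * u y)"
    unfolding smoothed_representation[OF e(1)] P using tendsto_add[OF LP1 LP2] by simp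
  with L1 show ?thesis by (rule LIMSEQ_unique)
qed

end

section \<open>The Pohozaev identity\<close>

text \<open>The radial derivative \<open>x \<bullet> grad h\<close>, the generator of
  dilations.\<close>

definition euler :: "(real ^ 'n \<Rightarrow> real) \<Rightarrow> real ^ 'n \<Rightarrow> real" where
  "euler h x = (\<Sum>i\<in>UNIV. x $ i * partial i h x)"

lemma euler_mult:
  "f differentiable (at x) \<Longrightarrow> g differentiable (at x) \<Longrightarrow>
    euler (\<lambda>x. f x * g x) x = f x * euler g x + euler f x * g x"
  by (simp add: euler_def partial_mult algebra_simps sum.distrib sum_distrib_left)

lemma euler_compose:
  "f differentiable (at x) \<Longrightarrow> (h has_real_derivative h') (at (f x)) \<Longrightarrow>
    euler (\<lambda>x. h (f x)) x = h' * euler f x"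
  by (simp add: euler_def partial_compose sum_distrib_left algebra_simps)

lemma euler_cong_open:
  "open S \<Longrightarrow> x \<in> S \<Longrightarrow> (\<And>y. y \<in> S \<Longrightarrow> f y = g y) \<Longrightarrow> euler f x = euler g x"
  unfolding euler_def using partial_cong_open[of S x f g] by simp

lemma euler_const: "euler (\<lambda>x. c) x = 0"
  by (simp add: euler_def)

lemma euler_scale: "f differentiable (at (c *\<^sub>R x)) \<Longrightarrow> euler (\<lambda>x. f (c *\<^sub>R x)) x = euler f (c *\<^sub>R x)"
  by (simp add: euler_def partial_scale(1) sum_distrib_left algebra_simps)

lemma continuous_on_euler: "Ck_on 1 h S \<Longrightarrow> continuous_on S (euler h)"
  unfolding euler_def[abs_def] by (intro continuous_intros) auto

lemma euler_supp:
  assumes "\<And>x. norm x < a \<or> norm x > b \<Longrightarrow> \<phi> x = 0" "norm x < a \<or> norm x > b"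
  shows "euler \<phi> x = 0"
  unfolding euler_def using assms by (auto intro!: sum.neutral partial_supp[of a b])

text \<open>The integrand is the divergence of the field \<open>h x *\<^sub>R x\<close>.\<close>

lemma integral_euler:
  fixes h :: "real ^ 'n \<Rightarrow> real"
  assumes h: "Ck_on 1 h UNIV" and supp: "\<And>x. norm x > b \<Longrightarrow> h x = 0"
  shows "(LINT x|lborel. real CARD('n) * h x + euler h x) = 0"
proof -
  have d: "h differentiable (at x)" for x using h by (auto intro: Ck_on_differentiable[of UNIV 0])
  have dc: "(\<lambda>x. x $ i) differentiable (at x)" for i and x :: "real ^ 'n"
    using Ck_on_component[of 1 i 0 UNIV] by (auto intro: Ck_on_differentiable[of UNIV 0])
  have pc: "partial i (\<lambda>x. x $ i) x = 1" for i and x :: "real ^ 'n"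
    using partial_component[of i i 0 x] by simp
  have C: "Ck_on 1 (\<lambda>x. x $ i * h x) UNIV" for i
    using Ck_on_mult[OF open_UNIV Ck_on_component[of 1 i 0] h] by simp
  have eq: "partial i (\<lambda>x. x $ i * h x) x = h x + x $ i * partial i h x" for i x
    by (simp add: partial_mult[OF dc d] pc)
  have s: "partial i (\<lambda>x. x $ i * h x) x = 0" if "norm x > b" for i x
    using that supp by (intro partial_supp[of 0 b]) (auto simp: not_less[symmetric])
  have int: "integrable lborel (partial i (\<lambda>x. x $ i * h x))" for i
    using C[of i] s by (intro integrable_compact_supp[where b = b]) auto
  have "real CARD('n) * h x + euler h x = (\<Sum>i\<in>UNIV. partial i (\<lambda>x. x $ i * h x) x)" for x
    by (simp add: eq euler_def sum.distrib)
  then have "(LINT x|lborel. real CARD('n) * h x + euler h x) = (\<Sum>i\<in>UNIV. LINT x|lborel. partial i (\<lambda>x. x $ i * h x) x)"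
    using int by simp
  also have "\<dots> = 0" using supp by (intro sum.neutral ballI integral_partial_zero[OF C, of b]) auto
  finally show ?thesis .
qed

lemma euler_Eker:
  assumes "0 < e"
  shows "euler (Eker s e x) y = - 2 * s * (y \<bullet> (y - x)) * Eker (s + 1) e x y"
proof -
  have "e\<^sup>2 + (norm (y - x))\<^sup>2 > 0" using assms by (intro add_pos_nonneg) auto
  then have "euler (Eker s e x) y = (\<Sum>i\<in>UNIV. y $ i * (- 2 * s * (y $ i - x $ i) * Eker (s + 1) e x y))"
    by (simp add: euler_def partial_Eker)
  also have "\<dots> = (\<Sum>i\<in>UNIV. (- 2 * s) * (y $ i * (y $ i - x $ i)) * Eker (s + 1) e x y)"
    by (intro sum.cong refl) (simp add: algebra_simps)
  also have "\<dots> = - 2 * s * (\<Sum>i\<in>UNIV. y $ i * (y $ i - x $ i)) * Eker (s + 1) e x y"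
    by (simp only: sum_distrib_left sum_distrib_right)
  finally show ?thesis by (simp add: inner_vec_def)
qed

lemma Eker_sym: "Eker s e x y = Eker s e y x"
  by (simp add: Eker_def norm_minus_commute)

text \<open>\<open>integral_euler\<close> applied to \<open>h\<close> times the kernel: the product
  rule shifts the dilation derivative onto the kernel, where \<open>euler_Eker\<close> evaluates
  it.\<close>

lemma integral_euler_Eker:
  fixes h :: "real ^ 'n \<Rightarrow> real"
  assumes e: "0 < e" and h: "Ck_on 1 h UNIV" and supp: "\<And>x. norm x > b \<Longrightarrow> h x = 0"
  shows "(LINT y|lborel. (real CARD('n) * h y + euler h y) * Eker s e y x)
    = 2 * s * (LINT y|lborel. h y * (y \<bullet> (y - x)) * Eker (s + 1) e y x)"
proof -
  let ?E = "Eker s e x"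
  have CE: "Ck_on 1 ?E UNIV" by (rule Ck_on_Eker_UNIV[OF e])
  have d: "h differentiable (at y)" "?E differentiable (at y)" for y
    using h CE by (auto intro: Ck_on_differentiable[of UNIV 0])
  have s0: "euler h y = 0" if "norm y > b" for y
    using that supp euler_supp[of 0 b h y] by (auto simp: not_less[symmetric])
  have ch: "continuous_on UNIV h" "continuous_on UNIV (euler h)"
     "continuous_on UNIV ?E" "continuous_on UNIV (Eker (s + 1) e x)"
    using Ck_on_continuous[OF h] continuous_on_euler[OF h] Ck_on_continuous[OF CE]
      Ck_on_continuous[OF Ck_on_Eker_UNIV[OF e, of 0 "s + 1" x]] by auto
  have i1: "integrable lborel (\<lambda>y. (real CARD('n) * h y + euler h y) * ?E y)"
    using supp s0 by (intro integrable_compact_supp[where b = b] continuous_intros ch) auto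
  have i2: "integrable lborel (\<lambda>y. h y * (y \<bullet> (y - x)) * Eker (s + 1) e x y)"
    using supp by (intro integrable_compact_supp[where b = b] continuous_intros ch) auto
  have "0 = (LINT y|lborel. real CARD('n) * (h y * ?E y) + euler (\<lambda>y. h y * ?E y) y)"
    using supp by (intro integral_euler[symmetric, where b = b] Ck_on_mult h CE) auto
  also have "\<dots> = (LINT y|lborel. (real CARD('n) * h y + euler h y) * ?E y - 2 * s * (h y * (y \<bullet> (y - x)) * Eker (s + 1) e x y))"
    by (rule Bochner_Integration.integral_cong)
      (simp_all add: euler_mult[OF d] euler_Eker[OF e] algebra_simps)
  also have "\<dots> = (LINT y|lborel. (real CARD('n) * h y + euler h y) * ?E y) - 2 * s * (LINT y|lborel. h y * (y \<bullet> (y - x)) * Eker (s + 1) e x y)"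
    using i1 i2 by (subst Bochner_Integration.integral_diff) auto
  finally show ?thesis by (simp add: Eker_sym[of _ _ x])
qed

lemma C1_lipschitz:
  fixes f :: "real ^ 'n \<Rightarrow> real"
  assumes "Ck_on 1 f UNIV" "\<And>i x. \<bar>partial i f x\<bar> \<le> M"
  shows "\<bar>f y - f x\<bar> \<le> real CARD('n) * M * norm (y - x)"
proof -
  have d: "f differentiable (at x)" for x using assms(1) by (auto intro: Ck_on_differentiable[of UNIV 0])
  then obtain D where D: "\<And>x. (f has_derivative D x) (at x)" unfolding differentiable_def by metis
  have "norm (D x h) \<le> real CARD('n) * M * norm h" for x h
  proof -
    have "norm (D x h) \<le> (\<Sum>i\<in>UNIV. \<bar>h $ i * partial i f x\<bar>)"
      unfolding has_derivative_partial_sum[OF D] real_norm_def by (rule sum_abs)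
    also have "\<dots> \<le> (\<Sum>i\<in>(UNIV::'n set). norm h * M)"
      unfolding abs_mult by (intro sum_mono mult_mono component_le_norm_cart assms(2)) auto
    finally show ?thesis by (simp add: algebra_simps)
  qed
  then have "onorm (D x) \<le> real CARD('n) * M" for x
    by (intro onorm_le) auto
  then have "norm (f y - f x) \<le> real CARD('n) * M * norm (y - x)"
    using D by (intro differentiable_bound[OF convex_UNIV, of f D]) auto
  then show ?thesis by simp
qed

text \<open>With \<open>Z x = chi 2 x *\<^sub>R x\<close> the cut-off field is
  \<open>k Z(x / k) - Z(k x) / k\<close>. Both pieces are conjugates of \<open>Z\<close> by
  dilations and inherit its Lipschitz constant for every \<open>k\<close>.\<close>

lemma cutoff_field_lipschitz:
  "\<exists>L\<ge>0. \<forall>k\<ge>2. \<forall>x y :: real ^ 'n. \<bar>(cutoff 2 k y *\<^sub>R y - cutoff 2 k x *\<^sub>R x) \<bullet> (y - x)\<bar> \<le> L * (norm (y - x))\<^sup>2"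
proof -
  let ?Y = "\<lambda>i (x::real^'n). chi 2 x * x $ i"
  have C: "Ck_on 1 (?Y i) UNIV" for i
    using Ck_on_component[of 1 i 0 UNIV] by (intro Ck_on_mult open_UNIV Ck_on_chi) auto
  have supp: "partial j (?Y i) x = 0" if "norm x > 2" for i j x
    using that by (intro partial_supp[of 0 2]) (auto simp: chi_eq_0 not_less[symmetric])
  have "\<exists>M\<ge>0. \<forall>j x. \<bar>partial j (?Y i) x\<bar> \<le> M" for i
  proof -
    obtain M where M: "0 \<le> M" "derivs_le 1 M (?Y i) (cball 0 2)"
      using derivs_le_compact_ex[OF open_UNIV compact_cball subset_UNIV C] by blast
    have "\<bar>partial j (?Y i) x\<bar> \<le> M" for j x
    proof (cases "norm x \<le> 2")
      case True
      then show ?thesis using M(2) by auto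
    next
      case False
      then show ?thesis using supp[of x j i] M(1) by simp
    qed
    then show ?thesis using M(1) by blast
  qed
  then obtain M where M: "\<And>i. 0 \<le> M i" "\<And>i j x. \<bar>partial j (?Y i) x\<bar> \<le> M i" by metis
  define N where "N = sum M UNIV"
  have MN: "M i \<le> N" for i unfolding N_def using M(1) by (intro member_le_sum) auto
  define L0 where "L0 = real CARD('n) * (real CARD('n) * N)"
  have N0: "0 \<le> N" unfolding N_def using M(1) by (rule sum_nonneg)
  have L0: "0 \<le> L0" unfolding L0_def using N0 by simp
  have Y: "norm (chi 2 y *\<^sub>R y - chi 2 x *\<^sub>R x) \<le> L0 * norm (y - x)" for x y :: "real ^ 'n"
  proof -
    have "norm (chi 2 y *\<^sub>R y - chi 2 x *\<^sub>R x) \<le> (\<Sum>i\<in>UNIV. \<bar>(chi 2 y *\<^sub>R y - chi 2 x *\<^sub>R x) $ i\<bar>)"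
      by (rule norm_le_l1_cart)
    also have "\<dots> \<le> (\<Sum>i\<in>(UNIV::'n set). real CARD('n) * N * norm (y - x))"
    proof (rule sum_mono)
      fix i
      have "\<bar>?Y i y - ?Y i x\<bar> \<le> real CARD('n) * N * norm (y - x)"
        by (rule C1_lipschitz[OF C]) (use M(2) MN order_trans in blast)
      then show "\<bar>(chi 2 y *\<^sub>R y - chi 2 x *\<^sub>R x) $ i\<bar> \<le> real CARD('n) * N * norm (y - x)" by simp
    qed
    finally show ?thesis by (simp add: L0_def algebra_simps)
  qed
  have main: "\<bar>(cutoff 2 k y *\<^sub>R y - cutoff 2 k x *\<^sub>R x) \<bullet> (y - x)\<bar> \<le> (2 * L0) * (norm (y - x))\<^sup>2"
    if k: "k \<ge> 2" for k and x y :: "real ^ 'n"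
  proof -
    define Z where "Z x = chi 2 x *\<^sub>R x" for x :: "real ^ 'n"
    \<comment> \<open>The supports are nested: wherever \<open>chi 2 (k x)\<close> is nonzero,
      \<open>chi 2 (x / k)\<close> equals 1, so the product in \<open>cutoff\<close> is a
      difference.\<close>
    have eq: "cutoff 2 k x *\<^sub>R x = real k *\<^sub>R Z ((1 / real k) *\<^sub>R x) - (1 / real k) *\<^sub>R Z (real k *\<^sub>R x)" for x :: "real ^ 'n"
    proof -
      have "chi 2 ((1 / real k) *\<^sub>R x) * chi 2 (real k *\<^sub>R x) = chi 2 (real k *\<^sub>R x)"
      proof (cases "norm (real k *\<^sub>R x) \<ge> 2")
        case True
        then show ?thesis by (simp add: chi_eq_0)
      next
        case False
        have "norm x * real k < 2" using False by (simp add: mult.commute)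
        moreover have "norm x * 2 \<le> norm x * real k" using k by (intro mult_left_mono) auto
        ultimately have "norm x \<le> 1" by linarith
        also have "1 \<le> real k" using k by simp
        finally have "norm ((1 / real k) *\<^sub>R x) \<le> 1" using k by simp
        then show ?thesis by (simp add: chi_eq_1)
      qed
      then have "cutoff 2 k x = chi 2 ((1 / real k) *\<^sub>R x) - chi 2 (real k *\<^sub>R x)"
        by (simp add: cutoff_def right_diff_distrib)
      then show ?thesis using k by (simp add: Z_def scaleR_left_diff_distrib)
    qed
    have e2: "cutoff 2 k y *\<^sub>R y - cutoff 2 k x *\<^sub>R x = real k *\<^sub>R (Z ((1 / real k) *\<^sub>R y) - Z ((1 / real k) *\<^sub>R x))
       - (1 / real k) *\<^sub>R (Z (real k *\<^sub>R y) - Z (real k *\<^sub>R x))"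
      unfolding eq by (simp add: scaleR_right_diff_distrib)
    have "norm (cutoff 2 k y *\<^sub>R y - cutoff 2 k x *\<^sub>R x) \<le> norm (real k *\<^sub>R (Z ((1 / real k) *\<^sub>R y) - Z ((1 / real k) *\<^sub>R x)))
       + norm ((1 / real k) *\<^sub>R (Z (real k *\<^sub>R y) - Z (real k *\<^sub>R x)))"
      unfolding e2 by (rule norm_triangle_ineq4)
    also have "\<dots> \<le> real k * (L0 * norm ((1 / real k) *\<^sub>R y - (1 / real k) *\<^sub>R x)) + 1 / real k * (L0 * norm (real k *\<^sub>R y - real k *\<^sub>R x))"
      unfolding norm_scaleR Z_def abs_of_nat abs_of_nonneg[OF divide_nonneg_nonneg[OF zero_le_one of_nat_0_le_iff]]
      by (intro add_mono mult_left_mono Y) auto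
    also have "\<dots> = 2 * L0 * norm (y - x)"
    proof -
      have "norm ((1 / real k) *\<^sub>R y - (1 / real k) *\<^sub>R x) = norm (y - x) / real k"
        "norm (real k *\<^sub>R y - real k *\<^sub>R x) = real k * norm (y - x)"
        unfolding scaleR_right_diff_distrib[symmetric] by simp_all
      then show ?thesis using k by simp
    qed
    finally have n: "norm (cutoff 2 k y *\<^sub>R y - cutoff 2 k x *\<^sub>R x) \<le> 2 * L0 * norm (y - x)" .
    have "\<bar>(cutoff 2 k y *\<^sub>R y - cutoff 2 k x *\<^sub>R x) \<bullet> (y - x)\<bar> \<le> norm (cutoff 2 k y *\<^sub>R y - cutoff 2 k x *\<^sub>R x) * norm (y - x)"
      by (rule Cauchy_Schwarz_ineq2)
    also have "\<dots> \<le> 2 * L0 * norm (y - x) * norm (y - x)" by (intro mult_right_mono n) auto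
    finally show ?thesis by (simp add: power2_eq_square mult.assoc)
  qed
  show ?thesis using main L0 by (intro exI[of _ "2 * L0"]) auto
qed

text \<open>The operator \<open>euler\<close> commutes with dilations, so a bound for the fixed
  profile \<open>chi 2\<close> is a bound at all scales.\<close>

lemma euler_cutoff_bound: "\<exists>B\<ge>0. \<forall>k\<ge>2. \<forall>x :: real ^ 'n. \<bar>euler (cutoff 2 k) x\<bar> \<le> B"
proof -
  have C: "Ck_on 1 (chi 2) (UNIV :: (real ^ 'n) set)" by (rule Ck_on_chi) simp
  then have d: "chi 2 differentiable (at x)" for x :: "real ^ 'n" by (auto intro: Ck_on_differentiable[of UNIV 0])
  have d2: "(\<lambda>x. chi 2 (c *\<^sub>R x)) differentiable (at x)" for c and x :: "real ^ 'n"
    using d by (rule partial_scale(2))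
  have "compact (euler (chi 2) ` cball (0::real^'n) 2)"
    using continuous_on_euler[OF C] by (intro compact_continuous_image compact_cball) (auto intro: continuous_on_subset)
  then obtain B0 where B0: "\<forall>y\<in>euler (chi 2) ` cball (0::real^'n) 2. \<bar>y\<bar> \<le> B0"
    using compact_imp_bounded bounded_real by metis
  define B where "B = max B0 0"
  have B: "\<bar>euler (chi 2) x\<bar> \<le> B" for x :: "real ^ 'n"
  proof (cases "norm x \<le> 2")
    case True
    then show ?thesis using B0 unfolding B_def by force
  next
    case False
    then have "euler (chi 2) x = 0"
      by (intro euler_supp[of 0 2]) (auto simp: chi_eq_0 not_less[symmetric])
    then show ?thesis unfolding B_def by simp
  qed
  have "\<bar>euler (cutoff 2 k) x\<bar> \<le> 2 * B" for k and x :: "real ^ 'n"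
  proof -
    let ?c = "1 / real k"
    have d3: "(\<lambda>x. 1 - chi 2 (real k *\<^sub>R x)) differentiable (at x)"
      using d2 by (intro differentiable_diff differentiable_const)
    have "partial i (\<lambda>x. 1 - chi 2 (real k *\<^sub>R x)) x = - partial i (\<lambda>x. chi 2 (real k *\<^sub>R x)) x" for i
    proof -
      obtain D where D: "((\<lambda>x. chi 2 (real k *\<^sub>R x)) has_derivative D) (at x)"
        using d2[of "real k" x] unfolding differentiable_def by blast
      show ?thesis
        using partial_eq_derivative[OF has_derivative_diff[OF has_derivative_const[of 1] D], of i]
          partial_eq_derivative[OF D, of i] by simp
    qed
    then have e1: "euler (\<lambda>x. 1 - chi 2 (real k *\<^sub>R x)) x = - euler (chi 2) (real k *\<^sub>R x)"
      using euler_scale[OF d, of "real k" x] by (simp add: euler_def sum_negf)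
    have "euler (cutoff 2 k) x = chi 2 (?c *\<^sub>R x) * - euler (chi 2) (real k *\<^sub>R x) + euler (chi 2) (?c *\<^sub>R x) * (1 - chi 2 (real k *\<^sub>R x))"
      unfolding cutoff_def[abs_def] by (simp only: euler_mult[OF d2 d3] e1 euler_scale[OF d])
    also have "\<bar>\<dots>\<bar> \<le> 1 * B + B * 1"
    proof -
      have "\<bar>chi 2 (?c *\<^sub>R x)\<bar> * \<bar>- euler (chi 2) (real k *\<^sub>R x)\<bar> \<le> 1 * B"
        using B[of "real k *\<^sub>R x"] chi_bounds[of 2 "?c *\<^sub>R x"] by (intro mult_mono) auto
      moreover have "\<bar>euler (chi 2) (?c *\<^sub>R x)\<bar> * \<bar>1 - chi 2 (real k *\<^sub>R x)\<bar> \<le> B * 1"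
        using B[of "?c *\<^sub>R x"] chi_bounds[of 2 "real k *\<^sub>R x"] by (intro mult_mono) auto
      ultimately show ?thesis by (intro order_trans[OF abs_triangle_ineq] add_mono) (simp_all only: abs_mult)
    qed
    finally show ?thesis by simp
  qed
  then show ?thesis by (intro exI[of _ "2 * B"]) (auto simp: B_def)
qed

lemma cutoff_eventually_const:
  fixes x :: "real ^ 'n"
  assumes "x \<noteq> 0"
  shows "eventually (\<lambda>k. cutoff 2 (k + 2) x = 1 \<and> euler (cutoff 2 (k + 2)) x = 0) sequentially"
proof -
  obtain k0 :: nat where k0: "real k0 \<ge> norm x + 2 / norm x" using real_arch_simple by blast
  have "cutoff 2 (k + 2) x = 1 \<and> euler (cutoff 2 (k + 2)) x = 0" if "k \<ge> k0" for k
  proof -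
    have p: "0 < norm x" "0 \<le> 2 / norm x" using assms by auto
    have k: "real (k + 2) > norm x + 2 / norm x" using k0 that by simp
    have "norm x < real (k + 2)" using k p by linarith
    moreover have "2 / norm x < real (k + 2)" using k p by linarith
    then have "2 / real (k + 2) < norm x" using p by (simp add: field_simps)
    moreover define A where "A = {z :: real ^ 'n. 2 / real (k + 2) < norm z \<and> norm z < real (k + 2)}"
    ultimately have x: "x \<in> A" by simp
    have o: "open A" unfolding A_def by (intro open_Collect_conj open_Collect_less continuous_intros)
    have one: "cutoff 2 (k + 2) z = 1" if "z \<in> A" for z
      using that unfolding A_def by (intro cutoff_props(4)) auto
    show ?thesis using one[OF x] euler_cong_open[OF o x one] by (simp add: euler_const)
  qed
  then show ?thesis by (auto simp: eventually_sequentially)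
qed

section \<open>Double integrals against the kernel\<close>

lemma AE_pair_neq: "AE z in lborel \<Otimes>\<^sub>M (lborel :: (real ^ 'n) measure). fst z \<noteq> snd z"
proof (rule lborel_pair.AE_pair_measure)
  show "{z \<in> space (lborel \<Otimes>\<^sub>M (lborel :: (real ^ 'n) measure)). fst z \<noteq> snd z} \<in> sets (lborel \<Otimes>\<^sub>M lborel)"
    by measurable
  show "AE x in lborel. AE y in (lborel :: (real ^ 'n) measure). fst (x, y) \<noteq> snd (x, y)"
  proof (rule AE_I2)
    fix x :: "real ^ 'n"
    show "AE y in lborel. fst (x, y) \<noteq> snd (x, y)"
      using AE_lborel_singleton[of x] by eventually_elim auto
  qed
qed

lemma Eker_tendsto:
  assumes "x \<noteq> y" "e \<longlonglongrightarrow> 0"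
  shows "(\<lambda>j. Eker r (e j) y x) \<longlonglongrightarrow> norm (x - y) powr (- 2 * r)"
proof -
  have "(\<lambda>j. Eker r (e j) y x) \<longlonglongrightarrow> (0\<^sup>2 + (norm (x - y))\<^sup>2) powr (- r)"
    unfolding Eker_def using assms by (intro tendsto_intros) auto
  also have "(0\<^sup>2 + (norm (x - y))\<^sup>2) powr (- r) = (norm (x - y) powr 2) powr (- r)"
    using assms by (simp add: powr_numeral)
  also have "\<dots> = norm (x - y) powr (- 2 * r)" by (simp only: powr_powr) simp
  finally show ?thesis .
qed

text \<open>The first bound is uniform in \<open>e\<close> and serves the symmetrized integrand,
  which is quadratic in the distance. The second degenerates as \<open>e\<close> tends to 0; it only
  justifies Fubini for one equation at fixed \<open>e\<close>.\<close>

lemma Eker_Suc_bound: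
  assumes "y \<noteq> x" "0 \<le> s"
  shows "(norm (y - x))\<^sup>2 * Eker (s + 1) e y x \<le> norm (x - y) powr (- 2 * s)"
    and "0 < e \<Longrightarrow> norm (y - x) * Eker (s + 1) e y x \<le> (1 / e) * norm (x - y) powr (- 2 * s)"
proof -
  let ?r = "norm (y - x)"
  have r: "0 < ?r" using assms by simp
  have p: "0 < e\<^sup>2 + ?r\<^sup>2" using r by (intro add_nonneg_pos) auto
  have E: "Eker (s + 1) e y x = Eker s e y x / (e\<^sup>2 + ?r\<^sup>2)"
  proof -
    have "- (s + 1) = - s - 1" by simp
    then show ?thesis unfolding Eker_def norm_minus_commute[of x y] using p by (simp only: powr_diff) simp
  qed
  have le: "Eker s e y x \<le> norm (x - y) powr (- 2 * s)"
  proof -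
    have "Eker s e y x \<le> (?r\<^sup>2) powr (- s)" unfolding Eker_def norm_minus_commute[of x y] using r assms by (intro powr_mono2') auto
    also have "(?r\<^sup>2) powr (- s) = (?r powr 2) powr (- s)" using r by (simp add: powr_numeral)
    also have "\<dots> = ?r powr (- 2 * s)" by (simp only: powr_powr) simp
    finally show ?thesis by (simp add: norm_minus_commute)
  qed
  have "?r\<^sup>2 * Eker (s + 1) e y x = (?r\<^sup>2 / (e\<^sup>2 + ?r\<^sup>2)) * Eker s e y x" unfolding E by simp
  also have "\<dots> \<le> 1 * Eker s e y x" using p by (intro mult_right_mono Eker_nonneg) simp
  finally show "?r\<^sup>2 * Eker (s + 1) e y x \<le> norm (x - y) powr (- 2 * s)" using le by simp
  show "?r * Eker (s + 1) e y x \<le> (1 / e) * norm (x - y) powr (- 2 * s)" if e: "0 < e"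
  proof -
    have "?r * e \<le> e\<^sup>2 + ?r\<^sup>2"
      using sum_squares_bound[of ?r e] mult_pos_pos[OF r e] by linarith
    then have "?r / (e\<^sup>2 + ?r\<^sup>2) \<le> 1 / e" using p e by (simp add: field_simps)
    then have "(?r / (e\<^sup>2 + ?r\<^sup>2)) * Eker s e y x \<le> (1 / e) * norm (x - y) powr (- 2 * s)"
      using e le by (intro mult_mono Eker_nonneg) auto
    then show ?thesis unfolding E by simp
  qed
qed

context polyharmonic_growth
begin

lemma pair_measurable [measurable]:
  assumes [measurable]: "p \<in> borel_measurable borel"
  shows "(\<lambda>(x, y). p y * (F x * norm (x - y) powr (- 2 * s))) \<in> borel_measurable (lborel \<Otimes>\<^sub>M lborel)"
  by measurable

text \<open>Integrating in \<open>x\<close> first turns the kernel integral into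
  \<open>rconst * u y\<close> by \<open>representation\<close>; Tonelli transfers
  finiteness.\<close>

lemma pair_integral:
  assumes [measurable]: "p \<in> borel_measurable borel"
    and fin: "(\<integral>\<^sup>+y. ennreal (\<bar>p y\<bar> * u y) \<partial>lborel) < \<infinity>"
  shows "integrable (lborel \<Otimes>\<^sub>M lborel) (\<lambda>(x, y). p y * (F x * norm (x - y) powr (- 2 * s)))" (is "integrable _ ?f")
    and "(LINT z|(lborel \<Otimes>\<^sub>M lborel). (case z of (x, y) \<Rightarrow> p y * (F x * norm (x - y) powr (- 2 * s)))) = rconst * (LINT y|lborel. p y * u y)"
proof -
  show int: "integrable (lborel \<Otimes>\<^sub>M lborel) ?f"
  proof (rule integrableI_bounded)
    show "?f \<in> borel_measurable (lborel \<Otimes>\<^sub>M lborel)" by (rule pair_measurable) simp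
    have m: "(\<lambda>z. ennreal (norm (?f z))) \<in> borel_measurable (lborel \<Otimes>\<^sub>M lborel)"
      by (rule measurable_compose[OF measurable_compose[OF pair_measurable[OF assms(1)] borel_measurable_norm] measurable_ennreal])
    have "(\<integral>\<^sup>+z. ennreal (norm (?f z)) \<partial>(lborel \<Otimes>\<^sub>M lborel))
       = (\<integral>\<^sup>+y. \<integral>\<^sup>+x. ennreal (norm (?f (x, y))) \<partial>lborel \<partial>lborel)"
      by (rule lborel_pair.nn_integral_snd[OF m, symmetric])
    also have "\<dots> = (\<integral>\<^sup>+y. ennreal rconst * ennreal (\<bar>p y\<bar> * u y) \<partial>lborel)"
    proof (rule nn_integral_cong)
      fix y
      have "(\<integral>\<^sup>+x. ennreal (norm (?f (x, y))) \<partial>lborel) = (\<integral>\<^sup>+x. ennreal \<bar>p y\<bar> * ennreal (F x * norm (x - y) powr (- 2 * s)) \<partial>lborel)"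
        using F(2) by (intro nn_integral_cong) (simp add: abs_mult ennreal_mult)
      also have "\<dots> = ennreal \<bar>p y\<bar> * (\<integral>\<^sup>+x. ennreal (F x * norm (x - y) powr (- 2 * s)) \<partial>lborel)"
        by (rule nn_integral_cmult) measurable
      also have "\<dots> = ennreal \<bar>p y\<bar> * ennreal (rconst * u y)" by (simp only: representation)
      also have "\<dots> = ennreal rconst * ennreal (\<bar>p y\<bar> * u y)"
        using u(2)[of y] rconst_pos by (simp add: ennreal_mult[symmetric] mult_ac)
      finally show "(\<integral>\<^sup>+x. ennreal (norm (?f (x, y))) \<partial>lborel) = ennreal rconst * ennreal (\<bar>p y\<bar> * u y)" .
    qed
    also have "\<dots> = ennreal rconst * (\<integral>\<^sup>+y. ennreal (\<bar>p y\<bar> * u y) \<partial>lborel)"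
      by (rule nn_integral_cmult) measurable
    also have "\<dots> < \<infinity>" using fin by (simp add: ennreal_mult_less_top)
    finally show "(\<integral>\<^sup>+z. ennreal (norm (?f z)) \<partial>(lborel \<Otimes>\<^sub>M lborel)) < \<infinity>" .
  qed
  have inner: "(LINT x|lborel. F x * norm (x - y) powr (- 2 * s)) = rconst * u y" for y
  proof -
    have "(LINT x|lborel. F x * norm (x - y) powr (- 2 * s)) = enn2real (\<integral>\<^sup>+x. ennreal (F x * norm (x - y) powr (- 2 * s)) \<partial>lborel)"
      using F(2) by (intro integral_eq_nn_integral) auto
    then show ?thesis using u(2)[of y] rconst_pos by (simp only: representation) simp
  qed
  have "integral\<^sup>L (lborel \<Otimes>\<^sub>M lborel) ?f = (LINT y|lborel. LINT x|lborel. p y * (F x * norm (x - y) powr (- 2 * s)))"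
    by (rule lborel_pair.integral_snd[symmetric, OF int])
  also have "\<dots> = (LINT y|lborel. rconst * (p y * u y))"
    by (simp only: integral_mult_right_zero[of lborel "p y" for y] inner mult.left_commute[of rconst])
  finally show "integral\<^sup>L (lborel \<Otimes>\<^sub>M lborel) ?f = rconst * (LINT y|lborel. p y * u y)"
    by (simp only: integral_mult_right_zero)
qed

lemma pair_integrable_bound:
  fixes q :: "real ^ 'n \<Rightarrow> real ^ 'n \<Rightarrow> real"
  assumes [measurable]: "p \<in> borel_measurable borel" "case_prod q \<in> borel_measurable (lborel \<Otimes>\<^sub>M lborel)"
    and fin: "(\<integral>\<^sup>+y. ennreal (\<bar>p y\<bar> * u y) \<partial>lborel) < \<infinity>"
    and b: "\<And>x y. x \<noteq> y \<Longrightarrow> \<bar>q x y\<bar> \<le> p y * (F x * norm (x - y) powr (- 2 * s))"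
  shows "integrable (lborel \<Otimes>\<^sub>M lborel) (case_prod q)"
proof (rule Bochner_Integration.integrable_bound[OF pair_integral(1)[OF assms(1) fin] assms(2)])
  show "AE z in (lborel \<Otimes>\<^sub>M lborel). norm (case_prod q z) \<le> norm (case z of (x, y) \<Rightarrow> p y * (F x * norm (x - y) powr (- 2 * s)))"
    using AE_pair_neq
  proof eventually_elim
    case (elim z)
    then show ?case using b[of "fst z" "snd z"] by (auto simp: case_prod_beta)
  qed
qed

lemma compact_weight_finite:
  assumes "continuous_on UNIV p" "\<And>x. norm x > b \<Longrightarrow> p x = 0"
  shows "(\<integral>\<^sup>+y. ennreal (\<bar>p y\<bar> * u y) \<partial>lborel) < \<infinity>"
proof -
  have "integrable lborel (\<lambda>y. \<bar>p y\<bar> * u y)"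
    using assms by (intro integrable_compact_supp[where b = b] continuous_intros u(1)) auto
  then show ?thesis using u(2) by (subst nn_integral_eq_integral) auto
qed

text \<open>Here the inner integral is the one in \<open>y\<close>, where
  \<open>integral_euler_Eker\<close> applies, in contrast to \<open>pair_integral\<close>. The order
  matters, as \<open>h\<close> carries the smoothness while \<open>F\<close> is merely
  measurable.\<close>

lemma pair_by_parts:
  assumes e: "0 < e" and h: "Ck_on 1 h UNIV" and supp: "\<And>x. norm x > b \<Longrightarrow> h x = 0"
  shows "(LINT z|(lborel \<Otimes>\<^sub>M lborel). (case z of (x, y) \<Rightarrow> (real CARD('n) * h y + euler h y) * (F x * Eker s e y x)))
     = 2 * s * (LINT z|(lborel \<Otimes>\<^sub>M lborel). (case z of (x, y) \<Rightarrow> h y * (y \<bullet> (y - x)) * (F x * Eker (s + 1) e y x)))" (is "?A = _ * ?B")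
    and "integrable (lborel \<Otimes>\<^sub>M lborel) (\<lambda>(x, y). h y * (y \<bullet> (y - x)) * (F x * Eker (s + 1) e y x))"
proof -
  let ?D = "\<lambda>y. real CARD('n) * h y + euler h y"
  have ch: "continuous_on UNIV h" "continuous_on UNIV (euler h)"
    using Ck_on_continuous[OF h] continuous_on_euler[OF h] by auto
  have s0: "euler h y = 0" if "norm y > b" for y
    using that supp euler_supp[of 0 b h y] by auto
  note [measurable] = borel_measurable_continuous_onI[OF ch(1)] borel_measurable_continuous_onI[OF ch(2)]
  have Em: "(\<lambda>(x, y). Eker r e y x) \<in> borel_measurable (lborel \<Otimes>\<^sub>M lborel)" for r
    unfolding Eker_def by measurable
  note [measurable] = Em
  have i1: "integrable (lborel \<Otimes>\<^sub>M lborel) (\<lambda>(x, y). ?D y * (F x * Eker s e y x))"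
  proof (rule pair_integrable_bound[where p = "\<lambda>y. \<bar>?D y\<bar>"])
    show "(\<integral>\<^sup>+y. ennreal (\<bar>\<bar>?D y\<bar>\<bar> * u y) \<partial>lborel) < \<infinity>"
      using supp s0 by (intro compact_weight_finite[where b = b] continuous_intros ch) auto
    show "\<bar>?D y * (F x * Eker s e y x)\<bar> \<le> \<bar>?D y\<bar> * (F x * norm (x - y) powr (- 2 * s))" if "x \<noteq> y" for x y
      unfolding abs_mult using F(2)[of x] Eker_le[OF that, of s e] s Eker_nonneg[of s e y x]
      by (intro mult_left_mono mult_mono) auto
  qed measurable
  show i2: "integrable (lborel \<Otimes>\<^sub>M lborel) (\<lambda>(x, y). h y * (y \<bullet> (y - x)) * (F x * Eker (s + 1) e y x))"
  proof (rule pair_integrable_bound[where p = "\<lambda>y. \<bar>h y\<bar> * norm y * (1 / e)"])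
    show "(\<integral>\<^sup>+y. ennreal (\<bar>\<bar>h y\<bar> * norm y * (1 / e)\<bar> * u y) \<partial>lborel) < \<infinity>"
      using supp by (intro compact_weight_finite[where b = b] continuous_intros ch) auto
    show "\<bar>h y * (y \<bullet> (y - x)) * (F x * Eker (s + 1) e y x)\<bar> \<le> \<bar>h y\<bar> * norm y * (1 / e) * (F x * norm (x - y) powr (- 2 * s))"
      if "x \<noteq> y" for x y
    proof -
      have "\<bar>h y * (y \<bullet> (y - x)) * (F x * Eker (s + 1) e y x)\<bar> = \<bar>h y\<bar> * F x * (\<bar>y \<bullet> (y - x)\<bar> * Eker (s + 1) e y x)"
        using F(2)[of x] Eker_nonneg[of "s + 1" e y x] by (simp add: abs_mult)
      also have "\<dots> \<le> \<bar>h y\<bar> * F x * ((norm y * norm (y - x)) * Eker (s + 1) e y x)"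
        using F(2)[of x] by (intro mult_left_mono mult_right_mono Cauchy_Schwarz_ineq2 Eker_nonneg) auto
      also have "\<dots> = \<bar>h y\<bar> * F x * norm y * (norm (y - x) * Eker (s + 1) e y x)" by simp
      also have "\<dots> \<le> \<bar>h y\<bar> * F x * norm y * ((1 / e) * norm (x - y) powr (- 2 * s))"
        using F(2)[of x] that s e by (intro mult_left_mono Eker_Suc_bound(2)) auto
      finally show ?thesis by (simp add: mult_ac)
    qed
  qed measurable
  have "?A = (LINT x|lborel. LINT y|lborel. ?D y * (F x * Eker s e y x))"
    by (rule lborel_pair.integral_fst'[symmetric, OF i1, simplified])
  also have "\<dots> = (LINT x|lborel. F x * (LINT y|lborel. ?D y * Eker s e y x))"
    by (subst integral_mult_right_zero[symmetric]) (simp add: mult_ac)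
  also have "\<dots> = (LINT x|lborel. F x * (2 * s * (LINT y|lborel. h y * (y \<bullet> (y - x)) * Eker (s + 1) e y x)))"
    by (simp only: integral_euler_Eker[OF e h supp])
  also have "\<dots> = 2 * s * (LINT x|lborel. LINT y|lborel. h y * (y \<bullet> (y - x)) * (F x * Eker (s + 1) e y x))"
    by (subst integral_mult_right_zero[symmetric])+ (simp add: mult_ac)
  also have "(LINT x|lborel. LINT y|lborel. h y * (y \<bullet> (y - x)) * (F x * Eker (s + 1) e y x)) = ?B"
    by (rule lborel_pair.integral_fst'[OF i2, simplified])
  finally show "?A = 2 * s * ?B" .
qed

text \<open>Only the undifferentiated side of \<open>pair_by_parts\<close> is passed to the limit.
  The other side stays regularized, since the domination available for it at this stage blows up
  like \<open>1 / e\<close>; it is treated after symmetrization.\<close>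

lemma pair_by_parts_limit:
  assumes e: "\<And>j. 0 < e j" "e \<longlonglongrightarrow> 0" and h: "Ck_on 1 h UNIV" and supp: "\<And>x. norm x > b \<Longrightarrow> h x = 0"
  shows "(\<lambda>j. 2 * s * (LINT z|(lborel \<Otimes>\<^sub>M lborel). (case z of (x, y) \<Rightarrow> h y * (y \<bullet> (y - x)) * (F x * Eker (s + 1) (e j) y x))))
    \<longlonglongrightarrow> rconst * (LINT y|lborel. (real CARD('n) * h y + euler h y) * u y)"
proof -
  let ?D = "\<lambda>y. real CARD('n) * h y + euler h y"
  have ch: "continuous_on UNIV h" "continuous_on UNIV (euler h)"
    using Ck_on_continuous[OF h] continuous_on_euler[OF h] by auto
  have s0: "euler h y = 0" if "norm y > b" for y
    using that supp euler_supp[of 0 b h y] by auto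
  note [measurable] = borel_measurable_continuous_onI[OF ch(1)] borel_measurable_continuous_onI[OF ch(2)]
  have Em: "(\<lambda>(x, y). Eker r e y x) \<in> borel_measurable (lborel \<Otimes>\<^sub>M lborel)" for r e
    unfolding Eker_def by measurable
  note [measurable] = Em
  have Dm: "?D \<in> borel_measurable borel" by measurable
  have fin: "(\<integral>\<^sup>+y. ennreal (\<bar>?D y\<bar> * u y) \<partial>lborel) < \<infinity>"
    using supp s0 by (intro compact_weight_finite[where b = b] continuous_intros ch) auto
  have "(\<lambda>j. LINT z|(lborel \<Otimes>\<^sub>M lborel). (case z of (x, y) \<Rightarrow> ?D y * (F x * Eker s (e j) y x)))
    \<longlonglongrightarrow> (LINT z|(lborel \<Otimes>\<^sub>M lborel). (case z of (x, y) \<Rightarrow> ?D y * (F x * norm (x - y) powr (- 2 * s))))"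
  proof (rule integral_dominated_convergence[where w = "\<lambda>z. norm (case z of (x, y) \<Rightarrow> ?D y * (F x * norm (x - y) powr (- 2 * s)))"])
    show "integrable (lborel \<Otimes>\<^sub>M lborel) (\<lambda>z. norm (case z of (x, y) \<Rightarrow> ?D y * (F x * norm (x - y) powr (- 2 * s))))"
      by (rule integrable_norm[OF pair_integral(1)[OF Dm fin]])
    show "AE z in (lborel \<Otimes>\<^sub>M lborel). (\<lambda>j. case z of (x, y) \<Rightarrow> ?D y * (F x * Eker s (e j) y x))
       \<longlonglongrightarrow> (case z of (x, y) \<Rightarrow> ?D y * (F x * norm (x - y) powr (- 2 * s)))"
      using AE_pair_neq
    proof eventually_elim
      case (elim z)
      have "(\<lambda>j. Eker s (e j) (snd z) (fst z)) \<longlonglongrightarrow> norm (fst z - snd z) powr (- 2 * s)"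
        using elim e by (intro Eker_tendsto) auto
      then show ?case by (auto simp: case_prod_beta intro!: tendsto_intros)
    qed
    show "AE z in (lborel \<Otimes>\<^sub>M lborel). norm (case z of (x, y) \<Rightarrow> ?D y * (F x * Eker s (e j) y x))
       \<le> norm (case z of (x, y) \<Rightarrow> ?D y * (F x * norm (x - y) powr (- 2 * s)))" for j
      using AE_pair_neq
    proof eventually_elim
      case (elim z)
      then show ?case
        using F(2)[of "fst z"] Eker_le[OF elim, of s "e j"] s Eker_nonneg[of s "e j" "snd z" "fst z"]
        by (auto simp: case_prod_beta abs_mult intro!: mult_left_mono)
    qed
  qed measurable
  moreover have "(LINT z|(lborel \<Otimes>\<^sub>M lborel). (case z of (x, y) \<Rightarrow> ?D y * (F x * Eker s (e j) y x)))
     = 2 * s * (LINT z|(lborel \<Otimes>\<^sub>M lborel). (case z of (x, y) \<Rightarrow> h y * (y \<bullet> (y - x)) * (F x * Eker (s + 1) (e j) y x)))" for j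
    by (rule pair_by_parts(1)[OF e(1) h supp])
  ultimately show ?thesis by (simp only: pair_integral(2)[OF Dm fin])
qed

end

text \<open>The weight is a kernel with \<open>e = 0\<close> and pole 0, so the calculus for
  \<open>Eker\<close> applies to it. At the origin both sides are 0 by the convention for
  \<open>0 powr _\<close>.\<close>

lemma norm_powr_eq_Eker: "norm x powr (- t) = Eker (t / 2) 0 0 (x :: real ^ 'n)"
proof (cases "x = 0")
  case False
  have "Eker (t / 2) 0 0 x = (norm x powr 2) powr (- (t / 2))"
    unfolding Eker_def using False by (simp add: powr_numeral)
  also have "\<dots> = norm x powr (- t)" by (simp only: powr_powr) simp
  finally show ?thesis by simp
qed (simp add: Eker_def)

lemma Ck_on_norm_powr: "Ck_on k (\<lambda>x :: real ^ 'n. norm x powr (- t)) (- {0})"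
  unfolding norm_powr_eq_Eker by (rule Ck_on_Eker) auto

lemma euler_norm_powr:
  assumes "(x :: real ^ 'n) \<noteq> 0"
  shows "euler (\<lambda>x. norm x powr (- t)) x = - t * norm x powr (- t)"
proof -
  have p: "0\<^sup>2 + (norm (x - 0))\<^sup>2 > 0" using assms by simp
  have "euler (\<lambda>x. norm x powr (- t)) x = (\<Sum>i\<in>UNIV. x $ i * (- 2 * (t / 2) * (x $ i - 0 $ i) * Eker (t / 2 + 1) 0 0 x))"
    unfolding norm_powr_eq_Eker euler_def partial_Eker[OF p] ..
  also have "\<dots> = - t * ((norm x)\<^sup>2 * Eker (t / 2 + 1) 0 0 x)"
    unfolding power2_norm_eq_inner inner_vec_def by (simp add: sum_distrib_left sum_distrib_right algebra_simps)
  also have "(norm x)\<^sup>2 * Eker (t / 2 + 1) 0 0 x = Eker (t / 2) 0 0 x"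
  proof -
    have "- (t / 2) = 1 + - (t / 2 + 1)" by simp
    then show ?thesis unfolding Eker_def using p by (simp only: powr_mult_base less_imp_le) (simp add: powr_mult_base)
  qed
  finally show ?thesis by (simp add: norm_powr_eq_Eker)
qed

lemma energy_weight_Ck:
  fixes u :: "real ^ 'n \<Rightarrow> real"
  assumes "Ck_on 1 u (- {0})" "\<And>x. 0 < u x" "2 \<le> k"
  shows "Ck_on 1 (\<lambda>x. norm x powr (- t) * u x powr q * cutoff 2 k x) UNIV"
    and "norm x > 2 * real k \<Longrightarrow> norm x powr (- t) * u x powr q * cutoff 2 k x = 0"
proof -
  have z: "cutoff 2 k x = 0" if "norm x < 1 / real k \<or> norm x > 2 * real k" for x :: "real ^ 'n"
    using cutoff_props(3)[of 2 k x] assms(3) that by auto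
  have "Ck_on 1 (\<lambda>x. u x powr q) (- {0})" by (rule Ck_on_powr[OF _ assms(2,1)]) auto
  then have "Ck_on 1 (\<lambda>x. norm x powr (- t) * u x powr q) (- {0})"
    using Ck_on_norm_powr[of 1 t] by (intro Ck_on_mult) auto
  then show "Ck_on 1 (\<lambda>x. norm x powr (- t) * u x powr q * cutoff 2 k x) UNIV"
    using assms(3) by (rule_tac Ck_on_mult_supp[where a = "1 / real k" and b = "2 * real k"])
      (simp_all only: z Ck_on_cutoff one_less_numeral_iff semiring_norm, simp)
  show "norm x > 2 * real k \<Longrightarrow> norm x powr (- t) * u x powr q * cutoff 2 k x = 0" using z[of x] by simp
qed

text \<open>Since \<open>u * euler (u powr q)\<close> is \<open>q / (q + 1)\<close> times
  \<open>euler (u powr (q + 1))\<close>, the integrand is a divergence, which integrates to zero,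
  plus a term free of derivatives of \<open>u\<close>.\<close>

lemma energy_identity:
  fixes t :: real and u :: "real ^ 'n \<Rightarrow> real"
  assumes u: "Ck_on 1 u (- {0})" "\<And>x. 0 < u x" and k: "2 \<le> k" and q: "0 < q"
  defines "h \<equiv> \<lambda>x. norm x powr (- t) * u x powr q * cutoff 2 k x"
  shows "(LINT x|lborel. (real CARD('n) * h x + euler h x) * u x)
    = (LINT x|lborel. norm x powr (- t) * u x powr (q + 1) * ((real CARD('n) - t) * cutoff 2 k x + euler (cutoff 2 k) x)) / (q + 1)"
proof -
  let ?n = "real CARD('n)"
  let ?\<eta> = "cutoff 2 k :: real ^ 'n \<Rightarrow> real"
  define h2 where "h2 x = norm x powr (- t) * u x powr (q + 1) * ?\<eta> x" for x
  have C: "Ck_on 1 h UNIV" "Ck_on 1 h2 UNIV" "\<And>x. norm x > 2 * real k \<Longrightarrow> h x = 0" "\<And>x. norm x > 2 * real k \<Longrightarrow> h2 x = 0"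
    unfolding h_def h2_def using energy_weight_Ck[OF u k] by auto
  have \<eta>0: "?\<eta> x = 0" if "norm x < 1 / real k \<or> norm x > 2 * real k" for x
    using cutoff_props(3)[of 2 k x] k that by auto
  have C\<eta>: "Ck_on 1 ?\<eta> UNIV" by (rule Ck_on_cutoff) simp
  have e0: "euler g 0 = 0" for g :: "real ^ 'n \<Rightarrow> real" by (simp add: euler_def)
  define T where "T x = norm x powr (- t) * u x powr (q + 1) * ((?n - t) * ?\<eta> x + euler ?\<eta> x)" for x
  \<comment> \<open>\<open>?n * h2 x + euler h2 x\<close> is the divergence part; \<open>T\<close>
    collects the homogeneity \<open>- t\<close> of the weight and the derivative of the
    cutoff.\<close>
  have pt: "(?n * h x + euler h x) * u x = q / (q + 1) * (?n * h2 x + euler h2 x) + T x / (q + 1)" for x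
  proof (cases "x = 0")
    case True
    have "?\<eta> 0 = 0" using \<eta>0[of 0] k by simp
    then show ?thesis unfolding True e0 by (simp add: h_def h2_def T_def e0)
  next
    case False
    let ?A = "\<lambda>x :: real ^ 'n. norm x powr (- t)"
    have dA: "?A differentiable (at x)" and du: "u differentiable (at x)" and d\<eta>: "?\<eta> differentiable (at x)"
      using Ck_on_norm_powr[of 1 t] u(1) C\<eta> False
      by (auto intro: Ck_on_differentiable[of "- {0}" 0] Ck_on_differentiable[of UNIV 0])
    have dp: "((\<lambda>y. y powr p) has_real_derivative p * u x powr (p - 1)) (at (u x))" for p
      using u(2)[of x] by (auto intro!: derivative_eq_intros)
    have dup: "(\<lambda>x. u x powr p) differentiable (at x)" for p by (rule partial_compose(2)[OF du dp])
    have eup: "euler (\<lambda>x. u x powr p) x = p * u x powr (p - 1) * euler u x" for p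
      by (rule euler_compose[OF du dp])
    have eh: "euler (\<lambda>x. ?A x * u x powr p * ?\<eta> x) x
       = ?A x * u x powr p * euler ?\<eta> x + (?A x * (p * u x powr (p - 1) * euler u x) + (- t * ?A x) * u x powr p) * ?\<eta> x" for p
      by (subst euler_mult[OF differentiable_mult[OF dA dup] d\<eta>], subst euler_mult[OF dA dup])
        (simp add: eup euler_norm_powr[OF False])
    have b1: "u x powr (q + 1) = u x * u x powr q" "u x powr q = u x * u x powr (q - 1)"
      using u(2)[of x] powr_mult_base[of "u x" q] powr_mult_base[of "u x" "q - 1"] by (auto simp: add.commute)
    define Uq where "Uq = u x powr (q - 1)"
    have e1: "euler h x = ?A x * (u x * Uq) * euler ?\<eta> x + (?A x * (q * Uq * euler u x) + (- t * ?A x) * (u x * Uq)) * ?\<eta> x"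
      unfolding h_def eh Uq_def b1(2)[symmetric] ..
    have e2: "euler h2 x = ?A x * (u x * (u x * Uq)) * euler ?\<eta> x
        + (?A x * ((q + 1) * (u x * Uq) * euler u x) + (- t * ?A x) * (u x * (u x * Uq))) * ?\<eta> x"
      using eh[of "q + 1"] unfolding h2_def Uq_def b1(2)[symmetric] b1(1)[symmetric] by simp
    have hh: "h x = ?A x * (u x * Uq) * ?\<eta> x" "h2 x = ?A x * (u x * (u x * Uq)) * ?\<eta> x"
      "T x = ?A x * (u x * (u x * Uq)) * ((?n - t) * ?\<eta> x + euler ?\<eta> x)"
      unfolding h_def h2_def T_def Uq_def b1(2)[symmetric] b1(1)[symmetric] by simp_all
    have "(q + 1) * ((?n * h x + euler h x) * u x) = q * (?n * h2 x + euler h2 x) + T x"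
      unfolding e1 e2 hh by algebra
    then have "(?n * h x + euler h x) * u x = (q * (?n * h2 x + euler h2 x) + T x) / (q + 1)"
      using q by (simp add: eq_divide_eq mult.commute)
    then show ?thesis by (simp only: add_divide_distrib times_divide_eq_left)
  qed
  have i0: "integrable lborel (\<lambda>x. ?n * g x + euler g x)" "integrable lborel (\<lambda>x. (?n * g x + euler g x) * w x)"
    if "Ck_on 1 g UNIV" "\<And>x. norm x > 2 * real k \<Longrightarrow> g x = 0" "continuous_on UNIV w" for g w
  proof -
    have "euler g x = 0" if "norm x > 2 * real k" for x
      using that \<open>\<And>x. norm x > 2 * real k \<Longrightarrow> g x = 0\<close> euler_supp[of 0 "2 * real k" g x] by auto
    then show "integrable lborel (\<lambda>x. ?n * g x + euler g x)" "integrable lborel (\<lambda>x. (?n * g x + euler g x) * w x)"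
      using that Ck_on_continuous[OF that(1)] continuous_on_euler[OF that(1)]
      by (auto intro!: integrable_compact_supp[where b = "2 * real k"] continuous_intros)
  qed
  have iT: "integrable lborel T"
  proof (rule integrable_compact_supp[where b = "2 * real k"])
    have e\<eta>0: "euler ?\<eta> x = 0" if "norm x < 1 / real k \<or> norm x > 2 * real k" for x
      using \<eta>0 that by (rule euler_supp)
    have "Ck_on 0 T UNIV" unfolding T_def
      using u k Ck_on_continuous[OF C\<eta>] continuous_on_euler[OF C\<eta>] Ck_on_mono[OF u(1), of 0] Ck_on_norm_powr[of 0 t]
      by (intro Ck_on_mult_supp[where a = "1 / real k" and b = "2 * real k"] Ck_on_mult Ck_on_powr)
        (auto intro!: continuous_intros simp: \<eta>0 e\<eta>0)
    then show "continuous_on UNIV T" by simp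
    show "T x = 0" if "norm x > 2 * real k" for x unfolding T_def using \<eta>0[of x] e\<eta>0[of x] that by simp
  qed
  have "(LINT x|lborel. (?n * h x + euler h x) * u x) = (LINT x|lborel. q / (q + 1) * (?n * h2 x + euler h2 x) + T x / (q + 1))"
    by (rule Bochner_Integration.integral_cong[OF refl pt])
  also have "\<dots> = q / (q + 1) * (LINT x|lborel. ?n * h2 x + euler h2 x) + (LINT x|lborel. T x) / (q + 1)"
    using i0(1)[OF C(2) C(4) continuous_on_const] iT by (subst Bochner_Integration.integral_add) auto
  also have "(LINT x|lborel. ?n * h2 x + euler h2 x) = 0"
    by (rule integral_euler[OF C(2) C(4)])
  finally show ?thesis by (simp add: T_def)
qed

text \<open>The cutoffs tend to 1 and their dilation derivatives to 0 off the origin, both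
  boundedly. In the factor \<open>n - t\<close>, \<open>n\<close> is the divergence of
  \<open>x\<close> and \<open>- t\<close> the homogeneity of the weight.\<close>

lemma energy_identity_limit:
  fixes t :: real and u :: "real ^ 'n \<Rightarrow> real"
  assumes u: "Ck_on 1 u (- {0})" "\<And>x. 0 < u x" "continuous_on UNIV u" and q: "0 < q"
    and int: "integrable lborel (\<lambda>x. norm x powr (- t) * u x powr (q + 1))"
  defines "h \<equiv> \<lambda>k x. norm x powr (- t) * u x powr q * cutoff 2 k x"
  shows "(\<lambda>k. LINT x|lborel. (real CARD('n) * h (k + 2) x + euler (h (k + 2)) x) * u x)
    \<longlonglongrightarrow> (real CARD('n) - t) / (q + 1) * (LINT x|lborel. norm x powr (- t) * u x powr (q + 1))"
proof -
  let ?n = "real CARD('n)"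
  let ?g = "\<lambda>x. norm x powr (- t) * u x powr (q + 1)"
  obtain B where B: "0 \<le> B" "\<And>k (x :: real ^ 'n). 2 \<le> k \<Longrightarrow> \<bar>euler (cutoff 2 k) x\<bar> \<le> B"
    using euler_cutoff_bound by blast
  note [measurable] = borel_measurable_continuous_onI[OF u(3)]
  have C\<eta>: "Ck_on 1 (cutoff 2 k :: real ^ 'n \<Rightarrow> real) UNIV" for k by (rule Ck_on_cutoff) simp
  note [measurable] = borel_measurable_continuous_onI[OF Ck_on_continuous[OF C\<eta>]] borel_measurable_continuous_onI[OF continuous_on_euler[OF C\<eta>]]
  have "(\<lambda>k. LINT x|lborel. ?g x * ((?n - t) * cutoff 2 (k + 2) x + euler (cutoff 2 (k + 2)) x))
    \<longlonglongrightarrow> (LINT x|lborel. ?g x * (?n - t))"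
  proof (rule integral_dominated_convergence[where w = "\<lambda>x. ?g x * (\<bar>?n - t\<bar> + B)"])
    show "integrable lborel (\<lambda>x. ?g x * (\<bar>?n - t\<bar> + B))" using int by (rule integrable_mult_left)
    show "AE x in lborel. (\<lambda>k. ?g x * ((?n - t) * cutoff 2 (k + 2) x + euler (cutoff 2 (k + 2)) x)) \<longlonglongrightarrow> ?g x * (?n - t)"
      using AE_lborel_singleton[of 0]
    proof eventually_elim
      case (elim x)
      show ?case by (rule tendsto_eventually, use cutoff_eventually_const[OF elim] in eventually_elim) simp
    qed
    show "AE x in lborel. norm (?g x * ((?n - t) * cutoff 2 (k + 2) x + euler (cutoff 2 (k + 2)) x)) \<le> ?g x * (\<bar>?n - t\<bar> + B)" for k
    proof (rule AE_I2)
      fix x :: "real ^ 'n"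
      have "\<bar>(?n - t) * cutoff 2 (k + 2) x + euler (cutoff 2 (k + 2)) x\<bar> \<le> \<bar>?n - t\<bar> * 1 + B"
        using cutoff_props(1,2)[of 2 "k + 2" x] B(2)[of "k + 2" x]
        by (intro order_trans[OF abs_triangle_ineq] add_mono) (auto simp: abs_mult intro!: mult_left_le)
      note m = this
      show "norm (?g x * ((?n - t) * cutoff 2 (k + 2) x + euler (cutoff 2 (k + 2)) x)) \<le> ?g x * (\<bar>?n - t\<bar> + B)"
      proof -
        have "0 \<le> ?g x" by simp
        from mult_left_mono[OF m this] show ?thesis
          unfolding real_norm_def abs_mult[of "?g x"] abs_of_nonneg[OF \<open>0 \<le> ?g x\<close>] by simp
      qed
    qed
  qed measurable
  then have "(\<lambda>k. (LINT x|lborel. ?g x * ((?n - t) * cutoff 2 (k + 2) x + euler (cutoff 2 (k + 2)) x)) / (q + 1))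
    \<longlonglongrightarrow> (LINT x|lborel. ?g x * (?n - t)) / (q + 1)" using q by (intro tendsto_divide tendsto_const) auto
  moreover have "(LINT x|lborel. (?n * h (k + 2) x + euler (h (k + 2)) x) * u x)
     = (LINT x|lborel. ?g x * ((?n - t) * cutoff 2 (k + 2) x + euler (cutoff 2 (k + 2)) x)) / (q + 1)" for k
    unfolding h_def by (rule energy_identity[OF u(1,2) _ q]) simp
  ultimately show ?thesis by (simp add: mult.commute)
qed

text \<open>The sum of both differentiated integral equations is evaluated in two ways:
  \<open>energy_identity_limit\<close> gives the energy with the factor on the left, while in the
  double integral the symmetrized field tends to \<open>|x - y|^2\<close>, which lowers the kernel
  \<open>s + 1\<close> to \<open>s\<close> and leaves \<open>2 * s\<close> times the same
  energy.\<close>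

theorem pohozaev_exponents:
  fixes t :: real and u v :: "real ^ 'n \<Rightarrow> real"
  defines "F \<equiv> \<lambda>q w (x :: real ^ 'n). norm x powr (- t) * w x powr q"
  assumes U: "polyharmonic_growth l s a C u (F q2 v)" and V: "polyharmonic_growth l s b C' v (F q1 u)"
    and pos: "\<And>x. 0 < u x" "\<And>x. 0 < v x" and q: "0 < q1" "0 < q2"
    and int: "integrable lborel (F (q1 + 1) u)" "integrable lborel (F (q2 + 1) v)"
  shows "(real CARD('n) - t) * (1 / (q1 + 1) + 1 / (q2 + 1)) = 2 * s"
proof -
  interpret U: polyharmonic_growth l s a C u "F q2 v" by (rule U)
  interpret V: polyharmonic_growth l s b C' v "F q1 u" by (rule V)
  let ?n = "real CARD('n)"
  let ?\<eta> = "\<lambda>k. cutoff 2 (k + 2) :: real ^ 'n \<Rightarrow> real"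
  let ?P = "(lborel :: (real ^ 'n) measure) \<Otimes>\<^sub>M (lborel :: (real ^ 'n) measure)"
  have C1: "Ck_on 1 u (- {0})" "Ck_on 1 v (- {0})"
    using Ck_on_mono[OF U.u(3), of 1] Ck_on_mono[OF V.u(3), of 1] U.l by auto
  define c where "c = U.rconst"
  have c: "0 < c" unfolding c_def by (rule U.rconst_pos)
  have cV: "V.rconst = c" unfolding c_def U.rconst_def V.rconst_def ..
  have Gu: "F q1 u x * u x = F (q1 + 1) u x" "F q2 v x * v x = F (q2 + 1) v x" for x
    unfolding F_def using pos[of x] by (simp_all add: powr_add)
  have nnF: "0 \<le> F q w x" for q w x unfolding F_def by simp
  have fin: "(\<integral>\<^sup>+x. ennreal (\<bar>F q1 u x\<bar> * u x) \<partial>lborel) < \<infinity>" "(\<integral>\<^sup>+x. ennreal (\<bar>F q2 v x\<bar> * v x) \<partial>lborel) < \<infinity>"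
    using int nnF by (simp_all add: Gu nn_integral_eq_integral)
  define H where "H z = (case z of (x, y) \<Rightarrow> F q1 u y * (F q2 v x * norm (x - y) powr (- 2 * s)))" for z
  define A where "A = (LINT x|lborel. F (q1 + 1) u x)"
  have HA: "integrable ?P H" "integral\<^sup>L ?P H = c * A"
    unfolding H_def[abs_def] using U.pair_integral[OF V.F_borel fin(1)] by (simp_all add: c_def A_def Gu)
  have swap: "integral\<^sup>L ?P (\<lambda>(x, y). f (y, x)) = integral\<^sup>L ?P f" if "f \<in> borel_measurable ?P" for f :: "(real^'n) \<times> (real^'n) \<Rightarrow> real"
    by (rule lborel_pair.integral_product_swap[OF that])
  \<comment> \<open>The kernel is symmetric, so exchanging the variables identifies the double
    integrals of the two equations and thus the two energies.\<close>
  have "c * A = c * (LINT x|lborel. F (q2 + 1) v x)"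
  proof -
    let ?f = "\<lambda>(x, y). F q2 v y * (F q1 u x * norm (x - y) powr (- 2 * s))"
    have "integral\<^sup>L ?P ?f = c * (LINT x|lborel. F (q2 + 1) v x)"
      using V.pair_integral(2)[OF U.F_borel fin(2)] by (simp add: cV Gu)
    moreover have "integral\<^sup>L ?P (\<lambda>(x, y). ?f (y, x)) = integral\<^sup>L ?P ?f"
      by (rule swap[OF V.pair_measurable[OF U.F_borel]])
    moreover have "(\<lambda>(x, y). ?f (y, x)) = H" by (auto simp: H_def norm_minus_commute)
    ultimately show ?thesis using HA(2) by metis
  qed
  then have AV: "(LINT x|lborel. F (q2 + 1) v x) = A" using c by simp
  \<comment> \<open>Needed to cancel \<open>c * A\<close> at the end: a vanishing energy contradicts
    positivity of \<open>u\<close>.\<close>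
  have A: "A \<noteq> 0"
  proof
    assume "A = 0"
    then have "AE x in lborel. F (q1 + 1) u x = 0"
      unfolding A_def using integral_nonneg_eq_0_iff_AE[OF int(1) AE_I2[OF nnF]] by simp
    then have "AE x in (lborel :: (real ^ 'n) measure). False"
      using AE_lborel_singleton[of 0]
    proof eventually_elim
      case (elim x)
      then show ?case using pos(1)[of x] by (simp add: F_def)
    qed
    then have "emeasure lborel (UNIV :: (real ^ 'n) set) = 0" by (simp add: AE_iff_measurable[of UNIV])
    then show False using emeasure_lborel_UNIV[where 'a = "real ^ 'n"] by simp
  qed
  define e where "e j = inverse (real (Suc j))" for j
  have e: "0 < e j" for j unfolding e_def by simp
  have e0: "e \<longlonglongrightarrow> 0" unfolding e_def by (rule LIMSEQ_inverse_real_of_nat)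
  obtain L where L: "0 \<le> L" "\<And>k (x :: real ^ 'n) y. 2 \<le> k \<Longrightarrow>
      \<bar>(cutoff 2 k y *\<^sub>R y - cutoff 2 k x *\<^sub>R x) \<bullet> (y - x)\<bar> \<le> L * (norm (y - x))\<^sup>2"
    using cutoff_field_lipschitz by blast
  \<comment> \<open>The first summand comes from the equation for \<open>u\<close>, the second from
    that for \<open>v\<close> after exchanging \<open>x\<close> and \<open>y\<close>. Their
    difference vanishes on the diagonal, which the Lipschitz bound \<open>Zb\<close>
    quantifies.\<close>
  define Z where "Z k x y = (?\<eta> k y *\<^sub>R y - ?\<eta> k x *\<^sub>R x) \<bullet> (y - x)" for k and x y :: "real ^ 'n"
  have Zb: "\<bar>Z k x y\<bar> \<le> L * (norm (y - x))\<^sup>2" for k x y unfolding Z_def by (rule L(2)) simp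
  define h1 where "h1 k x = F q1 u x * ?\<eta> k x" for k x
  define h2 where "h2 k x = F q2 v x * ?\<eta> k x" for k x
  have h1: "Ck_on 1 (h1 k) UNIV" "\<And>x. norm x > 2 * real (k + 2) \<Longrightarrow> h1 k x = 0" for k
    using energy_weight_Ck[OF C1(1) pos(1), of "k + 2"] unfolding h1_def F_def by auto
  have h2: "Ck_on 1 (h2 k) UNIV" "\<And>x. norm x > 2 * real (k + 2) \<Longrightarrow> h2 k x = 0" for k
    using energy_weight_Ck[OF C1(2) pos(2), of "k + 2"] unfolding h2_def F_def by auto
  define D1 where "D1 k = (LINT x|lborel. (?n * h1 k x + euler (h1 k) x) * u x)" for k
  define D2 where "D2 k = (LINT x|lborel. (?n * h2 k x + euler (h2 k) x) * v x)" for k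
  have etam [measurable]: "?\<eta> k \<in> borel_measurable borel" for k
    using Ck_on_cutoff[of 0 2 "k + 2"] by (auto intro: borel_measurable_continuous_onI)
  have Em [measurable]: "(\<lambda>(x, y). Eker r d y x) \<in> borel_measurable ?P" for r d
    unfolding Eker_def by measurable
  have Fm [measurable]: "F q1 u \<in> borel_measurable borel" "F q2 v \<in> borel_measurable borel"
    using U.F_borel V.F_borel by auto
  define S where "S k j z = (case z of (x, y) \<Rightarrow> F q1 u y * F q2 v x * Z k x y * Eker (s + 1) (e j) y x)" for k j z
  have Sm: "S k j \<in> borel_measurable ?P" for k j unfolding S_def[abs_def] Z_def by measurable
  have Sint: "(\<lambda>j. 2 * s * integral\<^sup>L ?P (S k j)) \<longlonglongrightarrow> c * (D1 k + D2 k)" for k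
  proof -
    define J1 where "J1 j z = (case z of (x, y) \<Rightarrow> h1 k y * (y \<bullet> (y - x)) * (F q2 v x * Eker (s + 1) (e j) y x))" for j z
    define J2 where "J2 j z = (case z of (x, y) \<Rightarrow> h2 k y * (y \<bullet> (y - x)) * (F q1 u x * Eker (s + 1) (e j) y x))" for j z
    have i: "integrable ?P (J1 j)" "integrable ?P (J2 j)" for j
      unfolding J1_def[abs_def] J2_def[abs_def]
      using U.pair_by_parts(2)[OF e h1(1) h1(2)] V.pair_by_parts(2)[OF e h2(1) h2(2)] by auto
    have l1: "(\<lambda>j. 2 * s * integral\<^sup>L ?P (J1 j)) \<longlonglongrightarrow> c * D1 k"
      using U.pair_by_parts_limit[OF e e0 h1(1) h1(2)] unfolding J1_def D1_def c_def .
    have l2: "(\<lambda>j. 2 * s * integral\<^sup>L ?P (J2 j)) \<longlonglongrightarrow> c * D2 k"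
      using V.pair_by_parts_limit[OF e e0 h2(1) h2(2)] unfolding J2_def D2_def cV .
    have "integral\<^sup>L ?P (J1 j) + integral\<^sup>L ?P (J2 j) = integral\<^sup>L ?P (S k j)" for j
    proof -
      have i': "integrable ?P (\<lambda>(x, y). J2 j (y, x))" by (rule lborel_pair.integrable_product_swap[OF i(2)])
      have "integral\<^sup>L ?P (J2 j) = integral\<^sup>L ?P (\<lambda>(x, y). J2 j (y, x))"
        by (rule swap[symmetric]) (use i(2) in auto)
      then have "integral\<^sup>L ?P (J1 j) + integral\<^sup>L ?P (J2 j) = integral\<^sup>L ?P (\<lambda>z. J1 j z + (case z of (x, y) \<Rightarrow> J2 j (y, x)))"
        using i(1) i' by (simp add: Bochner_Integration.integral_add)
      also have "(\<lambda>z. J1 j z + (case z of (x, y) \<Rightarrow> J2 j (y, x))) = S k j"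
        by (auto simp: fun_eq_iff J1_def J2_def S_def Z_def h1_def h2_def Eker_sym[of _ _ _ "_ :: real^'n"]
          inner_diff_left inner_diff_right algebra_simps)
      finally show ?thesis .
    qed
    then show ?thesis using tendsto_add[OF l1 l2] by (simp add: distrib_left[symmetric])
  qed
  define R where "R k z = (case z of (x, y) \<Rightarrow> F q1 u y * F q2 v x * Z k x y * norm (x - y) powr (- 2 * (s + 1)))" for k z
  have Rm: "R k \<in> borel_measurable ?P" for k unfolding R_def[abs_def] Z_def by measurable
  have iLH: "integrable ?P (\<lambda>z. L * H z)" using HA(1) by (rule integrable_mult_right)
  \<comment> \<open>The limits are taken one after the other, first \<open>e\<close> to 0 with the
    cutoff fixed, then \<open>k\<close> to infinity. Both are dominated by
    \<open>L * H\<close>.\<close>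
  have "(\<lambda>j. integral\<^sup>L ?P (S k j)) \<longlonglongrightarrow> integral\<^sup>L ?P (R k)" for k
  proof (rule integral_dominated_convergence[OF Rm Sm iLH])
    show "AE z in ?P. (\<lambda>j. S k j z) \<longlonglongrightarrow> R k z"
      using AE_pair_neq
    proof eventually_elim
      case (elim z)
      show ?case unfolding S_def R_def case_prod_beta using elim e0
        by (intro tendsto_intros Eker_tendsto) auto
    qed
    show "AE z in ?P. norm (S k j z) \<le> L * H z" for j
      using AE_pair_neq
    proof eventually_elim
      case (elim z)
      let ?x = "fst z" and ?y = "snd z"
      have "\<bar>Z k ?x ?y\<bar> * Eker (s + 1) (e j) ?y ?x \<le> L * (norm (?y - ?x))\<^sup>2 * Eker (s + 1) (e j) ?y ?x"
        by (intro mult_right_mono Zb Eker_nonneg)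
      also have "\<dots> \<le> L * norm (?x - ?y) powr (- 2 * s)"
        unfolding mult.assoc using elim U.s L(1) by (intro mult_left_mono Eker_Suc_bound(1)) auto
      finally have "F q1 u ?y * F q2 v ?x * (\<bar>Z k ?x ?y\<bar> * Eker (s + 1) (e j) ?y ?x)
          \<le> F q1 u ?y * F q2 v ?x * (L * norm (?x - ?y) powr (- 2 * s))"
        by (intro mult_left_mono mult_nonneg_nonneg nnF)
      moreover have "\<bar>F q1 u ?y * F q2 v ?x * Z k ?x ?y * Eker (s + 1) (e j) ?y ?x\<bar>
          = F q1 u ?y * F q2 v ?x * (\<bar>Z k ?x ?y\<bar> * Eker (s + 1) (e j) ?y ?x)"
        by (simp only: abs_mult abs_of_nonneg[OF nnF] abs_of_nonneg[OF Eker_nonneg] mult.assoc)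
      ultimately show ?case unfolding S_def H_def case_prod_beta real_norm_def by (simp only: mult_ac)
    qed
  qed
  then have "c * (D1 k + D2 k) = 2 * s * integral\<^sup>L ?P (R k)" for k
    using LIMSEQ_unique[OF Sint tendsto_mult[OF tendsto_const]] by blast
  moreover have "(\<lambda>k. 2 * s * integral\<^sup>L ?P (R k)) \<longlonglongrightarrow> 2 * s * integral\<^sup>L ?P H"
  proof (intro tendsto_mult tendsto_const integral_dominated_convergence[OF _ Rm iLH])
    show "H \<in> borel_measurable ?P" using HA(1) by auto
    have zz: "(norm (y - x))\<^sup>2 * norm (x - y) powr (- 2 * (s + 1)) = norm (x - y) powr (- 2 * s)" if "x \<noteq> y" for x y :: "real ^ 'n"
    proof -
      have "(norm (y - x))\<^sup>2 = norm (x - y) powr 2" using that by (simp add: powr_numeral norm_minus_commute)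
      also have "norm (x - y) powr 2 * norm (x - y) powr (- 2 * (s + 1)) = norm (x - y) powr (2 + - 2 * (s + 1))"
        by (rule powr_add[symmetric])
      also have "2 + - 2 * (s + 1) = - 2 * s" by simp
      finally show ?thesis .
    qed
    \<comment> \<open>The cutoffs become 1 only at nonzero points, so pairs with a zero component
      are discarded as a null set, together with the diagonal.\<close>
    show "AE z in ?P. (\<lambda>k. R k z) \<longlonglongrightarrow> H z"
    proof -
      have m: "{z \<in> space ?P. fst z \<noteq> 0 \<and> snd z \<noteq> 0} \<in> sets ?P" by measurable
      have "AE y in (lborel :: (real ^ 'n) measure). fst (x, y) \<noteq> 0 \<and> snd (x, y) \<noteq> 0" if "x \<noteq> 0" for x :: "real ^ 'n"
        using AE_lborel_singleton[of 0] by eventually_elim (use that in simp)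
      then have "AE x in lborel. AE y in (lborel :: (real ^ 'n) measure). fst (x, y) \<noteq> (0 :: real ^ 'n) \<and> snd (x, y) \<noteq> 0"
        using AE_lborel_singleton[of "0 :: real ^ 'n"] by (rule eventually_mono[rotated])
      from lborel_pair.AE_pair_measure[OF m this]
      have "AE z in ?P. fst z \<noteq> 0 \<and> snd z \<noteq> 0" .
      then show ?thesis using AE_pair_neq
      proof eventually_elim
        case (elim z)
        have "eventually (\<lambda>k. R k z = H z) sequentially"
        proof -
          have "eventually (\<lambda>k. ?\<eta> k (fst z) = 1) sequentially" "eventually (\<lambda>k. ?\<eta> k (snd z) = 1) sequentially"
            using cutoff_eventually_const[of "fst z"] cutoff_eventually_const[of "snd z"] elim
            by (auto elim: eventually_mono)
          then show ?thesis
          proof eventually_elim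
            case (elim k)
            then have "Z k (fst z) (snd z) = (norm (snd z - fst z))\<^sup>2" by (simp add: Z_def power2_norm_eq_inner)
            then show ?case using zz[OF \<open>fst z \<noteq> snd z\<close>] by (simp add: R_def H_def case_prod_beta mult.assoc)
          qed
        qed
        then show ?case by (rule tendsto_eventually)
      qed
    qed
    show "AE z in ?P. norm (R k z) \<le> L * H z" for k
      using AE_pair_neq
    proof eventually_elim
      case (elim z)
      let ?x = "fst z" and ?y = "snd z"
      have "\<bar>Z k ?x ?y\<bar> * norm (?x - ?y) powr (- 2 * (s + 1)) \<le> L * (norm (?y - ?x))\<^sup>2 * norm (?x - ?y) powr (- 2 * (s + 1))"
        by (intro mult_right_mono Zb) auto
      also have "\<dots> = L * norm (?x - ?y) powr (- 2 * s)" unfolding mult.assoc zz[OF elim] ..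
      finally have "F q1 u ?y * F q2 v ?x * (\<bar>Z k ?x ?y\<bar> * norm (?x - ?y) powr (- 2 * (s + 1)))
          \<le> F q1 u ?y * F q2 v ?x * (L * norm (?x - ?y) powr (- 2 * s))"
        by (intro mult_left_mono mult_nonneg_nonneg nnF)
      moreover have "\<bar>F q1 u ?y * F q2 v ?x * Z k ?x ?y * norm (?x - ?y) powr (- 2 * (s + 1))\<bar>
          = F q1 u ?y * F q2 v ?x * (\<bar>Z k ?x ?y\<bar> * norm (?x - ?y) powr (- 2 * (s + 1)))"
        by (simp only: abs_mult abs_of_nonneg[OF nnF] abs_of_nonneg[OF powr_ge_zero] mult.assoc)
      ultimately show ?case unfolding R_def H_def case_prod_beta real_norm_def by (simp only: mult_ac)
    qed
  qed
  ultimately have l1: "(\<lambda>k. c * (D1 k + D2 k)) \<longlonglongrightarrow> 2 * s * (c * A)" by (simp add: HA(2))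
  have "D1 \<longlonglongrightarrow> (?n - t) / (q1 + 1) * A"
    using energy_identity_limit[OF C1(1) pos(1) U.u(1) q(1), of t] int(1)
    unfolding D1_def h1_def[abs_def] A_def F_def by simp
  moreover have "D2 \<longlonglongrightarrow> (?n - t) / (q2 + 1) * A"
    using energy_identity_limit[OF C1(2) pos(2) V.u(1) q(2), of t] int(2)
    unfolding D2_def h2_def[abs_def] AV[symmetric] F_def by simp
  ultimately have "(\<lambda>k. c * (D1 k + D2 k)) \<longlonglongrightarrow> c * ((?n - t) / (q1 + 1) * A + (?n - t) / (q2 + 1) * A)"
    by (intro tendsto_intros)
  from LIMSEQ_unique[OF l1 this] have "c * A * (2 * s) = c * A * ((?n - t) * (1 / (q1 + 1) + 1 / (q2 + 1)))"
    by (simp add: algebra_simps)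
  then show ?thesis using c A by simp
qed

lemma Lp_norm_weighted_finite:
  fixes u :: "real ^ 'n \<Rightarrow> real"
  assumes "\<And>x. 0 \<le> u x" "0 < p"
  shows "Lp_norm p (\<lambda>x. norm x powr (- t / p) * u x) < \<infinity> \<longleftrightarrow>
    (\<integral>\<^sup>+x. ennreal (norm x powr (- t) * u x powr p) \<partial>lborel) < \<infinity>"
proof -
  have "(\<bar>norm x powr (- t / p) * u x\<bar>) powr p = norm x powr (- t) * u x powr p" for x :: "real ^ 'n"
    using assms by (simp add: abs_mult powr_mult powr_powr)
  then show ?thesis by (simp add: Lp_norm_def Let_def less_top[symmetric])
qed

lemma finite_energy_imp_critical:
  fixes u v :: "real ^ 'n \<Rightarrow> real"
  assumes fe: "finite_energy_solution l t q1 q2 u v"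
    and t: "0 < t" "t < real CARD('n)" and q: "0 < q1" "0 < q2" and l: "1 \<le> l" "2 * real l < real CARD('n)"
  shows "1 / (q1 + 1) + 1 / (q2 + 1) = (real CARD('n) - 2 * real l) / (real CARD('n) - t)"
proof -
  let ?n = "real CARD('n)"
  define s where "s = (?n - 2 * real l) / 2"
  have s: "0 < s" "?n = 2 * s + 2 * real l" unfolding s_def using l by (auto simp: field_simps)
  have cl: "continuous_on UNIV u" "continuous_on UNIV v" "Ck_on (2 * l) u (- {0})" "Ck_on (2 * l) v (- {0})"
    "\<And>x. 0 < u x" "\<And>x. 0 < v x"
    "\<And>x. x \<noteq> 0 \<Longrightarrow> neg_laplacian_power l u x = norm x powr (- t) * v x powr q2"
    "\<And>x. x \<noteq> 0 \<Longrightarrow> neg_laplacian_power l v x = norm x powr (- t) * u x powr q1"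
    using fe unfolding finite_energy_solution_def classical_positive_solution_def by auto
  note [measurable] = borel_measurable_continuous_onI[OF cl(1)] borel_measurable_continuous_onI[OF cl(2)]
  have fin: "(\<integral>\<^sup>+x. ennreal (norm x powr (- t) * u x powr (q1 + 1)) \<partial>lborel) < \<infinity>"
    "(\<integral>\<^sup>+x. ennreal (norm x powr (- t) * v x powr (q2 + 1)) \<partial>lborel) < \<infinity>"
    using fe q cl(5,6) Lp_norm_weighted_finite[of u "q1 + 1" t] Lp_norm_weighted_finite[of v "q2 + 1" t]
    unfolding finite_energy_solution_def by (auto simp: less_imp_le)
  have grow: "\<exists>C\<ge>0. \<forall>R\<ge>1. (\<integral>\<^sup>+x. ennreal (w x) * indicator (cball 0 R) x \<partial>lborel)
      \<le> ennreal (C * R powr (?n - (?n - t) / (q + 1)))"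
    if "w \<in> borel_measurable borel" "\<And>x. 0 < w x" "0 < q"
      "(\<integral>\<^sup>+x. ennreal (norm x powr (- t) * w x powr (q + 1)) \<partial>lborel) < \<infinity>" for w :: "real ^ 'n \<Rightarrow> real" and q
    using that t by (intro growth_from_energy) (auto simp: less_imp_le)
  obtain C1 where C1: "0 \<le> C1" "\<And>R. 1 \<le> R \<Longrightarrow> (\<integral>\<^sup>+x. ennreal (u x) * indicator (cball 0 R) x \<partial>lborel)
      \<le> ennreal (C1 * R powr (?n - (?n - t) / (q1 + 1)))"
    using grow[OF _ cl(5) q(1) fin(1)] by (auto intro: borel_measurable_continuous_onI[OF cl(1)])
  obtain C2 where C2: "0 \<le> C2" "\<And>R. 1 \<le> R \<Longrightarrow> (\<integral>\<^sup>+x. ennreal (v x) * indicator (cball 0 R) x \<partial>lborel)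
      \<le> ennreal (C2 * R powr (?n - (?n - t) / (q2 + 1)))"
    using grow[OF _ cl(6) q(2) fin(2)] by (auto intro: borel_measurable_continuous_onI[OF cl(2)])
  have "(?n - t) * (1 / (q1 + 1) + 1 / (q2 + 1)) = 2 * s"
  proof (rule pohozaev_exponents)
    show "polyharmonic_growth l s ((?n - t) / (q1 + 1)) C1 u (\<lambda>x. norm x powr (- t) * v x powr q2)"
      by unfold_locales (use l s t q cl C1 in \<open>auto simp: less_imp_le\<close>)
    show "polyharmonic_growth l s ((?n - t) / (q2 + 1)) C2 v (\<lambda>x. norm x powr (- t) * u x powr q1)"
      by unfold_locales (use l s t q cl C2 in \<open>auto simp: less_imp_le\<close>)
    show "integrable lborel (\<lambda>x. norm x powr (- t) * u x powr (q1 + 1))"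
      by (rule integrableI_nonneg) (use fin in auto)
    show "integrable lborel (\<lambda>x. norm x powr (- t) * v x powr (q2 + 1))"
      by (rule integrableI_nonneg) (use fin in auto)
  qed (use cl q in auto)
  moreover have "2 * s = ?n - 2 * real l" using s by simp
  ultimately show ?thesis using t by (simp add: eq_divide_eq mult.commute)
qed

section \<open>Resolvents on the line\<close>

text \<open>The Green's function of \<open>(\<alpha> - d/ds) (\<beta> + d/ds)\<close>: by partial
  fractions the inverse is the sum of the two one-sided exponential averages divided by
  \<open>\<alpha> + \<beta>\<close>. Positive \<open>\<tau>\<close> looks forward from
  \<open>s\<close>.\<close>

definition ker :: "real \<Rightarrow> real \<Rightarrow> real \<Rightarrow> real" where
  "ker \<alpha> \<beta> \<tau> = (if 0 \<le> \<tau> then exp (- \<alpha> * \<tau>) else exp (\<beta> * \<tau>)) / (\<alpha> + \<beta>)"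

lemma ker_borel [measurable]: "ker \<alpha> \<beta> \<in> borel_measurable borel"
  unfolding ker_def[abs_def] by measurable

lemma ker_pos: "0 < \<alpha> \<Longrightarrow> 0 < \<beta> \<Longrightarrow> 0 < ker \<alpha> \<beta> \<tau>"
  by (simp add: ker_def add_pos_pos)

lemma ker_minus: "ker \<alpha> \<beta> (- \<tau>) = ker \<beta> \<alpha> \<tau>"
  by (auto simp: ker_def add.commute)

lemma integrable_exp_atLeast:
  assumes "0 < (\<gamma>::real)"
  shows "integrable lborel (\<lambda>x. indicator {0..} x * exp (- \<gamma> * x))"
proof (rule integrableI_nonneg)
  have "((\<lambda>x. - exp (- \<gamma> * x) / \<gamma>) \<longlongrightarrow> - 0 / \<gamma>) at_top"
    using assms by (intro tendsto_intros filterlim_compose[OF exp_at_bot] filterlim_tendsto_neg_mult_at_bot[OF tendsto_const])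
      (auto intro: filterlim_ident)
  then have "(\<integral>\<^sup>+x. ennreal (exp (- \<gamma> * x)) * indicator {0..} x \<partial>lborel) = ennreal (0 - (- exp (- \<gamma> * 0) / \<gamma>))"
    using assms by (intro nn_integral_FTC_atLeast[where F = "\<lambda>x. - exp (- \<gamma> * x) / \<gamma>"])
      (auto intro!: derivative_eq_intros)
  moreover have "(\<integral>\<^sup>+x. ennreal (indicator {0..} x * exp (- \<gamma> * x)) \<partial>lborel)
      = (\<integral>\<^sup>+x. ennreal (exp (- \<gamma> * x)) * indicator {0..} x \<partial>lborel)"
    by (intro nn_integral_cong) (auto simp: indicator_def)
  ultimately show "(\<integral>\<^sup>+x. ennreal (indicator {0..} x * exp (- \<gamma> * x)) \<partial>lborel) < \<infinity>" by simp
qed auto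

lemma integrable_reflect:
  fixes f :: "real \<Rightarrow> real"
  shows "integrable lborel f \<Longrightarrow> integrable lborel (\<lambda>x. f (- x))"
  using lborel_integrable_real_affine[of f "-1" 0] by simp

lemma integral_reflect: "(LINT x|lborel. f (- x)) = (LINT x|lborel. f (x::real) :: real)"
  using lborel_integral_real_affine[of "-1" f 0] by simp

lemma ker_exp_integrable:
  assumes "0 < \<alpha>" "0 < \<beta>" "\<kappa> < \<alpha>" "- \<beta> < \<kappa>"
  shows "integrable lborel (\<lambda>\<tau>. ker \<alpha> \<beta> \<tau> * exp (\<kappa> * \<tau>))"
proof -
  let ?e = "\<lambda>\<gamma> x::real. indicator {0..} x * exp (- \<gamma> * x)"
  have "integrable lborel (\<lambda>\<tau>. (?e (\<alpha> - \<kappa>) \<tau> + ?e (\<beta> + \<kappa>) (- \<tau>)) / (\<alpha> + \<beta>))"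
    using assms by (intro integrable_divide_zero Bochner_Integration.integrable_add integrable_exp_atLeast
        integrable_reflect[of "?e (\<beta> + \<kappa>)"]) auto
  then show ?thesis
  proof (rule Bochner_Integration.integrable_bound)
    show "AE \<tau> in lborel. norm (ker \<alpha> \<beta> \<tau> * exp (\<kappa> * \<tau>)) \<le> norm ((?e (\<alpha> - \<kappa>) \<tau> + ?e (\<beta> + \<kappa>) (- \<tau>)) / (\<alpha> + \<beta>))"
    proof (rule AE_I2)
      fix \<tau> :: real
      have "ker \<alpha> \<beta> \<tau> * exp (\<kappa> * \<tau>) \<le> (?e (\<alpha> - \<kappa>) \<tau> + ?e (\<beta> + \<kappa>) (- \<tau>)) / (\<alpha> + \<beta>)"
      proof (cases "0 \<le> \<tau>")
        case True
        have "ker \<alpha> \<beta> \<tau> * exp (\<kappa> * \<tau>) = ?e (\<alpha> - \<kappa>) \<tau> / (\<alpha> + \<beta>)"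
          using True by (simp add: ker_def exp_add[symmetric] algebra_simps)
        then show ?thesis using assms by (simp add: divide_right_mono)
      next
        case False
        then show ?thesis by (simp add: ker_def exp_add[symmetric] algebra_simps)
      qed
      moreover have "0 \<le> ker \<alpha> \<beta> \<tau> * exp (\<kappa> * \<tau>)" using ker_pos[OF assms(1,2)] by (simp add: less_imp_le)
      ultimately show "norm (ker \<alpha> \<beta> \<tau> * exp (\<kappa> * \<tau>)) \<le> norm ((?e (\<alpha> - \<kappa>) \<tau> + ?e (\<beta> + \<kappa>) (- \<tau>)) / (\<alpha> + \<beta>))"
        by (smt (verit) real_norm_def)
    qed
  qed measurable
qed

lemma ker_integrable: "0 < \<alpha> \<Longrightarrow> 0 < \<beta> \<Longrightarrow> integrable lborel (ker \<alpha> \<beta>)"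
  using ker_exp_integrable[of \<alpha> \<beta> 0] by simp

text \<open>A class on which all resolvent integrals converge absolutely and which resolvents,
  products and nonnegative powers preserve.\<close>

definition bounded_borel :: "(real \<Rightarrow> real) \<Rightarrow> bool" where
  "bounded_borel f \<longleftrightarrow> f \<in> borel_measurable borel \<and> (\<exists>M. \<forall>x. \<bar>f x\<bar> \<le> M)"

lemma bbI: "f \<in> borel_measurable borel \<Longrightarrow> (\<And>x. \<bar>f x\<bar> \<le> M) \<Longrightarrow> bounded_borel f"
  by (auto simp: bounded_borel_def)

lemma bounded_borel_borel [measurable_dest]: "bounded_borel f \<Longrightarrow> f \<in> borel_measurable borel"
  by (simp add: bounded_borel_def)

lemma bounded_borel_boundE:
  assumes "bounded_borel f"
  obtains M where "0 \<le> M" "\<And>x. \<bar>f x\<bar> \<le> M"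
proof -
  from assms obtain M where M: "\<And>x. \<bar>f x\<bar> \<le> M" by (auto simp: bounded_borel_def)
  then have "0 \<le> M" using abs_ge_zero order_trans by blast
  with M show ?thesis by (rule that[rotated])
qed

lemma bounded_borel_shift: "bounded_borel f \<Longrightarrow> bounded_borel (\<lambda>x. f (x + c))"
  by (auto simp: bounded_borel_def)

lemma bounded_borel_reflect: "bounded_borel f \<Longrightarrow> bounded_borel (\<lambda>x. f (- x))"
  by (auto simp: bounded_borel_def)

lemma bounded_borel_cmult:
  assumes "bounded_borel f"
  shows "bounded_borel (\<lambda>x. c * f x)"
proof -
  obtain M where M: "0 \<le> M" "\<And>x. \<bar>f x\<bar> \<le> M" using bounded_borel_boundE[OF assms] by blast
  note [measurable] = bounded_borel_borel[OF assms]
  show ?thesis by (rule bbI[where M = "\<bar>c\<bar> * M"]) (auto simp: abs_mult intro!: mult_left_mono M)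
qed

lemma bounded_borel_powr:
  assumes "bounded_borel f" "\<And>x. 0 \<le> f x" "0 \<le> p"
  shows "bounded_borel (\<lambda>x. f x powr p)"
proof -
  obtain M where M: "0 \<le> M" "\<And>x. \<bar>f x\<bar> \<le> M" using bounded_borel_boundE[OF assms(1)] by blast
  note [measurable] = bounded_borel_borel[OF assms(1)]
  show ?thesis
    by (rule bbI[where M = "M powr p"]) (use M assms in \<open>auto intro!: powr_mono2 elim: order_trans[OF abs_ge_self]\<close>)
qed

text \<open>\<open>resolvent \<alpha> \<beta>\<close> inverts \<open>(\<alpha> - d/ds) (\<beta> + d/ds)\<close>.\<close>

definition resolvent :: "real \<Rightarrow> real \<Rightarrow> (real \<Rightarrow> real) \<Rightarrow> real \<Rightarrow> real" where
  "resolvent \<alpha> \<beta> f s = (LINT \<tau>|lborel. ker \<alpha> \<beta> \<tau> * f (s + \<tau>))"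

lemma resolvent_reflect: "resolvent \<alpha> \<beta> f (- s) = resolvent \<beta> \<alpha> (\<lambda>x. f (- x)) s"
  unfolding resolvent_def using integral_reflect[of "\<lambda>\<tau>. ker \<alpha> \<beta> \<tau> * f (- s + \<tau>)"] by (simp add: ker_minus)

lemma resolvent_translate: "resolvent \<alpha> \<beta> (\<lambda>x. f (x + c)) s = resolvent \<alpha> \<beta> f (s + c)"
  by (simp add: resolvent_def algebra_simps)

lemma resolvent_cmult: "resolvent \<alpha> \<beta> (\<lambda>x. c * f x) s = c * resolvent \<alpha> \<beta> f s"
  by (simp add: resolvent_def mult.left_commute)

context
  fixes \<alpha> \<beta> :: real
  assumes pos: "0 < \<alpha>" "0 < \<beta>"
begin

lemma resolvent_integrable:
  assumes "bounded_borel f"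
  shows "integrable lborel (\<lambda>\<tau>. ker \<alpha> \<beta> \<tau> * f (s + \<tau>))"
proof -
  obtain M where M: "0 \<le> M" "\<And>x. \<bar>f x\<bar> \<le> M" using bounded_borel_boundE[OF assms] by blast
  note [measurable] = bounded_borel_borel[OF assms]
  have "integrable lborel (\<lambda>\<tau>. ker \<alpha> \<beta> \<tau> * M)" using ker_integrable[OF pos] by simp
  then show ?thesis
    by (rule Bochner_Integration.integrable_bound)
      (measurable, auto simp: abs_mult M(1) intro!: mult_left_mono M)
qed

lemma resolvent_nonneg: "(\<And>x. 0 \<le> f x) \<Longrightarrow> 0 \<le> resolvent \<alpha> \<beta> f s"
  unfolding resolvent_def using ker_pos[OF pos] by (intro Bochner_Integration.integral_nonneg) (simp add: less_imp_le)

lemma resolvent_bound: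
  assumes "bounded_borel f" "\<And>x. \<bar>f x\<bar> \<le> M"
  shows "\<bar>resolvent \<alpha> \<beta> f s\<bar> \<le> (LINT \<tau>|lborel. ker \<alpha> \<beta> \<tau>) * M"
proof -
  have "norm (resolvent \<alpha> \<beta> f s) \<le> (LINT \<tau>|lborel. ker \<alpha> \<beta> \<tau> * M)"
    unfolding resolvent_def
    by (rule Bochner_Integration.integral_norm_bound_integral[OF resolvent_integrable[OF assms(1)]])
      (use ker_integrable[OF pos] assms(2) ker_pos[OF pos] in \<open>auto simp: abs_mult abs_of_pos intro!: mult_left_mono less_imp_le\<close>)
  then show ?thesis by simp
qed

lemma resolvent_bb:
  assumes "bounded_borel f"
  shows "bounded_borel (resolvent \<alpha> \<beta> f)"
proof -
  obtain M where M: "0 \<le> M" "\<And>x. \<bar>f x\<bar> \<le> M" using bounded_borel_boundE[OF assms] by blast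
  note [measurable] = bounded_borel_borel[OF assms]
  have "resolvent \<alpha> \<beta> f \<in> borel_measurable borel" unfolding resolvent_def[abs_def] by measurable
  then show ?thesis using resolvent_bound[OF assms M(2)] by (rule bbI)
qed

text \<open>Exponentials are eigenfunctions of convolutions. The eigenvalue is a convergent integral
  exactly for rates strictly between \<open>- \<beta>\<close> and \<open>\<alpha>\<close>.\<close>

lemma resolvent_exp_bound:
  assumes "bounded_borel f" "\<And>x. f x \<le> C * exp (\<kappa> * x)" "\<kappa> < \<alpha>" "- \<beta> < \<kappa>"
  shows "resolvent \<alpha> \<beta> f s \<le> (C * (LINT \<tau>|lborel. ker \<alpha> \<beta> \<tau> * exp (\<kappa> * \<tau>))) * exp (\<kappa> * s)"
proof -
  have i: "integrable lborel (\<lambda>\<tau>. (C * exp (\<kappa> * s)) * (ker \<alpha> \<beta> \<tau> * exp (\<kappa> * \<tau>)))"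
    using ker_exp_integrable[OF pos assms(3,4)] by (rule integrable_mult_right)
  have "resolvent \<alpha> \<beta> f s \<le> (LINT \<tau>|lborel. (C * exp (\<kappa> * s)) * (ker \<alpha> \<beta> \<tau> * exp (\<kappa> * \<tau>)))"
    unfolding resolvent_def
  proof (rule Bochner_Integration.integral_mono[OF resolvent_integrable[OF assms(1)] i])
    fix \<tau>
    have "ker \<alpha> \<beta> \<tau> * f (s + \<tau>) \<le> ker \<alpha> \<beta> \<tau> * (C * exp (\<kappa> * (s + \<tau>)))"
      using assms(2) less_imp_le[OF ker_pos[OF pos]] by (intro mult_left_mono) auto
    then show "ker \<alpha> \<beta> \<tau> * f (s + \<tau>) \<le> (C * exp (\<kappa> * s)) * (ker \<alpha> \<beta> \<tau> * exp (\<kappa> * \<tau>))"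
      by (simp add: distrib_left exp_add mult_ac)
  qed
  also have "\<dots> = (C * exp (\<kappa> * s)) * (LINT \<tau>|lborel. ker \<alpha> \<beta> \<tau> * exp (\<kappa> * \<tau>))"
    by (rule integral_mult_right_zero)
  finally show ?thesis by (simp add: mult_ac)
qed

lemma ker_shift:
  assumes "0 \<le> h"
  shows "ker \<alpha> \<beta> (\<tau> - h) \<le> exp (\<alpha> * h) * ker \<alpha> \<beta> \<tau>" "ker \<alpha> \<beta> (\<tau> + h) \<le> exp (\<beta> * h) * ker \<alpha> \<beta> \<tau>"
proof -
  have *: "(if 0 \<le> \<tau> - h then exp (- \<alpha> * (\<tau> - h)) else exp (\<beta> * (\<tau> - h))) \<le> exp (\<alpha> * h) * (if 0 \<le> \<tau> then exp (- \<alpha> * \<tau>) else exp (\<beta> * \<tau>))"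
  proof -
    consider "h \<le> \<tau>" | "0 \<le> \<tau>" "\<tau> < h" | "\<tau> < 0" by linarith
    then show ?thesis
    proof cases
      case 1
      then show ?thesis using assms by (simp add: exp_add[symmetric] algebra_simps)
    next
      case 2
      have "\<beta> * (\<tau> - h) \<le> 0" using 2 pos by (simp add: mult_le_0_iff)
      moreover have "0 \<le> \<alpha> * h - \<alpha> * \<tau>" using 2 pos by simp
      ultimately show ?thesis using 2 by (simp add: exp_add[symmetric])
    next
      case 3
      have "0 \<le> \<beta> * h" "0 \<le> \<alpha> * h" using assms pos by auto
      then show ?thesis using 3 assms by (simp add: exp_add[symmetric] right_diff_distrib)
    qed
  qed
  then show "ker \<alpha> \<beta> (\<tau> - h) \<le> exp (\<alpha> * h) * ker \<alpha> \<beta> \<tau>"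
    unfolding ker_def using pos divide_right_mono[OF *, of "\<alpha> + \<beta>"] by simp
  have **: "(if 0 \<le> \<tau> + h then exp (- \<alpha> * (\<tau> + h)) else exp (\<beta> * (\<tau> + h))) \<le> exp (\<beta> * h) * (if 0 \<le> \<tau> then exp (- \<alpha> * \<tau>) else exp (\<beta> * \<tau>))"
  proof -
    consider "0 \<le> \<tau>" | "\<tau> < 0" "0 \<le> \<tau> + h" | "\<tau> + h < 0" by linarith
    then show ?thesis
    proof cases
      case 1
      have "0 \<le> \<beta> * h" "0 \<le> \<alpha> * h" using assms pos by auto
      then show ?thesis using 1 assms by (simp add: exp_add[symmetric] distrib_left)
    next
      case 2
      have "0 \<le> \<beta> * (\<tau> + h)" "0 \<le> \<alpha> * (\<tau> + h)" using 2 pos by auto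
      then show ?thesis using 2 by (simp add: exp_add[symmetric] algebra_simps)
    next
      case 3
      then show ?thesis using assms by (simp add: exp_add[symmetric] algebra_simps)
    qed
  qed
  then show "ker \<alpha> \<beta> (\<tau> + h) \<le> exp (\<beta> * h) * ker \<alpha> \<beta> \<tau>"
    unfolding ker_def using pos divide_right_mono[OF **, of "\<alpha> + \<beta>"] by simp
qed

text \<open>A Harnack inequality: a shift of the argument is moved onto the kernel, which changes by
  at most the factor in \<open>ker_shift\<close>. It holds for every nonnegative \<open>f\<close>,
  whatever its regularity.\<close>

lemma resolvent_shift_le:
  assumes f: "bounded_borel f" "\<And>x. 0 \<le> f x" and h: "0 \<le> h"
  shows "resolvent \<alpha> \<beta> f (s + h) \<le> exp (\<alpha> * h) * resolvent \<alpha> \<beta> f s" "resolvent \<alpha> \<beta> f (s - h) \<le> exp (\<beta> * h) * resolvent \<alpha> \<beta> f s"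
proof -
  have tr: "resolvent \<alpha> \<beta> f (s + d) = (LINT \<tau>|lborel. ker \<alpha> \<beta> (\<tau> - d) * f (s + \<tau>))"
    "integrable lborel (\<lambda>\<tau>. ker \<alpha> \<beta> (\<tau> - d) * f (s + \<tau>))" for d
    using lborel_integral_real_affine[of 1 "\<lambda>\<tau>. ker \<alpha> \<beta> \<tau> * f (s + d + \<tau>)" "- d"]
      lborel_integrable_real_affine[OF resolvent_integrable[OF f(1), of "s + d"], of 1 "- d"]
    by (simp_all add: resolvent_def)
  have "resolvent \<alpha> \<beta> f (s + h) \<le> (LINT \<tau>|lborel. exp (\<alpha> * h) * (ker \<alpha> \<beta> \<tau> * f (s + \<tau>)))"
    unfolding tr(1)
    by (intro Bochner_Integration.integral_mono tr(2) integrable_mult_right resolvent_integrable f)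
      (use ker_shift(1)[OF h] f(2) in \<open>auto simp: mult.assoc[symmetric] intro!: mult_right_mono\<close>)
  then show "resolvent \<alpha> \<beta> f (s + h) \<le> exp (\<alpha> * h) * resolvent \<alpha> \<beta> f s" by (simp add: resolvent_def)
  have "resolvent \<alpha> \<beta> f (s + - h) \<le> (LINT \<tau>|lborel. exp (\<beta> * h) * (ker \<alpha> \<beta> \<tau> * f (s + \<tau>)))"
    unfolding tr(1)
    by (intro Bochner_Integration.integral_mono tr(2) integrable_mult_right resolvent_integrable f)
      (use ker_shift(2)[OF h] f(2) in \<open>auto simp: mult.assoc[symmetric] intro!: mult_right_mono\<close>)
  then show "resolvent \<alpha> \<beta> f (s - h) \<le> exp (\<beta> * h) * resolvent \<alpha> \<beta> f s" by (simp add: resolvent_def)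
qed

lemma resolvent_tendsto:
  assumes "\<And>j. bounded_borel (f j)" "bounded_borel g" "\<And>j x. \<bar>f j x\<bar> \<le> M" "\<And>x. (\<lambda>j. f j x) \<longlonglongrightarrow> g x"
  shows "(\<lambda>j. resolvent \<alpha> \<beta> (f j) s) \<longlonglongrightarrow> resolvent \<alpha> \<beta> g s"
  unfolding resolvent_def
proof (rule integral_dominated_convergence[where w = "\<lambda>\<tau>. ker \<alpha> \<beta> \<tau> * M"])
  note [measurable] = bounded_borel_borel[OF assms(1)] bounded_borel_borel[OF assms(2)]
  show "(\<lambda>\<tau>. ker \<alpha> \<beta> \<tau> * g (s + \<tau>)) \<in> borel_measurable lborel" by measurable
  show "(\<lambda>\<tau>. ker \<alpha> \<beta> \<tau> * f j (s + \<tau>)) \<in> borel_measurable lborel" for j by measurable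
  show "integrable lborel (\<lambda>\<tau>. ker \<alpha> \<beta> \<tau> * M)" using ker_integrable[OF pos] by simp
  show "AE \<tau> in lborel. (\<lambda>j. ker \<alpha> \<beta> \<tau> * f j (s + \<tau>)) \<longlonglongrightarrow> ker \<alpha> \<beta> \<tau> * g (s + \<tau>)"
    using assms(4) by (intro AE_I2 tendsto_intros)
  show "AE \<tau> in lborel. norm (ker \<alpha> \<beta> \<tau> * f j (s + \<tau>)) \<le> ker \<alpha> \<beta> \<tau> * M" for j
    using assms(3) ker_pos[OF pos] by (intro AE_I2) (auto simp: abs_mult abs_of_pos intro!: mult_left_mono less_imp_le)
qed

text \<open>For \<open>s\<close> in the unit interval the values \<open>s + \<tau>\<close> sweep it
  while \<open>\<tau>\<close> runs through a window of length 1 inside \<open>[-1, 1]\<close>, where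
  the kernel is at least \<open>exp (- (\<alpha> + \<beta>)) / (\<alpha> + \<beta>)\<close>.\<close>

lemma resolvent_lower:
  assumes f: "bounded_borel f" "\<And>x. 0 \<le> f x" and m: "\<And>x. 0 \<le> x \<Longrightarrow> x \<le> 1 \<Longrightarrow> m \<le> f x" "0 \<le> m" and s: "0 \<le> s" "s \<le> 1"
  shows "exp (- (\<alpha> + \<beta>)) / (\<alpha> + \<beta>) * m \<le> resolvent \<alpha> \<beta> f s"
proof -
  let ?c = "exp (- (\<alpha> + \<beta>)) / (\<alpha> + \<beta>)"
  have c: "?c \<le> ker \<alpha> \<beta> \<tau>" if "- 1 \<le> \<tau>" "\<tau> \<le> 1" for \<tau>
  proof -
    have "\<alpha> * \<tau> \<le> \<alpha> * 1" "\<beta> * (- 1) \<le> \<beta> * \<tau>"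
      using that pos by (intro mult_left_mono; simp)+
    then have "- (\<alpha> + \<beta>) \<le> - \<alpha> * \<tau>" "- (\<alpha> + \<beta>) \<le> \<beta> * \<tau>" using pos by linarith+
    then show ?thesis unfolding ker_def using pos by (intro divide_right_mono) auto
  qed
  have "?c * m = (LINT \<tau>|lborel. ?c * m * indicator {- s .. 1 - s} \<tau>)" using s by simp
  also have "\<dots> \<le> resolvent \<alpha> \<beta> f s"
    unfolding resolvent_def
  proof (rule Bochner_Integration.integral_mono[OF _ resolvent_integrable[OF f(1)]])
    show "integrable lborel (\<lambda>\<tau>. ?c * m * indicator {- s..1 - s} \<tau>)"
      by (intro integrable_mult_right integrable_real_indicator) auto
    fix \<tau>
    show "?c * m * indicator {- s..1 - s} \<tau> \<le> ker \<alpha> \<beta> \<tau> * f (s + \<tau>)"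
    proof (cases "\<tau> \<in> {- s..1 - s}")
      case True
      have "?c * m \<le> ker \<alpha> \<beta> \<tau> * f (s + \<tau>)"
        using True s by (intro mult_mono c m less_imp_le[OF ker_pos[OF pos]]) auto
      then show ?thesis using True by simp
    next
      case False
      then show ?thesis using f(2)[of "s + \<tau>"] ker_pos[OF pos, of \<tau>] by (simp add: less_imp_le)
    qed
  qed
  finally show ?thesis .
qed

end

section \<open>Compositions of resolvents and the Harnack class\<close>

primrec resolvents :: "(real \<times> real) list \<Rightarrow> (real \<Rightarrow> real) \<Rightarrow> real \<Rightarrow> real" where
  "resolvents [] f = f"
| "resolvents (p # ps) f = resolvent (fst p) (snd p) (resolvents ps f)"

abbreviation pospairs :: "(real \<times> real) list \<Rightarrow> bool" where
  "pospairs ps \<equiv> (\<forall>p\<in>set ps. 0 < fst p \<and> 0 < snd p)"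

lemma resolvents_append: "resolvents (ps @ qs) f = resolvents ps (resolvents qs f)"
  by (induction ps) auto

lemma resolvents_reflect: "resolvents ps f (- s) = resolvents (map prod.swap ps) (\<lambda>x. f (- x)) s"
proof (induction ps arbitrary: s)
  case (Cons p ps)
  have "(\<lambda>x. resolvents ps f (- x)) = resolvents (map prod.swap ps) (\<lambda>x. f (- x))" using Cons by auto
  then show ?case by (simp add: resolvent_reflect)
qed simp

lemma resolvents_translate: "resolvents ps (\<lambda>x. f (x + c)) = (\<lambda>s. resolvents ps f (s + c))"
  by (induction ps) (auto simp: resolvent_translate)

lemma resolvents_cmult: "resolvents ps (\<lambda>x. c * f x) = (\<lambda>s. c * resolvents ps f s)"
  by (induction ps) (auto simp: resolvent_cmult)

lemma resolvents_bb: "pospairs ps \<Longrightarrow> bounded_borel f \<Longrightarrow> bounded_borel (resolvents ps f)"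
  by (induction ps) (auto intro: resolvent_bb)

lemma resolvents_nonneg: "pospairs ps \<Longrightarrow> (\<And>x. 0 \<le> f x) \<Longrightarrow> 0 \<le> resolvents ps f s"
  by (induction ps arbitrary: s) (auto intro!: resolvent_nonneg)

lemma resolvents_bound: "pospairs ps \<Longrightarrow> \<exists>C>0. \<forall>f M. bounded_borel f \<longrightarrow> (\<forall>x. \<bar>f x\<bar> \<le> M) \<longrightarrow> (\<forall>s. \<bar>resolvents ps f s\<bar> \<le> C * M)"
proof (induction ps)
  case Nil
  show ?case by (intro exI[of _ 1]) auto
next
  case (Cons p ps)
  then obtain C where C: "0 < C" "\<And>f M s. bounded_borel f \<Longrightarrow> (\<And>x. \<bar>f x\<bar> \<le> M) \<Longrightarrow> \<bar>resolvents ps f s\<bar> \<le> C * M" by auto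
  let ?I = "LINT \<tau>|lborel. ker (fst p) (snd p) \<tau>"
  have I: "0 \<le> ?I" using Cons.prems ker_pos[of "fst p" "snd p"] by (intro Bochner_Integration.integral_nonneg) (auto intro: less_imp_le)
  have "\<bar>resolvents (p # ps) f s\<bar> \<le> (?I + 1) * C * M" if "bounded_borel f" "\<And>x. \<bar>f x\<bar> \<le> M" for f M s
  proof -
    have "\<bar>resolvents (p # ps) f s\<bar> \<le> ?I * (C * M)"
      using Cons.prems C(2)[OF that] that by (auto intro!: resolvent_bound resolvents_bb)
    also have "\<dots> \<le> (?I + 1) * (C * M)"
      using C(1) order_trans[OF abs_ge_zero that(2)[of 0]] by (intro mult_right_mono) auto
    finally show ?thesis by simp
  qed
  then show ?case using I C(1) by (intro exI[of _ "(?I + 1) * C"]) auto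
qed

lemma resolvents_exp_bound:
  assumes "pospairs ps" "\<And>p. p \<in> set ps \<Longrightarrow> \<kappa> < fst p \<and> - snd p < \<kappa>"
  shows "\<exists>D\<ge>0. \<forall>f C. bounded_borel f \<longrightarrow> 0 \<le> C \<longrightarrow> (\<forall>x. f x \<le> C * exp (\<kappa> * x)) \<longrightarrow> (\<forall>s. resolvents ps f s \<le> C * D * exp (\<kappa> * s))"
  using assms
proof (induction ps)
  case Nil
  show ?case by (intro exI[of _ 1]) auto
next
  case (Cons p ps)
  then obtain D where D: "0 \<le> D" "\<And>f C s. bounded_borel f \<Longrightarrow> 0 \<le> C \<Longrightarrow> (\<And>x. f x \<le> C * exp (\<kappa> * x)) \<Longrightarrow> resolvents ps f s \<le> C * D * exp (\<kappa> * s)" by auto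
  let ?I = "LINT \<tau>|lborel. ker (fst p) (snd p) \<tau> * exp (\<kappa> * \<tau>)"
  have I: "0 \<le> ?I" using Cons.prems ker_pos[of "fst p" "snd p"] by (intro Bochner_Integration.integral_nonneg) (auto intro: less_imp_le)
  have "resolvents (p # ps) f s \<le> C * (D * ?I) * exp (\<kappa> * s)" if "bounded_borel f" "0 \<le> C" "\<And>x. f x \<le> C * exp (\<kappa> * x)" for f C s
  proof -
    have "resolvent (fst p) (snd p) (resolvents ps f) s \<le> (C * D * ?I) * exp (\<kappa> * s)"
      using Cons.prems D(2)[OF that] that by (intro resolvent_exp_bound resolvents_bb) auto
    then show ?thesis by (simp add: mult_ac)
  qed
  then show ?case using I D(1) by (intro exI[of _ "D * ?I"]) auto
qed

lemma resolvents_tendsto: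
  assumes "pospairs ps" "\<And>j. bounded_borel (f j)" "bounded_borel g" "\<And>j x. \<bar>f j x\<bar> \<le> M" "\<And>x. (\<lambda>j. f j x) \<longlonglongrightarrow> g x"
  shows "(\<lambda>j. resolvents ps (f j) s) \<longlonglongrightarrow> resolvents ps g s"
  using assms(1)
proof (induction ps arbitrary: s)
  case (Cons p ps)
  obtain C where C: "0 < C" "\<And>f M s. bounded_borel f \<Longrightarrow> (\<And>x. \<bar>f x\<bar> \<le> M) \<Longrightarrow> \<bar>resolvents ps f s\<bar> \<le> C * M"
    using resolvents_bound[of ps] Cons.prems by auto
  show ?case unfolding resolvents.simps
    using Cons C(2)[OF assms(2,4)] assms(2,3) by (intro resolvent_tendsto[where M = "C * M"] resolvents_bb) auto
qed (use assms in simp)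

lemma resolvents_lower:
  assumes "pospairs ps"
  shows "\<exists>c>0. \<forall>f m. bounded_borel f \<longrightarrow> (\<forall>x. 0 \<le> f x) \<longrightarrow> 0 \<le> m \<longrightarrow> (\<forall>x. 0 \<le> x \<longrightarrow> x \<le> 1 \<longrightarrow> m \<le> f x) \<longrightarrow>
     (\<forall>s. 0 \<le> s \<longrightarrow> s \<le> 1 \<longrightarrow> c * m \<le> resolvents ps f s)"
  using assms
proof (induction ps)
  case Nil
  show ?case by (intro exI[of _ 1]) auto
next
  case (Cons p ps)
  then obtain c where c: "0 < c" "\<And>f m s. bounded_borel f \<Longrightarrow> (\<And>x. 0 \<le> f x) \<Longrightarrow> 0 \<le> m \<Longrightarrow> (\<And>x. 0 \<le> x \<Longrightarrow> x \<le> 1 \<Longrightarrow> m \<le> f x) \<Longrightarrow>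
     0 \<le> s \<Longrightarrow> s \<le> 1 \<Longrightarrow> c * m \<le> resolvents ps f s" by auto
  let ?k = "exp (- (fst p + snd p)) / (fst p + snd p)"
  have k: "0 < ?k" using Cons.prems by (auto intro!: divide_pos_pos add_pos_pos)
  have "?k * c * m \<le> resolvents (p # ps) f s" if "bounded_borel f" "\<And>x. 0 \<le> f x" "0 \<le> m" "\<And>x. 0 \<le> x \<Longrightarrow> x \<le> 1 \<Longrightarrow> m \<le> f x" "0 \<le> s" "s \<le> 1" for f m s
  proof -
    have "?k * (c * m) \<le> resolvent (fst p) (snd p) (resolvents ps f) s"
      using Cons.prems c that by (intro resolvent_lower resolvents_bb resolvents_nonneg) auto
    then show ?thesis by (simp add: mult_ac)
  qed
  moreover have "0 < ?k * c" using k c(1) by (rule mult_pos_pos)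
  ultimately show ?case by blast
qed

text \<open>Lipschitz continuity of \<open>ln f\<close> in multiplicative form. It is closed under
  pointwise limits and admits the zero function, for which the logarithm would be
  meaningless.\<close>

definition loglip :: "real \<Rightarrow> (real \<Rightarrow> real) \<Rightarrow> bool" where
  "loglip L f \<longleftrightarrow> (\<forall>x y. 0 \<le> f x \<and> f y \<le> exp (L * \<bar>y - x\<bar>) * f x)"

text \<open>The constant depends on the rates alone, not on the input. This is the source of
  compactness, uniformly in the period.\<close>

lemma resolvent_loglip:
  assumes "0 < \<alpha>" "0 < \<beta>" "\<alpha> \<le> L" "\<beta> \<le> L" "bounded_borel f" "\<And>x. 0 \<le> f x"
  shows "loglip L (resolvent \<alpha> \<beta> f)"
  unfolding loglip_def
proof (intro allI conjI)
  fix x y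
  show n: "0 \<le> resolvent \<alpha> \<beta> f x" for x using assms by (intro resolvent_nonneg)
  show "resolvent \<alpha> \<beta> f y \<le> exp (L * \<bar>y - x\<bar>) * resolvent \<alpha> \<beta> f x"
  proof (cases "x \<le> y")
    case True
    have "resolvent \<alpha> \<beta> f (x + (y - x)) \<le> exp (\<alpha> * (y - x)) * resolvent \<alpha> \<beta> f x"
      using True assms by (intro resolvent_shift_le) auto
    also have "\<dots> \<le> exp (L * (y - x)) * resolvent \<alpha> \<beta> f x"
      using True assms by (intro mult_right_mono n) (auto intro!: mult_right_mono)
    finally show ?thesis using True by simp
  next
    case False
    have "resolvent \<alpha> \<beta> f (x - (x - y)) \<le> exp (\<beta> * (x - y)) * resolvent \<alpha> \<beta> f x"
      using False assms by (intro resolvent_shift_le) auto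
    also have "\<dots> \<le> exp (L * (x - y)) * resolvent \<alpha> \<beta> f x"
      using False assms by (intro mult_right_mono n) (auto intro!: mult_right_mono)
    finally show ?thesis using False by simp
  qed
qed

lemma loglip_cmult: "loglip L f \<Longrightarrow> 0 \<le> c \<Longrightarrow> loglip L (\<lambda>x. c * f x)"
  unfolding loglip_def by (auto simp: mult.left_commute[of _ c] intro!: mult_left_mono)

lemma loglip_shift: "loglip L f \<Longrightarrow> loglip L (\<lambda>x. f (x + c))"
  unfolding loglip_def by (metis add_diff_cancel_right)

lemma loglip_limit:
  assumes "\<And>j. loglip L (f j)" "\<And>x. (\<lambda>j. f j x) \<longlonglongrightarrow> g x"
  shows "loglip L g"
  unfolding loglip_def
proof (intro allI conjI)
  fix x y
  show "0 \<le> g x" by (rule LIMSEQ_le_const[OF assms(2)]) (use assms(1) in \<open>auto simp: loglip_def\<close>)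
  show "g y \<le> exp (L * \<bar>y - x\<bar>) * g x"
    by (rule LIMSEQ_le[OF assms(2) tendsto_mult[OF tendsto_const assms(2)]]) (use assms(1) in \<open>auto simp: loglip_def\<close>)
qed

lemma loglip_isCont:
  assumes "loglip L f"
  shows "isCont f x"
proof -
  have l: "((\<lambda>y. exp (- (L * \<bar>y - x\<bar>)) * f x) \<longlongrightarrow> exp (- (L * \<bar>x - x\<bar>)) * f x) (at x)"
    and u: "((\<lambda>y. exp (L * \<bar>y - x\<bar>) * f x) \<longlongrightarrow> exp (L * \<bar>x - x\<bar>) * f x) (at x)"
    by (intro tendsto_intros)+
  have lo: "exp (- (L * \<bar>y - x\<bar>)) * f x \<le> f y" for y
  proof -
    have "exp (- (L * \<bar>y - x\<bar>)) * f x \<le> exp (- (L * \<bar>y - x\<bar>)) * (exp (L * \<bar>x - y\<bar>) * f y)"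
      using assms unfolding loglip_def by (intro mult_left_mono) auto
    also have "\<dots> = f y" by (simp add: mult.assoc[symmetric] exp_add[symmetric] abs_minus_commute)
    finally show ?thesis .
  qed
  have "(f \<longlongrightarrow> f x) (at x)"
    by (rule tendsto_sandwich[OF _ _ l[simplified] u[simplified]])
      (use lo assms in \<open>auto simp: loglip_def\<close>)
  then show ?thesis by (simp add: isCont_def)
qed

lemma loglip_borel: "loglip L f \<Longrightarrow> f \<in> borel_measurable borel"
  using loglip_isCont[of L f] by (intro borel_measurable_continuous_onI continuous_at_imp_continuous_on) auto

text \<open>Arzela-Ascoli: \<open>function_convergent_subsequence\<close> gives convergence on the
  rationals by a diagonal choice, and boundedness with the Harnack inequality gives an
  equicontinuity estimate that extends it to all points.\<close>

lemma loglip_subseq: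
  assumes "\<And>j. loglip L (f j)" "\<And>j x. f j x \<le> B" "0 \<le> L"
  obtains r g where "strict_mono (r :: nat \<Rightarrow> nat)" "\<And>x. (\<lambda>j. f (r j) x) \<longlonglongrightarrow> g x"
proof -
  have nn: "0 \<le> f j x" for j x using assms(1) by (auto simp: loglip_def)
  have B0: "0 \<le> B" using nn[of 0 0] assms(2)[of 0 0] by linarith
  obtain r :: "nat \<Rightarrow> nat" where r: "strict_mono r" "\<And>x. x \<in> \<rat> \<Longrightarrow> \<exists>l. (\<lambda>j. f (r j) x) \<longlonglongrightarrow> l"
    using function_convergent_subsequence[OF countable_rat, of f B] nn assms(2) by (auto simp: abs_of_nonneg)
  have "convergent (\<lambda>j. f (r j) x)" for x
  proof (rule Cauchy_convergent, rule metric_CauchyI)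
    fix e :: real assume e: "0 < e"
    have mod: "\<bar>f j y - f j x\<bar> \<le> B * (exp (L * \<bar>y - x\<bar>) - 1)" for j y
    proof -
      have 1: "1 \<le> exp (L * \<bar>y - x\<bar>)" using assms(3) by simp
      have "f j y - f j x \<le> (exp (L * \<bar>y - x\<bar>) - 1) * f j x" "f j x - f j y \<le> (exp (L * \<bar>y - x\<bar>) - 1) * f j y"
      proof -
        have "f j y \<le> exp (L * \<bar>y - x\<bar>) * f j x" "f j x \<le> exp (L * \<bar>x - y\<bar>) * f j y"
          using assms(1)[of j] unfolding loglip_def by blast+
        then show "f j y - f j x \<le> (exp (L * \<bar>y - x\<bar>) - 1) * f j x" "f j x - f j y \<le> (exp (L * \<bar>y - x\<bar>) - 1) * f j y"
          by (simp_all add: left_diff_distrib abs_minus_commute)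
      qed
      moreover have "(exp (L * \<bar>y - x\<bar>) - 1) * f j z \<le> (exp (L * \<bar>y - x\<bar>) - 1) * B" for z
        using 1 assms(2) by (intro mult_left_mono) auto
      ultimately show ?thesis by (smt (verit) mult.commute)
    qed
    have "((\<lambda>y. B * (exp (L * \<bar>y - x\<bar>) - 1)) \<longlongrightarrow> B * (exp (L * \<bar>x - x\<bar>) - 1)) (nhds x)"
      using continuous_within_tendsto_compose
      by (intro tendsto_intros filterlim_ident)
    then have "eventually (\<lambda>y. B * (exp (L * \<bar>y - x\<bar>) - 1) < e / 3) (nhds x)"
      using e by (intro order_tendstoD(2)) auto
    then obtain d where d: "0 < d" "\<And>y. dist y x < d \<Longrightarrow> B * (exp (L * \<bar>y - x\<bar>) - 1) < e / 3"
      unfolding eventually_nhds_metric by blast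
    obtain y where y: "y \<in> \<rat>" "x < y" "y < x + d" using Rats_dense_in_real[of x "x + d"] d(1) by auto
    have b: "B * (exp (L * \<bar>y - x\<bar>) - 1) < e / 3" using y by (intro d(2)) (simp add: dist_real_def)
    have "Cauchy (\<lambda>j. f (r j) y)" using r(2)[OF y(1)] by (auto intro: LIMSEQ_imp_Cauchy)
    then obtain M where M: "\<And>i j. i \<ge> M \<Longrightarrow> j \<ge> M \<Longrightarrow> dist (f (r i) y) (f (r j) y) < e / 3"
      unfolding Cauchy_def using e by (metis zero_less_divide_iff zero_less_numeral)
    have "dist (f (r i) x) (f (r j) x) < e" if "i \<ge> M" "j \<ge> M" for i j
      using M[OF that] mod[of "r i" y] mod[of "r j" y] b unfolding dist_real_def by linarith
    then show "\<exists>M. \<forall>i\<ge>M. \<forall>j\<ge>M. dist (f (r i) x) (f (r j) x) < e" by blast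
  qed
  then have "(\<lambda>j. f (r j) x) \<longlonglongrightarrow> lim (\<lambda>j. f (r j) x)" for x by (simp add: convergent_LIMSEQ_iff)
  then show ?thesis by (rule that[OF r(1)])
qed

section \<open>The periodic problem\<close>

text \<open>A strictly convex power lies above its tangent at 1. The equality case later identifies
  the limit of the power iteration.\<close>

lemma young_strict:
  fixes r p :: real
  assumes "0 \<le> r" "1 < p"
  shows "1 + p * (r - 1) \<le> r powr p" and "1 + p * (r - 1) = r powr p \<Longrightarrow> r = 1"
proof -
  have mvt: "\<exists>z. x < z \<and> z < y \<and> y powr p - x powr p = (y - x) * (p * z powr (p - 1))" if "0 < x" "x < y" for x y :: real
    by (rule MVT2[OF that(2)]) (use that in \<open>auto intro!: derivative_eq_intros\<close>)
  have *: "1 + p * (r - 1) < r powr p" if r1: "r \<noteq> 1"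
  proof -
    consider "r = 0" | "0 < r" "r < 1" | "1 < r" using assms(1) r1 by linarith
    then show ?thesis
    proof cases
      case 1
      then show ?thesis using assms by simp
    next
      case 2
      obtain z where z: "r < z" "z < 1" "1 powr p - r powr p = (1 - r) * (p * z powr (p - 1))"
        using mvt[OF 2] by blast
      have "z powr (p - 1) < 1 powr (p - 1)" using z 2 assms by (intro powr_less_mono2) auto
      then have "(1 - r) * (p * z powr (p - 1)) < (1 - r) * (p * 1)"
        using 2 assms by (intro mult_strict_left_mono) auto
      then show ?thesis using z(3) by (simp add: algebra_simps)
    next
      case 3
      obtain z where z: "1 < z" "z < r" "r powr p - 1 powr p = (r - 1) * (p * z powr (p - 1))"
        using mvt[OF _ 3] by auto
      have "1 powr (p - 1) < z powr (p - 1)" using z 3 assms by (intro powr_less_mono2) auto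
      then have "(r - 1) * (p * 1) < (r - 1) * (p * z powr (p - 1))"
        using 3 assms by (intro mult_strict_left_mono) auto
      then show ?thesis using z(3) by (simp add: algebra_simps)
    qed
  qed
  show "1 + p * (r - 1) \<le> r powr p" using * by (cases "r = 1") (auto intro: less_imp_le)
  show "r = 1" if "1 + p * (r - 1) = r powr p" using * that by fastforce
qed

lemma young:
  fixes x y q :: real
  assumes "0 \<le> x" "0 \<le> y" "0 < q"
  shows "(q + 1) * (x powr q * y) \<le> q * x powr (q + 1) + y powr (q + 1)"
    and "0 < x \<Longrightarrow> (q + 1) * (x powr q * y) = q * x powr (q + 1) + y powr (q + 1) \<Longrightarrow> y = x"
proof -
  have main: "(q + 1) * (x powr q * y) = x powr (q + 1) * (1 + (q + 1) * (y / x - 1)) + q * x powr (q + 1)"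
    "y powr (q + 1) = x powr (q + 1) * (y / x) powr (q + 1)" if "0 < x"
    using that assms by (simp_all add: powr_add powr_divide field_simps)
  show "(q + 1) * (x powr q * y) \<le> q * x powr (q + 1) + y powr (q + 1)"
  proof (cases "x = 0")
    case False
    then have x: "0 < x" using assms by simp
    have "1 + (q + 1) * (y / x - 1) \<le> (y / x) powr (q + 1)" using assms x by (intro young_strict) auto
    then have "x powr (q + 1) * (1 + (q + 1) * (y / x - 1)) \<le> x powr (q + 1) * (y / x) powr (q + 1)"
      by (intro mult_left_mono) auto
    then show ?thesis unfolding main[OF x] by simp
  qed simp
  show "y = x" if x: "0 < x" and e: "(q + 1) * (x powr q * y) = q * x powr (q + 1) + y powr (q + 1)"
  proof -
    have "1 + (q + 1) * (y / x - 1) = (y / x) powr (q + 1)"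
      using e x unfolding main[OF x] by simp
    then have "y / x = 1" using assms x by (intro young_strict(2)) auto
    then show ?thesis using x by simp
  qed
qed

section \<open>Integration over one period and duality\<close>

definition periodic :: "real \<Rightarrow> (real \<Rightarrow> real) \<Rightarrow> bool" where
  "periodic N f \<longleftrightarrow> (\<forall>s. f (s + N) = f s)"

text \<open>With a half-open interval the translates by multiples of \<open>N\<close> tile the line
  without overlap.\<close>

definition period_int :: "real \<Rightarrow> (real \<Rightarrow> real) \<Rightarrow> real" where
  "period_int N f = (LINT s|lborel. indicator {0..<N} s * f s)"

lemma periodic_int: "periodic N f \<Longrightarrow> f (s + real_of_int m * N) = f s"
proof (induction m rule: int_induct[where k = 0])
  case (step1 i)
  then show ?case using step1(3)[unfolded periodic_def, rule_format, of "s + real_of_int i * N"] by (simp add: algebra_simps)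
next
  case (step2 i)
  then show ?case using step2(3)[unfolded periodic_def, rule_format, of "s + real_of_int (i - 1) * N"] by (simp add: algebra_simps)
qed simp

lemma bounded_borel_integrable:
  assumes "bounded_borel f"
  shows "integrable lborel (\<lambda>s. indicator {a..<b} s * f s)"
proof -
  obtain M where M: "0 \<le> M" "\<And>x. \<bar>f x\<bar> \<le> M" using bounded_borel_boundE[OF assms] by blast
  note [measurable] = bounded_borel_borel[OF assms]
  show ?thesis
  proof (rule Bochner_Integration.integrable_bound)
    show "integrable lborel (\<lambda>s. M * indicator {a..<b} s)"
    proof -
      have "emeasure lborel {a..<b} < \<infinity>" by (cases "a \<le> b") auto
      then show ?thesis by (intro integrable_mult_right integrable_real_indicator) auto
    qed
    show "AE s in lborel. norm (indicator {a..<b} s * f s) \<le> norm (M * indicator {a..<b} s)"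
      using M by (auto simp: indicator_def)
  qed measurable
qed

lemma period_int_shift:
  assumes "bounded_borel f" "periodic N f" "0 < N"
  shows "period_int N (\<lambda>s. f (s + \<tau>)) = period_int N f"
proof -
  have base: "period_int N (\<lambda>s. f (s + r)) = period_int N f" if r: "0 \<le> r" "r < N" for r
  proof -
    have "period_int N (\<lambda>s. f (s + r)) = (LINT s|lborel. indicator {r..<N + r} s * f s)"
      unfolding period_int_def using lborel_integral_real_affine[of 1 "\<lambda>s. indicator {r..<N + r} s * f s" r]
      by (simp add: indicator_def add.commute)
    also have "\<dots> = (LINT s|lborel. indicator {r..<N} s * f s + indicator {N..<N + r} s * f s)"
      using r by (intro Bochner_Integration.integral_cong) (auto simp: indicator_def)
    also have "\<dots> = (LINT s|lborel. indicator {r..<N} s * f s) + (LINT s|lborel. indicator {N..<N + r} s * f s)"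
      by (intro Bochner_Integration.integral_add bounded_borel_integrable assms(1))
    also have "(LINT s|lborel. indicator {N..<N + r} s * f s) = (LINT s|lborel. indicator {0..<r} s * f s)"
      using lborel_integral_real_affine[of 1 "\<lambda>s. indicator {N..<N + r} s * f s" N] assms(2)
      by (simp add: indicator_def add.commute periodic_def)
    also have "(LINT s|lborel. indicator {r..<N} s * f s) + (LINT s|lborel. indicator {0..<r} s * f s)
       = (LINT s|lborel. indicator {r..<N} s * f s + indicator {0..<r} s * f s)"
      by (intro Bochner_Integration.integral_add[symmetric] bounded_borel_integrable assms(1))
    also have "\<dots> = period_int N f" unfolding period_int_def
      using r by (intro Bochner_Integration.integral_cong) (auto simp: indicator_def)
    finally show ?thesis .
  qed
  \<comment> \<open>Whole periods are removed from the shift, leaving a remainder in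
    \<open>[0, N)\<close> for which \<open>base\<close> splits the interval at
    \<open>N\<close>.\<close>
  define m where "m = \<lfloor>\<tau> / N\<rfloor>"
  define r where "r = \<tau> - real_of_int m * N"
  have "real_of_int m \<le> \<tau> / N" "\<tau> / N < real_of_int m + 1" unfolding m_def by linarith+
  then have "0 \<le> r" "r < N" unfolding r_def using assms(3) by (auto simp: field_simps)
  moreover have "f (s + \<tau>) = f (s + r)" for s
    using periodic_int[OF assms(2), of "s + r" m] by (simp add: r_def)
  ultimately show ?thesis using base by simp
qed

lemma bounded_borel_mult:
  assumes "bounded_borel f" "bounded_borel g"
  shows "bounded_borel (\<lambda>x. f x * g x)"
proof -
  obtain M where M: "0 \<le> M" "\<And>x. \<bar>f x\<bar> \<le> M" using bounded_borel_boundE[OF assms(1)] by blast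
  obtain K where K: "0 \<le> K" "\<And>x. \<bar>g x\<bar> \<le> K" using bounded_borel_boundE[OF assms(2)] by blast
  note [measurable] = bounded_borel_borel[OF assms(1)] bounded_borel_borel[OF assms(2)]
  show ?thesis by (rule bbI[where M = "M * K"]) (auto simp: abs_mult intro!: mult_mono M K)
qed

lemma bounded_borel_add:
  assumes "bounded_borel f" "bounded_borel g"
  shows "bounded_borel (\<lambda>x. f x + g x)"
proof -
  obtain M where M: "0 \<le> M" "\<And>x. \<bar>f x\<bar> \<le> M" using bounded_borel_boundE[OF assms(1)] by blast
  obtain K where K: "0 \<le> K" "\<And>x. \<bar>g x\<bar> \<le> K" using bounded_borel_boundE[OF assms(2)] by blast
  note [measurable] = bounded_borel_borel[OF assms(1)] bounded_borel_borel[OF assms(2)]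
  show ?thesis by (rule bbI[where M = "M + K"]) (auto intro!: order_trans[OF abs_triangle_ineq] add_mono M K)
qed

lemma period_int_mono:
  assumes "bounded_borel f" "bounded_borel g" "\<And>s. f s \<le> g s"
  shows "period_int N f \<le> period_int N g"
  unfolding period_int_def using assms
  by (intro Bochner_Integration.integral_mono bounded_borel_integrable) (auto intro!: mult_left_mono)

lemma period_int_nonneg: "(\<And>s. 0 \<le> f s) \<Longrightarrow> 0 \<le> period_int N f"
  unfolding period_int_def by (intro Bochner_Integration.integral_nonneg) auto

lemma period_int_cmult: "period_int N (\<lambda>s. c * f s) = c * period_int N f"
  unfolding period_int_def by (simp add: mult.left_commute)

lemma period_int_add: "bounded_borel f \<Longrightarrow> bounded_borel g \<Longrightarrow> period_int N (\<lambda>s. f s + g s) = period_int N f + period_int N g"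
  unfolding period_int_def by (simp add: distrib_left bounded_borel_integrable)

lemma period_int_const: "0 \<le> N \<Longrightarrow> period_int N (\<lambda>s. c) = N * c"
  unfolding period_int_def by (simp add: measure_def)

lemma period_int_resolvent:
  assumes pos: "0 < \<alpha>" "0 < \<beta>" and f: "bounded_borel f" and g: "bounded_borel g"
  shows "period_int N (\<lambda>s. g s * resolvent \<alpha> \<beta> f s) = (LINT \<tau>|lborel. ker \<alpha> \<beta> \<tau> * period_int N (\<lambda>s. g s * f (s + \<tau>)))"
proof -
  note [measurable] = bounded_borel_borel[OF f] bounded_borel_borel[OF g]
  obtain M where M: "0 \<le> M" "\<And>x. \<bar>f x\<bar> \<le> M" using bounded_borel_boundE[OF f] by blast
  obtain K where K: "0 \<le> K" "\<And>x. \<bar>g x\<bar> \<le> K" using bounded_borel_boundE[OF g] by blast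
  let ?h = "\<lambda>s \<tau>. indicator {0..<N} s * g s * (ker \<alpha> \<beta> \<tau> * f (s + \<tau>))"
  let ?I = "LINT \<tau>|lborel. ker \<alpha> \<beta> \<tau>"
  have hm: "case_prod ?h \<in> borel_measurable (lborel \<Otimes>\<^sub>M lborel)" by measurable
  have int: "integrable (lborel \<Otimes>\<^sub>M lborel) (case_prod ?h)"
  proof (rule lborel_pair.Fubini_integrable[OF hm])
    have per_norm: "(LINT \<tau>|lborel. norm (case_prod ?h (s, \<tau>))) = indicator {0..<N} s * (\<bar>g s\<bar> * resolvent \<alpha> \<beta> (\<lambda>x. \<bar>f x\<bar>) s)" for s
    proof -
      have "(LINT \<tau>|lborel. norm (case_prod ?h (s, \<tau>))) = (LINT \<tau>|lborel. (indicator {0..<N} s * \<bar>g s\<bar>) * (ker \<alpha> \<beta> \<tau> * \<bar>f (s + \<tau>)\<bar>))"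
        using ker_pos[OF pos] by (intro Bochner_Integration.integral_cong refl) (simp add: abs_mult abs_of_pos)
      then show ?thesis by (simp add: resolvent_def mult.assoc)
    qed
    have "bounded_borel (\<lambda>x. \<bar>f x\<bar>)" "bounded_borel (\<lambda>x. \<bar>g x\<bar>)" using M K by (auto intro!: bbI)
    then have "bounded_borel (\<lambda>s. \<bar>g s\<bar> * resolvent \<alpha> \<beta> (\<lambda>x. \<bar>f x\<bar>) s)" by (intro bounded_borel_mult resolvent_bb pos)
    then show "integrable lborel (\<lambda>s. LINT \<tau>|lborel. norm (case_prod ?h (s, \<tau>)))"
      unfolding per_norm by (rule bounded_borel_integrable)
    show "AE s in lborel. integrable lborel (\<lambda>\<tau>. case_prod ?h (s, \<tau>))"
      using resolvent_integrable[OF pos f] by (intro AE_I2) simp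
  qed
  have "period_int N (\<lambda>s. g s * resolvent \<alpha> \<beta> f s) = (LINT s|lborel. LINT \<tau>|lborel. ?h s \<tau>)"
    unfolding period_int_def resolvent_def by (simp add: mult.assoc)
  also have "\<dots> = (LINT \<tau>|lborel. LINT s|lborel. ?h s \<tau>)"
    by (rule lborel_pair.Fubini_integral[OF int, symmetric])
  also have "\<dots> = (LINT \<tau>|lborel. ker \<alpha> \<beta> \<tau> * period_int N (\<lambda>s. g s * f (s + \<tau>)))"
  proof (rule Bochner_Integration.integral_cong[OF refl])
    fix \<tau>
    have "(LINT s|lborel. ?h s \<tau>) = (LINT s|lborel. ker \<alpha> \<beta> \<tau> * (indicator {0..<N} s * (g s * f (s + \<tau>))))"
      by (intro Bochner_Integration.integral_cong refl) (simp add: mult_ac)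
    then show "(LINT s|lborel. ?h s \<tau>) = ker \<alpha> \<beta> \<tau> * period_int N (\<lambda>s. g s * f (s + \<tau>))"
      by (simp add: period_int_def)
  qed
  finally show ?thesis .
qed

text \<open>Moving the shift from \<open>f\<close> to \<open>g\<close> by periodicity reverses its
  sign, and reflecting the kernel exchanges its two rates.\<close>

lemma period_int_resolvent_dual:
  assumes pos: "0 < \<alpha>" "0 < \<beta>" and f: "bounded_borel f" "periodic N f" and g: "bounded_borel g" "periodic N g" and N: "0 < N"
  shows "period_int N (\<lambda>s. g s * resolvent \<alpha> \<beta> f s) = period_int N (\<lambda>s. f s * resolvent \<beta> \<alpha> g s)"
proof -
  have sh: "period_int N (\<lambda>s. g s * f (s + \<tau>)) = period_int N (\<lambda>s. f s * g (s + - \<tau>))" for \<tau>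
  proof -
    have "bounded_borel (\<lambda>s. f s * g (s + - \<tau>))" by (intro bounded_borel_mult f bounded_borel_shift g)
    moreover have "periodic N (\<lambda>s. f s * g (s + - \<tau>))"
      using f(2) g(2) unfolding periodic_def by (metis add.assoc add.commute)
    ultimately have "period_int N (\<lambda>s. f (s + \<tau>) * g (s + \<tau> + - \<tau>)) = period_int N (\<lambda>s. f s * g (s + - \<tau>))"
      by (rule period_int_shift[OF _ _ N])
    then show ?thesis by (simp add: mult.commute)
  qed
  have "period_int N (\<lambda>s. f s * resolvent \<beta> \<alpha> g s) = (LINT \<tau>|lborel. ker \<beta> \<alpha> \<tau> * period_int N (\<lambda>s. f s * g (s + \<tau>)))"
    by (rule period_int_resolvent[OF pos(2,1) g(1) f(1)])
  also have "\<dots> = (LINT \<tau>|lborel. ker \<beta> \<alpha> (- \<tau>) * period_int N (\<lambda>s. f s * g (s + - \<tau>)))"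
    by (rule integral_reflect[symmetric])
  also have "\<dots> = period_int N (\<lambda>s. g s * resolvent \<alpha> \<beta> f s)"
    unfolding period_int_resolvent[OF pos f(1) g(1)] by (simp add: ker_minus sh)
  finally show ?thesis by simp
qed

lemma resolvents_periodic: "periodic N f \<Longrightarrow> periodic N (resolvents ps f)"
proof -
  assume "periodic N f"
  then have "(\<lambda>s. f (s + N)) = f" by (auto simp: periodic_def)
  then have "resolvents ps f (s + N) = resolvents ps f s" for s using fun_cong[OF resolvents_translate[of ps f N], of s] by simp
  then show ?thesis by (simp add: periodic_def)
qed

text \<open>The adjoint of a composition is the composition of the adjoints in reverse order: hence
  the reversed list of swapped pairs.\<close>

lemma period_int_resolvents_dual:
  assumes "pospairs ps" and f: "bounded_borel f" "periodic N f" and N: "0 < N"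
  shows "bounded_borel g \<Longrightarrow> periodic N g \<Longrightarrow> period_int N (\<lambda>s. g s * resolvents ps f s) = period_int N (\<lambda>s. f s * resolvents (rev (map prod.swap ps)) g s)"
  using assms(1)
proof (induction ps arbitrary: g)
  case (Cons p ps)
  have p: "0 < fst p" "0 < snd p" "pospairs ps" using Cons.prems by auto
  have g': "bounded_borel (resolvent (snd p) (fst p) g)" "periodic N (resolvent (snd p) (fst p) g)"
    using resolvent_bb[OF p(2,1) Cons.prems(1)] resolvents_periodic[OF Cons.prems(2), of "[(snd p, fst p)]"] by auto
  have "period_int N (\<lambda>s. g s * resolvents (p # ps) f s) = period_int N (\<lambda>s. resolvents ps f s * resolvent (snd p) (fst p) g s)"
    using p Cons.prems f N by (simp add: period_int_resolvent_dual resolvents_bb resolvents_periodic)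
  also have "\<dots> = period_int N (\<lambda>s. f s * resolvents (rev (map prod.swap ps)) (resolvent (snd p) (fst p) g) s)"
    using Cons.IH[OF g' p(3)] by (simp add: mult.commute)
  finally show ?case by (simp add: resolvents_append)
qed (simp add: mult.commute)

section \<open>Norms over a period and the power iteration\<close>

definition per_norm :: "real \<Rightarrow> real \<Rightarrow> (real \<Rightarrow> real) \<Rightarrow> real" where
  "per_norm N p f = period_int N (\<lambda>s. f s powr p) powr (1 / p)"

text \<open>The nonnegative part of the unit sphere of \<open>L^(q+1)\<close> over one period. The
  power iteration alternates between two such spheres.\<close>

definition admissible :: "real \<Rightarrow> real \<Rightarrow> (real \<Rightarrow> real) \<Rightarrow> bool" where
  "admissible N q f \<longleftrightarrow> bounded_borel f \<and> (\<forall>s. 0 \<le> f s) \<and> periodic N f \<and> period_int N (\<lambda>s. f s powr (q + 1)) = 1"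

lemma per_norm_powr: "0 < p \<Longrightarrow> per_norm N p f powr p = period_int N (\<lambda>s. f s powr p)"
  unfolding per_norm_def using period_int_nonneg[of "\<lambda>s. f s powr p" N] by (simp add: powr_powr)

lemma per_norm_nonneg: "0 \<le> per_norm N p f" by (simp add: per_norm_def)

lemma admissible_normalize:
  assumes "bounded_borel f" "\<And>s. 0 \<le> f s" "periodic N f" "0 < per_norm N (q + 1) f" "0 < q"
  shows "admissible N q (\<lambda>s. f s / per_norm N (q + 1) f)"
proof -
  let ?n = "per_norm N (q + 1) f"
  have "period_int N (\<lambda>s. (f s / ?n) powr (q + 1)) = period_int N (\<lambda>s. (1 / ?n powr (q + 1)) * f s powr (q + 1))"
    using assms by (simp add: powr_divide)
  also have "\<dots> = (1 / ?n powr (q + 1)) * ?n powr (q + 1)"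
    unfolding period_int_cmult using per_norm_powr[of "q + 1" N f] assms(5) by simp
  also have "\<dots> = 1" using assms(4) by simp
  finally show ?thesis
    using assms bounded_borel_cmult[OF assms(1), of "1 / ?n"] by (auto simp: admissible_def periodic_def)
qed

text \<open>Young's inequality for \<open>Z\<close> and \<open>c * Y\<close>, integrated over a
  period; normalization of \<open>Z\<close> makes the first integral 1, and \<open>c\<close> is
  taken as the reciprocal of the norm of \<open>Y\<close>.\<close>

lemma hoelder:
  assumes Z: "admissible N q Z" and q: "0 < q" and Y: "bounded_borel Y" "\<And>s. 0 \<le> Y s"
  shows "period_int N (\<lambda>s. Z s powr q * Y s) \<le> per_norm N (q + 1) Y"
proof -
  let ?n = "per_norm N (q + 1) Y" and ?X = "period_int N (\<lambda>s. Z s powr q * Y s)"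
  have Z': "bounded_borel Z" "\<And>s. 0 \<le> Z s" "period_int N (\<lambda>s. Z s powr (q + 1)) = 1" using Z by (auto simp: admissible_def)
  have b: "(q + 1) * (c * ?X) \<le> q + (c * ?n) powr (q + 1)" if c: "0 < c" for c
  proof -
    have "(q + 1) * (c * ?X) = period_int N (\<lambda>s. (q + 1) * (Z s powr q * (c * Y s)))"
      by (simp add: period_int_cmult mult.left_commute[of c] period_int_cmult[of N c, symmetric])
    also have "\<dots> \<le> period_int N (\<lambda>s. q * Z s powr (q + 1) + (c * Y s) powr (q + 1))"
      using Z' Y q c young(1)[of "Z s" "c * Y s" q for s]
      by (intro period_int_mono bounded_borel_cmult bounded_borel_mult bounded_borel_powr) (auto intro!: bounded_borel_add bounded_borel_cmult bounded_borel_powr)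
    also have "\<dots> = q * 1 + c powr (q + 1) * period_int N (\<lambda>s. Y s powr (q + 1))"
      using Z' Y q c by (subst period_int_add) (auto intro!: bounded_borel_cmult bounded_borel_powr simp: period_int_cmult powr_mult)
    also have "\<dots> = q + (c * ?n) powr (q + 1)"
      using per_norm_powr[of "q + 1" N Y] q c per_norm_nonneg[of N "q + 1" Y] by (simp add: powr_mult)
    finally show ?thesis .
  qed
  show ?thesis
  proof (cases "?n = 0")
    case False
    then have n: "0 < ?n" using per_norm_nonneg[of N "q + 1" Y] by simp
    have "(q + 1) * (?X / ?n) \<le> (q + 1) * 1" using b[of "1 / ?n"] n by simp
    then have "?X / ?n \<le> 1" using q by (simp only: mult_le_cancel_left_pos add_pos_pos zero_less_one)
    then show ?thesis using n by simp
  next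
    case True
    \<comment> \<open>With norm zero that choice of \<open>c\<close> fails;
      \<open>c = 1 / ?X\<close> would yield \<open>q + 1 \<le> q\<close>.\<close>
    have "?X \<le> 0"
    proof (rule ccontr)
      assume "\<not> ?X \<le> 0"
      then have X: "0 < ?X" by simp
      then have "(q + 1) * ((1 / ?X) * ?X) \<le> q" using b[of "1 / ?X"] True q by simp
      then show False using X by simp
    qed
    then show ?thesis using True by simp
  qed
qed

text \<open>Duality and Hoelder's inequality make the norm nondecreasing along the power iteration.\<close>

lemma half_step:
  assumes ps: "pospairs ps" "ps \<noteq> []" "\<And>p. p \<in> set ps \<Longrightarrow> fst p \<le> L \<and> snd p \<le> L"
    and q: "0 < q" "0 < r" and N: "0 < N" and Z: "admissible N q Z"
  defines "S \<equiv> per_norm N (r + 1) (resolvents ps (\<lambda>s. Z s powr q))"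
  assumes S: "0 < S"
  defines "W \<equiv> \<lambda>s. resolvents ps (\<lambda>s. Z s powr q) s / S"
  shows "admissible N r W" "loglip L W" "S = period_int N (\<lambda>s. Z s powr q * resolvents (rev (map prod.swap ps)) (\<lambda>s. W s powr r) s)"
    and "S \<le> per_norm N (q + 1) (resolvents (rev (map prod.swap ps)) (\<lambda>s. W s powr r))"
proof -
  let ?qs = "rev (map prod.swap ps)"
  have Z': "bounded_borel Z" "\<And>s. 0 \<le> Z s" "periodic N Z" using Z by (auto simp: admissible_def)
  have Zq: "bounded_borel (\<lambda>s. Z s powr q)" "periodic N (\<lambda>s. Z s powr q)"
    using Z' q by (auto intro!: bounded_borel_powr simp: periodic_def)
  have RZ: "bounded_borel (resolvents ps (\<lambda>s. Z s powr q))" "\<And>s. 0 \<le> resolvents ps (\<lambda>s. Z s powr q) s" "periodic N (resolvents ps (\<lambda>s. Z s powr q))"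
    using ps Zq by (auto intro!: resolvents_bb resolvents_nonneg resolvents_periodic)
  show W: "admissible N r W" unfolding W_def S_def using RZ S q unfolding S_def by (intro admissible_normalize) auto
  obtain p ps' where p: "ps = p # ps'" using ps(2) by (cases ps) auto
  have "loglip L (resolvents ps (\<lambda>s. Z s powr q))"
    unfolding p resolvents.simps using ps Zq unfolding p by (intro resolvent_loglip resolvents_bb) (auto intro!: resolvents_nonneg)
  from loglip_cmult[OF this, of "1 / S"] show "loglip L W" unfolding W_def using S by simp
  have W': "bounded_borel W" "\<And>s. 0 \<le> W s" "periodic N W" "period_int N (\<lambda>s. W s powr (r + 1)) = 1" using W by (auto simp: admissible_def)
  have Wr: "bounded_borel (\<lambda>s. W s powr r)" "periodic N (\<lambda>s. W s powr r)"
    using W' q by (auto intro!: bounded_borel_powr simp: periodic_def)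
  have "S = S * period_int N (\<lambda>s. W s powr (r + 1))" using W' by simp
  \<comment> \<open>Since \<open>S * W\<close> is the resolvent image, one factor \<open>W\<close>
    of \<open>W powr (r + 1)\<close> absorbs \<open>S\<close>; duality can then move the resolvents
    onto \<open>W powr r\<close>.\<close>
  also have "\<dots> = period_int N (\<lambda>s. W s powr r * resolvents ps (\<lambda>s. Z s powr q) s)"
  proof -
    have "S * W s powr (r + 1) = W s powr r * resolvents ps (\<lambda>s. Z s powr q) s" for s
    proof -
      have "W s powr (r + 1) = W s * W s powr r" using powr_mult_base[of "W s" r] W'(2) by (simp add: add.commute)
      then show ?thesis using S by (simp add: W_def)
    qed
    then show ?thesis by (simp add: period_int_cmult[symmetric])
  qed
  also have "\<dots> = period_int N (\<lambda>s. Z s powr q * resolvents ?qs (\<lambda>s. W s powr r) s)"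
    by (rule period_int_resolvents_dual[OF ps(1) Zq N Wr])
  finally show S1: "S = period_int N (\<lambda>s. Z s powr q * resolvents ?qs (\<lambda>s. W s powr r) s)" .
  have "pospairs ?qs" using ps(1) by auto
  then show "S \<le> per_norm N (q + 1) (resolvents ?qs (\<lambda>s. W s powr r))"
    by (subst S1) (intro hoelder[OF Z q(1)] resolvents_bb Wr resolvents_nonneg, auto)
qed

lemma per_norm_tendsto:
  assumes "\<And>j. bounded_borel (f j)" "bounded_borel g" "\<And>j s. 0 \<le> f j s" "\<And>s. 0 \<le> g s" "\<And>j s. f j s \<le> M" "\<And>s. (\<lambda>j. f j s) \<longlonglongrightarrow> g s" "0 < p"
  shows "(\<lambda>j. period_int N (\<lambda>s. f j s powr p)) \<longlonglongrightarrow> period_int N (\<lambda>s. g s powr p)"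
    and "(\<lambda>j. per_norm N p (f j)) \<longlonglongrightarrow> per_norm N p g"
proof -
  have pt: "(\<lambda>j. f j s powr p) \<longlonglongrightarrow> g s powr p" for s
    using assms by (intro tendsto_powr' tendsto_const) auto
  have M0: "0 \<le> M" using assms(3,5)[of 0 0] by linarith
  show L: "(\<lambda>j. period_int N (\<lambda>s. f j s powr p)) \<longlonglongrightarrow> period_int N (\<lambda>s. g s powr p)"
    unfolding period_int_def
  proof (rule integral_dominated_convergence[where w = "\<lambda>s. indicator {0..<N} s * M powr p"])
    note [measurable] = bounded_borel_borel[OF assms(1)] bounded_borel_borel[OF assms(2)]
    show "(\<lambda>s. indicator {0..<N} s * g s powr p) \<in> borel_measurable lborel" by measurable
    show "(\<lambda>s. indicator {0..<N} s * f j s powr p) \<in> borel_measurable lborel" for j by measurable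
    show "integrable lborel (\<lambda>s. indicator {0..<N} s * M powr p)"
      by (rule bounded_borel_integrable) (auto intro!: bbI[where M = "M powr p"])
    show "AE s in lborel. (\<lambda>j. indicator {0..<N} s * f j s powr p) \<longlonglongrightarrow> indicator {0..<N} s * g s powr p"
      by (intro AE_I2 tendsto_intros pt)
    show "AE s in lborel. norm (indicator {0..<N} s * f j s powr p) \<le> indicator {0..<N} s * M powr p" for j
      using assms by (intro AE_I2) (auto simp: indicator_def intro!: powr_mono2)
  qed
  show "(\<lambda>j. per_norm N p (f j)) \<longlonglongrightarrow> per_norm N p g"
    unfolding per_norm_def using assms(7) period_int_nonneg[of "\<lambda>s. f j s powr p" N for j]
    by (intro tendsto_powr' L tendsto_const) auto
qed

text \<open>A value at \<open>s\<close> forces at least \<open>exp (- L)\<close> times this value on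
  \<open>[s, s + 1)\<close>. As a period has length at least 1, unit norm caps it, independently of
  \<open>N\<close>.\<close>

lemma admissible_loglip_bound:
  assumes Z: "admissible N q Z" and l: "loglip L Z" "0 \<le> L" and N: "1 \<le> N" and q: "0 < q"
  shows "Z s \<le> exp L"
proof -
  have Z': "bounded_borel Z" "\<And>s. 0 \<le> Z s" "periodic N Z" "period_int N (\<lambda>s. Z s powr (q + 1)) = 1" using Z by (auto simp: admissible_def)
  let ?m = "exp (- L) * Z s"
  have m: "?m \<le> Z (x + s)" if "0 \<le> x" "x < 1" for x
  proof -
    have "Z s \<le> exp (L * \<bar>s - (x + s)\<bar>) * Z (x + s)" using l(1) unfolding loglip_def by blast
    also have "\<dots> \<le> exp L * Z (x + s)"
      using that l(2) Z'(2) by (intro mult_right_mono) (auto intro: mult_left_le)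
    finally have "exp (- L) * Z s \<le> exp (- L) * (exp L * Z (x + s))" by (intro mult_left_mono) auto
    then show ?thesis by (simp add: mult.assoc[symmetric] exp_add[symmetric])
  qed
  have b: "bounded_borel (\<lambda>s. Z s powr (q + 1))" "periodic N (\<lambda>s. Z s powr (q + 1))"
    using Z' q by (auto intro!: bounded_borel_powr simp: periodic_def)
  have "?m powr (q + 1) = (LINT x|lborel. indicator {0..<1::real} x * ?m powr (q + 1))"
    by (simp add: measure_def)
  also have "\<dots> \<le> period_int N (\<lambda>x. Z (x + s) powr (q + 1))"
    unfolding period_int_def
  proof (intro Bochner_Integration.integral_mono bounded_borel_integrable bounded_borel_shift[OF b(1)])
    show "bounded_borel (\<lambda>x. ?m powr (q + 1))" by (rule bbI) auto
    fix x
    show "indicator {0..<1::real} x * ?m powr (q + 1) \<le> indicator {0..<N} x * Z (x + s) powr (q + 1)"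
      using m[of x] N q Z'(2) by (auto simp: indicator_def intro!: powr_mono2)
  qed
  also have "\<dots> = 1" using period_int_shift[OF b, of s] N Z'(4) by simp
  finally have "?m powr (q + 1) \<le> 1" .
  moreover have "1 < ?m powr (q + 1)" if "1 < ?m"
    using powr_less_mono2[of "q + 1" 1 ?m] that q by simp
  ultimately have "?m \<le> 1" by fastforce
  then have "exp L * ?m \<le> exp L * 1" by (intro mult_left_mono) auto
  then show ?thesis by (simp add: mult.assoc[symmetric] exp_add[symmetric])
qed

lemma loglip_pos: "loglip L f \<Longrightarrow> f x \<noteq> 0 \<Longrightarrow> 0 < f y"
proof -
  assume l: "loglip L f" and x: "f x \<noteq> 0"
  have "f x \<le> exp (L * \<bar>x - y\<bar>) * f y" "0 \<le> f x" "0 \<le> f y" using l unfolding loglip_def by blast+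
  then show ?thesis using x by (cases "f y = 0") auto
qed

lemma loglip_bb: "loglip L f \<Longrightarrow> (\<And>x. f x \<le> M) \<Longrightarrow> bounded_borel f"
  using loglip_borel[of L f] by (auto intro!: bbI[where M = M] simp: loglip_def)

lemma periodic_start:
  assumes "1 \<le> N" "0 < q"
  obtains Z where "admissible N q Z" "\<And>s. 0 \<le> s \<Longrightarrow> s \<le> 1 \<Longrightarrow> 1 \<le> Z s powr q"
proof -
  \<comment> \<open>The periodic extension of the indicator of \<open>[0, 1]\<close>: unit norm for
    every \<open>N\<close>, and a lower bound on an interval independent of
    \<open>N\<close>.\<close>
  define Z where "Z s = (if frac (s / N) * N \<le> 1 then 1 else 0 :: real)" for s
  have fr: "frac (s / N) * N = s" if "0 \<le> s" "s < N" for s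
  proof -
    have "frac (s / N) = s / N" using that by (subst frac_eq) auto
    then show ?thesis using assms by simp
  qed
  have "bounded_borel Z"
  proof -
    have [measurable]: "(\<lambda>s. frac (s / N) * N) \<in> borel_measurable borel"
    proof -
      have "(\<lambda>s. real_of_int \<lfloor>s / N\<rfloor>) \<in> borel_measurable borel"
        by (rule measurable_compose[OF _ borel_measurable_real_floor]) measurable
      then show ?thesis unfolding frac_def by measurable
    qed
    have "Z \<in> borel_measurable borel" unfolding Z_def[abs_def] by measurable
    then show ?thesis by (rule bbI[where M = 1]) (simp add: Z_def)
  qed
  moreover have "periodic N Z"
  proof -
    have "(s + N) / N = s / N + 1" for s using assms by (simp add: add_divide_distrib)
    then show ?thesis unfolding periodic_def Z_def by (simp add: frac_1_eq)
  qed
  moreover have "period_int N (\<lambda>s. Z s powr (q + 1)) = 1"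
  proof -
    have e: "indicator {0..<N} s * Z s powr (q + 1) = indicator ({0..1} \<inter> {0..<N}) s" for s
      using fr[of s] by (auto simp: Z_def indicator_def)
    have "emeasure lborel ({0..1} \<inter> {0..<N}) = 1"
    proof (cases "N = 1")
      case True
      then have "{0..1} \<inter> {0..<N} = {0..<1}" by auto
      then show ?thesis by simp
    next
      case False
      then have "{0..1} \<inter> {0..<N} = {0..1}" using assms by auto
      then show ?thesis by simp
    qed
    then show ?thesis unfolding period_int_def e by (simp add: measure_def)
  qed
  ultimately have "admissible N q Z" by (auto simp: admissible_def Z_def)
  moreover have "1 \<le> Z s powr q" if "0 \<le> s" "s \<le> 1" for s
  proof (cases "s < N")
    case True
    then show ?thesis using fr[of s] that by (simp add: Z_def)
  next
    \<comment> \<open>This happens only for \<open>s = N = 1\<close>, whose fractional part is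
      0.\<close>
    case False
    then have "s = N" using that assms by simp
    then show ?thesis using assms by (simp add: Z_def)
  qed
  ultimately show ?thesis by (rule that)
qed

text \<open>Along the iteration the norms increase and stay bounded, so they converge. A
  subsequential limit has the same norm before and after a full step, which is equality in Hoelder's
  inequality and makes it a fixed point. Monotonicity carries the lower bound at the start to the
  limit, so \<open>c\<close> does not depend on \<open>N\<close>.\<close>

lemma periodic_solution:
  assumes ps: "pospairs ps" "ps \<noteq> []" "\<And>p. p \<in> set ps \<Longrightarrow> fst p \<le> L \<and> snd p \<le> L"
    and q: "0 < q" "0 < r"
  defines "qs \<equiv> rev (map prod.swap ps)"
  shows "\<exists>c>0. \<forall>N\<ge>1. \<exists>S W Z. c \<le> S \<and> admissible N r W \<and> admissible N q Z \<and> loglip L W \<and> loglip L Z \<and>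
    (\<forall>s. resolvents ps (\<lambda>s. Z s powr q) s = S * W s) \<and> (\<forall>s. resolvents qs (\<lambda>s. W s powr r) s = S * Z s)"
proof -
  have qs: "pospairs qs" "qs \<noteq> []" "\<And>p. p \<in> set qs \<Longrightarrow> fst p \<le> L \<and> snd p \<le> L"
    "rev (map prod.swap qs) = ps"
    using ps by (auto simp: qs_def rev_map comp_def)
  have L: "0 \<le> L"
  proof -
    obtain p where "p \<in> set ps" using ps(2) by (cases ps) auto
    then have "0 < fst p" "fst p \<le> L" using ps by auto
    then show ?thesis by linarith
  qed
  obtain c where c0: "0 < c" and cr: "\<forall>f m. bounded_borel f \<longrightarrow> (\<forall>x. 0 \<le> f x) \<longrightarrow> 0 \<le> m \<longrightarrow> (\<forall>x. 0 \<le> x \<longrightarrow> x \<le> 1 \<longrightarrow> m \<le> f x) \<longrightarrow>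
     (\<forall>s. 0 \<le> s \<longrightarrow> s \<le> 1 \<longrightarrow> c * m \<le> resolvents ps f s)"
    using resolvents_lower[OF ps(1)] by (elim exE conjE)
  have c: "0 < c" "\<And>f m s. bounded_borel f \<Longrightarrow> (\<And>x. 0 \<le> f x) \<Longrightarrow> 0 \<le> m \<Longrightarrow> (\<And>x. 0 \<le> x \<Longrightarrow> x \<le> 1 \<Longrightarrow> m \<le> f x) \<Longrightarrow>
     0 \<le> s \<Longrightarrow> s \<le> 1 \<Longrightarrow> c * m \<le> resolvents ps f s"
    using c0 cr by simp_all
  obtain C where C: "0 < C" "\<And>f M s. bounded_borel f \<Longrightarrow> (\<And>x. \<bar>f x\<bar> \<le> M) \<Longrightarrow> \<bar>resolvents ps f s\<bar> \<le> C * M"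
    using resolvents_bound[OF ps(1)] by blast
  obtain C' where C': "0 < C'" "\<And>f M s. bounded_borel f \<Longrightarrow> (\<And>x. \<bar>f x\<bar> \<le> M) \<Longrightarrow> \<bar>resolvents qs f s\<bar> \<le> C' * M"
    using resolvents_bound[OF qs(1)] by blast
  have "\<exists>S W Z. c \<le> S \<and> admissible N r W \<and> admissible N q Z \<and> loglip L W \<and> loglip L Z \<and>
    (\<forall>s. resolvents ps (\<lambda>s. Z s powr q) s = S * W s) \<and> (\<forall>s. resolvents qs (\<lambda>s. W s powr r) s = S * Z s)" if N: "1 \<le> N" for N
  proof -
    have N0: "0 < N" using N by simp
    define nS where "nS Z = per_norm N (r + 1) (resolvents ps (\<lambda>s. Z s powr q))" for Z
    define nS' where "nS' W = per_norm N (q + 1) (resolvents qs (\<lambda>s. W s powr r))" for W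
    define w where "w Z = (\<lambda>s. resolvents ps (\<lambda>s. Z s powr q) s / nS Z)" for Z
    define z where "z W = (\<lambda>s. resolvents qs (\<lambda>s. W s powr r) s / nS' W)" for W
    have hs1: "admissible N r (w Z)" "loglip L (w Z)" "nS Z = period_int N (\<lambda>s. Z s powr q * resolvents qs (\<lambda>s. w Z s powr r) s)" "nS Z \<le> nS' (w Z)"
      if "admissible N q Z" "0 < nS Z" for Z
      using half_step[OF ps q N0 that(1) that(2)[unfolded nS_def]] unfolding w_def nS_def nS'_def qs_def by auto
    have hs2: "admissible N q (z W)" "loglip L (z W)" "nS' W \<le> nS (z W)"
      if "admissible N r W" "0 < nS' W" for W
      using half_step[OF qs(1-3) q(2,1) N0 that(1) that(2)[unfolded nS'_def]] unfolding z_def nS_def nS'_def qs(4) by auto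
    obtain Z0 where Z0: "admissible N q Z0" "\<And>s. 0 \<le> s \<Longrightarrow> s \<le> 1 \<Longrightarrow> 1 \<le> Z0 s powr q"
      using periodic_start[OF N q(1)] by blast
    \<comment> \<open>On \<open>[0, 1]\<close> the image of the starting function is at least
      \<open>c\<close>, and a period contains this unit interval up to an endpoint.\<close>
    have S0: "c \<le> nS Z0"
    proof -
      let ?f = "resolvents ps (\<lambda>s. Z0 s powr q)"
      have bZ: "bounded_borel (\<lambda>s. Z0 s powr q)" using Z0 q by (auto intro!: bounded_borel_powr simp: admissible_def)
      have l: "c \<le> ?f s" if "0 \<le> s" "s \<le> 1" for s using c(2)[OF bZ, of 1 s] Z0(2) that by auto
      have "c powr (r + 1) = (LINT x|lborel. indicator {0..<1::real} x * c powr (r + 1))" by simp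
      also have "\<dots> \<le> period_int N (\<lambda>s. ?f s powr (r + 1))"
        unfolding period_int_def
      proof (intro Bochner_Integration.integral_mono bounded_borel_integrable)
        show "bounded_borel (\<lambda>s. ?f s powr (r + 1))" using q
          by (intro bounded_borel_powr resolvents_bb[OF ps(1) bZ] resolvents_nonneg[OF ps(1)]) auto
        show "bounded_borel (\<lambda>x. c powr (r + 1))" by (rule bbI) auto
        show "indicator {0..<1::real} x * c powr (r + 1) \<le> indicator {0..<N} x * ?f x powr (r + 1)" for x
          using l[of x] N q c(1) by (auto simp: indicator_def intro!: powr_mono2)
      qed
      finally have "(c powr (r + 1)) powr (1 / (r + 1)) \<le> nS Z0"
        unfolding nS_def per_norm_def using q by (intro powr_mono2) auto
      then show ?thesis using q c(1) by (simp add: powr_powr)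
    qed
    define Zs where "Zs k = ((\<lambda>Z. z (w Z)) ^^ k) Z0" for k
    have Zs0: "Zs 0 = Z0" and ZsS: "Zs (Suc k) = z (w (Zs k))" for k by (simp_all add: Zs_def)
    have inv: "admissible N q (Zs k) \<and> c \<le> nS (Zs k)" for k
    proof (induction k)
      case (Suc k)
      have p: "0 < nS (Zs k)" using Suc c(1) by linarith
      note a = hs1[OF conjunct1[OF Suc] p]
      have p': "0 < nS' (w (Zs k))" using a(4) p by linarith
      show ?case unfolding ZsS using hs2[OF a(1) p'] a(4) Suc by auto
    qed (simp add: Zs0 Z0 S0)
    have pos: "0 < nS (Zs k)" for k using inv[of k] c(1) by linarith
    have wk: "admissible N r (w (Zs k))" "loglip L (w (Zs k))" "nS (Zs k) \<le> nS' (w (Zs k))" for k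
      using hs1[OF _ pos] inv by auto
    have pos': "0 < nS' (w (Zs k))" for k using wk(3)[of k] pos[of k] by linarith
    \<comment> \<open>The starting function is a step function; from index 1 on the iterates are
      outputs of resolvents and lie in the Harnack class, which explains the \<open>Suc\<close>
      below.\<close>
    have zk: "loglip L (Zs (Suc k))" "nS' (w (Zs k)) \<le> nS (Zs (Suc k))" for k
      unfolding ZsS using hs2[OF wk(1) pos'] by auto
    have Zb: "Zs (Suc k) s \<le> exp L" for k s using admissible_loglip_bound[OF _ zk(1) L N q(1)] inv by blast
    have Wb: "w (Zs k) s \<le> exp L" for k s using admissible_loglip_bound[OF wk(1) wk(2) L N q(2)] by blast
    have Zn: "0 \<le> Zs k s" and Wn: "0 \<le> w (Zs k) s" and Zbb: "bounded_borel (Zs k)" and Wbb: "bounded_borel (w (Zs k))" for k s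
      using inv wk(1) by (auto simp: admissible_def)
    have Zqb: "Zs (Suc k) s powr q \<le> exp L powr q" for k s using Zn Zb q by (intro powr_mono2) auto
    have Wrb: "w (Zs k) s powr r \<le> exp L powr r" for k s using Wn Wb q by (intro powr_mono2) auto
    have RZb: "resolvents ps (\<lambda>s. Zs (Suc k) s powr q) s \<le> C * exp L powr q" for k s
      by (rule abs_le_D1, rule C(2)) (use Zqb q Zn Zbb in \<open>auto intro!: bounded_borel_powr\<close>)
    have RWb: "resolvents qs (\<lambda>s. w (Zs k) s powr r) s \<le> C' * exp L powr r" for k s
      by (rule abs_le_D1, rule C'(2)) (use Wrb q Wn Wbb in \<open>auto intro!: bounded_borel_powr\<close>)
    have RZbb: "bounded_borel (resolvents ps (\<lambda>s. Zs k s powr q))" "0 \<le> resolvents ps (\<lambda>s. Zs k s powr q) s" for k s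
      using ps q Zbb Zn by (auto intro!: resolvents_bb bounded_borel_powr resolvents_nonneg)
    have RWbb: "bounded_borel (resolvents qs (\<lambda>s. w (Zs k) s powr r))" "0 \<le> resolvents qs (\<lambda>s. w (Zs k) s powr r) s" for k s
      using qs q Wbb Wn by (auto intro!: resolvents_bb bounded_borel_powr resolvents_nonneg)
    have inc: "incseq (\<lambda>k. nS (Zs k))" using wk(3) zk(2) by (intro incseq_SucI) (meson order_trans)
    have "nS (Zs (Suc k)) \<le> (N * (C * exp L powr q) powr (r + 1)) powr (1 / (r + 1))" for k
    proof -
      have "period_int N (\<lambda>s. resolvents ps (\<lambda>s. Zs (Suc k) s powr q) s powr (r + 1)) \<le> period_int N (\<lambda>s. (C * exp L powr q) powr (r + 1))"
      proof (intro period_int_mono)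
        show "bounded_borel (\<lambda>s. resolvents ps (\<lambda>s. Zs (Suc k) s powr q) s powr (r + 1))" using q by (intro bounded_borel_powr RZbb) auto
        show "bounded_borel (\<lambda>s. (C * exp L powr q) powr (r + 1))" by (rule bbI) auto
        show "resolvents ps (\<lambda>s. Zs (Suc k) s powr q) s powr (r + 1) \<le> (C * exp L powr q) powr (r + 1)" for s
          using q RZb RZbb by (intro powr_mono2) auto
      qed
      also have "\<dots> = N * (C * exp L powr q) powr (r + 1)" using N0 by (simp add: period_int_const)
      finally show ?thesis unfolding nS_def per_norm_def using q
        by (intro powr_mono2 period_int_nonneg) auto
    qed
    then have "nS (Zs k) \<le> (N * (C * exp L powr q) powr (r + 1)) powr (1 / (r + 1))" for k
      using order_trans[OF incseq_SucD[OF inc, of k]] by blast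
    then obtain S where S: "(\<lambda>k. nS (Zs k)) \<longlonglongrightarrow> S" using incseq_convergent[OF inc] by blast
    \<comment> \<open>The norms of the two half steps interlace and share their limit.\<close>
    have S': "(\<lambda>k. nS' (w (Zs k))) \<longlonglongrightarrow> S"
      by (rule tendsto_sandwich[OF _ _ S LIMSEQ_Suc[OF S]]) (use wk zk in auto)
    have cS: "c \<le> S" by (rule LIMSEQ_le_const[OF S]) (use inv in blast)
    have Spos: "0 < S" using cS c(1) by linarith
    obtain \<rho> Z where \<rho>: "strict_mono (\<rho> :: nat \<Rightarrow> nat)" "\<And>s. (\<lambda>j. Zs (Suc (\<rho> j)) s) \<longlonglongrightarrow> Z s"
      using loglip_subseq[of L "\<lambda>k. Zs (Suc k)" "exp L"] zk(1) Zb L by blast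
    have Zl: "loglip L Z" using loglip_limit[OF zk(1) \<rho>(2)] .
    have Zle: "Z s \<le> exp L" for s using Zb by (intro LIMSEQ_le_const2[OF \<rho>(2)]) auto
    have Znn: "0 \<le> Z s" for s using Zl by (auto simp: loglip_def)
    have bZ: "bounded_borel Z" by (rule loglip_bb[OF Zl Zle])
    have Zper: "periodic N Z"
      unfolding periodic_def
    proof
      fix s
      have "(\<lambda>j. Zs (Suc (\<rho> j)) (s + N)) = (\<lambda>j. Zs (Suc (\<rho> j)) s)"
        using inv by (auto simp: admissible_def periodic_def)
      then show "Z (s + N) = Z s" using \<rho>(2)[of "s + N"] \<rho>(2)[of s] LIMSEQ_unique by metis
    qed
    have "(\<lambda>j. period_int N (\<lambda>s. Zs (Suc (\<rho> j)) s powr (q + 1))) \<longlonglongrightarrow> period_int N (\<lambda>s. Z s powr (q + 1))"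
      using q by (intro per_norm_tendsto(1)[where M = "exp L"] Zbb bZ Zn Znn Zb \<rho>(2)) auto
    moreover have "period_int N (\<lambda>s. Zs (Suc (\<rho> j)) s powr (q + 1)) = 1" for j using inv by (auto simp: admissible_def)
    ultimately have "period_int N (\<lambda>s. Z s powr (q + 1)) = 1" by (simp add: LIMSEQ_const_iff)
    then have Zadm: "admissible N q Z" using bZ Znn Zper by (auto simp: admissible_def)
    have sub: "(\<lambda>j. f (Suc (\<rho> j))) \<longlonglongrightarrow> x" if "f \<longlonglongrightarrow> x" for f :: "nat \<Rightarrow> real" and x
      using LIMSEQ_subseq_LIMSEQ[OF LIMSEQ_Suc[OF that] \<rho>(1)] by (simp add: o_def)
    have RZt: "(\<lambda>j. resolvents ps (\<lambda>s. Zs (Suc (\<rho> j)) s powr q) s) \<longlonglongrightarrow> resolvents ps (\<lambda>s. Z s powr q) s" for s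
      using q ps Zn Zqb \<rho>(2) Zbb bZ Znn
      by (intro resolvents_tendsto[where M = "exp L powr q"] bounded_borel_powr tendsto_powr' tendsto_const) auto
    have RZ: "bounded_borel (resolvents ps (\<lambda>s. Z s powr q))" "0 \<le> resolvents ps (\<lambda>s. Z s powr q) s" for s
      using ps q bZ Znn by (auto intro!: resolvents_bb bounded_borel_powr resolvents_nonneg)
    have "(\<lambda>j. nS (Zs (Suc (\<rho> j)))) \<longlonglongrightarrow> nS Z"
      unfolding nS_def using q by (intro per_norm_tendsto(2)[where M = "C * exp L powr q"] RZbb RZ RZb RZt) auto
    then have nSZ: "nS Z = S" using LIMSEQ_unique[OF sub[OF S]] by blast
    have h1: "admissible N r (w Z)" "loglip L (w Z)" "S = period_int N (\<lambda>s. Z s powr q * resolvents qs (\<lambda>s. w Z s powr r) s)"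
      using hs1[OF Zadm] nSZ Spos by auto
    have wt: "(\<lambda>j. w (Zs (Suc (\<rho> j))) s) \<longlonglongrightarrow> w Z s" for s
      unfolding w_def nSZ by (intro tendsto_divide RZt sub[OF S]) (use Spos in simp)
    have wn: "0 \<le> w Z s" and wbb: "bounded_borel (w Z)" for s using h1(1) by (auto simp: admissible_def)
    have RWt: "(\<lambda>j. resolvents qs (\<lambda>s. w (Zs (Suc (\<rho> j))) s powr r) s) \<longlonglongrightarrow> resolvents qs (\<lambda>s. w Z s powr r) s" for s
      using q qs Wn Wrb wt Wbb wbb wn
      by (intro resolvents_tendsto[where M = "exp L powr r"] bounded_borel_powr tendsto_powr' tendsto_const) auto
    have RW: "bounded_borel (resolvents qs (\<lambda>s. w Z s powr r))" "0 \<le> resolvents qs (\<lambda>s. w Z s powr r) s" for s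
      using qs q wbb wn by (auto intro!: resolvents_bb bounded_borel_powr resolvents_nonneg)
    have "(\<lambda>j. nS' (w (Zs (Suc (\<rho> j))))) \<longlonglongrightarrow> nS' (w Z)"
      unfolding nS'_def using q by (intro per_norm_tendsto(2)[where M = "C' * exp L powr r"] RWbb RW RWb RWt) auto
    then have nSW: "nS' (w Z) = S" using LIMSEQ_unique[OF sub[OF S']] by blast
    have Y: "admissible N q (z (w Z))" "loglip L (z (w Z))" using hs2[OF h1(1)] nSW Spos by auto
    define Y where "Y = z (w Z)"
    have Yb: "bounded_borel Y" "\<And>s. 0 \<le> Y s" "periodic N Y" "period_int N (\<lambda>s. Y s powr (q + 1)) = 1" using Y(1) by (auto simp: admissible_def Y_def)
    have SY: "resolvents qs (\<lambda>s. w Z s powr r) s = S * Y s" for s unfolding Y_def z_def nSW using Spos by simp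
    \<comment> \<open>Two functions on the unit sphere whose Hoelder pairing is 1: the equality
      case.\<close>
    have ZY: "period_int N (\<lambda>s. Z s powr q * Y s) = 1"
    proof -
      have "S = period_int N (\<lambda>s. S * (Z s powr q * Y s))" using h1(3) by (simp add: SY mult_ac)
      then show ?thesis using Spos by (simp add: period_int_cmult)
    qed
    have Zpos: "0 < Z s" for s
    proof -
      have "\<exists>x. Z x \<noteq> 0"
      proof (rule ccontr)
        assume "\<not> ?thesis"
        then have "period_int N (\<lambda>s. Z s powr (q + 1)) = 0" by (simp add: period_int_def)
        then show False using Zadm by (simp add: admissible_def)
      qed
      then show ?thesis using loglip_pos[OF Zl] by blast
    qed
    have Ypos: "0 < Y s" for s
    proof -
      have "\<exists>x. Y x \<noteq> 0"
      proof (rule ccontr)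
        assume "\<not> ?thesis"
        then have "period_int N (\<lambda>s. Y s powr (q + 1)) = 0" by (simp add: period_int_def)
        then show False using Yb(4) by simp
      qed
      then show ?thesis using loglip_pos[OF Y(2)] by (auto simp: Y_def)
    qed
    \<comment> \<open>The Young defect \<open>h\<close> is nonnegative with zero integral.
      Continuity would turn one positive value into a positive integral, so it vanishes everywhere
      and the equality case of \<open>young\<close> gives \<open>Y = Z\<close>.\<close>
    have "Y s0 = Z s0" for s0
    proof (rule ccontr)
      assume ne: "Y s0 \<noteq> Z s0"
      define h where "h s = (q * Z s powr (q + 1) + Y s powr (q + 1)) + (- (q + 1)) * (Z s powr q * Y s)" for s
      have bs: "bounded_borel (\<lambda>s. Z s powr (q + 1))" "bounded_borel (\<lambda>s. Y s powr (q + 1))" "bounded_borel (\<lambda>s. Z s powr q * Y s)"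
        using bZ Yb Znn q by (auto intro!: bounded_borel_powr bounded_borel_mult)
      then have bh: "bounded_borel h" unfolding h_def by (intro bounded_borel_add bounded_borel_cmult)
      have ph: "periodic N h" using Zper Yb(3) by (simp add: periodic_def h_def)
      have h0: "0 \<le> h s" for s
        unfolding h_def mult_minus_left using young(1)[OF Znn[of s] Yb(2)[of s] q(1)] by linarith
      have "period_int N h = (q * period_int N (\<lambda>s. Z s powr (q + 1)) + period_int N (\<lambda>s. Y s powr (q + 1))) + (- (q + 1)) * period_int N (\<lambda>s. Z s powr q * Y s)"
        unfolding h_def using bs by (simp only: period_int_add bounded_borel_add bounded_borel_cmult period_int_cmult)
      then have "period_int N h = 0" using Zadm Yb(4) ZY by (simp add: admissible_def)
      have hp: "0 < h s0" using h0[of s0] young(2)[OF Znn[of s0] Yb(2)[of s0] q(1) Zpos[of s0]] ne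
        unfolding h_def mult_minus_left by linarith
      have "isCont h s0"
        unfolding h_def using loglip_isCont[OF Zl, of s0] loglip_isCont[OF Y(2)[folded Y_def], of s0] Zpos[of s0] Ypos[of s0]
        by (intro continuous_intros) auto
      then have "eventually (\<lambda>s. h s0 / 2 < h s) (nhds s0)"
        using hp by (intro order_tendstoD(1)[of h "h s0"]) (auto simp: isCont_def tendsto_at_iff_tendsto_nhds)
      then obtain d where d: "0 < d" "\<And>s. dist s s0 < d \<Longrightarrow> h s0 / 2 < h s"
        unfolding eventually_nhds_metric by blast
      define m where "m = min d N"
      have m: "0 < m" using d(1) N0 by (simp add: m_def)
      have "h s0 / 2 * m = (LINT x|lborel. indicator {0..<m} x * (h s0 / 2))" using m by (simp add: measure_def)
      also have "\<dots> \<le> period_int N (\<lambda>s. h (s + s0))"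
        unfolding period_int_def
      proof (intro Bochner_Integration.integral_mono bounded_borel_integrable bounded_borel_shift[OF bh])
        show "bounded_borel (\<lambda>x. h s0 / 2)" by (rule bbI[where M = "\<bar>h s0 / 2\<bar>"]) auto
        show "indicator {0..<m} x * (h s0 / 2) \<le> indicator {0..<N} x * h (x + s0)" for x
          using d(2)[of "x + s0"] h0[of "x + s0"] by (auto simp: indicator_def m_def dist_real_def less_imp_le)
      qed
      also have "\<dots> = 0" using period_int_shift[OF bh ph N0, of s0] \<open>period_int N h = 0\<close> by simp
      finally have "h s0 / 2 * m \<le> 0" .
      moreover have "0 < h s0 / 2 * m" using hp m by simp
      ultimately show False by linarith
    qed
    then have YZ: "Y = Z" by auto
    have "resolvents ps (\<lambda>s. Z s powr q) s = S * w Z s" for s unfolding w_def nSZ using Spos by simp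
    then show ?thesis using cS h1(1,2) Zadm Zl SY YZ by blast
  qed
  then show ?thesis using c(1) by blast
qed

section \<open>Decay\<close>

text \<open>Bounded window integrals make \<open>f powr p\<close> integrable. By the Harnack
  inequality a value \<open>e\<close> far out fills a whole unit interval with values at least
  \<open>exp (- L) * e\<close>, more than the tail of the integral allows.\<close>

lemma loglip_vanishes:
  assumes l: "loglip L f" "0 \<le> L" and b: "\<And>s. f s \<le> B" and p: "0 < p"
    and E: "\<And>K::nat. (LINT s|lborel. indicator {- real K..<real K} s * f s powr p) \<le> E" and e: "0 < e"
  shows "\<exists>K. \<forall>s. K \<le> \<bar>s\<bar> \<longrightarrow> f s < e"
proof -
  have nn: "0 \<le> f s" for s using l by (auto simp: loglip_def)
  have bf: "bounded_borel f" by (rule loglip_bb[OF l(1) b])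
  have bp: "bounded_borel (\<lambda>s. f s powr p)" using bf nn p by (intro bounded_borel_powr) auto
  note [measurable] = bounded_borel_borel[OF bp]
  have int: "integrable lborel (\<lambda>s. f s powr p)"
  proof (rule integrableI_nonneg)
    have "(\<lambda>K. \<integral>\<^sup>+s. ennreal (indicator {- real K..<real K} s * f s powr p) \<partial>lborel) \<longlonglongrightarrow> (\<integral>\<^sup>+s. ennreal (f s powr p) \<partial>lborel)"
    proof (rule nn_integral_LIMSEQ)
      show "incseq (\<lambda>K s. ennreal (indicator {- real K..<real K} s * f s powr p))"
        by (auto simp: incseq_def le_fun_def indicator_def)
      show "(\<lambda>s. ennreal (indicator {- real K..<real K} s * f s powr p)) \<in> borel_measurable lborel" for K by measurable
      fix s
      obtain k :: nat where k: "\<bar>s\<bar> < real k" using reals_Archimedean2 by blast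
      have "eventually (\<lambda>K. ennreal (f s powr p) = ennreal (indicator {- real K..<real K} s * f s powr p)) sequentially"
        by (rule eventually_sequentiallyI[of k]) (use k in \<open>auto simp: indicator_def\<close>)
      then show "(\<lambda>K. ennreal (indicator {- real K..<real K} s * f s powr p)) \<longlonglongrightarrow> ennreal (f s powr p)"
        by (rule Lim_transform_eventually[OF tendsto_const])
    qed
    moreover have "(\<integral>\<^sup>+s. ennreal (indicator {- real K..<real K} s * f s powr p) \<partial>lborel) \<le> ennreal E" for K :: nat
      using E[of K] by (subst nn_integral_eq_integral[OF bounded_borel_integrable[OF bp]]) (auto intro: ennreal_leI)
    ultimately have "(\<integral>\<^sup>+s. ennreal (f s powr p) \<partial>lborel) \<le> ennreal E"
      by (intro LIMSEQ_le_const2) auto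
    then show "(\<integral>\<^sup>+s. ennreal (f s powr p) \<partial>lborel) < \<infinity>" using le_less_trans ennreal_less_top infinity_ennreal_def by metis
  qed auto
  let ?t = "\<lambda>K::nat. LINT s|lborel. indicator {s. real K \<le> \<bar>s\<bar>} s * f s powr p"
  have "?t \<longlonglongrightarrow> (LINT s|(lborel :: real measure). 0 :: real)"
  proof (rule integral_dominated_convergence[where w = "\<lambda>s. f s powr p"])
    show "AE s in lborel. (\<lambda>K. indicator {s. real K \<le> \<bar>s\<bar>} s * f s powr p) \<longlonglongrightarrow> 0"
    proof (rule AE_I2)
      fix s
      obtain k :: nat where k: "\<bar>s\<bar> < real k" using reals_Archimedean2 by blast
      have "eventually (\<lambda>K. 0 = indicator {s. real K \<le> \<bar>s\<bar>} s * f s powr p) sequentially"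
        by (rule eventually_sequentiallyI[of k]) (use k in \<open>auto simp: indicator_def\<close>)
      then show "(\<lambda>K. indicator {s. real K \<le> \<bar>s\<bar>} s * f s powr p) \<longlonglongrightarrow> 0"
        by (rule Lim_transform_eventually[OF tendsto_const])
    qed
  qed (use int in \<open>auto simp: indicator_def\<close>)
  then have "?t \<longlonglongrightarrow> 0" by simp
  then have "eventually (\<lambda>K. ?t K < (exp (- L) * e) powr p) sequentially"
    using e by (intro order_tendstoD(2)) auto
  then obtain K where K: "?t K < (exp (- L) * e) powr p" by (auto simp: eventually_sequentially)
  \<comment> \<open>The extra 1 keeps the interval \<open>[s, s + 1)\<close> outside
    \<open>(- K, K)\<close> also for negative \<open>s\<close>.\<close>
  have "f s < e" if s: "real K + 1 \<le> \<bar>s\<bar>" for s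
  proof (rule ccontr)
    assume "\<not> f s < e"
    then have fs: "e \<le> f s" by simp
    have low: "exp (- L) * e \<le> f x" if "s \<le> x" "x < s + 1" for x
    proof -
      have "e \<le> exp (L * \<bar>s - x\<bar>) * f x" using fs l(1) unfolding loglip_def by (meson order_trans)
      also have "\<dots> \<le> exp L * f x" using that l(2) nn by (intro mult_right_mono) (auto intro: mult_left_le)
      finally have "exp (- L) * e \<le> exp (- L) * (exp L * f x)" by (intro mult_left_mono) auto
      then show ?thesis by (simp add: mult.assoc[symmetric] exp_add[symmetric])
    qed
    have "(exp (- L) * e) powr p = (LINT x|lborel. indicator {s..<s + 1} x * (exp (- L) * e) powr p)" by simp
    also have "\<dots> \<le> ?t K"
    proof (intro Bochner_Integration.integral_mono bounded_borel_integrable)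
      show "bounded_borel (\<lambda>x. (exp (- L) * e) powr p)" by (rule bbI) auto
      show "integrable lborel (\<lambda>s. indicator {s. real K \<le> \<bar>s\<bar>} s * f s powr p)"
        by (rule Bochner_Integration.integrable_bound[OF int]) (auto simp: indicator_def)
      show "indicator {s..<s + 1} x * (exp (- L) * e) powr p \<le> indicator {s. real K \<le> \<bar>s\<bar>} x * f x powr p" for x
        using low[of x] e p s by (auto simp: indicator_def intro!: powr_mono2)
    qed
    finally show False using K by simp
  qed
  then show ?thesis by blast
qed

lemma resolvent_add:
  assumes "0 < \<alpha>" "0 < \<beta>" "bounded_borel f" "bounded_borel g"
  shows "resolvent \<alpha> \<beta> (\<lambda>x. f x + g x) s = resolvent \<alpha> \<beta> f s + resolvent \<alpha> \<beta> g s"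
  unfolding resolvent_def using resolvent_integrable[OF assms(1,2) assms(3), of s] resolvent_integrable[OF assms(1,2) assms(4), of s]
  by (simp add: distrib_left)

lemma resolvents_add:
  assumes "pospairs ps" "bounded_borel f" "bounded_borel g"
  shows "resolvents ps (\<lambda>x. f x + g x) = (\<lambda>s. resolvents ps f s + resolvents ps g s)"
  using assms(1)
proof (induction ps)
  case (Cons p ps)
  then have "resolvents ps (\<lambda>x. f x + g x) = (\<lambda>s. resolvents ps f s + resolvents ps g s)" by simp
  moreover have "resolvent (fst p) (snd p) (\<lambda>s. resolvents ps f s + resolvents ps g s) s = resolvent (fst p) (snd p) (resolvents ps f) s + resolvent (fst p) (snd p) (resolvents ps g) s" for s
    using Cons.prems assms by (intro resolvent_add resolvents_bb) auto
  ultimately show ?case by simp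
qed simp

text \<open>A mixed weight is handled by linearity: one part of \<open>f\<close> obeys the
  exponential bound, the remainder the constant one.\<close>

lemma resolvents_exp_const_bound:
  assumes "pospairs ps" "\<And>p. p \<in> set ps \<Longrightarrow> \<kappa> < fst p" "0 \<le> \<kappa>"
  shows "\<exists>D>0. \<forall>f A \<delta>. bounded_borel f \<longrightarrow> (\<forall>x. 0 \<le> f x) \<longrightarrow> 0 \<le> A \<longrightarrow> 0 \<le> \<delta> \<longrightarrow> (\<forall>x. f x \<le> A * (exp (\<kappa> * x) + \<delta>)) \<longrightarrow>
    (\<forall>s. resolvents ps f s \<le> D * A * (exp (\<kappa> * s) + \<delta>))"
proof -
  have "\<And>p. p \<in> set ps \<Longrightarrow> \<kappa> < fst p \<and> - snd p < \<kappa>" using assms by force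
  from resolvents_exp_bound[OF assms(1) this]
  obtain D1 where D1: "0 \<le> D1" "\<And>f C s. bounded_borel f \<Longrightarrow> 0 \<le> C \<Longrightarrow> (\<And>x. f x \<le> C * exp (\<kappa> * x)) \<Longrightarrow> resolvents ps f s \<le> C * D1 * exp (\<kappa> * s)"
    by auto
  obtain D2 where D2: "0 < D2" "\<And>f M s. bounded_borel f \<Longrightarrow> (\<And>x. \<bar>f x\<bar> \<le> M) \<Longrightarrow> \<bar>resolvents ps f s\<bar> \<le> D2 * M"
    using resolvents_bound[OF assms(1)] by blast
  have "resolvents ps f s \<le> (D1 + D2) * A * (exp (\<kappa> * s) + \<delta>)"
    if f: "bounded_borel f" "\<And>x. 0 \<le> f x" "0 \<le> A" "0 \<le> \<delta>" "\<And>x. f x \<le> A * (exp (\<kappa> * x) + \<delta>)" for f A \<delta> s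
  proof -
    \<comment> \<open>Truncation at the exponential; what is left over is at most
      \<open>A * \<delta>\<close>.\<close>
    define f1 where "f1 x = min (f x) (A * exp (\<kappa> * x))" for x
    define f2 where "f2 x = f x - f1 x" for x
    obtain M where M: "0 \<le> M" "\<And>x. \<bar>f x\<bar> \<le> M" using bounded_borel_boundE[OF f(1)] by blast
    note [measurable] = bounded_borel_borel[OF f(1)]
    have n1: "0 \<le> f1 x" "f1 x \<le> f x" "f1 x \<le> A * exp (\<kappa> * x)" for x using f unfolding f1_def by auto
    have n2: "0 \<le> f2 x" "f2 x \<le> A * \<delta>" "f2 x \<le> f x" for x
      using f(5)[of x] f(2)[of x] f(3,4) unfolding f2_def f1_def by (auto simp: min_def algebra_simps)
    have b: "bounded_borel f1" "bounded_borel f2"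
    proof -
      have "f1 \<in> borel_measurable borel" unfolding f1_def[abs_def] by measurable
      moreover from this have "f2 \<in> borel_measurable borel" unfolding f2_def[abs_def] by measurable
      moreover have "\<bar>f1 x\<bar> \<le> M" "\<bar>f2 x\<bar> \<le> M" for x
        using n1(1,2)[of x] n2(1,3)[of x] M(2)[of x] by linarith+
      ultimately show "bounded_borel f1" "bounded_borel f2" by (auto intro!: bbI[where M = M])
    qed
    have "resolvents ps f s = resolvents ps f1 s + resolvents ps f2 s"
    proof -
      have "f = (\<lambda>x. f1 x + f2 x)" by (simp add: f2_def)
      then show ?thesis using fun_cong[OF resolvents_add[OF assms(1) b], of s] by simp
    qed
    also have "\<dots> \<le> A * D1 * exp (\<kappa> * s) + D2 * (A * \<delta>)"
      using n2 by (intro add_mono D1(2) b n1 f(3) order_trans[OF abs_ge_self D2(2)]) auto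
    also have "\<dots> \<le> (D1 + D2) * A * (exp (\<kappa> * s) + \<delta>)"
    proof -
      have "0 \<le> D1 * (A * \<delta>)" "0 \<le> D2 * (A * exp (\<kappa> * s))" using D1 D2 f by auto
      then show ?thesis by (simp add: algebra_simps)
    qed
    finally show ?thesis .
  qed
  then show ?thesis using D1(1) D2(1) by (intro exI[of _ "D1 + D2"]) auto
qed

text \<open>The constant \<open>\<delta>\<close> in the weight \<open>exp (\<kappa> s) + \<delta>\<close> makes the supremum of the weighted solution finite; it is
  then bounded independently of \<open>\<delta>\<close> because the nonlinearity is superlinear and the solution small near \<open>-\<infinity>\<close>.\<close>

lemma exp_decay:
  assumes ps: "pospairs ps" "\<And>p. p \<in> set ps \<Longrightarrow> \<kappa> < fst p" and qs: "pospairs qs" "\<And>p. p \<in> set qs \<Longrightarrow> \<kappa> < fst p"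
    and \<kappa>: "0 < \<kappa>" and q: "1 < q" "1 < r"
    and w: "bounded_borel w" "\<And>s. 0 \<le> w s" "\<And>s. w s \<le> B" "w = resolvents ps (\<lambda>s. z s powr q)"
    and z: "bounded_borel z" "\<And>s. 0 \<le> z s" "\<And>s. z s \<le> B" "z = resolvents qs (\<lambda>s. w s powr r)"
    and vanish: "\<And>e. 0 < e \<Longrightarrow> \<exists>K. \<forall>s\<le>- K. w s < e \<and> z s < e"
  shows "\<exists>C\<ge>0. \<forall>s. w s \<le> C * exp (\<kappa> * s) \<and> z s \<le> C * exp (\<kappa> * s)"
proof -
  obtain D1 where D1: "0 < D1" "\<And>f A \<delta> s. bounded_borel f \<Longrightarrow> (\<And>x. 0 \<le> f x) \<Longrightarrow> 0 \<le> A \<Longrightarrow> 0 \<le> \<delta> \<Longrightarrow> (\<And>x. f x \<le> A * (exp (\<kappa> * x) + \<delta>)) \<Longrightarrow>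
    resolvents ps f s \<le> D1 * A * (exp (\<kappa> * s) + \<delta>)"
    using resolvents_exp_const_bound[OF ps less_imp_le[OF \<kappa>]] by auto
  obtain D2 where D2: "0 < D2" "\<And>f A \<delta> s. bounded_borel f \<Longrightarrow> (\<And>x. 0 \<le> f x) \<Longrightarrow> 0 \<le> A \<Longrightarrow> 0 \<le> \<delta> \<Longrightarrow> (\<And>x. f x \<le> A * (exp (\<kappa> * x) + \<delta>)) \<Longrightarrow>
    resolvents qs f s \<le> D2 * A * (exp (\<kappa> * s) + \<delta>)"
    using resolvents_exp_const_bound[OF qs less_imp_le[OF \<kappa>]] by auto
  define D where "D = D1 + D2"
  have D: "0 < D" "D1 \<le> D" "D2 \<le> D" using D1(1) D2(1) by (auto simp: D_def)
  \<comment> \<open>Below this threshold both powers are at most \<open>1 / (2 * D)\<close> times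
    their argument, a small linear term.\<close>
  define e where "e = min ((1 / (2 * D)) powr (1 / (q - 1))) ((1 / (2 * D)) powr (1 / (r - 1)))"
  have e: "0 < e" using D by (simp add: e_def)
  obtain K where K: "\<And>s. s \<le> - K \<Longrightarrow> w s < e \<and> z s < e" using vanish[OF e] by blast
  \<comment> \<open>To the right of \<open>- K\<close> boundedness suffices, as
    \<open>exp (\<kappa> * (K + s))\<close> is at least 1 there.\<close>
  define M where "M = (B powr q + B powr r) * exp (\<kappa> * K)"
  have M: "0 \<le> M" unfolding M_def by simp
  have pw: "x powr p \<le> 1 / (2 * D) * x" if x: "0 \<le> x" "x < (1 / (2 * D)) powr (1 / (p - 1))" and p: "1 < p" for x p
  proof -
    have "x powr (p - 1) \<le> ((1 / (2 * D)) powr (1 / (p - 1))) powr (p - 1)" using x p by (intro powr_mono2) auto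
    also have "\<dots> = 1 / (2 * D)" using p D by (simp add: powr_powr)
    finally have "x * x powr (p - 1) \<le> x * (1 / (2 * D))" using x by (intro mult_left_mono) auto
    then show ?thesis using powr_mult_base[of x "p - 1"] x by (simp add: mult.commute)
  qed
  have big: "x powr p \<le> M * exp (\<kappa> * s)" if "0 \<le> x" "x \<le> B" "- K < s" "p = q \<or> p = r" for x p s
  proof -
    have "x powr p \<le> B powr p" using that q by (intro powr_mono2) auto
    also have "B powr p \<le> B powr q + B powr r" using that(4) by auto
    also have "\<dots> \<le> (B powr q + B powr r) * (exp (\<kappa> * K) * exp (\<kappa> * s))"
    proof -
      have "0 \<le> \<kappa> * (K + s)" using that \<kappa> by simp
      then have "1 \<le> exp (\<kappa> * K) * exp (\<kappa> * s)" by (simp add: exp_add[symmetric] distrib_left)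
      then have "(B powr q + B powr r) * 1 \<le> (B powr q + B powr r) * (exp (\<kappa> * K) * exp (\<kappa> * s))"
        by (intro mult_left_mono) auto
      then show ?thesis by simp
    qed
    finally show ?thesis by (simp add: M_def mult.assoc)
  qed
  have pt: "z s powr q \<le> 1 / (2 * D) * z s + M * exp (\<kappa> * s)" "w s powr r \<le> 1 / (2 * D) * w s + M * exp (\<kappa> * s)" for s
  proof -
    have nn: "0 \<le> M * exp (\<kappa> * s)" "0 \<le> 1 / (2 * D) * z s" "0 \<le> 1 / (2 * D) * w s" using M D z(2) w(2) by auto
    show "z s powr q \<le> 1 / (2 * D) * z s + M * exp (\<kappa> * s)" "w s powr r \<le> 1 / (2 * D) * w s + M * exp (\<kappa> * s)"
    proof (atomize (full), goal_cases)
      case 1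
      show ?case
      proof (cases "s \<le> - K")
        case True
        then have "z s powr q \<le> 1 / (2 * D) * z s" "w s powr r \<le> 1 / (2 * D) * w s"
          using K[OF True] q z(2) w(2) unfolding e_def by (intro pw; simp)+
        then show ?thesis using nn by linarith
      next
        case False
        then have "z s powr q \<le> M * exp (\<kappa> * s)" "w s powr r \<le> M * exp (\<kappa> * s)"
          using z(2,3) w(2,3) by (intro big; simp)+
        then show ?thesis using nn by linarith
      qed
    qed
  qed
  have main: "w s \<le> 2 * D * M * (exp (\<kappa> * s) + \<delta>) \<and> z s \<le> 2 * D * M * (exp (\<kappa> * s) + \<delta>)" if \<delta>: "0 < \<delta>" for \<delta> s
  proof -
    define \<omega> where "\<omega> s = exp (\<kappa> * s) + \<delta>" for s
    have \<omega>: "0 < \<omega> s" "\<delta> \<le> \<omega> s" "exp (\<kappa> * s) \<le> \<omega> s" for s unfolding \<omega>_def using \<delta> by (auto intro: add_pos_pos)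
    define h where "h s = max (w s) (z s) / \<omega> s" for s
    have B0: "0 \<le> B" using w(2,3)[of 0] by linarith
    have "h s \<le> B / \<delta>" for s unfolding h_def using w(2,3)[of s] z(2,3)[of s] \<omega>(2)[of s] \<delta> B0 by (intro frac_le) auto
    then have bdd: "bdd_above (range h)" by (intro bdd_aboveI[of _ "B / \<delta>"]) auto
    define A where "A = (SUP s. h s)"
    have hA: "h s \<le> A" for s unfolding A_def by (rule cSUP_upper[OF _ bdd]) simp
    have "0 \<le> h 0" unfolding h_def using w(2)[of 0] \<omega>(1)[of 0] by (auto simp: le_max_iff_disj)
    then have A0: "0 \<le> A" using hA[of 0] by linarith
    have wA: "w s \<le> A * \<omega> s" "z s \<le> A * \<omega> s" for s
      using hA[of s] \<omega>(1)[of s] unfolding h_def by (auto simp: divide_le_eq)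
    have up: "x + M * exp (\<kappa> * s) \<le> (1 / (2 * D) * A + M) * (exp (\<kappa> * s) + \<delta>)" if "x \<le> 1 / (2 * D) * (A * \<omega> s)" for x s
    proof -
      have "M * exp (\<kappa> * s) \<le> M * \<omega> s" using M \<omega> by (intro mult_left_mono) auto
      then show ?thesis using that unfolding \<omega>_def by (simp add: distrib_right)
    qed
    have z1: "z s powr q \<le> (1 / (2 * D) * A + M) * (exp (\<kappa> * s) + \<delta>)" for s
      using pt(1)[of s] up[of "1 / (2 * D) * z s" s] mult_left_mono[OF wA(2)[of s], of "1 / (2 * D)"] D by auto
    have w1: "w s powr r \<le> (1 / (2 * D) * A + M) * (exp (\<kappa> * s) + \<delta>)" for s
      using pt(2)[of s] up[of "1 / (2 * D) * w s" s] mult_left_mono[OF wA(1)[of s], of "1 / (2 * D)"] D by auto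
    have A1: "0 \<le> 1 / (2 * D) * A + M" using A0 M D by simp
    have "w s \<le> D1 * (1 / (2 * D) * A + M) * \<omega> s" for s
      unfolding \<omega>_def using z q by (subst w(4), intro D1(2) bounded_borel_powr z1 A1) (use \<delta> in auto)
    then have w2: "w s \<le> D * (1 / (2 * D) * A + M) * \<omega> s" for s
      using mult_right_mono[OF mult_right_mono[OF D(2) A1] less_imp_le[OF \<omega>(1)]] order_trans by blast
    have "z s \<le> D2 * (1 / (2 * D) * A + M) * \<omega> s" for s
      unfolding \<omega>_def using w q by (subst z(4), intro D2(2) bounded_borel_powr w1 A1) (use \<delta> in auto)
    then have z2: "z s \<le> D * (1 / (2 * D) * A + M) * \<omega> s" for s
      using mult_right_mono[OF mult_right_mono[OF D(3) A1] less_imp_le[OF \<omega>(1)]] order_trans by blast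
    have "h s \<le> D * (1 / (2 * D) * A + M)" for s
      unfolding h_def using w2[of s] z2[of s] \<omega>(1)[of s] by (auto simp: divide_le_eq)
    \<comment> \<open>The factor \<open>1 / (2 * D)\<close> leaves half of the finite supremum
      \<open>A\<close>, which is absorbed; the resulting bound no longer contains
      \<open>\<delta>\<close>.\<close>
    then have "A \<le> D * (1 / (2 * D) * A + M)" unfolding A_def by (intro cSUP_least) auto
    also have "\<dots> = A / 2 + D * M" using D by (simp add: field_simps)
    finally have "A \<le> 2 * D * M" by simp
    then have "A * \<omega> s \<le> 2 * D * M * \<omega> s" using \<omega>(1)[of s] by (intro mult_right_mono) auto
    then show ?thesis using wA[of s] unfolding \<omega>_def by auto
  qed
  have "w s \<le> 2 * D * M * exp (\<kappa> * s) \<and> z s \<le> 2 * D * M * exp (\<kappa> * s)" for s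
  proof -
    have l: "((\<lambda>\<delta>. 2 * D * M * (exp (\<kappa> * s) + \<delta>)) \<longlongrightarrow> 2 * D * M * (exp (\<kappa> * s) + 0)) (at_right 0)"
      by (intro tendsto_intros)
    have ev: "eventually (\<lambda>\<delta>. 0 < \<delta>) (at_right (0::real))" by (simp add: eventually_at_right_less)
    have "w s \<le> 2 * D * M * (exp (\<kappa> * s) + 0)"
      by (rule tendsto_lowerbound[OF l]) (use ev main in \<open>auto elim: eventually_mono\<close>)
    moreover have "z s \<le> 2 * D * M * (exp (\<kappa> * s) + 0)"
      by (rule tendsto_lowerbound[OF l]) (use ev main in \<open>auto elim: eventually_mono\<close>)
    ultimately show ?thesis by simp
  qed
  then show ?thesis using D M by (intro exI[of _ "2 * D * M"]) auto
qed

text \<open>At the borderline rate \<open>a\<close> the integral in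
  \<open>resolvent_exp_bound\<close> diverges. The inner resolvents, whose rates exceed
  \<open>a\<close>, produce a function \<open>h\<close> decaying strictly faster than
  \<open>exp (a * s)\<close> at \<open>-\<infinity>\<close>; then the bound
  \<open>exp (- a * \<tau>) / (a + \<beta>)\<close> for the outermost kernel leaves the convergent
  integral of \<open>exp (- a * x) * h x\<close>.\<close>

lemma resolvents_sharp_decay:
  assumes ps: "pospairs ((a, \<beta>) # ps)" "\<And>p. p \<in> set ps \<Longrightarrow> \<mu> \<le> fst p" "a < \<mu>"
    and f: "bounded_borel f" "\<And>x. 0 \<le> f x" "\<And>x. f x \<le> C * exp (\<kappa> * x)" "a < \<kappa>" "0 \<le> C"
  shows "\<exists>C'\<ge>0. \<forall>s. resolvents ((a, \<beta>) # ps) f s \<le> C' * exp (a * s)"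
proof -
  have a: "0 < a" "0 < \<beta>" "pospairs ps" using ps by auto
  obtain M where M: "0 \<le> M" "\<And>x. \<bar>f x\<bar> \<le> M" using bounded_borel_boundE[OF f(1)] by blast
  \<comment> \<open>A rate strictly above \<open>a\<close>, but below the decay rate of
    \<open>f\<close> and below all inner rates.\<close>
  define k where "k = (a + min \<kappa> \<mu>) / 2"
  have k: "a < k" "k < \<kappa>" "k < \<mu>" using f ps(3) unfolding k_def by (auto simp: min_def)
  have fk: "f x \<le> (C + M) * exp (k * x)" for x
  proof (cases "x \<le> 0")
    case True
    have "\<kappa> * x \<le> k * x" using True k by (intro mult_right_mono_neg) auto
    then have "C * exp (\<kappa> * x) \<le> C * exp (k * x)" using f(5) by (intro mult_left_mono) auto
    moreover have "0 \<le> M * exp (k * x)" using M by simp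
    ultimately show ?thesis using f(3)[of x] by (simp add: distrib_right)
  next
    case False
    have "f x \<le> M * 1" using M(2)[of x] by simp
    also have "\<dots> \<le> M * exp (k * x)" using False k a M by (intro mult_left_mono) auto
    also have "\<dots> \<le> (C + M) * exp (k * x)" using f(5) by (intro mult_right_mono) auto
    finally show ?thesis .
  qed
  have "\<And>p. p \<in> set ps \<Longrightarrow> k < fst p \<and> - snd p < k" using ps k a by force
  from resolvents_exp_bound[OF a(3) this]
  obtain D where D: "0 \<le> D" "\<And>s. resolvents ps f s \<le> (C + M) * D * exp (k * s)"
    using f(1,5) fk M(1) by (metis add_nonneg_nonneg)
  define h where "h = resolvents ps f"
  have hb: "bounded_borel h" and hn: "\<And>x. 0 \<le> h x" unfolding h_def using a f by (auto intro: resolvents_bb resolvents_nonneg)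
  obtain H where H: "0 \<le> H" "\<And>x. \<bar>h x\<bar> \<le> H" using bounded_borel_boundE[OF hb] by blast
  note [measurable] = bounded_borel_borel[OF hb]
  let ?e = "\<lambda>\<gamma> x::real. indicator {0..} x * exp (- \<gamma> * x)"
  define D' where "D' = (C + M) * D"
  have D': "0 \<le> D'" unfolding D'_def using f(5) M D by simp
  have int: "integrable lborel (\<lambda>x. exp (- a * x) * h x)"
  proof (rule Bochner_Integration.integrable_bound)
    show "integrable lborel (\<lambda>x. H * ?e a x + D' * ?e (k - a) (- x))"
      using a k by (intro Bochner_Integration.integrable_add integrable_mult_right integrable_exp_atLeast
          integrable_reflect[of "?e (k - a)"]) auto
    show "AE x in lborel. norm (exp (- a * x) * h x) \<le> norm (H * ?e a x + D' * ?e (k - a) (- x))"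
    proof (rule AE_I2)
      fix x :: real
      have nn: "0 \<le> H * ?e a x" "0 \<le> D' * ?e (k - a) (- x)" using H D' by auto
      have "exp (- a * x) * h x \<le> H * ?e a x + D' * ?e (k - a) (- x)"
      proof (cases "0 \<le> x")
        case True
        have "exp (- a * x) * h x \<le> exp (- a * x) * H" using H(2)[of x] by (intro mult_left_mono) auto
        also have "\<dots> = H * ?e a x" using True by (simp add: mult.commute)
        finally show ?thesis using nn(2) by linarith
      next
        case False
        have "exp (- a * x) * h x \<le> exp (- a * x) * (D' * exp (k * x))"
          using D(2)[of x] unfolding h_def D'_def by (intro mult_left_mono) auto
        also have "\<dots> = D' * exp ((k - a) * x)" by (simp add: exp_add[symmetric] algebra_simps)
        also have "\<dots> = D' * ?e (k - a) (- x)" using False by (simp add: algebra_simps)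
        finally show ?thesis using nn(1) by linarith
      qed
      then show "norm (exp (- a * x) * h x) \<le> norm (H * ?e a x + D' * ?e (k - a) (- x))"
        using nn hn[of x] by simp
    qed
  qed measurable
  define J where "J = (LINT x|lborel. exp (- a * x) * h x)"
  have J: "0 \<le> J" unfolding J_def using hn by (intro Bochner_Integration.integral_nonneg) auto
  have "resolvent a \<beta> h s \<le> J / (a + \<beta>) * exp (a * s)" for s
  proof -
    have int2: "integrable lborel (\<lambda>\<tau>. exp (- a * (s + \<tau>)) * h (s + \<tau>))"
      using lborel_integrable_real_affine[OF int, of 1 s] by simp
    have "resolvent a \<beta> h s \<le> (LINT \<tau>|lborel. (exp (a * s) / (a + \<beta>)) * (exp (- a * (s + \<tau>)) * h (s + \<tau>)))"
      unfolding resolvent_def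
    proof (rule Bochner_Integration.integral_mono[OF resolvent_integrable[OF a(1,2) hb] integrable_mult_right[OF int2]])
      fix \<tau>
      have "ker a \<beta> \<tau> \<le> exp (- a * \<tau>) / (a + \<beta>)"
      proof -
        have "exp (\<beta> * \<tau>) \<le> exp (- a * \<tau>)" if "\<tau> < 0"
        proof -
          have "\<beta> * \<tau> \<le> 0" "0 \<le> - a * \<tau>" using that a by (auto simp: mult_le_0_iff mult_nonpos_nonpos)
          then show ?thesis by simp
        qed
        then show ?thesis unfolding ker_def using a by (intro divide_right_mono) auto
      qed
      then have "ker a \<beta> \<tau> * h (s + \<tau>) \<le> exp (- a * \<tau>) / (a + \<beta>) * h (s + \<tau>)" using hn by (intro mult_right_mono)
      also have "\<dots> = (exp (a * s) / (a + \<beta>)) * (exp (- a * (s + \<tau>)) * h (s + \<tau>))"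
        by (simp add: distrib_left exp_add[symmetric] mult.assoc[symmetric])
      finally show "ker a \<beta> \<tau> * h (s + \<tau>) \<le> (exp (a * s) / (a + \<beta>)) * (exp (- a * (s + \<tau>)) * h (s + \<tau>))" .
    qed
    also have "\<dots> = (exp (a * s) / (a + \<beta>)) * (LINT \<tau>|lborel. exp (- a * (s + \<tau>)) * h (s + \<tau>))"
      by (rule integral_mult_right_zero)
    also have "(LINT \<tau>|lborel. exp (- a * (s + \<tau>)) * h (s + \<tau>)) = J"
      unfolding J_def using lborel_integral_real_affine[of 1 "\<lambda>x. exp (- a * x) * h x" s] by simp
    finally show ?thesis by (simp add: mult_ac)
  qed
  then show ?thesis using J a by (intro exI[of _ "J / (a + \<beta>)"]) (auto simp: h_def)
qed

section \<open>Radial functions\<close>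

text \<open>The inverse of \<open>\<gamma> - d/ds\<close> on bounded functions; together with its
  reflection it gives the partial fraction decomposition in \<open>resolvent_split\<close>.\<close>

definition half_resolvent :: "real \<Rightarrow> (real \<Rightarrow> real) \<Rightarrow> real \<Rightarrow> real" where
  "half_resolvent \<gamma> f s = (LINT \<tau>|lborel. indicator {0..} \<tau> * exp (- \<gamma> * \<tau>) * f (s + \<tau>))"

lemma half_resolvent_integrable:
  assumes "0 < \<gamma>" "bounded_borel f"
  shows "integrable lborel (\<lambda>\<tau>. indicator {0..} \<tau> * exp (- \<gamma> * \<tau>) * f (s + \<tau>))"
proof -
  obtain M where M: "0 \<le> M" "\<And>x. \<bar>f x\<bar> \<le> M" using bounded_borel_boundE[OF assms(2)] by blast
  note [measurable] = bounded_borel_borel[OF assms(2)]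
  have "integrable lborel (\<lambda>\<tau>. indicator {0..} \<tau> * exp (- \<gamma> * \<tau>) * M)"
    using integrable_exp_atLeast[OF assms(1)] by (rule integrable_mult_left)
  then show ?thesis
    by (rule Bochner_Integration.integrable_bound)
      (measurable, auto simp: abs_mult M(1) intro!: mult_left_mono M)
qed

lemma resolvent_split:
  assumes "0 < \<alpha>" "0 < \<beta>" "bounded_borel f"
  shows "resolvent \<alpha> \<beta> f s = (half_resolvent \<alpha> f s + half_resolvent \<beta> (\<lambda>x. f (- x)) (- s)) / (\<alpha> + \<beta>)"
proof -
  let ?p = "\<lambda>\<tau>::real. indicator {0..} \<tau> * exp (- \<alpha> * \<tau>) * f (s + \<tau>)"
  let ?q = "\<lambda>\<tau>::real. indicator {0..} \<tau> * exp (- \<beta> * \<tau>) * f (- (- s + \<tau>))"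
  have ip: "integrable lborel ?p" by (rule half_resolvent_integrable[OF assms(1,3)])
  have iq: "integrable lborel (\<lambda>\<tau>. ?q (- \<tau>))"
    by (rule integrable_reflect[OF half_resolvent_integrable[OF assms(2) bounded_borel_reflect[OF assms(3)]]])
  note [measurable] = bounded_borel_borel[OF assms(3)]
  have "resolvent \<alpha> \<beta> f s = (LINT \<tau>|lborel. (?p \<tau> + ?q (- \<tau>)) / (\<alpha> + \<beta>))"
    unfolding resolvent_def
  proof (rule integral_cong_AE)
    show "AE \<tau> in lborel. ker \<alpha> \<beta> \<tau> * f (s + \<tau>) = (?p \<tau> + ?q (- \<tau>)) / (\<alpha> + \<beta>)"
      using AE_lborel_singleton[of 0] by eventually_elim (auto simp: ker_def indicator_def add.commute)
  qed measurable
  also have "\<dots> = ((LINT \<tau>|lborel. ?p \<tau>) + (LINT \<tau>|lborel. ?q (- \<tau>))) / (\<alpha> + \<beta>)"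
    using ip iq by simp
  also have "(LINT \<tau>|lborel. ?q (- \<tau>)) = (LINT \<tau>|lborel. ?q \<tau>)" by (rule integral_reflect)
  finally show ?thesis by (simp add: half_resolvent_def)
qed

text \<open>The substitution \<open>x = s + \<tau>\<close> writes it as
  \<open>exp (\<gamma> * s)\<close> times the integral of \<open>exp (- \<gamma> * x) * f x\<close>
  over \<open>[s, \<infinity>)\<close>, to which the fundamental theorem of calculus
  applies.\<close>

lemma half_resolvent_deriv:
  assumes \<gamma>: "0 < \<gamma>" and f: "bounded_borel f" "\<And>s. isCont f s"
  shows "(half_resolvent \<gamma> f has_real_derivative \<gamma> * half_resolvent \<gamma> f s - f s) (at s)"
proof -
  define h where "h x = exp (- \<gamma> * x) * f x" for x
  have ch: "isCont h x" for x unfolding h_def by (intro continuous_intros f(2))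
  obtain H where H: "\<And>x. (H has_vector_derivative h x) (at x)"
    using einterval_antiderivative[of "-\<infinity>" "\<infinity>" h] ch by auto
  have HD: "(H has_real_derivative h x) (at x)" for x
    using H[of x] by (simp add: has_real_derivative_iff_has_vector_derivative)
  define G where "G s = (LINT x|lborel. indicator {s..} x * h x)" for s
  have PG: "half_resolvent \<gamma> f s = exp (\<gamma> * s) * G s" for s
  proof -
    have "G s = (LINT \<tau>|lborel. indicator {s..} (s + \<tau>) * h (s + \<tau>))"
      unfolding G_def using lborel_integral_real_affine[of 1 "\<lambda>x. indicator {s..} x * h x" s] by simp
    also have "\<dots> = (LINT \<tau>|lborel. exp (- \<gamma> * s) * (indicator {0..} \<tau> * exp (- \<gamma> * \<tau>) * f (s + \<tau>)))"
    proof (intro Bochner_Integration.integral_cong refl)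
      fix \<tau> :: real
      have e: "exp (- \<gamma> * (s + \<tau>)) = exp (- \<gamma> * s) * exp (- \<gamma> * \<tau>)" by (simp only: exp_add[symmetric] distrib_left)
      show "indicator {s..} (s + \<tau>) * h (s + \<tau>) = exp (- \<gamma> * s) * (indicator {0..} \<tau> * exp (- \<gamma> * \<tau>) * f (s + \<tau>))"
        unfolding h_def e by (simp add: indicator_def)
    qed
    also have "\<dots> = exp (- \<gamma> * s) * half_resolvent \<gamma> f s" unfolding half_resolvent_def by (rule integral_mult_right_zero)
    finally show ?thesis by (simp add: mult.assoc[symmetric] exp_add[symmetric])
  qed
  have intG: "integrable lborel (\<lambda>x. indicator {s..} x * h x)" for s
  proof -
    define k where "k \<tau> = exp (- \<gamma> * s) * (indicator {0..} \<tau> * exp (- \<gamma> * \<tau>) * f (s + \<tau>))" for \<tau> :: real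
    have ik: "integrable lborel k"
      unfolding k_def[abs_def] by (intro integrable_mult_right half_resolvent_integrable \<gamma> f)
    have e: "k (x - s) = indicator {s..} x * h x" for x
    proof -
      have "exp (- \<gamma> * s) * exp (- \<gamma> * (x - s)) = exp (- \<gamma> * x)"
        by (simp add: exp_add[symmetric] algebra_simps)
      then show ?thesis unfolding k_def h_def by (simp add: indicator_def)
    qed
    show ?thesis using lborel_integrable_real_affine[OF ik, of 1 "- s"] by (simp add: e)
  qed
  have [measurable]: "h \<in> borel_measurable borel"
    using ch by (intro borel_measurable_continuous_onI continuous_at_imp_continuous_on) auto
  have diff: "G x - G y = H y - H x" if "x \<le> y" for x y
  proof -
    have "G x - G y = (LINT z|lborel. indicator {x..} z * h z - indicator {y..} z * h z)"
      unfolding G_def using intG by simp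
    also have "\<dots> = (LINT z|lborel. h z * indicator {x..y} z)"
    proof (rule integral_cong_AE)
      show "AE z in lborel. indicator {x..} z * h z - indicator {y..} z * h z = h z * indicator {x..y} z"
        using AE_lborel_singleton[of y] by eventually_elim (use that in \<open>auto simp: indicator_def\<close>)
    qed measurable
    also have "\<dots> = H y - H x"
      using that HD ch by (intro integral_FTC_Icc_real) auto
    finally show ?thesis .
  qed
  have "G x = G 0 + H 0 - H x" for x
    using diff[of x 0] diff[of 0 x] by (cases "x \<le> 0") auto
  then have GH: "G = (\<lambda>x. G 0 + H 0 - H x)" by blast
  have "(G has_real_derivative - h s) (at s)"
    by (subst GH) (auto intro!: derivative_eq_intros HD)
  then have "((\<lambda>s. exp (\<gamma> * s) * G s) has_real_derivative \<gamma> * (exp (\<gamma> * s) * G s) - exp (\<gamma> * s) * h s) (at s)"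
    by (auto intro!: derivative_eq_intros simp: algebra_simps)
  moreover have "exp (\<gamma> * s) * h s = f s" by (simp add: h_def mult.assoc[symmetric] exp_add[symmetric])
  ultimately show ?thesis by (simp add: PG[abs_def] PG)
qed

text \<open>The one-sided parts satisfy \<open>P' = \<alpha> * P - f\<close> and
  \<open>Q' = f - \<beta> * Q\<close>. The jump terms cancel in the derivative of the sum, so it can
  be differentiated again, giving \<open>(\<alpha> - d/ds) (\<beta> + d/ds) w = f\<close> in
  expanded form.\<close>

lemma resolvent_ode:
  assumes pos: "0 < \<alpha>" "0 < \<beta>" and f: "bounded_borel f" "\<And>s. isCont f s"
  shows "\<exists>w1. (\<forall>s. (resolvent \<alpha> \<beta> f has_real_derivative w1 s) (at s)) \<and>
    (\<forall>s. (w1 has_real_derivative (\<alpha> - \<beta>) * w1 s + \<alpha> * \<beta> * resolvent \<alpha> \<beta> f s - f s) (at s))"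
proof -
  let ?g = "\<lambda>x. f (- x)"
  have g: "bounded_borel ?g" "\<And>s. isCont ?g s"
    using bounded_borel_reflect[OF f(1)] f(2) isCont_o2[of _ uminus f] by (auto intro!: continuous_intros)
  define P where "P = half_resolvent \<alpha> f"
  define Q where "Q s = half_resolvent \<beta> ?g (- s)" for s
  have dP: "(P has_real_derivative \<alpha> * P s - f s) (at s)" for s
    unfolding P_def by (rule half_resolvent_deriv[OF pos(1) f])
  have dQ: "(Q has_real_derivative f s - \<beta> * Q s) (at s)" for s
  proof -
    have c: "((\<lambda>s. - s) has_real_derivative - 1) (at s)" by (auto intro!: derivative_eq_intros)
    show ?thesis unfolding Q_def
      using DERIV_chain2[where f = "half_resolvent \<beta> ?g" and g = "\<lambda>s. - s" and x = s, OF half_resolvent_deriv[OF pos(2) g] c]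
      by (simp add: algebra_simps)
  qed
  have Tw: "resolvent \<alpha> \<beta> f = (\<lambda>s. (P s + Q s) / (\<alpha> + \<beta>))"
    by (rule ext) (simp add: resolvent_split[OF pos f(1)] P_def Q_def)
  define w1 where "w1 s = (\<alpha> * P s - \<beta> * Q s) / (\<alpha> + \<beta>)" for s
  have ab: "\<alpha> + \<beta> \<noteq> 0" using pos by simp
  have "(resolvent \<alpha> \<beta> f has_real_derivative w1 s) (at s)" for s
  proof -
    have "((\<lambda>s. (P s + Q s) / (\<alpha> + \<beta>)) has_real_derivative ((\<alpha> * P s - f s) + (f s - \<beta> * Q s)) / (\<alpha> + \<beta>)) (at s)"
      by (intro DERIV_cdivide DERIV_add dP dQ)
    then show ?thesis unfolding Tw w1_def by simp
  qed
  moreover have "(w1 has_real_derivative (\<alpha> - \<beta>) * w1 s + \<alpha> * \<beta> * resolvent \<alpha> \<beta> f s - f s) (at s)" for s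
  proof -
    have "(w1 has_real_derivative (\<alpha> * (\<alpha> * P s - f s) - \<beta> * (f s - \<beta> * Q s)) / (\<alpha> + \<beta>)) (at s)"
      unfolding w1_def using ab by (auto intro!: derivative_eq_intros dP dQ)
    moreover have "(\<alpha> * (\<alpha> * P s - f s) - \<beta> * (f s - \<beta> * Q s)) / (\<alpha> + \<beta>) = (\<alpha> - \<beta>) * w1 s + \<alpha> * \<beta> * resolvent \<alpha> \<beta> f s - f s"
      unfolding Tw w1_def using ab by (simp add: divide_simps) algebra
    ultimately show ?thesis by simp
  qed
  ultimately show ?thesis by blast
qed

section \<open>Regularity of resolvents and of radial profiles\<close>

lemma Ck1_on_mono: "Ck1_on m f S \<Longrightarrow> k \<le> m \<Longrightarrow> Ck1_on k f S"
proof (induction m)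
  case (Suc m)
  then show ?case using Ck1_on_Suc_D[of m f S] by (cases "k = Suc m") (auto simp del: Ck1_on.simps)
qed simp

lemma Ck1_on_lin: "Ck1_on k f UNIV \<Longrightarrow> Ck1_on k g UNIV \<Longrightarrow> Ck1_on k (\<lambda>x. c * f x + d * g x) UNIV"
proof (induction k arbitrary: f g)
  case (Suc k)
  have "(f has_real_derivative deriv f s) (at s)" "(g has_real_derivative deriv g s) (at s)" for s
    using Suc.prems by (auto simp: DERIV_deriv_iff_field_differentiable)
  then have "((\<lambda>x. c * f x + d * g x) has_real_derivative c * deriv f s + d * deriv g s) (at s)" for s
    by (auto intro!: derivative_eq_intros)
  then show ?case using Suc by (intro Ck1_on_SucI[where f' = "\<lambda>s. c * deriv f s + d * deriv g s"]) auto
qed (auto intro!: continuous_intros)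

lemma Ck1_on_exp_mult: "Ck1_on k f UNIV \<Longrightarrow> Ck1_on k (\<lambda>x. exp (c * x) * f x) UNIV"
proof (induction k arbitrary: f)
  case (Suc k)
  have "(f has_real_derivative deriv f s) (at s)" for s
    using Suc.prems by (auto simp: DERIV_deriv_iff_field_differentiable)
  then have "((\<lambda>x. exp (c * x) * f x) has_real_derivative exp (c * s) * (c * f s + 1 * deriv f s)) (at s)" for s
    by (auto intro!: derivative_eq_intros simp: algebra_simps)
  moreover have "Ck1_on k (\<lambda>s. exp (c * s) * (c * f s + 1 * deriv f s)) UNIV"
    using Suc.prems Ck1_on_Suc_D[OF Suc.prems] by (intro Suc.IH Ck1_on_lin) auto
  ultimately show ?case by (intro Ck1_on_SucI[where f' = "\<lambda>s. exp (c * s) * (c * f s + 1 * deriv f s)"]) auto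
qed (auto intro!: continuous_intros)

lemma Ck1_on_resolvent:
  assumes pos: "0 < \<alpha>" "0 < \<beta>" and f: "bounded_borel f" "Ck1_on k f UNIV"
  shows "Ck1_on (Suc (Suc k)) (resolvent \<alpha> \<beta> f) UNIV"
proof -
  have cf: "isCont f s" for s
    using Ck1_on_mono[OF f(2), of 0] by (auto simp: continuous_on_eq_continuous_at)
  obtain w1 where w1: "\<And>s. (resolvent \<alpha> \<beta> f has_real_derivative w1 s) (at s)"
    "\<And>s. (w1 has_real_derivative (\<alpha> - \<beta>) * w1 s + \<alpha> * \<beta> * resolvent \<alpha> \<beta> f s - f s) (at s)"
    using resolvent_ode[OF pos f(1) cf] by blast
  have "j \<le> Suc k \<Longrightarrow> Ck1_on j w1 UNIV \<and> Ck1_on j (resolvent \<alpha> \<beta> f) UNIV" for j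
  proof (induction j)
    case 0
    then show ?case using w1 by (auto intro!: continuous_at_imp_continuous_on DERIV_isCont)
  next
    case (Suc j)
    then have IH: "Ck1_on j w1 UNIV" "Ck1_on j (resolvent \<alpha> \<beta> f) UNIV" by auto
    have "Ck1_on j (\<lambda>s. 1 * ((\<alpha> - \<beta>) * w1 s + (\<alpha> * \<beta>) * resolvent \<alpha> \<beta> f s) + (- 1) * f s) UNIV"
      using Suc.prems by (intro Ck1_on_lin IH Ck1_on_mono[OF f(2)]) simp
    then have "Ck1_on (Suc j) w1 UNIV"
      by (intro Ck1_on_SucI[OF open_UNIV w1(2)]) simp
    then show ?case using Ck1_on_SucI[OF open_UNIV w1(1) IH(1)] by blast
  qed
  from this[of "Suc k"] show ?thesis using Ck1_on_SucI[OF open_UNIV w1(1)] by blast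
qed

text \<open>Written through the squared norm, a polynomial, the logarithm of the norm falls under
  \<open>Ck_on_compose\<close> away from the origin.\<close>

lemma ln_norm_eq: "ln (norm x) = (1 / 2) * ln ((norm (x - 0))\<^sup>2)" for x :: "real ^ 'n"
  by (cases "x = 0") (simp_all add: ln_realpow)

lemma Ck_on_ln_norm: "Ck_on k (\<lambda>x :: real ^ 'n. ln (norm x)) (- {0})"
proof -
  have "Ck1_on k (\<lambda>y. (1 / 2) * ln y) {0<..}"
  proof (cases k)
    case (Suc j)
    show ?thesis unfolding Suc
      by (rule Ck1_on_SucI[OF _ _ Ck1_on_powr[of j "1 / 2" "- 1"]])
        (auto intro!: derivative_eq_intros simp: powr_minus inverse_eq_divide)
  qed (auto intro!: continuous_intros)
  then show ?thesis unfolding ln_norm_eq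
    by (intro Ck_on_compose[where I = "{0<..}" and h = "\<lambda>y. (1 / 2) * ln y"] Ck_on_sqdist) auto
qed

lemma partial_ln_norm:
  assumes "(x :: real ^ 'n) \<noteq> 0"
  shows "partial i (\<lambda>x. ln (norm x)) x = x $ i * Eker 1 0 0 x"
proof -
  have d: "(\<lambda>x. (norm (x - 0))\<^sup>2) differentiable (at x)"
    using Ck_on_sqdist[of 1 0 UNIV] by (intro Ck_on_differentiable[of UNIV 0]) auto
  have "((\<lambda>y. (1 / 2) * ln y) has_real_derivative (1 / 2) * inverse ((norm (x - 0))\<^sup>2)) (at ((norm (x - 0))\<^sup>2))"
    using assms by (auto intro!: derivative_eq_intros simp: inverse_eq_divide)
  from partial_compose(1)[OF d this, of i] show ?thesis
    unfolding ln_norm_eq by (simp add: partial_sqdist[of _ 0, simplified] Eker_def powr_minus)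
qed

text \<open>In the variable \<open>s = ln (norm x)\<close> the Laplacian of a radial function is
  \<open>exp (- 2 * s)\<close> times \<open>d^2/ds^2 + (n - 2) d/ds\<close>.\<close>

lemma laplacian_radial:
  assumes U: "\<And>s. (U has_real_derivative U1 s) (at s)" "\<And>s. (U1 has_real_derivative U2 s) (at s)" and x: "(x :: real ^ 'n) \<noteq> 0"
  shows "laplacian (\<lambda>x. U (ln (norm x))) x = exp (- 2 * ln (norm x)) * (U2 (ln (norm x)) + (real CARD('n) - 2) * U1 (ln (norm x)))"
proof -
  let ?l = "\<lambda>x :: real ^ 'n. ln (norm x)" and ?E = "Eker 1 0 0 :: real ^ 'n \<Rightarrow> real"
  have dl: "?l differentiable (at x)" if "x \<noteq> 0" for x
    using that Ck_on_ln_norm[of 1] by (intro Ck_on_differentiable[of "- {0}" 0]) auto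
  have pos: "0\<^sup>2 + (norm (x - 0))\<^sup>2 > 0" using x by simp
  have dE: "?E differentiable (at x)"
    using x Ck_on_Eker[of "- {0}" 0 0 1 1] by (intro Ck_on_differentiable[of "- {0}" 0]) auto
  have dc: "(\<lambda>x. x $ i) differentiable (at x)" for i
    using Ck_on_component[of 1 i 0 UNIV] by (auto intro: Ck_on_differentiable[of UNIV 0])
  have pc: "partial i (\<lambda>x. x $ i) x = 1" for i using partial_component[of i i 0 x] by simp
  note dU1 = partial_compose(2)[OF dl[OF x] U(2)] and pU1 = partial_compose(1)[OF dl[OF x] U(2)]
  have E2: "?E x = exp (- 2 * ?l x)" "Eker 2 0 0 x = ?E x * ?E x" "(norm x)\<^sup>2 * ?E x = 1"
  proof -
    have "?E x = norm x powr (- 2)" using norm_powr_eq_Eker[of x 2] by simp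
    then show "?E x = exp (- 2 * ?l x)" using x by (simp add: powr_def)
    show "Eker 2 0 0 x = ?E x * ?E x" unfolding Eker_def using powr_add[of "0\<^sup>2 + (norm (x - 0))\<^sup>2" "- 1" "- 1"] by simp
    show "(norm x)\<^sup>2 * ?E x = 1" using x by (simp add: Eker_def powr_minus)
  qed
  have "partial i (partial i (\<lambda>x. U (?l x))) x
     = U1 (?l x) * ?E x + (U2 (?l x) - 2 * U1 (?l x)) * ((x $ i)\<^sup>2 * (?E x * ?E x))" for i
  proof -
    have "partial i (partial i (\<lambda>x. U (?l x))) x = partial i (\<lambda>x. U1 (?l x) * (x $ i * ?E x)) x"
      by (rule partial_cong_open[of "- {0}"])
        (use x in \<open>auto simp: partial_compose(1)[OF dl U(1)] partial_ln_norm\<close>)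
    also have "\<dots> = U1 (?l x) * (x $ i * (- 2 * 1 * (x $ i - 0 $ i) * Eker (1 + 1) 0 0 x) + 1 * ?E x)
        + (U2 (?l x) * (x $ i * ?E x)) * (x $ i * ?E x)"
      using dc[of i] dE dU1
      by (subst partial_mult) (simp_all only: partial_mult differentiable_mult pc partial_Eker[OF pos] pU1 partial_ln_norm[OF x])
    finally show ?thesis using E2(2) by (simp add: algebra_simps power2_eq_square)
  qed
  then have "laplacian (\<lambda>x. U (?l x)) x = real CARD('n) * (U1 (?l x) * ?E x)
      + (U2 (?l x) - 2 * U1 (?l x)) * ((\<Sum>i\<in>UNIV. (x $ i)\<^sup>2) * (?E x * ?E x))"
    by (simp add: laplacian_def sum.distrib sum_distrib_left sum_distrib_right)
  also have "(\<Sum>i\<in>UNIV. (x $ i)\<^sup>2) = (norm x)\<^sup>2"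
    unfolding power2_norm_eq_inner inner_vec_def by (simp add: power2_eq_square)
  also have "(norm x)\<^sup>2 * (?E x * ?E x) = ?E x" using E2(3) by (simp add: mult.assoc[symmetric])
  finally show ?thesis unfolding E2(1)[symmetric] by (simp add: algebra_simps)
qed

text \<open>The radial form of \<open>-\<Delta>\<close> maps \<open>|x|\<^sup>-\<^sup>c w(ln |x|)\<close> to \<open>|x|\<close> to the power \<open>- c - 2\<close> times
  \<open>(c - d/ds) (d - c + d/ds) w\<close>, where \<open>d = n - 2\<close>.\<close>

primrec exponents :: "real \<Rightarrow> nat \<Rightarrow> real \<Rightarrow> (real \<times> real) list" where
  "exponents d 0 c = []"
| "exponents d (Suc m) c = (c, d - c) # exponents d m (c + 2)"

lemma exponents_snoc: "exponents d (Suc m) c = exponents d m c @ [(c + 2 * real m, d - c - 2 * real m)]"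
proof (induction m arbitrary: c)
  case (Suc m)
  have "exponents d (Suc (Suc m)) c = (c, d - c) # exponents d (Suc m) (c + 2)" by (rule exponents.simps(2))
  also note Suc.IH[of "c + 2"]
  finally show ?case by (simp add: algebra_simps)
qed simp

text \<open>This is where criticality enters. With \<open>d = n - 2\<close> the hypothesis says
  \<open>a + b = n - 2 * m\<close>; then the factors of the radial operator belonging to
  \<open>b\<close> are the adjoints of those belonging to \<open>a\<close>.\<close>

lemma exponents_dual: "a + b = d - 2 * (real m - 1) \<Longrightarrow> rev (map prod.swap (exponents d m a)) = exponents d m b"
proof (induction m arbitrary: a)
  case (Suc m)
  have "rev (map prod.swap (exponents d m (a + 2))) = exponents d m b" using Suc.prems by (intro Suc.IH) (simp add: algebra_simps)
  moreover have "b + 2 * real m = d - a" "d - b - 2 * real m = a" using Suc.prems by (auto simp: algebra_simps)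
  ultimately show ?case unfolding exponents_snoc[of d m b] by simp
qed simp

lemma exponents_set: "p \<in> set (exponents d m c) \<Longrightarrow> c \<le> fst p \<and> d - c - 2 * (real m - 1) \<le> snd p \<and> fst p + snd p = d"
proof (induction m arbitrary: c)
  case (Suc m)
  from Suc.prems consider "p = (c, d - c)" | "p \<in> set (exponents d m (c + 2))" by auto
  then show ?case
  proof cases
    case 2
    from Suc.IH[OF this] show ?thesis by (simp add: algebra_simps)
  qed simp
qed simp

text \<open>One application of the negative Laplacian strips the outermost resolvent and raises the
  exponent \<open>c\<close> by 2, matching the recursion of \<open>exponents\<close>.\<close>

lemma radial_polyharmonic:
  fixes f :: "real \<Rightarrow> real"
  assumes f: "bounded_borel f" "\<And>s. isCont f s"
  shows "pospairs (exponents (real CARD('n) - 2) m c) \<Longrightarrow>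
    Ck1_on (2 * m) (resolvents (exponents (real CARD('n) - 2) m c) f) UNIV \<and>
    (\<forall>x :: real ^ 'n. x \<noteq> 0 \<longrightarrow> neg_laplacian_power m
      (\<lambda>x. exp (- c * ln (norm x)) * resolvents (exponents (real CARD('n) - 2) m c) f (ln (norm x))) x
      = exp (- (c + 2 * real m) * ln (norm x)) * f (ln (norm x)))"
proof (induction m arbitrary: c)
  case 0
  then show ?case using f(2) by (auto simp: neg_laplacian_power_0 intro!: continuous_at_imp_continuous_on)
next
  case (Suc m)
  let ?d = "real CARD('n) - 2"
  let ?g = "resolvents (exponents ?d m (c + 2)) f"
  define \<beta> where "\<beta> = ?d - c"
  have pp: "pospairs (exponents ?d m (c + 2))" "0 < c" "0 < \<beta>" using Suc.prems by (auto simp: \<beta>_def)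
  note IH = Suc.IH[OF pp(1)]
  have g: "bounded_borel ?g" using resolvents_bb[OF pp(1) f(1)] .
  have gc: "isCont ?g s" for s
    using Ck1_on_mono[OF conjunct1[OF IH], of 0] by (auto simp: continuous_on_eq_continuous_at)
  let ?w = "resolvent c \<beta> ?g"
  have resolvents: "resolvents (exponents ?d (Suc m) c) f = ?w" by (simp add: \<beta>_def)
  have C: "Ck1_on (2 * Suc m) ?w UNIV" using Ck1_on_resolvent[OF pp(2,3) g conjunct1[OF IH]] by simp
  obtain w1 where w1: "\<And>s. (?w has_real_derivative w1 s) (at s)"
    "\<And>s. (w1 has_real_derivative (c - \<beta>) * w1 s + c * \<beta> * ?w s - ?g s) (at s)"
    using resolvent_ode[OF pp(2,3) g gc] by blast
  define U where "U s = exp (- c * s) * ?w s" for s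
  define U1 where "U1 s = exp (- c * s) * (w1 s - c * ?w s)" for s
  define U2 where "U2 s = exp (- c * s) * (((c - \<beta>) * w1 s + c * \<beta> * ?w s - ?g s) - 2 * c * w1 s + c * c * ?w s)" for s
  have dU: "(U has_real_derivative U1 s) (at s)" "(U1 has_real_derivative U2 s) (at s)" for s
    unfolding U_def U1_def U2_def by (auto intro!: derivative_eq_intros w1 simp: algebra_simps)
  have lap: "- laplacian (\<lambda>x. U (ln (norm x))) x = exp (- (c + 2) * ln (norm x)) * ?g (ln (norm x))" if "x \<noteq> 0" for x :: "real ^ 'n"
  proof -
    let ?s = "ln (norm x)"
    \<comment> \<open>Conjugation by \<open>exp (- c * s)\<close> turns
      \<open>d^2/ds^2 + (n - 2) d/ds\<close> into minus the operator inverted by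
      \<open>resolvent c \<beta>\<close>, with \<open>c + \<beta> = n - 2\<close>.\<close>
    have "U2 ?s + ?d * U1 ?s = - (exp (- c * ?s) * ?g ?s)" unfolding U1_def U2_def by (simp add: \<beta>_def algebra_simps)
    then have "laplacian (\<lambda>x. U (ln (norm x))) x = exp (- 2 * ?s) * - (exp (- c * ?s) * ?g ?s)"
      using laplacian_radial[OF dU that] by simp
    then show ?thesis by (simp add: mult.assoc[symmetric] exp_add[symmetric] algebra_simps)
  qed
  have "neg_laplacian_power (Suc m) (\<lambda>x. U (ln (norm x))) x = exp (- (c + 2 * real (Suc m)) * ln (norm x)) * f (ln (norm x))"
    if x: "x \<noteq> 0" for x :: "real ^ 'n"
  proof -
    have "neg_laplacian_power (Suc m) (\<lambda>x. U (ln (norm x))) x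
       = neg_laplacian_power m (\<lambda>x. exp (- (c + 2) * ln (norm x)) * ?g (ln (norm x))) x"
      unfolding neg_laplacian_power_Suc
      by (rule neg_laplacian_power_cong_open[of "- {0}"]) (use x lap in auto)
    also have "\<dots> = exp (- (c + 2 + 2 * real m) * ln (norm x)) * f (ln (norm x))"
      using IH x by blast
    also have "- (c + 2 + 2 * real m) = - (c + 2 * real (Suc m))" by simp
    finally show ?thesis .
  qed
  then show ?case using C unfolding resolvents U_def by blast
qed

lemma Ck_on_radial:
  assumes "Ck1_on k g UNIV"
  shows "Ck_on k (\<lambda>x :: real ^ 'n. exp (- c * ln (norm x)) * g (ln (norm x))) (- {0})"
  using Ck_on_compose[OF _ open_UNIV subset_UNIV Ck_on_ln_norm Ck1_on_exp_mult[OF assms, of "- c"]] by auto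

section \<open>A solution on the whole line\<close>

text \<open>The periodic solutions are rescaled to remove the eigenvalue \<open>S\<close>,
  translated so that the maximum is nearly attained at 0, and sent to infinite period. Bounds for
  sup and energy and the positive value at 0 are independent of the period, so the limit is nonzero
  and has finite energy.\<close>

lemma line_solution:
  assumes ps: "pospairs ps" "ps \<noteq> []" "\<And>p. p \<in> set ps \<Longrightarrow> fst p \<le> L \<and> snd p \<le> L"
    and q: "1 < q" "1 < r"
  defines "qs \<equiv> rev (map prod.swap ps)"
  shows "\<exists>w z B E. loglip L w \<and> loglip L z \<and> (\<forall>s. w s \<le> B) \<and> (\<forall>s. z s \<le> B) \<and> 0 < w 0 \<and>
    w = resolvents ps (\<lambda>s. z s powr q) \<and> z = resolvents qs (\<lambda>s. w s powr r) \<and>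
    (\<forall>K::nat. (LINT s|lborel. indicator {- real K..<real K} s * w s powr (r + 1)) \<le> E) \<and>
    (\<forall>K::nat. (LINT s|lborel. indicator {- real K..<real K} s * z s powr (q + 1)) \<le> E)"
proof -
  have qs: "pospairs qs" using ps by (auto simp: qs_def)
  have L: "0 \<le> L"
  proof -
    obtain p where "p \<in> set ps" using ps(2) by (cases ps) auto
    then have "0 < fst p" "fst p \<le> L" using ps by auto
    then show ?thesis by linarith
  qed
  obtain C where C: "0 < C" "\<And>f M s. bounded_borel f \<Longrightarrow> (\<And>x. \<bar>f x\<bar> \<le> M) \<Longrightarrow> \<bar>resolvents ps f s\<bar> \<le> C * M"
    using resolvents_bound[OF ps(1)] by blast
  obtain C' where C': "0 < C'" "\<And>f M s. bounded_borel f \<Longrightarrow> (\<And>x. \<bar>f x\<bar> \<le> M) \<Longrightarrow> \<bar>resolvents qs f s\<bar> \<le> C' * M"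
    using resolvents_bound[OF qs(1)] by blast
  obtain c where c: "0 < c" "\<And>N. 1 \<le> N \<Longrightarrow> \<exists>S W Z. c \<le> S \<and> admissible N r W \<and> admissible N q Z \<and> loglip L W \<and> loglip L Z \<and>
    (\<forall>s. resolvents ps (\<lambda>s. Z s powr q) s = S * W s) \<and> (\<forall>s. resolvents qs (\<lambda>s. W s powr r) s = S * Z s)"
    using periodic_solution[OF ps, of q r] q unfolding qs_def by auto
  define D where "D = q * r - 1"
  have D: "0 < D" using mult_strict_mono[of 1 q 1 r] q by (simp add: D_def)
  \<comment> \<open>\<open>A0\<close> and \<open>B0\<close> are the rescaling factors
    \<open>a\<close> and \<open>b\<close> below evaluated at the lower bound \<open>c\<close> for
    \<open>S\<close>; they bound these factors from below for every period.\<close>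
  define A0 where "A0 = c powr ((1 + q) / D)"
  define B0 where "B0 = c powr ((1 + r) / D)"
  have AB0: "0 < A0" "0 < B0" using c by (simp_all add: A0_def B0_def)
  define B where "B = max (exp L / A0) (exp L / B0)"
  define E where "E = max (A0 powr (- (r + 1))) (B0 powr (- (q + 1)))"
  define K where "K = C * (C' powr q)"
  have K: "0 < K" using C C' by (simp add: K_def)
  \<comment> \<open>The threshold in \<open>m \<le> K * m powr (q * r)\<close>: as
    \<open>q * r > 1\<close>, a positive maximum \<open>m\<close> satisfying this is at least
    \<open>\<delta>\<close>.\<close>
  define \<delta> where "\<delta> = (1 / K) powr (1 / D)"
  have \<delta>: "0 < \<delta>" using K by (simp add: \<delta>_def)
  have "\<exists>w z. loglip L w \<and> loglip L z \<and> (\<forall>s. w s \<le> B) \<and> (\<forall>s. z s \<le> B) \<and> \<delta> / 2 \<le> w 0 \<and>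
    (\<forall>s. w s = resolvents ps (\<lambda>s. z s powr q) s) \<and> (\<forall>s. z s = resolvents qs (\<lambda>s. w s powr r) s) \<and>
    periodic N w \<and> periodic N z \<and> period_int N (\<lambda>s. w s powr (r + 1)) \<le> E \<and> period_int N (\<lambda>s. z s powr (q + 1)) \<le> E"
    if N: "1 \<le> N" for N
  proof -
    obtain S W Z where S: "c \<le> S" "admissible N r W" "admissible N q Z" "loglip L W" "loglip L Z"
      "\<And>s. resolvents ps (\<lambda>s. Z s powr q) s = S * W s" "\<And>s. resolvents qs (\<lambda>s. W s powr r) s = S * Z s"
      using c(2)[OF N] by blast
    have S0: "0 < S" using S(1) c(1) by linarith
    have W: "\<And>s. 0 \<le> W s" "periodic N W" "period_int N (\<lambda>s. W s powr (r + 1)) = 1" "\<And>s. W s \<le> exp L"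
      using S admissible_loglip_bound[OF S(2,4) L N] q by (auto simp: admissible_def)
    have Z: "\<And>s. 0 \<le> Z s" "periodic N Z" "period_int N (\<lambda>s. Z s powr (q + 1)) = 1" "\<And>s. Z s \<le> exp L"
      using S admissible_loglip_bound[OF S(3,5) L N] q by (auto simp: admissible_def)
    \<comment> \<open>Chosen to solve \<open>S * a = b powr q\<close> and
      \<open>S * b = a powr r\<close>, so that \<open>W / a\<close> and \<open>Z / b\<close> satisfy
      the system without the factor \<open>S\<close>.\<close>
    define a where "a = S powr ((1 + q) / D)"
    define b where "b = S powr ((1 + r) / D)"
    have ab: "A0 \<le> a" "B0 \<le> b" "0 < a" "0 < b"
      unfolding a_def b_def A0_def B0_def using S(1) S0 c(1) D q by (auto intro!: powr_mono2)
    have sab: "S * a = b powr q" "S * b = a powr r"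
    proof -
      have "1 + (1 + q) / D = (1 + r) / D * q" "1 + (1 + r) / D = (1 + q) / D * r"
        using D by (simp_all add: field_simps) (simp_all add: D_def algebra_simps)
      then show "S * a = b powr q" "S * b = a powr r"
        unfolding a_def b_def powr_powr using S0 by (simp_all add: powr_mult_base)
    qed
    define w where "w s = (1 / a) * W s" for s
    define z where "z s = (1 / b) * Z s" for s
    have lw: "loglip L w" "loglip L z" unfolding w_def[abs_def] z_def[abs_def]
      using S(4,5) ab(3,4) by (intro loglip_cmult; simp)+
    have wn: "0 \<le> w s" "0 \<le> z s" for s using lw by (auto simp: loglip_def)
    have wB: "w s \<le> B" "z s \<le> B" for s
    proof -
      have "w s \<le> exp L / A0" "z s \<le> exp L / B0"
        unfolding w_def z_def using frac_le[of "exp L" "W s" A0 a] frac_le[of "exp L" "Z s" B0 b]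
          W(1,4)[of s] Z(1,4)[of s] ab AB0 by simp_all
      then show "w s \<le> B" "z s \<le> B" unfolding B_def by auto
    qed
    have bw: "bounded_borel w" "bounded_borel z" using loglip_bb[OF lw(1) wB(1)] loglip_bb[OF lw(2) wB(2)] by auto
    have eq1: "resolvents ps (\<lambda>s. z s powr q) s = w s" for s
    proof -
      have "(\<lambda>s. z s powr q) = (\<lambda>s. (1 / b powr q) * Z s powr q)"
        unfolding z_def using ab Z(1) by (simp add: powr_mult powr_divide)
      then have "resolvents ps (\<lambda>s. z s powr q) s = (1 / b powr q) * (S * W s)" by (simp only: resolvents_cmult S(6))
      also have "\<dots> = w s" unfolding sab(1)[symmetric] w_def using S0 ab by simp
      finally show ?thesis .
    qed
    have eq2: "resolvents qs (\<lambda>s. w s powr r) s = z s" for s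
    proof -
      have "(\<lambda>s. w s powr r) = (\<lambda>s. (1 / a powr r) * W s powr r)"
        unfolding w_def using ab W(1) by (simp add: powr_mult powr_divide)
      then have "resolvents qs (\<lambda>s. w s powr r) s = (1 / a powr r) * (S * Z s)" by (simp only: resolvents_cmult S(7))
      also have "\<dots> = z s" unfolding sab(2)[symmetric] z_def using S0 ab by simp
      finally show ?thesis .
    qed
    have pw: "periodic N w" "periodic N z" using W(2) Z(2) by (auto simp: periodic_def w_def z_def)
    have pinv: "(1 / x) powr p = x powr (- p)" if "0 < x" for x p :: real
      using that by (simp add: powr_minus powr_divide inverse_eq_divide)
    have Ew: "period_int N (\<lambda>s. w s powr (r + 1)) \<le> E"
    proof -
      have "period_int N (\<lambda>s. w s powr (r + 1)) = period_int N (\<lambda>s. a powr (- (r + 1)) * W s powr (r + 1))"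
        unfolding w_def using ab W(1) by (simp only: powr_mult pinv)
      also have "\<dots> = a powr (- (r + 1))" by (simp only: period_int_cmult W(3))
      also have "\<dots> \<le> A0 powr (- (r + 1))" using ab AB0 q by (intro powr_mono2') auto
      finally show ?thesis by (simp add: E_def)
    qed
    have Ez: "period_int N (\<lambda>s. z s powr (q + 1)) \<le> E"
    proof -
      have "period_int N (\<lambda>s. z s powr (q + 1)) = period_int N (\<lambda>s. b powr (- (q + 1)) * Z s powr (q + 1))"
        unfolding z_def using ab Z(1) by (simp only: powr_mult pinv)
      also have "\<dots> = b powr (- (q + 1))" by (simp only: period_int_cmult Z(3))
      also have "\<dots> \<le> B0 powr (- (q + 1))" using ab AB0 q by (intro powr_mono2') auto
      finally show ?thesis by (simp add: E_def)
    qed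
    \<comment> \<open>The supremum is at least \<open>\<delta>\<close> by feeding sup bounds once
      through both equations; a point above \<open>\<delta> / 2\<close> avoids the question of
      attainment.\<close>
    obtain s0 where s0: "\<delta> / 2 \<le> w s0"
    proof -
      define m where "m = (SUP s. w s)"
      have bdd: "bdd_above (range w)" using wB(1) by (intro bdd_aboveI[of _ B]) auto
      have wm: "w s \<le> m" for s unfolding m_def by (rule cSUP_upper[OF _ bdd]) simp
      have "\<exists>s. w s \<noteq> 0"
      proof (rule ccontr)
        assume "\<not> ?thesis"
        then have "W s = 0" for s using ab by (simp add: w_def)
        then have "period_int N (\<lambda>s. W s powr (r + 1)) = 0" by (simp add: period_int_def)
        then show False using W(3) by simp
      qed
      then obtain s1 where "0 < w s1" using wn by (metis less_le)
      then have m0: "0 < m" using wm[of s1] by linarith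
      have "\<bar>z s\<bar> \<le> C' * m powr r" for s
        unfolding eq2[symmetric] using wm wn q bw by (intro C'(2) bounded_borel_powr) (auto intro!: powr_mono2)
      then have zb: "z s \<le> C' * m powr r" for s by (metis abs_le_D1)
      have "\<bar>w s\<bar> \<le> C * (C' * m powr r) powr q" for s
        unfolding eq1[symmetric] using zb wn q bw by (intro C(2) bounded_borel_powr) (auto intro!: powr_mono2)
      then have "w s \<le> C * (C' * m powr r) powr q" for s by (metis abs_le_D1)
      then have "m \<le> C * (C' * m powr r) powr q" unfolding m_def by (intro cSUP_least) auto
      also have "\<dots> = K * m powr (q * r)"
        using C' m0 by (simp add: K_def powr_mult powr_powr mult.commute)
      also have "\<dots> = K * (m * m powr D)"
        using m0 powr_mult_base[of m D] by (simp add: D_def)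
      finally have "m * 1 \<le> m * (K * m powr D)" by (simp add: mult_ac)
      then have "1 / K \<le> m powr D" using m0 K by (simp add: field_simps)
      then have "(1 / K) powr (1 / D) \<le> (m powr D) powr (1 / D)" using D K by (intro powr_mono2) auto
      then have "\<delta> \<le> m" using D m0 by (simp add: \<delta>_def powr_powr)
      then have "\<delta> / 2 < m" using \<delta> by simp
      then obtain s where "\<delta> / 2 < w s" unfolding m_def using less_cSUP_iff[OF UNIV_not_empty bdd, of "\<delta> / 2"] by blast
      then show ?thesis by (intro that[of s]) simp
    qed
    let ?w = "\<lambda>s. w (s + s0)" and ?z = "\<lambda>s. z (s + s0)"
    have sh: "period_int N (\<lambda>s. f (s + s0) powr p) = period_int N (\<lambda>s. f s powr p)" if "bounded_borel f" "periodic N f" "\<And>s. 0 \<le> f s" "0 < p" for f p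
      using that N by (intro period_int_shift[of "\<lambda>s. f s powr p"] bounded_borel_powr) (auto simp: periodic_def)
    have p1: "periodic N ?w" and p2: "periodic N ?z"
      using pw(1)[unfolded periodic_def, rule_format, of "s + s0" for s]
        pw(2)[unfolded periodic_def, rule_format, of "s + s0" for s]
      by (simp_all add: periodic_def add_ac)
    have f1: "?w s = resolvents ps (\<lambda>s. ?z s powr q) s" for s
      using fun_cong[OF resolvents_translate[of ps "\<lambda>s. z s powr q" s0], of s] eq1[of "s + s0"] by simp
    have f2: "?z s = resolvents qs (\<lambda>s. ?w s powr r) s" for s
      using fun_cong[OF resolvents_translate[of qs "\<lambda>s. w s powr r" s0], of s] eq2[of "s + s0"] by simp
    have e1: "period_int N (\<lambda>s. ?w s powr (r + 1)) \<le> E"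
      using sh[OF bw(1) pw(1) wn(1), of "r + 1"] q Ew by simp
    have e2: "period_int N (\<lambda>s. ?z s powr (q + 1)) \<le> E"
      using sh[OF bw(2) pw(2) wn(2), of "q + 1"] q Ez by simp
    show ?thesis
      by (intro exI[of _ ?w] exI[of _ ?z] conjI allI loglip_shift lw wB p1 p2 f1 f2 e1 e2) (use s0 in simp)
  qed
  note ex = this
  define PP where "PP n w z \<longleftrightarrow> loglip L w \<and> loglip L z \<and> (\<forall>s. w s \<le> B) \<and> (\<forall>s. z s \<le> B) \<and> \<delta> / 2 \<le> w 0 \<and>
    (\<forall>s. w s = resolvents ps (\<lambda>s. z s powr q) s) \<and> (\<forall>s. z s = resolvents qs (\<lambda>s. w s powr r) s) \<and>
    periodic (real (Suc n)) w \<and> periodic (real (Suc n)) z \<and> period_int (real (Suc n)) (\<lambda>s. w s powr (r + 1)) \<le> E \<and> period_int (real (Suc n)) (\<lambda>s. z s powr (q + 1)) \<le> E"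
    for n w z
  have "\<exists>w z. PP n w z" for n unfolding PP_def by (rule ex) simp
  then have "\<exists>wz. PP n (fst wz) (snd wz)" for n by simp
  then obtain wz0 where P0: "\<And>n. PP n (fst (wz0 n)) (snd (wz0 n))" by metis
  define w where "w n = fst (wz0 n)" for n
  define z where "z n = snd (wz0 n)" for n
  have P: "PP n (w n) (z n)" for n using P0 by (simp add: w_def z_def)
  note c0 = P[unfolded PP_def]
  note c1 = c0[THEN conjunct2]
  note c2 = c1[THEN conjunct2]
  note c3 = c2[THEN conjunct2]
  note c4 = c3[THEN conjunct2]
  note c5 = c4[THEN conjunct2]
  note c6 = c5[THEN conjunct2]
  note c7 = c6[THEN conjunct2]
  note c8 = c7[THEN conjunct2]
  note c9 = c8[THEN conjunct2]
  note c10 = c9[THEN conjunct2]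
  note wz = c0[THEN conjunct1] c1[THEN conjunct1] c2[THEN conjunct1, rule_format] c3[THEN conjunct1, rule_format] c4[THEN conjunct1] c5[THEN conjunct1, rule_format] c6[THEN conjunct1, rule_format] c7[THEN conjunct1] c8[THEN conjunct1] c9[THEN conjunct1] c10
  obtain \<rho> f where \<rho>: "strict_mono (\<rho> :: nat \<Rightarrow> nat)" "\<And>x. (\<lambda>j. w (\<rho> j) x) \<longlonglongrightarrow> f x"
    by (rule loglip_subseq[of L w, OF wz(1) wz(3) L]) (rule that)
  obtain \<rho>' g where \<rho>': "strict_mono (\<rho>' :: nat \<Rightarrow> nat)" "\<And>x. (\<lambda>j. z (\<rho> (\<rho>' j)) x) \<longlonglongrightarrow> g x"
    by (rule loglip_subseq[of L "\<lambda>j. z (\<rho> j)", OF wz(2) wz(4) L]) (rule that)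
  define \<sigma> where "\<sigma> j = \<rho> (\<rho>' j)" for j
  have \<sigma>: "strict_mono \<sigma>" using strict_mono_o[OF \<rho>(1) \<rho>'(1)] by (simp add: \<sigma>_def[abs_def] o_def)
  have lf: "(\<lambda>j. w (\<sigma> j) x) \<longlonglongrightarrow> f x" for x
    using LIMSEQ_subseq_LIMSEQ[OF \<rho>(2) \<rho>'(1)] by (simp add: \<sigma>_def o_def)
  have lg: "(\<lambda>j. z (\<sigma> j) x) \<longlonglongrightarrow> g x" for x using \<rho>'(2) by (simp add: \<sigma>_def)
  have L1: "loglip L f" "loglip L g" using loglip_limit[OF wz(1) lf] loglip_limit[OF wz(2) lg] by auto
  have B1: "f s \<le> B" "g s \<le> B" for s
    using wz(3,4) by (auto intro!: LIMSEQ_le_const2[OF lf] LIMSEQ_le_const2[OF lg])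
  have nn: "0 \<le> w n s" "0 \<le> z n s" "0 \<le> f s" "0 \<le> g s" for n s using wz(1,2) L1 by (auto simp: loglip_def)
  have bbs: "bounded_borel (w n)" "bounded_borel (z n)" "bounded_borel f" "bounded_borel g" for n
    using loglip_bb[OF wz(1) wz(3)] loglip_bb[OF wz(2) wz(4)] loglip_bb[OF L1(1) B1(1)] loglip_bb[OF L1(2) B1(2)] by auto
  have "(\<lambda>j. resolvents ps (\<lambda>s. z (\<sigma> j) s powr q) s) \<longlonglongrightarrow> resolvents ps (\<lambda>s. g s powr q) s" for s
    using q ps nn wz(4) lg bbs
    by (intro resolvents_tendsto[where M = "B powr q"] bounded_borel_powr tendsto_powr' tendsto_const) (auto intro!: powr_mono2)
  then have e1: "f s = resolvents ps (\<lambda>s. g s powr q) s" for s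
    using LIMSEQ_unique[OF lf] by (simp add: wz(6)[symmetric])
  have "(\<lambda>j. resolvents qs (\<lambda>s. w (\<sigma> j) s powr r) s) \<longlonglongrightarrow> resolvents qs (\<lambda>s. f s powr r) s" for s
    using q qs nn wz(3) lf bbs
    by (intro resolvents_tendsto[where M = "B powr r"] bounded_borel_powr tendsto_powr' tendsto_const) (auto intro!: powr_mono2)
  then have e2: "g s = resolvents qs (\<lambda>s. f s powr r) s" for s
    using LIMSEQ_unique[OF lg] by (simp add: wz(7)[symmetric])
  have "\<delta> / 2 \<le> f 0" by (rule LIMSEQ_le_const[OF lf]) (use wz(5) in auto)
  then have f0: "0 < f 0" using \<delta> by simp
  have en: "(LINT s|lborel. indicator {- real K..<real K} s * h s powr p) \<le> E"
    if h: "bounded_borel h" "\<And>s. 0 \<le> h s" and hn: "\<And>n. bounded_borel (hn n)" "\<And>n s. 0 \<le> hn n s" "\<And>n s. hn n s \<le> B" "\<And>n. periodic (real (Suc n)) (hn n)"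
      "\<And>n. period_int (real (Suc n)) (\<lambda>s. hn n s powr p) \<le> E" and lim: "\<And>s. (\<lambda>j. hn (\<sigma> j) s) \<longlonglongrightarrow> h s" and p: "0 < p"
    for h hn p and K :: nat
  proof -
    have bp: "bounded_borel (\<lambda>s. hn n s powr p)" "periodic (real (Suc n)) (\<lambda>s. hn n s powr p)" for n
      using hn p by (auto intro!: bounded_borel_powr simp: periodic_def)
    have tr: "(LINT s|lborel. indicator {- real K..<real K} s * k s) = period_int (2 * real K) (\<lambda>s. k (s + - real K))" for k :: "real \<Rightarrow> real"
      unfolding period_int_def using lborel_integral_real_affine[of 1 "\<lambda>s. indicator {- real K..<real K} s * k s" "- real K"]
      by (simp add: indicator_def add.commute)
    \<comment> \<open>Once the period \<open>Suc n\<close> exceeds \<open>2 * K\<close>, the window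
      fits into a single period, and the periodic energy bound applies after a shift.\<close>
    have le: "period_int (2 * real K) (\<lambda>s. hn n (s + - real K) powr p) \<le> E" if "2 * K \<le> n" for n
    proof -
      have "period_int (2 * real K) (\<lambda>s. hn n (s + - real K) powr p) \<le> period_int (real (Suc n)) (\<lambda>s. hn n (s + - real K) powr p)"
        unfolding period_int_def using that
        by (intro Bochner_Integration.integral_mono bounded_borel_integrable bounded_borel_shift[OF bp(1)]) (auto simp: indicator_def)
      also have "\<dots> = period_int (real (Suc n)) (\<lambda>s. hn n s powr p)" by (rule period_int_shift[OF bp]) simp
      also have "\<dots> \<le> E" by (rule hn(5))
      finally show ?thesis .
    qed
    have "(\<lambda>j. period_int (2 * real K) (\<lambda>s. hn (\<sigma> j) (s + - real K) powr p)) \<longlonglongrightarrow> period_int (2 * real K) (\<lambda>s. h (s + - real K) powr p)"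
      using h hn lim p by (intro per_norm_tendsto(1)[where M = B] bounded_borel_shift) auto
    moreover have "eventually (\<lambda>j. period_int (2 * real K) (\<lambda>s. hn (\<sigma> j) (s + - real K) powr p) \<le> E) sequentially"
      using le seq_suble[OF \<sigma>] by (auto simp: eventually_sequentially intro!: exI[of _ "2 * K"] intro: order_trans)
    ultimately have "period_int (2 * real K) (\<lambda>s. h (s + - real K) powr p) \<le> E"
      by (rule tendsto_upperbound) simp
    then show ?thesis by (simp only: tr)
  qed
  have "(LINT s|lborel. indicator {- real K..<real K} s * f s powr (r + 1)) \<le> E" for K :: nat
    by (rule en[OF bbs(3) nn(3) bbs(1) nn(1) wz(3) wz(8) wz(10) lf]) (use q in simp)
  moreover have "(LINT s|lborel. indicator {- real K..<real K} s * g s powr (q + 1)) \<le> E" for K :: nat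
    by (rule en[OF bbs(4) nn(4) bbs(2) nn(2) wz(4) wz(9) wz(11) lg]) (use q in simp)
  moreover have "f = resolvents ps (\<lambda>s. g s powr q)" by (rule ext) (rule e1)
  moreover have "g = resolvents qs (\<lambda>s. f s powr r)" by (rule ext) (rule e2)
  ultimately show ?thesis using L1 B1 f0
    by (intro exI[of _ f] exI[of _ g] exI[of _ B] exI[of _ E] conjI allI)
qed

section \<open>Existence\<close>

text \<open>Dyadic shells shrinking to the origin contribute a geometric series of ratio
  \<open>2 powr (t - n)\<close>.\<close>

lemma nn_integral_norm_powr_cball_finite:
  assumes t: "0 < t" "t < real CARD('n)"
  shows "(\<integral>\<^sup>+x. ennreal (norm (x :: real ^ 'n) powr (- t)) * indicator (cball 0 1) x \<partial>lborel) < \<infinity>"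
proof -
  let ?n = "CARD('n)"
  define V where "V = unit_ball_vol (real ?n)"
  have V: "0 \<le> V" by (simp add: V_def)
  let ?f = "\<lambda>k (x :: real ^ 'n). ennreal ((2 ^ Suc k) powr t) * indicator (cball 0 ((1 / 2) ^ k)) x"
  have im: "indicator (cball 0 r) \<in> borel_measurable (lborel :: (real ^ 'n) measure)" for r
    by (rule borel_measurable_indicator) simp
  have fm: "?f k \<in> borel_measurable lborel" for k
    by (intro borel_measurable_times_ennreal borel_measurable_const im)
  have "ennreal (norm x powr (- t)) * indicator (cball 0 1) x \<le> (\<Sum>k. ?f k x)" for x :: "real ^ 'n"
  proof (cases "x \<noteq> 0 \<and> norm x \<le> 1")
    case True
    then have x: "0 < norm x" "norm x \<le> 1" by auto
    obtain k :: nat where k: "2 ^ k \<le> 1 / norm x" "1 / norm x \<le> 2 ^ Suc k"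
    proof (cases "norm x = 1")
      case True
      then show ?thesis by (intro that[of 0]) auto
    next
      case False
      then have "1 < 1 / norm x" using x by simp
      from dyadic_exists[OF this] show ?thesis using that by blast
    qed
    have "norm x powr (- t) = (1 / norm x) powr t"
      using x by (simp add: powr_minus powr_divide inverse_eq_divide)
    also have "\<dots> \<le> (2 ^ Suc k) powr t" using k t x by (intro powr_mono2) auto
    finally have "ennreal (norm x powr (- t)) \<le> ennreal ((2 ^ Suc k) powr t)" by (rule ennreal_leI)
    moreover have "norm x \<le> (1 / 2) ^ k" using k(1) x by (simp add: power_one_over field_simps)
    ultimately have "ennreal (norm x powr (- t)) * indicator (cball 0 1) x \<le> ?f k x"
      using x by simp
    also have "\<dots> \<le> (\<Sum>k. ?f k x)"
    proof -
      have "F k \<le> (\<Sum>k. F k)" for F :: "nat \<Rightarrow> ennreal" using sum_le_suminf[of F "{k}"] by (simp add: summableI)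
      then show ?thesis .
    qed
    finally show ?thesis .
  next
    case False
    then have "ennreal (norm x powr (- t)) * indicator (cball 0 1) x = 0" by auto
    then show ?thesis by (simp only: zero_le)
  qed
  then have "(\<integral>\<^sup>+x. ennreal (norm (x :: real ^ 'n) powr (- t)) * indicator (cball 0 1) x \<partial>lborel)
     \<le> (\<integral>\<^sup>+x. (\<Sum>k. ?f k x) \<partial>lborel)" by (rule nn_integral_mono)
  also have "\<dots> = (\<Sum>k. \<integral>\<^sup>+x. ?f k x \<partial>lborel)"
    by (rule nn_integral_suminf[of ?f lborel, OF fm])
  also have "\<dots> = (\<Sum>k. ennreal (V * 2 powr t * (2 powr (t - real ?n)) ^ k))"
  proof (intro suminf_cong)
    fix k
    have "(\<integral>\<^sup>+x. ?f k x \<partial>lborel) = ennreal ((2 ^ Suc k) powr t) * ennreal (V * ((1 / 2) ^ k) ^ ?n)"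
      by (subst nn_integral_cmult[OF im]) (simp add: emeasure_cball_0 V_def)
    also have "\<dots> = ennreal ((2 ^ Suc k) powr t * (V * ((1 / 2) ^ k) ^ ?n))"
      using V by (subst ennreal_mult) auto
    also have "(2 ^ Suc k) powr t * (V * ((1 / 2) ^ k) ^ ?n) = V * 2 powr t * (2 powr (t - real ?n)) ^ k"
    proof -
      have "((2::real) ^ Suc k) powr t = 2 powr t * (2 powr t) ^ k"
        by (simp add: powr_mult powr_realpow[symmetric] powr_powr mult.commute)
      moreover have "((1 / 2 :: real) ^ k) ^ ?n = (2 powr (- real ?n)) ^ k"
        by (simp add: powr_minus powr_realpow power_mult[symmetric] mult.commute power_one_over inverse_eq_divide)
      ultimately show ?thesis
        by (simp add: powr_add[of 2 t "- real ?n", simplified] power_mult_distrib)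
    qed
    finally show "(\<integral>\<^sup>+x. ?f k x \<partial>lborel) = ennreal (V * 2 powr t * (2 powr (t - real ?n)) ^ k)" .
  qed
  also have "\<dots> = ennreal (\<Sum>k. V * 2 powr t * (2 powr (t - real ?n)) ^ k)"
  proof (rule suminf_ennreal2)
    have "(2::real) powr (t - real ?n) < 2 powr 0" using t by (intro powr_less_mono) auto
    then show "summable (\<lambda>k. V * 2 powr t * (2 powr (t - real ?n)) ^ k)"
      by (intro summable_mult summable_geometric) simp
  qed (use V in simp)
  also have "\<dots> < \<infinity>" by simp
  finally show ?thesis .
qed

text \<open>Near the origin boundedness of \<open>u\<close> and \<open>t < n\<close> suffice;
  outside the unit ball the total decay rate \<open>t + e * p\<close> exceeds
  \<open>n\<close>.\<close>

lemma nn_integral_weighted_finite: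
  fixes u :: "real ^ 'n \<Rightarrow> real"
  assumes t: "0 < t" "t < real CARD('n)" and p: "0 \<le> p" and u: "\<And>x. 0 \<le> u x" "\<And>x. u x \<le> m"
    and C: "0 \<le> C" "\<And>x. 1 < norm x \<Longrightarrow> u x \<le> C * norm x powr (- e)" and e: "real CARD('n) < t + e * p"
  shows "(\<integral>\<^sup>+x. ennreal (norm x powr (- t) * u x powr p) \<partial>lborel) < \<infinity>"
proof -
  let ?n = "real CARD('n)"
  define \<sigma> where "\<sigma> = t + e * p - ?n"
  have \<sigma>: "0 < \<sigma>" using e by (simp add: \<sigma>_def)
  let ?A = "\<lambda>x :: real ^ 'n. ennreal (norm x powr (- t)) * indicator (cball 0 1) x"
  let ?B = "\<lambda>x :: real ^ 'n. 1 * ennreal (norm x powr (- ?n - \<sigma>)) * indicator {x. 1 < norm x} x"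
  have [measurable]: "cball (0 :: real ^ 'n) 1 \<in> sets borel" by simp
  have mA: "?A \<in> borel_measurable lborel" by measurable
  have mB: "?B \<in> borel_measurable lborel" by measurable
  have A: "(\<integral>\<^sup>+x. ?A x \<partial>lborel) < \<infinity>" by (rule nn_integral_norm_powr_cball_finite[OF t])
  have B: "(\<integral>\<^sup>+x. ?B x \<partial>lborel) < \<infinity>"
    by (rule nn_integral_tail_finite[of "\<lambda>x. 1", OF _ \<sigma>, of "unit_ball_vol ?n"]) (auto simp: emeasure_cball_0)
  have "ennreal (norm x powr (- t) * u x powr p) \<le> ennreal (m powr p) * ?A x + ennreal (C powr p) * ?B x" for x
  proof (cases "norm x \<le> 1")
    case True
    have "norm x powr (- t) * u x powr p \<le> m powr p * norm x powr (- t)"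
      using u p by (subst mult.commute) (intro mult_right_mono powr_mono2, auto)
    then have "ennreal (norm x powr (- t) * u x powr p) \<le> ennreal (m powr p) * ennreal (norm x powr (- t))"
      by (simp add: ennreal_mult[symmetric] ennreal_leI)
    then show ?thesis using True by simp
  next
    case False
    have "u x powr p \<le> (C * norm x powr (- e)) powr p" using u p C False by (intro powr_mono2) auto
    also have "\<dots> = C powr p * norm x powr (- e * p)" using C by (simp add: powr_mult powr_powr)
    finally have "norm x powr (- t) * u x powr p \<le> norm x powr (- t) * (C powr p * norm x powr (- e * p))"
      by (intro mult_left_mono) auto
    also have "\<dots> = C powr p * norm x powr (- ?n - \<sigma>)"
      using powr_add[of "norm x" "- t" "- e * p"] by (simp add: \<sigma>_def)
    finally have "ennreal (norm x powr (- t) * u x powr p) \<le> ennreal (C powr p) * ennreal (norm x powr (- ?n - \<sigma>))"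
      by (simp add: ennreal_mult[symmetric] ennreal_leI)
    then show ?thesis using False by simp
  qed
  then have "(\<integral>\<^sup>+x. ennreal (norm x powr (- t) * u x powr p) \<partial>lborel)
    \<le> (\<integral>\<^sup>+x. ennreal (m powr p) * ?A x + ennreal (C powr p) * ?B x \<partial>lborel)" by (rule nn_integral_mono)
  also have "\<dots> = ennreal (m powr p) * (\<integral>\<^sup>+x. ?A x \<partial>lborel) + ennreal (C powr p) * (\<integral>\<^sup>+x. ?B x \<partial>lborel)"
    using mA mB by (simp add: nn_integral_add nn_integral_cmult)
  also have "\<dots> < \<infinity>" using A B by (simp add: ennreal_mult_less_top)
  finally show ?thesis .
qed

text \<open>The Harnack inequality with the exact rate \<open>a\<close> makes
  \<open>exp (- a * s) * w s\<close> nonincreasing. Being bounded by the sharp decay, it tends to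
  its supremum at \<open>-\<infinity>\<close>, the value of the solution at the origin.\<close>

lemma profile_limit:
  fixes w :: "real \<Rightarrow> real"
  assumes ps: "0 < a" "0 < \<beta>" and f: "bounded_borel f" "\<And>x. 0 \<le> f x" and w: "w = resolvent a \<beta> f" "\<And>s. 0 < w s"
    and C: "\<And>s. w s \<le> C * exp (a * s)"
  shows "\<exists>m>0. (\<forall>s. exp (- a * s) * w s \<le> m) \<and> ((\<lambda>s. exp (- a * s) * w s) \<longlongrightarrow> m) at_bot"
proof -
  define g where "g s = exp (- a * s) * w s" for s
  have gC: "g s \<le> C" for s
  proof -
    have "g s \<le> exp (- a * s) * (C * exp (a * s))" unfolding g_def using C by (intro mult_left_mono) auto
    also have "\<dots> = C" by (simp add: exp_minus)
    finally show ?thesis .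
  qed
  have gpos: "0 < g s" for s using w by (simp add: g_def)
  have anti: "g y \<le> g x" if "x \<le> y" for x y
  proof -
    have "w y \<le> exp (a * (y - x)) * w x"
      using resolvent_shift_le(1)[OF ps f, of "y - x" x] that by (simp add: w(1))
    then have "g y \<le> exp (- a * y) * (exp (a * (y - x)) * w x)" unfolding g_def by (intro mult_left_mono) auto
    also have "\<dots> = exp (- a * y) * exp (a * (y - x)) * w x" by simp
    also have "exp (- a * y) * exp (a * (y - x)) = exp (- a * x)" by (simp add: exp_add[symmetric] algebra_simps)
    finally show ?thesis by (simp add: g_def)
  qed
  have bdd: "bdd_above (range g)" using gC by (intro bdd_aboveI[of _ C]) auto
  define m where "m = (SUP s. g s)"
  have gm: "g s \<le> m" for s unfolding m_def by (rule cSUP_upper[OF _ bdd]) simp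
  have "(g \<longlongrightarrow> m) at_bot"
  proof (rule order_tendstoI)
    fix c assume "c < m"
    then obtain s where s: "c < g s" unfolding m_def using less_cSUP_iff[OF UNIV_not_empty bdd, of c] by blast
    have "c < g x" if "x \<le> s" for x using anti[OF that] s by linarith
    then show "eventually (\<lambda>x. c < g x) at_bot" unfolding eventually_at_bot_linorder by blast
  next
    fix c assume "m < c"
    then show "eventually (\<lambda>x. g x < c) at_bot" using gm by (intro always_eventually allI) (rule le_less_trans)
  qed
  moreover have "0 < m" using gpos[of 0] gm[of 0] by linarith
  ultimately show ?thesis using gm unfolding g_def by blast
qed

text \<open>The number \<open>m\<close> is the value at the origin, meant to be the limit of the
  profile at \<open>-\<infinity>\<close>.\<close>

definition radial :: "real \<Rightarrow> real \<Rightarrow> (real \<Rightarrow> real) \<Rightarrow> real ^ 'n \<Rightarrow> real" where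
  "radial a m w x = (if x = 0 then m else exp (- a * ln (norm x)) * w (ln (norm x)))"

lemma radial_continuous:
  assumes w: "\<And>s. isCont w s" and m: "((\<lambda>s. exp (- a * s) * w s) \<longlongrightarrow> m) at_bot"
  shows "continuous_on UNIV (radial a m w :: real ^ 'n \<Rightarrow> real)"
proof (rule continuous_at_imp_continuous_on, rule ballI)
  fix x :: "real ^ 'n"
  let ?g = "\<lambda>x :: real ^ 'n. exp (- a * ln (norm x)) * w (ln (norm x))"
  show "isCont (radial a m w) x"
  proof (cases "x = 0")
    case True
    have n: "filterlim norm (at_right 0) (at (0 :: real ^ 'n))"
      unfolding filterlim_at by (auto intro!: tendsto_norm_zero simp: eventually_at_filter)
    have "filterlim (\<lambda>x :: real ^ 'n. ln (norm x)) at_bot (at 0)"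
      by (rule filterlim_compose[OF ln_at_0 n])
    from filterlim_compose[OF m this] have "(?g \<longlongrightarrow> m) (at 0)" .
    moreover have "eventually (\<lambda>x. ?g x = radial a m w x) (at 0)"
      by (auto simp: eventually_at_filter radial_def)
    ultimately have "(radial a m w \<longlongrightarrow> m) (at (0 :: real ^ 'n))" by (rule Lim_transform_eventually)
    then show ?thesis using True by (simp add: isCont_def radial_def)
  next
    case False
    have l: "isCont (\<lambda>x. ln (norm x)) x" using False by (intro continuous_intros) auto
    have "isCont ?g x" using isCont_o2[OF l, of w] w l False by (intro continuous_intros) auto
    then have "(?g \<longlongrightarrow> radial a m w x) (at x)" using False by (simp add: isCont_def radial_def)
    moreover have "eventually (\<lambda>x. ?g x = radial a m w x) (at x)"
    proof -
      have "eventually (\<lambda>y. y \<in> - {0}) (at x)" using False by (intro eventually_at_in_open') auto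
      then show ?thesis by eventually_elim (simp add: radial_def)
    qed
    ultimately show ?thesis unfolding isCont_def by (rule Lim_transform_eventually)
  qed
qed

text \<open>A bootstrap in three stages: a common rate \<open>\<kappa>\<close> slightly below
  \<open>a\<close>; then \<open>q * \<kappa> > a\<close> gives \<open>w\<close> its sharp rate
  \<open>a\<close>; then \<open>r * a > b\<close> gives \<open>z\<close> its sharp rate
  \<open>b\<close>.\<close>

lemma line_decay:
  assumes ps: "pospairs ((a, \<beta>) # ps)" "\<And>p. p \<in> set ps \<Longrightarrow> a + 2 \<le> fst p"
    and qs: "pospairs ((b, \<gamma>) # qs)" "\<And>p. p \<in> set qs \<Longrightarrow> b + 2 \<le> fst p"
    and ab: "a \<le> b" "b < r * a" and q: "1 < q" "1 < r"
    and w: "bounded_borel w" "\<And>s. 0 \<le> w s" "\<And>s. w s \<le> B" "w = resolvents ((a, \<beta>) # ps) (\<lambda>s. z s powr q)"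
    and z: "bounded_borel z" "\<And>s. 0 \<le> z s" "\<And>s. z s \<le> B" "z = resolvents ((b, \<gamma>) # qs) (\<lambda>s. w s powr r)"
    and vanish: "\<And>e. 0 < e \<Longrightarrow> \<exists>K. \<forall>s\<le>- K. w s < e \<and> z s < e"
  shows "\<exists>C\<ge>0. \<forall>s. w s \<le> C * exp (a * s) \<and> z s \<le> C * exp (b * s)"
proof -
  have a: "0 < a" using ps(1) by simp
  \<comment> \<open>The midpoint of \<open>a / q\<close> and \<open>a\<close>: below all rates in
    both lists, yet above \<open>a\<close> after multiplication by \<open>q\<close>.\<close>
  define \<kappa> where "\<kappa> = (a / q + a) / 2"
  have "a / q < a" using a q by (simp add: divide_less_eq)
  then have \<kappa>: "0 < \<kappa>" "\<kappa> < a" using a q unfolding \<kappa>_def by (auto intro!: add_pos_pos divide_pos_pos)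
  have qk: "a < q * \<kappa>"
  proof -
    have "q * \<kappa> = (a + q * a) / 2" using q by (simp add: \<kappa>_def field_simps)
    moreover have "1 * a < q * a" using q a by (intro mult_strict_right_mono) auto
    ultimately show ?thesis by simp
  qed
  have pw: "x powr p \<le> c powr p * exp (p * k * s)" if "0 \<le> x" "x \<le> c * exp (k * s)" "0 \<le> c" "1 < p" for x p c k s :: real
  proof -
    have "x powr p \<le> (c * exp (k * s)) powr p" using that by (intro powr_mono2) auto
    also have "\<dots> = c powr p * exp (p * k * s)"
    proof -
      have "exp (k * s) powr p = exp (p * k * s)" by (simp add: powr_def)
      then show ?thesis using that by (simp add: powr_mult)
    qed
    finally show ?thesis .
  qed
  have k1: "\<kappa> < fst p" if "p \<in> set ((a, \<beta>) # ps)" for p using that \<kappa> ps(2)[of p] by auto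
  have k2: "\<kappa> < fst p" if "p \<in> set ((b, \<gamma>) # qs)" for p using that \<kappa> qs(2)[of p] ab by auto
  obtain C where C: "0 \<le> C" "\<And>s. w s \<le> C * exp (\<kappa> * s) \<and> z s \<le> C * exp (\<kappa> * s)"
    using exp_decay[OF ps(1) k1 qs(1) k2 \<kappa>(1) q w z vanish] by blast
  have bz: "bounded_borel (\<lambda>s. z s powr q)" using z q by (intro bounded_borel_powr) auto
  have bw: "bounded_borel (\<lambda>s. w s powr r)" using w q by (intro bounded_borel_powr) auto
  have "z x powr q \<le> C powr q * exp (q * \<kappa> * x)" for x using C z(2) q by (intro pw) auto
  from resolvents_sharp_decay[OF ps(1) ps(2) _ bz powr_ge_zero this qk powr_ge_zero]
  obtain C1 where C1: "0 \<le> C1" "\<And>s. w s \<le> C1 * exp (a * s)" unfolding w(4)[symmetric] by auto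
  have "w x powr r \<le> C1 powr r * exp (r * a * x)" for x using C1 w(2) q by (intro pw) auto
  from resolvents_sharp_decay[OF qs(1) qs(2) _ bw powr_ge_zero this ab(2) powr_ge_zero]
  obtain C2 where C2: "0 \<le> C2" "\<And>s. z s \<le> C2 * exp (b * s)" unfolding z(4)[symmetric] by auto
  show ?thesis
  proof (intro exI[of _ "max C1 C2"] conjI allI)
    show "w s \<le> max C1 C2 * exp (a * s)" for s by (intro order_trans[OF C1(2)] mult_right_mono; simp)
    show "z s \<le> max C1 C2 * exp (b * s)" for s by (intro order_trans[OF C2(2)] mult_right_mono; simp)
  qed (use C1 in simp)
qed

text \<open>One component of the system; the other arises by exchanging roles. The sharp rate at
  \<open>-\<infinity>\<close> yields continuity at the origin, while any positive rate
  \<open>\<kappa>\<close> at \<open>\<infinity>\<close> yields finite energy.\<close>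

lemma radial_solution:
  fixes l :: nat
  defines "d \<equiv> real CARD('n) - 2"
  assumes l: "1 \<le> l" and t: "0 < t" "t < real CARD('n)" and q: "0 < q" "1 < p" and a: "a * (p + 1) = real CARD('n) - t"
    and ps: "pospairs (exponents d l a)"
    and z: "bounded_borel z" "\<And>s. isCont z s" "\<And>s. 0 < z s"
    and w: "w = resolvents (exponents d l a) (\<lambda>s. z s powr q)" "\<And>s. isCont w s" "\<And>s. 0 < w s"
    and C: "\<And>s. w s \<le> C * exp (a * s)" and C': "\<And>s. w s \<le> C' * exp (- \<kappa> * s)" "0 < \<kappa>"
  shows "\<exists>m. continuous_on UNIV (radial a m w :: real ^ 'n \<Rightarrow> real) \<and> Ck_on (2 * l) (radial a m w :: real ^ 'n \<Rightarrow> real) (- {0}) \<and>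
    (\<forall>x :: real ^ 'n. 0 < radial a m w x) \<and>
    (\<forall>x :: real ^ 'n. x \<noteq> 0 \<longrightarrow> neg_laplacian_power l (radial a m w) x = exp (- (a + 2 * real l) * ln (norm x)) * z (ln (norm x)) powr q) \<and>
    Lp_norm (p + 1) (\<lambda>x :: real ^ 'n. norm x powr (- t / (p + 1)) * radial a m w x) < \<infinity>"
proof -
  obtain j where j: "l = Suc j" using l by (cases l) auto
  define f where "f s = z s powr q" for s
  have f: "bounded_borel f" "\<And>s. isCont f s"
    unfolding f_def[abs_def] using z q less_imp_le[OF z(3)] by (auto intro!: bounded_borel_powr continuous_intros simp: less_imp_neq[THEN not_sym])
  have pj: "0 < a" "0 < d - a" "pospairs (exponents d j (a + 2))" using ps by (auto simp: j)
  have g: "bounded_borel (resolvents (exponents d j (a + 2)) f)" "\<And>x. 0 \<le> resolvents (exponents d j (a + 2)) f x"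
    using pj f by (auto intro!: resolvents_bb resolvents_nonneg simp: f_def)
  have wT: "w = resolvent a (d - a) (resolvents (exponents d j (a + 2)) f)" unfolding w(1) j f_def by simp
  obtain m where m: "0 < m" "\<And>s. exp (- a * s) * w s \<le> m" "((\<lambda>s. exp (- a * s) * w s) \<longlongrightarrow> m) at_bot"
    using profile_limit[OF pj(1,2) g wT w(3) C] by blast
  note rp = radial_polyharmonic[OF f, where 'n = 'n, folded d_def, OF ps, folded w(1)[folded f_def]]
  let ?u = "radial a m w :: real ^ 'n \<Rightarrow> real"
  have eq: "exp (- a * ln (norm x)) * w (ln (norm x)) = ?u x" if "x \<in> - {0}" for x :: "real ^ 'n"
    using that by (simp add: radial_def)
  have o: "open (- {0 :: real ^ 'n})" by auto
  have pos: "0 < ?u x" for x using m(1) w(3) by (simp add: radial_def)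
  have "Ck_on (2 * l) ?u (- {0})"
    by (rule Ck_on_cong[OF o eq Ck_on_radial[OF conjunct1[OF rp]]])
  moreover have "neg_laplacian_power l ?u x = exp (- (a + 2 * real l) * ln (norm x)) * z (ln (norm x)) powr q" if "x \<noteq> 0" for x
  proof -
    have "neg_laplacian_power l ?u x = neg_laplacian_power l (\<lambda>x. exp (- a * ln (norm x)) * w (ln (norm x))) x"
      by (rule neg_laplacian_power_cong_open[OF o]) (use that eq in auto)
    also have "\<dots> = exp (- (a + 2 * real l) * ln (norm x)) * f (ln (norm x))"
      using conjunct2[OF rp] that by blast
    finally show ?thesis by (simp add: f_def)
  qed
  moreover have "Lp_norm (p + 1) (\<lambda>x. norm x powr (- t / (p + 1)) * ?u x) < \<infinity>"
  proof -
    have C0: "0 \<le> C'" using C'(1)[of 0] w(3)[of 0] by simp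
    have um: "?u x \<le> m" for x using m(2)[of "ln (norm x)"] by (simp add: radial_def)
    have dec: "?u x \<le> C' * norm x powr (- (a + \<kappa>))" if "1 < norm x" for x
    proof -
      let ?s = "ln (norm x)"
      have x: "x \<noteq> 0" using that by auto
      have "?u x \<le> exp (- a * ?s) * (C' * exp (- \<kappa> * ?s))"
        unfolding radial_def using x C'(1)[of ?s] by (simp add: mult_left_mono)
      also have "\<dots> = C' * exp (- a * ?s + - \<kappa> * ?s)" unfolding exp_add by simp
      also have "- a * ?s + - \<kappa> * ?s = - (a + \<kappa>) * ?s" by (simp add: algebra_simps)
      finally show ?thesis using x by (simp add: powr_def)
    qed
    \<comment> \<open>By the choice of \<open>a\<close> the undamped profile sits exactly at the
      borderline \<open>t + a * (p + 1) = n\<close>; \<open>\<kappa>\<close> pushes it into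
      convergence.\<close>
    have "0 < \<kappa> * (p + 1)" using C' q by simp
    then have "real CARD('n) < t + (a + \<kappa>) * (p + 1)" using a by (simp add: distrib_right)
    then have "(\<integral>\<^sup>+x. ennreal (norm x powr (- t) * ?u x powr (p + 1)) \<partial>lborel) < \<infinity>"
      using q by (intro nn_integral_weighted_finite[OF t _ less_imp_le[OF pos] um C0 dec]) auto
    then show ?thesis using Lp_norm_weighted_finite[of ?u "p + 1" t] less_imp_le[OF pos] q by simp
  qed
  ultimately show ?thesis using radial_continuous[OF w(2) m(3)] pos by (intro exI[of _ m] conjI allI impI)
qed

text \<open>Criticality serves twice: it makes the two resolvent lists adjoint, so that
  \<open>line_solution\<close> applies, and it matches the powers of \<open>norm x\<close> in both
  equations, so that a solution on the line lifts to the space.\<close>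

lemma critical_imp_finite_energy:
  fixes l :: nat
  assumes t: "0 < t" "t < 2" and q: "1 < q1" "1 < q2" and l: "1 \<le> l" "2 * real l < real CARD('n)"
    and crit: "1 / (q1 + 1) + 1 / (q2 + 1) = (real CARD('n) - 2 * real l) / (real CARD('n) - t)"
  shows "\<exists>u v :: real ^ 'n \<Rightarrow> real. finite_energy_solution l t q1 q2 u v"
proof -
  define n where "n = real CARD('n)"
  have n: "2 * real l < n" "t < n" "1 \<le> real l" using l t by (auto simp: n_def)
  define a where "a = (n - t) / (q1 + 1)"
  define b where "b = (n - t) / (q2 + 1)"
  define d where "d = n - 2"
  have ab0: "0 < a" "0 < b" using n q by (simp_all add: a_def b_def)
  have aq: "a * (q1 + 1) = n - t" "b * (q2 + 1) = n - t" using q by (simp_all add: a_def b_def)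
  have "a + b = (n - t) * (1 / (q1 + 1) + 1 / (q2 + 1))" by (simp add: a_def b_def distrib_left)
  also have "\<dots> = n - 2 * real l" using crit n by (simp add: n_def)
  finally have ab: "a + b = n - 2 * real l" .
  \<comment> \<open>The power of \<open>norm x\<close> produced by the iterated Laplacian equals the
    one on the right-hand side.\<close>
  have ex: "a + 2 * real l = t + b * q2" "b + 2 * real l = t + a * q1" using aq ab by (auto simp: algebra_simps)
  \<comment> \<open>Here \<open>t < 2 \<le> 2 * l\<close> is used: the nonlinear right-hand sides
    decay faster than the sharp rates, which drives the bootstrap in
    \<open>line_decay\<close>.\<close>
  have sup: "b < q1 * a" "a < q2 * b"
  proof -
    have "a * q1 = b + 2 * real l - t" "b * q2 = a + 2 * real l - t" using ex by linarith+
    then show "b < q1 * a" "a < q2 * b" using t n by (simp_all only: mult.commute[of q1] mult.commute[of q2])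
  qed
  obtain j where j: "l = Suc j" using l by (cases l) auto
  define ps where "ps = exponents d l a"
  define qs where "qs = exponents d l b"
  have dab: "a + b = d - 2 * (real l - 1)" using ab by (simp add: d_def)
  have dual: "rev (map prod.swap ps) = qs" unfolding ps_def qs_def by (rule exponents_dual[OF dab])
  have pset: "a \<le> fst p \<and> b \<le> snd p \<and> fst p + snd p = d" if "p \<in> set ps" for p
    using exponents_set[OF that[unfolded ps_def]] dab by auto
  have qset: "b \<le> fst p \<and> a \<le> snd p \<and> fst p + snd p = d" if "p \<in> set qs" for p
    using exponents_set[OF that[unfolded qs_def]] dab by auto
  have pp: "pospairs ps" "pospairs qs" using pset qset ab0 by fastforce+
  have ne: "ps \<noteq> []" by (simp add: ps_def j)
  \<comment> \<open>The rates of a pair are positive with sum \<open>d\<close>, so \<open>d\<close>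
    is a common log-Lipschitz constant.\<close>
  have L: "fst p \<le> d \<and> snd p \<le> d" if "p \<in> set ps" for p
    using pset[OF that] ab0 by linarith
  obtain w z B E where wz0: "loglip d w" "loglip d z" "\<forall>s. w s \<le> B" "\<forall>s. z s \<le> B" "0 < w 0"
    and weq: "w = resolvents ps (\<lambda>s. z s powr q2)" and zeq: "z = resolvents qs (\<lambda>s. w s powr q1)"
    and E0: "\<forall>K::nat. (LINT s|lborel. indicator {- real K..<real K} s * w s powr (q1 + 1)) \<le> E"
      "\<forall>K::nat. (LINT s|lborel. indicator {- real K..<real K} s * z s powr (q2 + 1)) \<le> E"
    using line_solution[OF pp(1) ne L q(2,1)] unfolding dual
    by - (drule meta_mp, assumption, elim exE conjE, rule that)
  note bd = wz0(3)[rule_format] wz0(4)[rule_format]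
  have d0: "0 \<le> d" using n by (simp add: d_def)
  have wpos: "0 < w s" for s by (rule loglip_pos[OF wz0(1), of 0]) (use wz0(5) in simp)
  have zpos: "0 < z s" for s
  proof -
    have "\<exists>x. z x \<noteq> 0"
    proof (rule ccontr)
      assume "\<not> ?thesis"
      then have "z = (\<lambda>s. 0)" by auto
      with weq have "w = resolvents ps (\<lambda>s. 0)" by simp
      moreover obtain C where "\<And>f M s. bounded_borel f \<Longrightarrow> (\<And>x. \<bar>f x\<bar> \<le> M) \<Longrightarrow> \<bar>resolvents ps f s\<bar> \<le> C * M"
        using resolvents_bound[OF pp(1)] by blast
      moreover have "bounded_borel (\<lambda>s. 0)" by (rule bbI[where M = 0]) auto
      ultimately have "\<bar>w 0\<bar> \<le> C * 0" by (metis abs_zero order_refl)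
      then show False using wz0(5) by simp
    qed
    then show ?thesis using loglip_pos[OF wz0(2)] by blast
  qed
  note nn = less_imp_le[OF wpos] less_imp_le[OF zpos]
  have bw: "bounded_borel w" and bz: "bounded_borel z" using loglip_bb[OF wz0(1) bd(1)] loglip_bb[OF wz0(2) bd(2)] by auto
  have cw: "isCont w s" and cz: "isCont z s" for s using loglip_isCont wz0(1,2) by auto
  have vanish: "\<exists>K. \<forall>s. K \<le> \<bar>s\<bar> \<longrightarrow> w s < e \<and> z s < e" if e: "0 < e" for e
  proof -
    obtain K1 where K1: "\<forall>s. K1 \<le> \<bar>s\<bar> \<longrightarrow> w s < e"
      using loglip_vanishes[OF wz0(1) d0 bd(1) _ E0(1)[rule_format] e] q by auto
    obtain K2 where K2: "\<forall>s. K2 \<le> \<bar>s\<bar> \<longrightarrow> z s < e"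
      using loglip_vanishes[OF wz0(2) d0 bd(2) _ E0(2)[rule_format] e] q by auto
    show ?thesis using K1 K2 by (intro exI[of _ "max K1 K2"]) auto
  qed
  have vl: "\<exists>K. \<forall>s\<le>- K. w s < e \<and> z s < e" if e: "0 < e" for e
  proof -
    obtain K where "\<forall>s. K \<le> \<bar>s\<bar> \<longrightarrow> w s < e \<and> z s < e" using vanish[OF e] by blast
    then show ?thesis by (intro exI[of _ "max K 0"]) auto
  qed
  \<comment> \<open>Reflection \<open>s\<close> to \<open>- s\<close> swaps the rates of all
    resolvents, so decay at \<open>\<infinity>\<close> follows from the same lemma as decay at
    \<open>-\<infinity>\<close>.\<close>
  have vr: "\<exists>K. \<forall>s\<le>- K. w (- s) < e \<and> z (- s) < e" if e: "0 < e" for e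
  proof -
    obtain K where "\<forall>s. K \<le> \<bar>s\<bar> \<longrightarrow> w s < e \<and> z s < e" using vanish[OF e] by blast
    then show ?thesis by (intro exI[of _ "max K 0"]) auto
  qed
  have psj: "ps = (a, d - a) # exponents d j (a + 2)" and qsj: "qs = (b, d - b) # exponents d j (b + 2)"
    by (simp_all add: ps_def qs_def j)
  have pj: "a + 2 \<le> fst p" if "p \<in> set (exponents d j (a + 2))" for p using exponents_set[OF that] by simp
  have qj: "b + 2 \<le> fst p" if "p \<in> set (exponents d j (b + 2))" for p using exponents_set[OF that] by simp
  obtain C where C: "\<And>s. w s \<le> C * exp (a * s)" "\<And>s. z s \<le> C * exp (b * s)"
  \<comment> \<open>The bootstrap starts with the component of smaller rate.\<close>
  proof (cases "a \<le> b")
    case True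
    show ?thesis
      using line_decay[OF pp(1)[unfolded psj] pj pp(2)[unfolded qsj] qj True sup(1) q(2,1)
        bw nn(1) bd(1) weq[unfolded psj] bz nn(2) bd(2) zeq[unfolded qsj] vl] that by blast
  next
    case False
    then have ba: "b \<le> a" by simp
    have vl': "\<exists>K. \<forall>s\<le>- K. z s < e \<and> w s < e" if e: "0 < e" for e using vl[OF e] by blast
    show ?thesis
      using line_decay[OF pp(2)[unfolded qsj] qj pp(1)[unfolded psj] pj ba sup(2) q
        bz nn(2) bd(2) zeq[unfolded qsj] bw nn(1) bd(1) weq[unfolded psj] vl'] that by blast
  qed
  \<comment> \<open>No sharp rate is needed at \<open>\<infinity>\<close>; half the minimum lies
    below every rate of the reflected lists.\<close>
  define \<kappa> where "\<kappa> = min a b / 2"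
  have \<kappa>: "0 < \<kappa>" "\<kappa> < a" "\<kappa> < b" using ab0 by (auto simp: \<kappa>_def min_def)
  have rp: "pospairs (map prod.swap ps)" "pospairs (map prod.swap qs)" using pp by auto
  have rk: "\<kappa> < fst p" if "p \<in> set (map prod.swap ps)" for p using that pset \<kappa> by fastforce
  have rk': "\<kappa> < fst p" if "p \<in> set (map prod.swap qs)" for p using that qset \<kappa> by fastforce
  have wr: "(\<lambda>s. w (- s)) = resolvents (map prod.swap ps) (\<lambda>s. z (- s) powr q2)"
    using fun_cong[OF weq] by (simp add: resolvents_reflect)
  have zr: "(\<lambda>s. z (- s)) = resolvents (map prod.swap qs) (\<lambda>s. w (- s) powr q1)"
    using fun_cong[OF zeq] by (simp add: resolvents_reflect)
  have "\<exists>C\<ge>0. \<forall>s. w (- s) \<le> C * exp (\<kappa> * s) \<and> z (- s) \<le> C * exp (\<kappa> * s)"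
    by (rule exp_decay[OF rp(1) rk rp(2) rk' \<kappa>(1) q(2,1) bounded_borel_reflect[OF bw] nn(1) bd(1) wr bounded_borel_reflect[OF bz] nn(2) bd(2) zr vr])
  then obtain C' where "\<And>s. w (- s) \<le> C' * exp (\<kappa> * s) \<and> z (- s) \<le> C' * exp (\<kappa> * s)" by blast
  from this[of "- s" for s] have C': "w s \<le> C' * exp (- \<kappa> * s)" "z s \<le> C' * exp (- \<kappa> * s)" for s by simp_all
  have q0: "0 < q1" "0 < q2" using q by auto
  obtain m1 where u: "continuous_on UNIV (radial a m1 w :: real ^ 'n \<Rightarrow> real)" "Ck_on (2 * l) (radial a m1 w :: real ^ 'n \<Rightarrow> real) (- {0})"
    "\<forall>x :: real ^ 'n. 0 < radial a m1 w x"
    "\<forall>x :: real ^ 'n. x \<noteq> 0 \<longrightarrow> neg_laplacian_power l (radial a m1 w) x = exp (- (a + 2 * real l) * ln (norm x)) * z (ln (norm x)) powr q2"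
    "Lp_norm (q1 + 1) (\<lambda>x :: real ^ 'n. norm x powr (- t / (q1 + 1)) * radial a m1 w x) < \<infinity>"
    using radial_solution[where 'n = 'n, folded n_def, folded d_def, OF l(1) t(1) n(2) q0(2) q(1) aq(1) pp(1)[unfolded ps_def]
      bz cz zpos weq[unfolded ps_def] cw wpos C(1) C'(1) \<kappa>(1)] by (elim exE conjE) (rule that)
  obtain m2 where v: "continuous_on UNIV (radial b m2 z :: real ^ 'n \<Rightarrow> real)" "Ck_on (2 * l) (radial b m2 z :: real ^ 'n \<Rightarrow> real) (- {0})"
    "\<forall>x :: real ^ 'n. 0 < radial b m2 z x"
    "\<forall>x :: real ^ 'n. x \<noteq> 0 \<longrightarrow> neg_laplacian_power l (radial b m2 z) x = exp (- (b + 2 * real l) * ln (norm x)) * w (ln (norm x)) powr q1"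
    "Lp_norm (q2 + 1) (\<lambda>x :: real ^ 'n. norm x powr (- t / (q2 + 1)) * radial b m2 z x) < \<infinity>"
    using radial_solution[where 'n = 'n, folded n_def, folded d_def, OF l(1) t(1) n(2) q0(1) q(2) aq(2) pp(2)[unfolded qs_def]
      bw cw wpos zeq[unfolded qs_def] cz zpos C(2) C'(2) \<kappa>(1)] by (elim exE conjE) (rule that)
  have rhs: "exp (- (t + c * r) * ln (norm x)) * h (ln (norm x)) powr r = norm x powr (- t) * radial c m h x powr r"
    if "x \<noteq> 0" "\<And>s. 0 < h s" for x :: "real ^ 'n" and c r m h
  proof -
    let ?s = "ln (norm x)"
    have "radial c m h x powr r = exp (- c * ?s) powr r * h ?s powr r"
      using that(1) less_imp_le[OF that(2)] by (simp add: radial_def powr_mult)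
    also have "exp (- c * ?s) powr r = exp (- (c * r) * ?s)" by (simp add: powr_def)
    finally have "norm x powr (- t) * radial c m h x powr r = exp (- t * ?s + - (c * r) * ?s) * h ?s powr r"
      unfolding exp_add using that by (simp add: powr_def)
    also have "- t * ?s + - (c * r) * ?s = - (t + c * r) * ?s" by (simp add: algebra_simps)
    finally show ?thesis by simp
  qed
  have pde: "neg_laplacian_power l (radial a m1 w) x = norm x powr - t * radial b m2 z x powr q2"
    "neg_laplacian_power l (radial b m2 z) x = norm x powr - t * radial a m1 w x powr q1" if "x \<noteq> 0" for x :: "real ^ 'n"
    using u(4)[rule_format, OF that] v(4)[rule_format, OF that] rhs[OF that zpos, where c = b and r = q2 and m = m2] rhs[OF that wpos, where c = a and r = q1 and m = m1]
    unfolding ex by auto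
  have "finite_energy_solution l t q1 q2 (radial a m1 w :: real ^ 'n \<Rightarrow> real) (radial b m2 z)"
    unfolding finite_energy_solution_def classical_positive_solution_def
    using u(3) v(3) pde by (intro conjI allI impI u(1,2,5) v(1,2,5)) auto
  then show ?thesis by blast
qed

theorem theorem2p4:
  fixes t q1 q2 :: real and l :: nat
  assumes "CARD('n::finite) \<ge> 3"
    and "0 < t" "t < 2"
    and "q1 > 1" "q2 > 1"
    and "1 \<le> l" "real l < real CARD('n) / 2"
  shows "(\<exists>u v :: real ^ 'n \<Rightarrow> real. finite_energy_solution l t q1 q2 u v) \<longleftrightarrow>
    1 / (q1 + 1) + 1 / (q2 + 1) = (real CARD('n) - 2 * real l) / (real CARD('n) - t)"
proof
  have l: "2 * real l < real CARD('n)" using assms by simp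
  show "1 / (q1 + 1) + 1 / (q2 + 1) = (real CARD('n) - 2 * real l) / (real CARD('n) - t)"
    if "\<exists>u v :: real ^ 'n \<Rightarrow> real. finite_energy_solution l t q1 q2 u v"
  proof -
    from that obtain u v :: "real ^ 'n \<Rightarrow> real" where uv: "finite_energy_solution l t q1 q2 u v" by blast
    show ?thesis by (rule finite_energy_imp_critical[OF uv]) (use assms l in auto)
  qed
  show "\<exists>u v :: real ^ 'n \<Rightarrow> real. finite_energy_solution l t q1 q2 u v"
    if "1 / (q1 + 1) + 1 / (q2 + 1) = (real CARD('n) - 2 * real l) / (real CARD('n) - t)"
    by (rule critical_imp_finite_energy[OF _ _ _ _ _ _ that]) (use assms l in auto)
qed

end
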